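(* Let $n,d\in\mathbb{N}^+$ and $k\in\{0,1,\dots,n-1\}$. Let $\mathcal{F}$ be the family of equidimensional subvarieties of $\mathbb{P}^n$ of dimension $n-k-1$ and degree at most $d$. Suppose $\mathcal{H}$ is an $\mathcal{F}$-evasive $k$-subspace family on $\mathbb{P}^n$. Then \[ |\mathcal{H}|\geq \begin{cases} (n-k)(k+1)+1 & \text{if } d=1, \\ \max\left\{d(n-k)(k+1)+1, \binom{d+n-k}{d}+(n-k+1)k \right\} & \text{if } d>1. \end{cases} \] In particular, $|\mathcal{H}|$ is superpolynomial in $n$ when $n-k=\Omega(n)$ and $d=\omega(1)$.
   Context: $\mathbb{F}$ is an algebraically closed field and $\mathbb{P}^n$ is projective $n$-space over $\mathbb{F}$ with the Zariski topology; subvarieties are Zariski-closed subsets, not necessarily irreducible. A variety is equidimensional if all its irreducible components have the same dimension. The degree of an irreducible subvariety $\mathcal{V}\subseteq\mathbb{P}^n$ is the number of intersection points of $\mathcal{V}$ with a general projective subspace of codimension $\dim\mathcal{V}$; the degree of a reducible variety is the sum of the degrees of its irreducible components. The dimension of the empty set is $-\infty$. A $k$-subspace is a projective linear subspace of dimension $k$; a $k$-subspace family on $\mathbb{P}^n$ is a finite multiset of $k$-subspaces. For irreducible $\mathcal{V}_1,\mathcal{V}_2\subseteq\mathbb{P}^n$, $\mathcal{V}_1$ evades $\mathcal{V}_2$ if $\dim(\mathcal{V}_1\cap\mathcal{V}_2)\le\dim\mathcal{V}_1+\dim\mathcal{V}_2-n$; for $\mathcal{V}_2$ possibly reducible, $\mathcal{V}_1$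 evades $\mathcal{V}_2$ if it evades each irreducible component of $\mathcal{V}_2$. A $k$-subspace family $\mathcal{H}$ is $\mathcal{F}$-evasive if for every $\mathcal{V}\in\mathcal{F}$ there exists $W\in\mathcal{H}$ that evades $\mathcal{V}$. *)

theory Defs
  imports
    "HOL-Analysis.Analysis"
    "HOL-Library.Poly_Mapping"
    "HOL-Library.Function_Algebras"
    "HOL-Library.Multiset"
    "HOL-Library.Landau_Symbols"
    "HOL-Computational_Algebra.Computational_Algebra"
begin

section \<open>Irreducible sets, components and dimension in a topological space\<close>

definition irreducible_in :: "'p topology \<Rightarrow> 'p set \<Rightarrow> bool" where
  "irreducible_in X Z \<longleftrightarrow> Z \<subseteq> topspace X \<and> Z \<noteq> {} \<and>
     (\<forall>A B. closedin X A \<and> closedin X B \<and> Z \<subseteq> A \<union> B \<longrightarrow> Z \<subseteq> A \<or> Z \<subseteq> B)"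

definition irreducible_components :: "'p topology \<Rightarrow> 'p set \<Rightarrow> 'p set set" where
  "irreducible_components X V = {Z. irreducible_in X Z \<and> Z \<subseteq> V \<and>
     (\<forall>Y. irreducible_in X Y \<and> Y \<subseteq> V \<and> Z \<subseteq> Y \<longrightarrow> Y = Z)}"

text \<open>
  Krull dimension of a closed set: the supremum of the lengths \<open>m\<close> of the chains
  \<open>Z 0 \<subset> \<dots> \<subset> Z m\<close> of irreducible closed subsets.  The supremum is taken in the
  extended reals, where the supremum of the empty set is \<open>-\<infinity>\<close>; so this is the
  dimension of the empty set.
\<close>

definition krull_dim :: "'p topology \<Rightarrow> 'p set \<Rightarrow> ereal" where
  "krull_dim X V = Sup {ereal (real m) | m :: nat. \<exists>Z :: nat \<Rightarrow> 'p set.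
     (\<forall>i\<le>m. closedin X (Z i) \<and> irreducible_in X (Z i) \<and> Z i \<subseteq> V) \<and>
     (\<forall>i<m. Z i \<subset> Z (Suc i))}"


section \<open>Polynomials in several variables\<close>

text \<open>
  A monomial is a finitely supported exponent function, a polynomial a finitely
  supported coefficient function on the monomials.
\<close>

type_synonym ('v, 'a) mpoly = "('v \<Rightarrow>\<^sub>0 nat) \<Rightarrow>\<^sub>0 'a"

definition eval_monom :: "('v \<Rightarrow>\<^sub>0 nat) \<Rightarrow> ('v \<Rightarrow> 'a::comm_semiring_1) \<Rightarrow> 'a" where
  "eval_monom m x = (\<Prod>i\<in>Poly_Mapping.keys m. x i ^ Poly_Mapping.lookup m i)"

definition eval_mpoly :: "('v, 'a::comm_semiring_1) mpoly \<Rightarrow> ('v \<Rightarrow> 'a) \<Rightarrow> 'a" where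
  "eval_mpoly f x = (\<Sum>m\<in>Poly_Mapping.keys f. Poly_Mapping.lookup f m * eval_monom m x)"

definition vars_in :: "'v set \<Rightarrow> ('v, 'a::zero) mpoly \<Rightarrow> bool" where
  "vars_in I f \<longleftrightarrow> (\<forall>m\<in>Poly_Mapping.keys f. Poly_Mapping.keys m \<subseteq> I)"

definition total_deg :: "('v \<Rightarrow>\<^sub>0 nat) \<Rightarrow> nat" where
  "total_deg m = (\<Sum>i\<in>Poly_Mapping.keys m. Poly_Mapping.lookup m i)"

definition homogeneous :: "nat \<Rightarrow> ('v, 'a::zero) mpoly \<Rightarrow> bool" where
  "homogeneous e f \<longleftrightarrow> (\<forall>m\<in>Poly_Mapping.keys f. total_deg m = e)"

definition hom_polys :: "nat \<Rightarrow> (nat, 'a::zero) mpoly set" where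
  "hom_polys n = {f. vars_in {..n} f \<and> (\<exists>e. homogeneous e f)}"

lemma eval_monom_superset:
  assumes "finite S" "Poly_Mapping.keys m \<subseteq> S"
  shows "eval_monom m x = (\<Prod>i\<in>S. x i ^ Poly_Mapping.lookup m i)"
  unfolding eval_monom_def using assms
  by (intro prod.mono_neutral_left) (auto simp: in_keys_iff)

lemma eval_monom_add: "eval_monom (m + m') x = eval_monom m x * eval_monom m' x"
proof -
  let ?S = "Poly_Mapping.keys m \<union> Poly_Mapping.keys m'"
  have "eval_monom (m + m') x = (\<Prod>i\<in>?S. x i ^ Poly_Mapping.lookup (m + m') i)"
    by (rule eval_monom_superset) (auto simp: Poly_Mapping.keys_add)
  also have "\<dots> = (\<Prod>i\<in>?S. x i ^ Poly_Mapping.lookup m i)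
                  * (\<Prod>i\<in>?S. x i ^ Poly_Mapping.lookup m' i)"
    by (simp add: lookup_add power_add prod.distrib)
  also have "\<dots> = eval_monom m x * eval_monom m' x"
    by (subst (1 2) eval_monom_superset[of ?S]) auto
  finally show ?thesis .
qed

lemma total_deg_superset:
  assumes "finite S" "Poly_Mapping.keys m \<subseteq> S"
  shows "total_deg m = (\<Sum>i\<in>S. Poly_Mapping.lookup m i)"
  unfolding total_deg_def using assms
  by (intro sum.mono_neutral_left) (auto simp: in_keys_iff)

lemma total_deg_add: "total_deg (m + m') = total_deg m + total_deg m'"
proof -
  let ?S = "Poly_Mapping.keys m \<union> Poly_Mapping.keys m'"
  have "total_deg (m + m') = (\<Sum>i\<in>?S. Poly_Mapping.lookup (m + m') i)"
    by (rule total_deg_superset) (auto simp: Poly_Mapping.keys_add)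
  also have "\<dots> = total_deg m + total_deg m'"
    by (subst (1 2) total_deg_superset[of ?S]) (auto simp: lookup_add sum.distrib)
  finally show ?thesis .
qed

lemma eval_mpoly_superset:
  assumes "finite S" "Poly_Mapping.keys f \<subseteq> S"
  shows "eval_mpoly f x = (\<Sum>m\<in>S. Poly_Mapping.lookup f m * eval_monom m x)"
  unfolding eval_mpoly_def using assms
  by (intro sum.mono_neutral_left) (auto simp: in_keys_iff)

lemma eval_mpoly_zero [simp]: "eval_mpoly 0 x = 0"
  by (simp add: eval_mpoly_def)

lemma eval_mpoly_one [simp]: "eval_mpoly 1 x = 1"
  by (simp add: eval_mpoly_def eval_monom_def)

lemma eval_mpoly_add: "eval_mpoly (f + g) x = eval_mpoly f x + eval_mpoly g x"
proof -
  let ?S = "Poly_Mapping.keys f \<union> Poly_Mapping.keys g"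
  have "eval_mpoly (f + g) x = (\<Sum>m\<in>?S. Poly_Mapping.lookup (f + g) m * eval_monom m x)"
    by (rule eval_mpoly_superset) (auto simp: Poly_Mapping.keys_add)
  also have "\<dots> = eval_mpoly f x + eval_mpoly g x"
    by (subst (1 2) eval_mpoly_superset[of ?S])
       (auto simp: lookup_add algebra_simps sum.distrib)
  finally show ?thesis .
qed

lemma eval_mpoly_single: "eval_mpoly (Poly_Mapping.single m a) x = a * eval_monom m x"
  by (subst eval_mpoly_superset[of "{m}"]) auto

lemma eval_mpoly_sum: "eval_mpoly (\<Sum>i\<in>I. f i) x = (\<Sum>i\<in>I. eval_mpoly (f i) x)"
  by (induction I rule: infinite_finite_induct) (auto simp: eval_mpoly_add)

lemma mpoly_eq_sum_single:
  "f = (\<Sum>m\<in>Poly_Mapping.keys f. Poly_Mapping.single m (Poly_Mapping.lookup f m))"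
proof (rule poly_mapping_eqI)
  fix k
  have "Poly_Mapping.lookup (\<Sum>m\<in>Poly_Mapping.keys f. Poly_Mapping.single m (Poly_Mapping.lookup f m)) k
      = (\<Sum>m\<in>Poly_Mapping.keys f. if m = k then Poly_Mapping.lookup f m else 0)"
    by (simp add: lookup_sum lookup_single when_def)
  also have "\<dots> = Poly_Mapping.lookup f k"
    by (simp add: in_keys_iff)
  finally show "Poly_Mapping.lookup f k = Poly_Mapping.lookup
      (\<Sum>m\<in>Poly_Mapping.keys f. Poly_Mapping.single m (Poly_Mapping.lookup f m)) k" by simp
qed

lemma eval_mpoly_mult: "eval_mpoly (f * g) x = eval_mpoly f x * eval_mpoly g x"
proof -
  have "f * g = (\<Sum>m\<in>Poly_Mapping.keys f. \<Sum>m'\<in>Poly_Mapping.keys g.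
      Poly_Mapping.single (m + m') (Poly_Mapping.lookup f m * Poly_Mapping.lookup g m'))"
    by (subst mpoly_eq_sum_single[of f], subst mpoly_eq_sum_single[of g])
       (simp add: sum_product mult_single)
  then have "eval_mpoly (f * g) x = (\<Sum>m\<in>Poly_Mapping.keys f. \<Sum>m'\<in>Poly_Mapping.keys g.
      (Poly_Mapping.lookup f m * Poly_Mapping.lookup g m') * (eval_monom m x * eval_monom m' x))"
    by (simp add: eval_mpoly_sum eval_mpoly_single eval_monom_add)
  then show ?thesis
    by (simp add: eval_mpoly_def sum_product mult_ac)
qed

lemma hom_polys_mult:
  assumes "f \<in> hom_polys n" "g \<in> hom_polys n"
  shows "f * g \<in> hom_polys n"
proof -
  from assms obtain e e' where e: "homogeneous e f" "homogeneous e' g"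
    and v: "vars_in {..n} f" "vars_in {..n} g" by (auto simp: hom_polys_def)
  have "Poly_Mapping.keys m \<subseteq> {..n} \<and> total_deg m = e + e'"
    if m_in: "m \<in> Poly_Mapping.keys (f * g)" for m
  proof -
    obtain a b where m: "m = a + b" "a \<in> Poly_Mapping.keys f" "b \<in> Poly_Mapping.keys g"
      using m_in Poly_Mapping.keys_mult[of f g] by blast
    then have "Poly_Mapping.keys m \<subseteq> {..n}"
      using v Poly_Mapping.keys_add[of a b] unfolding vars_in_def by blast
    then show ?thesis
      using m e by (simp add: total_deg_add homogeneous_def)
  qed
  then show ?thesis
    unfolding hom_polys_def vars_in_def homogeneous_def by blast
qed

lemma eval_monom_smult:
  fixes x :: "'v \<Rightarrow> 'a::comm_semiring_1"
  shows "eval_monom m (\<lambda>i. c * x i) = c ^ total_deg m * eval_monom m x"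
  by (simp add: eval_monom_def total_deg_def power_mult_distrib prod.distrib power_sum)

lemma eval_mpoly_smult:
  assumes "homogeneous e f"
  shows "eval_mpoly f (\<lambda>i. c * x i) = c ^ e * eval_mpoly f x"
  using assms
  by (simp add: eval_mpoly_def eval_monom_smult homogeneous_def sum_distrib_left mult_ac)


section \<open>Projective space and its Zariski topology\<close>

text \<open>
  The coordinate space of dimension \<open>n + 1\<close> consists of the vectors indexed by
  \<open>nat\<close> that vanish beyond index \<open>n\<close>.  A point of projective \<open>n\<close>-space is a
  one-dimensional linear subspace of it (a line through the origin, containing the
  zero vector).
\<close>

definition vscale :: "'a::field \<Rightarrow> (nat \<Rightarrow> 'a) \<Rightarrow> (nat \<Rightarrow> 'a)" where
  "vscale c v = (\<lambda>i. c * v i)"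

global_interpretation vec: vector_space "vscale :: 'a::field \<Rightarrow> _"
  by unfold_locales (auto simp: vscale_def fun_eq_iff algebra_simps)

definition coord_space :: "nat \<Rightarrow> (nat \<Rightarrow> 'a::field) set" where
  "coord_space n = {v. \<forall>i>n. v i = 0}"

type_synonym 'a point = "(nat \<Rightarrow> 'a) set"

definition proj_space :: "nat \<Rightarrow> 'a::field point set" where
  "proj_space n = {p. vec.subspace p \<and> p \<subseteq> coord_space n \<and> vec.dim p = 1}"

definition zero_locus :: "nat \<Rightarrow> (nat, 'a::field) mpoly set \<Rightarrow> 'a point set" where
  "zero_locus n S = {p \<in> proj_space n. \<forall>f\<in>S. \<forall>x\<in>p. eval_mpoly f x = 0}"

definition zariski :: "nat \<Rightarrow> 'a::field point topology" where
  "zariski n = topology (\<lambda>U. U \<subseteq> proj_space n \<and>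
     (\<exists>S \<subseteq> hom_polys n. proj_space n - U = zero_locus n S))"

lemma proj_space_generator:
  assumes "p \<in> proj_space n"
  obtains v where "v \<in> p" "\<And>x. x \<in> p \<Longrightarrow> \<exists>c. x = (\<lambda>i. c * v i)"
proof -
  from assms have p: "vec.subspace p" "vec.dim p = 1" by (auto simp: proj_space_def)
  obtain B where B: "B \<subseteq> p" "vec.independent B" "p \<subseteq> vec.span B" "card B = 1"
    using vec.basis_exists[of p] p(2) by metis
  then obtain v where v: "B = {v}" by (auto simp: card_1_singleton_iff)
  show thesis
  proof (rule that[of v])
    show "v \<in> p" using B v by auto
    fix x assume "x \<in> p"
    then have "x \<in> vec.span {v}" using B v by auto
    then show "\<exists>c. x = (\<lambda>i. c * v i)"
      by (auto simp: vec.span_singleton vscale_def)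
  qed
qed

lemma zero_locus_Union: "zero_locus n (\<Union>i\<in>I. S i) = proj_space n \<inter> (\<Inter>i\<in>I. zero_locus n (S i))"
  by (auto simp: zero_locus_def)

lemma zero_locus_Un:
  assumes "S \<subseteq> hom_polys n" "T \<subseteq> hom_polys n"
  shows "zero_locus n S \<union> zero_locus n T = zero_locus n {f * g | f g. f \<in> S \<and> g \<in> T}"
proof (intro equalityI subsetI)
  fix p assume "p \<in> zero_locus n S \<union> zero_locus n T"
  then show "p \<in> zero_locus n {f * g | f g. f \<in> S \<and> g \<in> T}"
    by (auto simp: zero_locus_def eval_mpoly_mult)
next
  fix p assume p: "p \<in> zero_locus n {f * g | f g. f \<in> S \<and> g \<in> T}"
  then have pp: "p \<in> proj_space n" by (simp add: zero_locus_def)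
  obtain v where v: "v \<in> p" "\<And>x. x \<in> p \<Longrightarrow> \<exists>c. x = (\<lambda>i. c * v i)"
    using proj_space_generator[OF pp] by blast
  have vanish: "\<forall>x\<in>p. eval_mpoly f x = 0" if f: "f \<in> hom_polys n" "eval_mpoly f v = 0" for f
  proof
    fix x assume "x \<in> p"
    then obtain c where "x = (\<lambda>i. c * v i)" using v by blast
    moreover obtain e where "homogeneous e f" using f by (auto simp: hom_polys_def)
    ultimately show "eval_mpoly f x = 0" using f by (simp add: eval_mpoly_smult)
  qed
  show "p \<in> zero_locus n S \<union> zero_locus n T"
  proof (rule ccontr)
    assume "p \<notin> zero_locus n S \<union> zero_locus n T"
    then obtain f g where "f \<in> S" "g \<in> T" "eval_mpoly f v \<noteq> 0" "eval_mpoly g v \<noteq> 0"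
      using vanish assms pp unfolding zero_locus_def by blast
    moreover have "eval_mpoly (f * g) v = 0"
      using p v(1) \<open>f \<in> S\<close> \<open>g \<in> T\<close> unfolding zero_locus_def by blast
    ultimately show False by (simp add: eval_mpoly_mult)
  qed
qed

lemma istopology_zariski:
  "istopology (\<lambda>U. U \<subseteq> proj_space n \<and>
     (\<exists>S \<subseteq> hom_polys n. proj_space n - U = zero_locus n (S :: (nat, 'a::field) mpoly set)))"
  (is "istopology ?L")
  unfolding istopology_def
proof (intro conjI allI impI)
  fix U V :: "'a point set" assume "?L U" "?L V"
  then obtain S T where S: "S \<subseteq> hom_polys n" "proj_space n - U = zero_locus n S"
    and T: "T \<subseteq> hom_polys n" "proj_space n - V = zero_locus n T" by blast
  have "proj_space n - U \<inter> V = zero_locus n {f * g | f g. f \<in> S \<and> g \<in> T}"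
    using zero_locus_Un[OF S(1) T(1)] S T by (simp add: Diff_Int)
  moreover have "{f * g | f g. f \<in> S \<and> g \<in> T} \<subseteq> hom_polys n"
    using S T hom_polys_mult by blast
  ultimately show "\<exists>S\<subseteq>hom_polys n. proj_space n - U \<inter> V = zero_locus n S" by blast
  show "U \<inter> V \<subseteq> proj_space n" using \<open>?L U\<close> by blast
next
  fix \<K> :: "'a point set set" assume K: "\<forall>K\<in>\<K>. ?L K"
  then show "\<Union>\<K> \<subseteq> proj_space n" by blast
  from K obtain S where S: "\<And>K. K \<in> \<K> \<Longrightarrow> S K \<subseteq> hom_polys n"
    "\<And>K. K \<in> \<K> \<Longrightarrow> proj_space n - K = zero_locus n (S K)" by metis
  have "proj_space n - \<Union>\<K> = proj_space n \<inter> (\<Inter>K\<in>\<K>. zero_locus n (S K))"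
    using S(2) by blast
  then have "proj_space n - \<Union>\<K> = zero_locus n (\<Union>K\<in>\<K>. S K)"
    by (simp add: zero_locus_Union)
  moreover have "(\<Union>K\<in>\<K>. S K) \<subseteq> hom_polys n" using S by blast
  ultimately show "\<exists>S\<subseteq>hom_polys n. proj_space n - \<Union>\<K> = zero_locus n S" by blast
qed

lemma openin_zariski:
  "openin (zariski n) U \<longleftrightarrow>
     U \<subseteq> proj_space n \<and> (\<exists>S \<subseteq> hom_polys n. proj_space n - U = zero_locus n S)"
  unfolding zariski_def topology_inverse'[OF istopology_zariski] ..

lemma topspace_zariski [simp]: "topspace (zariski n) = proj_space n"
proof -
  have "proj_space n - proj_space n = zero_locus n {1 :: (nat, 'a) mpoly}"
  proof -
    have "\<exists>x. x \<in> p" if "p \<in> proj_space n" for p :: "'a point"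
      using that proj_space_generator by metis
    then show ?thesis by (auto simp: zero_locus_def)
  qed
  moreover have "{1 :: (nat, 'a) mpoly} \<subseteq> hom_polys n"
    by (auto simp: hom_polys_def vars_in_def homogeneous_def)
  ultimately have "openin (zariski n) (proj_space n :: 'a point set)"
    unfolding openin_zariski by blast
  then show ?thesis
    by (metis openin_subset openin_topspace openin_zariski subset_antisym)
qed

lemma closedin_zariski:
  "closedin (zariski n) V \<longleftrightarrow> (\<exists>S \<subseteq> hom_polys n. V = zero_locus n S)"
proof -
  have "zero_locus n S \<subseteq> proj_space n" for S :: "(nat, 'a) mpoly set"
    by (auto simp: zero_locus_def)
  moreover have "proj_space n - (proj_space n - V) = V" if "V \<subseteq> proj_space n"
    using that by blast
  ultimately show ?thesis
    unfolding closedin_def openin_zariski topspace_zariski by auto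
qed

abbreviation proj_components :: "nat \<Rightarrow> 'a::field point set \<Rightarrow> 'a point set set" where
  "proj_components n V \<equiv> irreducible_components (zariski n) V"

abbreviation proj_dim :: "nat \<Rightarrow> 'a::field point set \<Rightarrow> ereal" where
  "proj_dim n V \<equiv> krull_dim (zariski n) V"

definition equidimensional :: "nat \<Rightarrow> 'a::field point set \<Rightarrow> bool" where
  "equidimensional n V \<longleftrightarrow>
     (\<forall>Y\<in>proj_components n V. \<forall>Z\<in>proj_components n V. proj_dim n Y = proj_dim n Z)"


section \<open>Projective linear subspaces and degree\<close>

definition proj_of :: "nat \<Rightarrow> (nat \<Rightarrow> 'a::field) set \<Rightarrow> 'a point set" where
  "proj_of n U = {p \<in> proj_space n. p \<subseteq> U}"

definition is_proj_subspace :: "nat \<Rightarrow> nat \<Rightarrow> 'a::field point set \<Rightarrow> bool" where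
  "is_proj_subspace n k W \<longleftrightarrow>
     (\<exists>U. vec.subspace U \<and> U \<subseteq> coord_space n \<and> vec.dim U = k + 1 \<and> W = proj_of n U)"

text \<open>The common kernel of the first \<open>c\<close> rows of a matrix \<open>A\<close>, read as linear forms.\<close>

definition kernel_space :: "nat \<Rightarrow> nat \<Rightarrow> (nat \<times> nat \<Rightarrow> 'a::field) \<Rightarrow> (nat \<Rightarrow> 'a) set" where
  "kernel_space n c A = {x \<in> coord_space n. \<forall>i<c. (\<Sum>j\<le>n. A (i, j) * x j) = 0}"

text \<open>
  A property holds for a general projective subspace of codimension \<open>c\<close> if it holds
  on a nonempty Zariski-open subset of the Grassmannian of these subspaces.  The
  Grassmannian is the open quotient, under the row-kernel map, of the
  \<open>c \<times> (n + 1)\<close> matrices of rank \<open>c\<close>, so this amounts to the property holding for the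
  kernels of all matrices of rank \<open>c\<close> outside the zero set of some nonzero polynomial
  \<open>G\<close> in the matrix entries.  Rank \<open>c\<close> is expressed by the dimension of the kernel.
\<close>

definition for_general_subspace :: "nat \<Rightarrow> nat \<Rightarrow> ('a::field point set \<Rightarrow> bool) \<Rightarrow> bool" where
  "for_general_subspace n c P \<longleftrightarrow>
     (\<exists>G :: (nat \<times> nat, 'a) mpoly. G \<noteq> 0 \<and> vars_in ({..<c} \<times> {..n}) G \<and>
        (\<forall>A. eval_mpoly G A \<noteq> 0 \<and> vec.dim (kernel_space n c A) + c = n + 1 \<longrightarrow>
           P (proj_of n (kernel_space n c A))))"

definition irreducible_degree :: "nat \<Rightarrow> 'a::field point set \<Rightarrow> nat" where
  "irreducible_degree n V = (THE D. \<exists>c. proj_dim n V = ereal (real c) \<and>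
     for_general_subspace n c (\<lambda>L. finite (V \<inter> L) \<and> card (V \<inter> L) = D))"

definition proj_degree :: "nat \<Rightarrow> 'a::field point set \<Rightarrow> nat" where
  "proj_degree n V = (\<Sum>Z\<in>proj_components n V. irreducible_degree n Z)"


section \<open>Evasive subspace families\<close>

definition subspace_family :: "nat \<Rightarrow> nat \<Rightarrow> 'a::field point set multiset \<Rightarrow> bool" where
  "subspace_family n k H \<longleftrightarrow> (\<forall>W\<in>#H. is_proj_subspace n k W)"

definition evades :: "nat \<Rightarrow> 'a::field point set \<Rightarrow> 'a point set \<Rightarrow> bool" where
  "evades n V1 V2 \<longleftrightarrow> (\<forall>Z\<in>proj_components n V2.
     proj_dim n (V1 \<inter> Z) \<le> proj_dim n V1 + proj_dim n Z - ereal (real n))"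

definition evasive :: "nat \<Rightarrow> 'a::field point set set \<Rightarrow> 'a point set multiset \<Rightarrow> bool" where
  "evasive n F H \<longleftrightarrow> (\<forall>V\<in>F. \<exists>W\<in>#H. evades n W V)"

definition equidim_subvarieties :: "nat \<Rightarrow> nat \<Rightarrow> nat \<Rightarrow> 'a::field point set set" where
  "equidim_subvarieties n r d = {V. closedin (zariski n) V \<and> equidimensional n V \<and>
     proj_dim n V = ereal (real r) \<and> proj_degree n V \<le> d}"

end

theory Submission
  imports Defs "Jordan_Normal_Form.Determinant"
begin

text \<open>
  Write \<open>m = n - k\<close>. If \<open>H\<close> is too small, there is a variety of dimension \<open>m - 1\<close> and degree at most
  \<open>d\<close> that meets all members of \<open>H\<close>; none of them evades it, since the expected dimension of the
  intersection with a \<open>k\<close>-subspace is negative.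

  Such a variety is sought as a hypersurface of degree \<open>d\<close> in an \<open>m\<close>-subspace. The pairs of an
  \<open>m\<close>-subspace and a form of degree \<open>d\<close> on it constitute a projective bundle over the Grassmannian.
  To meet a given \<open>k\<close>-subspace is one equation \<open>l = 0\<close> on this bundle. If \<open>N\<close> such equations had no common
  solution, then by the Nullstellensatz in the charts the graded ring generated by the values \<open>l\<close> and
  the coefficients of the form would grow like a polynomial of degree \<open>N - 1\<close>. But it
  contains \<open>N + 1\<close> algebraically independent elements when \<open>N\<close> is one less than the number of coefficients
  of a form plus \<open>k (m + 1)\<close> (plus \<open>k m\<close> for \<open>d = 1\<close>, because a linear form
  defines an \<open>(m - 1)\<close>-subspace that does not determine the \<open>m\<close>-subspace). The bound
  \<open>d (n - k) (k + 1) + 1\<close> comes from unions of \<open>d\<close> linear subspaces.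

  An irreducible form defines an irreducible hypersurface because it is prime and by the Nullstellensatz.
  Its dimension is bounded above by algebraic independence and below by successive sections with
  coordinate hyperplanes. Its degree is the degree of the form, since on some line, and hence on a
  general one, all roots of the form are simple.
\<close>

hide_const (open) Module.smult

section \<open>Multivariate polynomials\<close>

text \<open>The dimension of the bundle enters only through a count of functions on the set of all
  configurations. What makes the count work is a bigrading: the degree \<open>s\<close> in the
  Pluecker coordinates and the degree \<open>t\<close> in the coefficients and values. Powers of
  Pluecker coordinates clear denominators, and \<open>s\<close> can be held fixed while
  \<open>t\<close> grows; growth in \<open>t\<close> alone already gives the contradiction. A family
  of at most \<open>N\<close> subspaces is defeated, hence the bound \<open>N + 1\<close>. Linear
  forms give \<open>N = m * (k + 1)\<close>; cutting the family into \<open>d\<close> blocks of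
  \<open>N\<close> members and treating each block by one linear subspace gives
  \<open>d * N + 1\<close>. Forms of degree \<open>d > 1\<close> treat the family as a single block.
  The form that is found may be reducible or have repeated factors. The variety is therefore a union
  of irreducible hypersurfaces of a common subspace, a repeated factor counts once, and the degree
  is only bounded by \<open>d\<close>. Degree is defined by general sections, so in positive
  characteristic it has to be excluded that all partial derivatives of an irreducible form
  vanish.\<close>

lemma infinite_alg_closed: "infinite (UNIV :: 'a::alg_closed_field set)"
proof
  assume fin: "finite (UNIV :: 'a set)"
  define p where "p = (\<Prod>a\<in>(UNIV::'a set). [:-a, 1:])"
  have "degree p = card (UNIV::'a set)"
    unfolding p_def by (subst degree_prod_eq_sum_degree) auto
  then have dp: "degree p > 0" using fin by (simp add: finite_UNIV_card_ge_0)
  then have "degree (p + 1) > 0"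
    by (metis add.commute degree_1 degree_add_eq_right)
  then obtain x where "poly (p + 1) x = 0" using alg_closed_imp_poly_has_root by blast
  moreover have "poly p x = 0"
    unfolding p_def poly_prod using fin by (intro prod_zero) auto
  ultimately show False by simp
qed

lemma poly_nonroot:
  fixes p :: "'a::alg_closed_field poly"
  assumes "p \<noteq> 0"
  obtains x where "poly p x \<noteq> 0"
  using poly_roots_finite[OF assms] infinite_alg_closed
  by (metis (mono_tags, lifting) UNIV_I finite_subset mem_Collect_eq subsetI)

definition MC :: "'a::zero \<Rightarrow> ('v, 'a) mpoly" where
  "MC c = Poly_Mapping.single 0 c"

definition MX :: "'v \<Rightarrow> ('v, 'a::comm_semiring_1) mpoly" where
  "MX v = Poly_Mapping.single (Poly_Mapping.single v 1) 1"

lemma MC_simps [simp]: "MC 0 = 0" "MC 1 = 1"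
  by (simp_all add: MC_def)

lemma MC_mult: "MC (a * b) = MC a * (MC b :: ('v, 'a::comm_semiring_1) mpoly)"
  by (simp add: MC_def mult_single)

lemma MC_eq_0 [simp]: "MC c = 0 \<longleftrightarrow> c = 0"
  by (metis MC_def MC_simps(1) lookup_single_eq lookup_zero)

lemma eval_MC [simp]: "eval_mpoly (MC c) x = c"
  by (simp add: MC_def eval_mpoly_single eval_monom_def)

lemma eval_MX [simp]: "eval_mpoly (MX v) x = x v"
  by (simp add: MX_def eval_mpoly_single eval_monom_def)

lemma eval_mpoly_uminus [simp]: "eval_mpoly (- f) x = - eval_mpoly (f :: ('v, 'a::comm_ring_1) mpoly) x"
  by (metis eval_mpoly_add eval_mpoly_zero eq_neg_iff_add_eq_0 ab_left_minus)

lemma eval_mpoly_diff [simp]: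
  "eval_mpoly (f - g) x = eval_mpoly f x - eval_mpoly (g :: ('v, 'a::comm_ring_1) mpoly) x"
  by (metis eval_mpoly_add eval_mpoly_uminus add_uminus_conv_diff)

lemma eval_mpoly_prod: "eval_mpoly (\<Prod>i\<in>I. f i) x = (\<Prod>i\<in>I. eval_mpoly (f i) x)"
  by (induction I rule: infinite_finite_induct) (auto simp: eval_mpoly_mult)

lemma eval_mpoly_power: "eval_mpoly (f ^ k) x = eval_mpoly f x ^ k"
  by (induction k) (auto simp: eval_mpoly_mult)

lemmas eval_mpoly_hom = eval_mpoly_add eval_mpoly_mult eval_mpoly_sum eval_mpoly_prod
  eval_mpoly_power

lemma vars_in_MC [simp]: "vars_in I (MC c)"
  by (simp add: vars_in_def MC_def)

lemma vars_in_0 [simp]: "vars_in I 0" and vars_in_1 [simp]: "vars_in I 1"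
  by (simp_all add: vars_in_def)

lemma vars_in_MX [simp]: "vars_in I (MX v :: ('v, 'a::comm_semiring_1) mpoly) \<longleftrightarrow> v \<in> I"
  by (simp add: vars_in_def MX_def)

lemma vars_in_add: "vars_in I f \<Longrightarrow> vars_in I g \<Longrightarrow> vars_in I (f + g)"
  using Poly_Mapping.keys_add[of f g] unfolding vars_in_def by blast

lemma vars_in_uminus [simp]: "vars_in I (- f) \<longleftrightarrow> vars_in I (f :: ('v, 'a::comm_ring_1) mpoly)"
  by (auto simp: vars_in_def in_keys_iff)

lemma vars_in_diff:
  "vars_in I f \<Longrightarrow> vars_in I g \<Longrightarrow> vars_in I (f - g :: ('v, 'a::comm_ring_1) mpoly)"
  by (metis vars_in_add vars_in_uminus add_uminus_conv_diff)

lemma vars_in_mult: "vars_in I f \<Longrightarrow> vars_in I g \<Longrightarrow> vars_in I (f * g)"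
  unfolding vars_in_def
proof
  fix m assume I: "\<forall>m\<in>Poly_Mapping.keys f. Poly_Mapping.keys m \<subseteq> I"
    "\<forall>m\<in>Poly_Mapping.keys g. Poly_Mapping.keys m \<subseteq> I" and "m \<in> Poly_Mapping.keys (f * g)"
  then obtain a b where "m = a + b" "a \<in> Poly_Mapping.keys f" "b \<in> Poly_Mapping.keys g"
    using Poly_Mapping.keys_mult[of f g] by blast
  then show "Poly_Mapping.keys m \<subseteq> I" using I Poly_Mapping.keys_add[of a b] by blast
qed

lemma vars_in_sum: "(\<And>i. i \<in> A \<Longrightarrow> vars_in I (f i)) \<Longrightarrow> vars_in I (\<Sum>i\<in>A. f i)"
  by (induction A rule: infinite_finite_induct) (auto intro: vars_in_add)

lemma vars_in_prod: "(\<And>i. i \<in> A \<Longrightarrow> vars_in I (f i)) \<Longrightarrow> vars_in I (\<Prod>i\<in>A. f i)"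
  by (induction A rule: infinite_finite_induct) (auto intro: vars_in_mult)

lemma vars_in_power: "vars_in I f \<Longrightarrow> vars_in I (f ^ k)"
  by (induction k) (auto intro: vars_in_mult)

lemmas vars_in_intros = vars_in_add vars_in_diff vars_in_mult vars_in_sum vars_in_prod
  vars_in_power

lemma vars_in_mono: "vars_in I f \<Longrightarrow> I \<subseteq> J \<Longrightarrow> vars_in J f"
  by (auto simp: vars_in_def)

lemma vars_in_UNIV [simp]: "vars_in UNIV f"
  by (simp add: vars_in_def)

definition mvars :: "('v, 'a::zero) mpoly \<Rightarrow> 'v set" where
  "mvars f = (\<Union>m\<in>Poly_Mapping.keys f. Poly_Mapping.keys m)"

lemma finite_mvars [simp]: "finite (mvars f)" and vars_in_mvars [simp]: "vars_in (mvars f) f"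
  by (auto simp: mvars_def vars_in_def)

lemma single_monom_eq:
  "Poly_Mapping.single m c = MC c * (\<Prod>v\<in>Poly_Mapping.keys m. MX v ^ Poly_Mapping.lookup m v)"
proof -
  have pw: "MX v ^ k = Poly_Mapping.single (Poly_Mapping.single v k) (1::'b)" for v :: 'a and k
  proof (induction k)
    case (Suc k)
    have "Poly_Mapping.single v (Suc k) = Poly_Mapping.single v 1 + Poly_Mapping.single v k"
      by (simp add: single_add[symmetric])
    with Suc show ?case by (simp add: MX_def mult_single)
  qed simp
  have pr: "(\<Prod>v\<in>S. MX v ^ Poly_Mapping.lookup m v)
      = Poly_Mapping.single (\<Sum>v\<in>S. Poly_Mapping.single v (Poly_Mapping.lookup m v)) (1::'b)"
    if "finite S" for S using that
    by (induction S rule: finite_induct) (auto simp: pw mult_single)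
  have "(\<Sum>v\<in>Poly_Mapping.keys m. Poly_Mapping.single v (Poly_Mapping.lookup m v)) = m"
    by (rule poly_mapping_eqI) (simp add: lookup_sum lookup_single when_def in_keys_iff)
  then show ?thesis by (simp add: pr MC_def mult_single)
qed

text \<open>A term is a product of a constant and variables, so the polynomials in \<open>I\<close>
  are generated by these as a ring. Facts about substitutions are later checked on the generators
  only.\<close>

lemma mpoly_ring_induct [consumes 1, case_names const var add mult]:
  fixes f :: "('v, 'a::comm_semiring_1) mpoly"
  assumes f: "vars_in I f"
    and C: "\<And>c. P (MC c)" and X: "\<And>v. v \<in> I \<Longrightarrow> P (MX v)"
    and add: "\<And>f g. P f \<Longrightarrow> P g \<Longrightarrow> P (f + g)" and mult: "\<And>f g. P f \<Longrightarrow> P g \<Longrightarrow> P (f * g)"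
  shows "P f"
proof -
  have one: "P 1" using C[of 1] by simp
  have zero: "P 0" using C[of 0] by simp
  have pw: "P g \<Longrightarrow> P (g ^ k)" for g k by (induction k) (auto intro: one mult)
  have pr: "finite S \<Longrightarrow> (\<And>v. v \<in> S \<Longrightarrow> P (g v)) \<Longrightarrow> P (\<Prod>v\<in>S. g v)" for S :: "'v set" and g
    by (induction S rule: finite_induct) (auto intro: one mult)
  have sm: "finite S \<Longrightarrow> (\<And>v. v \<in> S \<Longrightarrow> P (g v)) \<Longrightarrow> P (\<Sum>v\<in>S. g v)"
    for S :: "('v \<Rightarrow>\<^sub>0 nat) set" and g
    by (induction S rule: finite_induct) (auto intro: zero add)
  have "P (\<Sum>m\<in>Poly_Mapping.keys f. Poly_Mapping.single m (Poly_Mapping.lookup f m))"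
  proof (rule sm)
    fix m assume "m \<in> Poly_Mapping.keys f"
    then have "Poly_Mapping.keys m \<subseteq> I" using f by (auto simp: vars_in_def)
    then show "P (Poly_Mapping.single m (Poly_Mapping.lookup f m))"
      unfolding single_monom_eq by (intro mult C pr pw X) auto
  qed simp
  then show ?thesis using mpoly_eq_sum_single[of f] by simp
qed

lemma eval_mpoly_cong:
  assumes "vars_in I f" "\<And>v. v \<in> I \<Longrightarrow> x v = y v"
  shows "eval_mpoly f x = eval_mpoly f y"
  using assms by (induction rule: mpoly_ring_induct) (auto simp: eval_mpoly_hom)

text \<open>Polynomials in \<open>insert v I\<close> as univariate polynomials in \<open>v\<close> over those in \<open>I\<close>.\<close>

definition coeffs_in :: "'v set \<Rightarrow> ('v, 'a::comm_ring_1) mpoly poly \<Rightarrow> bool" where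
  "coeffs_in I P \<longleftrightarrow> (\<forall>i. vars_in I (coeff P i))"

lemma coeffs_in_pCons [simp]: "coeffs_in I (pCons a P) \<longleftrightarrow> vars_in I a \<and> coeffs_in I P"
  unfolding coeffs_in_def by (auto simp: coeff_pCons split: nat.splits)

lemma coeffs_in_0 [simp]: "coeffs_in I 0"
  by (simp add: coeffs_in_def)

lemma coeffs_in_add: "coeffs_in I P \<Longrightarrow> coeffs_in I Q \<Longrightarrow> coeffs_in I (P + Q)"
  and coeffs_in_diff: "coeffs_in I P \<Longrightarrow> coeffs_in I Q \<Longrightarrow> coeffs_in I (P - Q)"
  and coeffs_in_mult: "coeffs_in I P \<Longrightarrow> coeffs_in I Q \<Longrightarrow> coeffs_in I (P * Q)"
  and coeffs_in_smult: "vars_in I c \<Longrightarrow> coeffs_in I P \<Longrightarrow> coeffs_in I (smult c P)"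
  and coeffs_in_monom: "vars_in I c \<Longrightarrow> coeffs_in I (monom c k)"
  unfolding coeffs_in_def by (auto simp: coeff_mult intro!: vars_in_intros)

lemma poly_rep_ex:
  fixes f :: "('v, 'a::comm_ring_1) mpoly"
  assumes "vars_in (insert v I) f"
  shows "\<exists>P. coeffs_in I P \<and> f = poly P (MX v)"
  using assms
proof (induction rule: mpoly_ring_induct)
  case (const c)
  show ?case by (rule exI[of _ "[:MC c:]"]) simp
next
  case (var u)
  show ?case
  proof (cases "u = v")
    case True then show ?thesis by (intro exI[of _ "[:0, 1:]"]) simp
  next
    case False then show ?thesis using var by (intro exI[of _ "[:MX u:]"]) simp
  qed
next
  case (add f g) then show ?case by (metis coeffs_in_add poly_add)
next
  case (mult f g) then show ?case by (metis coeffs_in_mult poly_mult)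
qed

lemma vars_in_poly:
  assumes "coeffs_in I P" "vars_in I' x" "I \<subseteq> I'"
  shows "vars_in I' (poly P x)"
  using assms by (induction P) (auto intro!: vars_in_intros intro: vars_in_mono)

definition ev_poly :: "('v \<Rightarrow> 'a::comm_ring_1) \<Rightarrow> ('v, 'a) mpoly poly \<Rightarrow> 'a poly" where
  "ev_poly x P = map_poly (\<lambda>c. eval_mpoly c x) P"

lemma coeff_ev_poly [simp]: "coeff (ev_poly x P) i = eval_mpoly (coeff P i) x"
  unfolding ev_poly_def by (rule coeff_map_poly) simp

lemma ev_poly_hom: "ev_poly x (P + Q) = ev_poly x P + ev_poly x Q"
  "ev_poly x (P * Q) = ev_poly x P * ev_poly x Q"
  "ev_poly x (smult c P) = smult (eval_mpoly c x) (ev_poly x P)"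
  by (auto intro!: poly_eqI simp: coeff_mult eval_mpoly_hom)

lemma ev_poly_pCons: "ev_poly x (pCons a P) = pCons (eval_mpoly a x) (ev_poly x P)"
  by (auto intro!: poly_eqI simp: coeff_pCons split: nat.splits)

lemma ev_poly_0 [simp]: "ev_poly x 0 = 0"
  by (simp add: ev_poly_def)

lemma eval_poly: "eval_mpoly (poly P f) x = poly (ev_poly x P) (eval_mpoly f x)"
  by (induction P) (auto simp: eval_mpoly_hom ev_poly_pCons)

lemma ev_poly_cong:
  assumes "coeffs_in I P" "\<And>v. v \<in> I \<Longrightarrow> x v = y v"
  shows "ev_poly x P = ev_poly y P"
  using assms by (auto intro!: poly_eqI eval_mpoly_cong simp: coeffs_in_def)

text \<open>Fix all variables but one so that some coefficient survives; the remaining univariate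
  polynomial has finitely many roots in an infinite field.\<close>

lemma mpoly_nonroot:
  fixes f :: "('v, 'a::alg_closed_field) mpoly"
  assumes "f \<noteq> 0"
  obtains x where "eval_mpoly f x \<noteq> 0"
proof -
  have "\<exists>x. eval_mpoly f x \<noteq> 0" if "finite V" "vars_in V f" "f \<noteq> 0"
    for V and f :: "('v, 'a) mpoly"
    using that
  proof (induction V arbitrary: f rule: finite_induct)
    case (empty f)
    define c where "c = Poly_Mapping.lookup f 0"
    have c: "f = MC c"
    proof (rule poly_mapping_eqI)
      fix k
      show "Poly_Mapping.lookup f k = Poly_Mapping.lookup (MC c) k"
      proof (cases "k = 0")
        case False
        then have "Poly_Mapping.keys k \<noteq> {}" by simp
        then have "k \<notin> Poly_Mapping.keys f" using empty(1) unfolding vars_in_def by blast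
        then show ?thesis using False by (simp add: MC_def lookup_single in_keys_iff)
      qed (simp add: MC_def c_def)
    qed
    then have "c \<noteq> 0" using empty(2) by auto
    then show ?case unfolding c by simp
  next
    case (insert v V f)
    obtain P where P: "coeffs_in V P" "f = poly P (MX v)"
      using poly_rep_ex[OF insert.prems(1)] by metis
    have "P \<noteq> 0" using P(2) insert.prems(2) by auto
    then obtain i where "coeff P i \<noteq> 0" using leading_coeff_neq_0 by metis
    then obtain x where "eval_mpoly (coeff P i) x \<noteq> 0"
      using insert.IH P(1) unfolding coeffs_in_def by blast
    then have "coeff (ev_poly x P) i \<noteq> 0" by simp
    then have "ev_poly x P \<noteq> 0" by (metis coeff_0)
    then obtain s where s: "poly (ev_poly x P) s \<noteq> 0" using poly_nonroot by blast
    have "ev_poly (x(v := s)) P = ev_poly x P"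
      using P(1) insert.hyps by (intro ev_poly_cong) auto
    then have "eval_mpoly f (x(v := s)) \<noteq> 0"
      using s by (simp add: P(2) eval_poly)
    then show ?case by blast
  qed
  from this[OF finite_mvars vars_in_mvars assms] show thesis using that by blast
qed

lemma mpoly_eqI:
  fixes f g :: "('v, 'a::alg_closed_field) mpoly"
  assumes "\<And>x. eval_mpoly f x = eval_mpoly g x"
  shows "f = g"
proof (rule ccontr)
  assume "f \<noteq> g"
  then have "f - g \<noteq> 0" by simp
  then obtain x where "eval_mpoly (f - g) x \<noteq> 0" by (rule mpoly_nonroot)
  then show False using assms by simp
qed

lemma poly_rep_unique:
  fixes P Q :: "('v, 'a::alg_closed_field) mpoly poly"
  assumes "coeffs_in I P" "coeffs_in I Q" "v \<notin> I" "poly P (MX v) = poly Q (MX v)"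
  shows "P = Q"
proof (rule poly_eqI, rule mpoly_eqI)
  fix i x
  have "poly (ev_poly x P) s = poly (ev_poly x Q) s" for s
  proof -
    have "ev_poly (x(v := s)) P = ev_poly x P" "ev_poly (x(v := s)) Q = ev_poly x Q"
      using assms(3) by (auto intro!: ev_poly_cong[OF assms(1)] ev_poly_cong[OF assms(2)])
    moreover have "eval_mpoly (poly P (MX v)) (x(v := s)) = eval_mpoly (poly Q (MX v)) (x(v := s))"
      using assms(4) by simp
    ultimately show ?thesis by (simp add: eval_poly)
  qed
  then have "ev_poly x P - ev_poly x Q = 0"
    using poly_nonroot[of "ev_poly x P - ev_poly x Q"] by auto
  then have "ev_poly x P = ev_poly x Q" by simp
  then show "eval_mpoly (coeff P i) x = eval_mpoly (coeff Q i) x"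
    by (metis coeff_ev_poly)
qed

lemma eval_line_poly:
  fixes f :: "('v, 'a::alg_closed_field) mpoly"
  shows "\<exists>p. \<forall>t. poly p t = eval_mpoly f (\<lambda>v. x v + t * y v)"
proof -
  have "vars_in UNIV f" by simp
  then show ?thesis
  proof (induction rule: mpoly_ring_induct)
    case (const c) show ?case by (rule exI[of _ "[:c:]"]) simp
  next
    case (var v) show ?case by (rule exI[of _ "[:x v, y v:]"]) simp
  next
    case (add f g)
    then obtain p q where "\<forall>t. poly p t = eval_mpoly f (\<lambda>v. x v + t * y v)"
      "\<forall>t. poly q t = eval_mpoly g (\<lambda>v. x v + t * y v)" by auto
    then show ?case by (intro exI[of _ "p + q"]) (simp add: eval_mpoly_add)
  next
    case (mult f g)
    then obtain p q where "\<forall>t. poly p t = eval_mpoly f (\<lambda>v. x v + t * y v)"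
      "\<forall>t. poly q t = eval_mpoly g (\<lambda>v. x v + t * y v)" by auto
    then show ?case by (intro exI[of _ "p * q"]) (simp add: eval_mpoly_mult)
  qed
qed

text \<open>On the line that joins a nonroot of \<open>f\<close> to a nonroot of \<open>g\<close>
  both restrict to nonzero univariate polynomials, whose product has a nonroot. This works for every
  type of variables.\<close>

lemma mpoly_common_nonroot:
  fixes f g :: "('v, 'a::alg_closed_field) mpoly"
  assumes "f \<noteq> 0" "g \<noteq> 0"
  obtains x where "eval_mpoly f x \<noteq> 0" "eval_mpoly g x \<noteq> 0"
proof -
  obtain a where a: "eval_mpoly f a \<noteq> 0" by (rule mpoly_nonroot[OF assms(1)])
  obtain b where b: "eval_mpoly g b \<noteq> 0" by (rule mpoly_nonroot[OF assms(2)])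
  define y where "y = (\<lambda>v. b v - a v)"
  obtain p where p: "\<forall>t. poly p t = eval_mpoly f (\<lambda>v. a v + t * y v)"
    using eval_line_poly[of f a y] by blast
  obtain q where q: "\<forall>t. poly q t = eval_mpoly g (\<lambda>v. a v + t * y v)"
    using eval_line_poly[of g a y] by blast
  have "poly p 0 \<noteq> 0" using p a by simp
  moreover have "poly q 1 \<noteq> 0" using q b by (simp add: y_def)
  ultimately have "p * q \<noteq> 0" by auto
  then obtain t where "poly (p * q) t \<noteq> 0" by (rule poly_nonroot)
  then show thesis using that[of "\<lambda>v. a v + t * y v"] p q by simp
qed

section \<open>Hilbert's Nullstellensatz\<close>

text \<open>Long division in which every step multiplies by the leading coefficient of
  \<open>F\<close> instead of dividing by it. The bound on \<open>degree Q\<close> serves to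
  contradict a minimality of degrees: the quotient by a nonconstant divisor is shorter than the
  dividend.\<close>

lemma pseudo_division:
  fixes P F :: "('v, 'a::alg_closed_field) mpoly poly"
  assumes "coeffs_in I P" "coeffs_in I F" "degree F > 0"
  shows "\<exists>N Q S. coeffs_in I Q \<and> coeffs_in I S \<and> smult (lead_coeff F ^ N) P = Q * F + S
    \<and> degree S < degree F \<and> degree Q \<le> degree P - degree F"
  using assms(1)
proof (induction "degree P" arbitrary: P rule: less_induct)
  case less
  show ?case
  proof (cases "degree P < degree F")
    case True
    then show ?thesis using less.prems
      by (intro exI[of _ 0] exI[of _ "0 :: ('v,'a) mpoly poly"] exI[of _ P]) simp
  next
    case False
    define c where "c = lead_coeff F"
    define M where "M = monom (lead_coeff P) (degree P - degree F)"
    define P' where "P' = smult c P - M * F"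
    have vc: "vars_in I c" and vM: "coeffs_in I M"
      using less.prems assms(2) unfolding c_def M_def coeffs_in_def by (auto simp: coeff_monom)
    have cP': "coeffs_in I P'"
      unfolding P'_def by (intro coeffs_in_diff coeffs_in_smult coeffs_in_mult vc vM less.prems assms(2))
    have "degree P' < degree P"
    proof (rule degree_lessI)
      have "degree P > 0" using False assms(3) by simp
      then show "P' \<noteq> 0 \<or> degree P > 0" by simp
      show "\<forall>k\<ge>degree P. coeff P' k = 0"
      proof (intro allI impI)
        fix k assume k: "k \<ge> degree P"
        have "coeff (M * F) k = lead_coeff P * coeff F (k - (degree P - degree F))"
          using k unfolding M_def by (simp add: coeff_monom_mult)
        then show "coeff P' k = 0"
          using k False unfolding P'_def c_def
          by (cases "k = degree P") (auto simp: coeff_eq_0 mult.commute)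
      qed
    qed
    from less.hyps[OF this cP'] obtain N Q S where NQS: "coeffs_in I Q" "coeffs_in I S"
      "smult (lead_coeff F ^ N) P' = Q * F + S" "degree S < degree F"
      "degree Q \<le> degree P' - degree F" by blast
    have "smult (c ^ Suc N) P = smult (c ^ N) P' + smult (c ^ N) M * F"
      by (simp add: P'_def smult_diff_right mult.commute)
    also have "\<dots> = (Q + smult (c ^ N) M) * F + S"
      using NQS(3) by (simp add: c_def algebra_simps)
    finally have "smult (c ^ Suc N) P = (Q + smult (c ^ N) M) * F + S" .
    moreover have "degree (Q + smult (c ^ N) M) \<le> degree P - degree F"
      using NQS(5) \<open>degree P' < degree P\<close> unfolding M_def
      by (intro degree_add_le order.trans[OF degree_smult_le] degree_monom_le) auto
    moreover have "coeffs_in I (Q + smult (c ^ N) M)"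
      using NQS(1) vc vM by (intro coeffs_in_add coeffs_in_smult vars_in_power)
    ultimately show ?thesis using NQS(2,4) unfolding c_def by blast
  qed
qed

definition prime_ideal_set :: "'r::comm_ring_1 set \<Rightarrow> bool" where
  "prime_ideal_set q \<longleftrightarrow> 0 \<in> q \<and> (\<forall>a\<in>q. \<forall>b\<in>q. a + b \<in> q) \<and> (\<forall>a\<in>q. \<forall>r. r * a \<in> q) \<and>
     1 \<notin> q \<and> (\<forall>a b. a * b \<in> q \<longrightarrow> a \<in> q \<or> b \<in> q)"

lemma prime_ideal_setD:
  assumes "prime_ideal_set q"
  shows "0 \<in> q" "\<And>a b. a \<in> q \<Longrightarrow> b \<in> q \<Longrightarrow> a + b \<in> q" "\<And>a r. a \<in> q \<Longrightarrow> r * a \<in> q"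
    "\<And>a r. a \<in> q \<Longrightarrow> a * r \<in> q" "1 \<notin> q" "\<And>a b. a * b \<in> q \<Longrightarrow> a \<in> q \<or> b \<in> q"
    "\<And>a b. a \<in> q \<Longrightarrow> b \<in> q \<Longrightarrow> a - b \<in> q"
proof -
  note q = assms[unfolded prime_ideal_set_def]
  show "a - b \<in> q" if "a \<in> q" "b \<in> q" for a b
  proof -
    have "- 1 * b \<in> q" using q that by blast
    then have "a + - 1 * b \<in> q" using q that by blast
    then show ?thesis by simp
  qed
qed (use assms in \<open>auto simp: prime_ideal_set_def mult.commute\<close>)

lemma prime_ideal_power:
  assumes "prime_ideal_set q" "a ^ k \<in> q" shows "a \<in> q"
  using assms(2)
proof (induction k)
  case (Suc k) then show ?case using prime_ideal_setD(6)[OF assms(1), of a "a ^ k"] by auto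
qed (use prime_ideal_setD(5)[OF assms(1)] in auto)

lemma prime_ideal_poly:
  assumes "prime_ideal_set q" "\<And>i. coeff P i \<in> q"
  shows "poly P x \<in> q"
proof -
  have "(\<Sum>i\<in>A. coeff P i * x ^ i) \<in> q" for A :: "nat set"
    by (induction A rule: infinite_finite_induct) (use prime_ideal_setD[OF assms(1)] assms(2) in auto)
  then show ?thesis unfolding poly_altdef by blast
qed

text \<open>The coefficients above the last one outside \<open>q\<close> are dropped. Afterwards the
  leading coefficient is nonzero modulo \<open>q\<close>, so degrees can be compared modulo
  \<open>q\<close>.\<close>

lemma truncate_mod_ideal:
  fixes P :: "('v, 'a::alg_closed_field) mpoly poly"
  assumes q: "prime_ideal_set q" and P: "coeffs_in I P" and ex: "\<exists>i. coeff P i \<notin> q"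
  shows "\<exists>P'. coeffs_in I P' \<and> degree P' \<le> degree P \<and> lead_coeff P' \<notin> q \<and> (\<forall>i. coeff (P - P') i \<in> q)"
proof -
  define A where "A = {i. coeff P i \<notin> q}"
  have "A \<subseteq> {..degree P}" unfolding A_def using prime_ideal_setD(1)[OF q] by (auto intro: le_degree)
  then have fin: "finite A" using finite_subset by blast
  define d where "d = Max A"
  have "A \<noteq> {}" using ex A_def by blast
  then have d: "d \<in> A" "\<And>i. i \<in> A \<Longrightarrow> i \<le> d" using fin unfolding d_def by auto
  define P' where "P' = (\<Sum>i\<le>d. monom (coeff P i) i)"
  have cP': "coeff P' i = (if i \<le> d then coeff P i else 0)" for i
    unfolding P'_def by (simp add: coeff_sum coeff_monom if_distrib[of "\<lambda>x. x = _"])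
  have "coeff P' d \<noteq> 0" using d prime_ideal_setD(1)[OF q] by (auto simp: cP' A_def)
  then have deg: "degree P' = d"
    by (intro antisym degree_le le_degree) (auto simp: cP')
  show ?thesis
  proof (intro exI[of _ P'] conjI allI)
    show "coeffs_in I P'" using P by (simp add: coeffs_in_def cP')
    show "degree P' \<le> degree P" using d(1) \<open>A \<subseteq> _\<close> deg by auto
    show "lead_coeff P' \<notin> q" using d(1) by (simp add: deg cP' A_def)
    show "coeff (P - P') i \<in> q" for i
      using d(2)[of i] prime_ideal_setD(1)[OF q] by (auto simp: cP' A_def)
  qed
qed

lemma vars_in_emptyD:
  assumes "vars_in {} f"
  obtains c where "f = MC c"
proof
  show "f = MC (Poly_Mapping.lookup f 0)"
  proof (rule poly_mapping_eqI)
    fix k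
    show "Poly_Mapping.lookup f k = Poly_Mapping.lookup (MC (Poly_Mapping.lookup f 0)) k"
    proof (cases "k = 0")
      case False
      then have "Poly_Mapping.keys k \<noteq> {}" by simp
      then have "k \<notin> Poly_Mapping.keys f" using assms unfolding vars_in_def by blast
      then show ?thesis using False by (simp add: MC_def lookup_single in_keys_iff)
    qed (simp add: MC_def)
  qed
qed

text \<open>Induction on the variables. Modulo \<open>q\<close> the new variable \<open>v\<close> is
  either transcendental or algebraic over the polynomials in \<open>I\<close>. The statement asks
  for \<open>t\<close> to stay nonzero because the induction has to keep leading coefficients and
  eliminants nonzero under specialization.\<close>

theorem nullstellensatz_prime:
  fixes t :: "('v, 'a::alg_closed_field) mpoly"
  assumes "finite I" and q: "prime_ideal_set q" and "vars_in I t" "t \<notin> q"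
  shows "\<exists>a. (\<forall>g\<in>q. vars_in I g \<longrightarrow> eval_mpoly g a = 0) \<and> eval_mpoly t a \<noteq> 0"
  using assms(1,3,4)
proof (induction I arbitrary: t rule: finite_induct)
  case (empty t)
  note qD = prime_ideal_setD[OF q]
  have unit: "c = 0" if "MC c \<in> q" for c
  proof (rule ccontr)
    assume "c \<noteq> 0"
    have "MC (inverse c) * MC c \<in> q" using qD(3) that by blast
    then show False using \<open>c \<noteq> 0\<close> qD(5) by (simp flip: MC_mult)
  qed
  obtain c where c: "t = MC c" using empty(1) by (rule vars_in_emptyD)
  then have "c \<noteq> 0" using empty(2) qD(1) by auto
  moreover have "eval_mpoly g a = 0" if g: "g \<in> q" "vars_in {} g" for g a
  proof -
    obtain d where d: "g = MC d" using g(2) by (rule vars_in_emptyD)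
    then show ?thesis using unit g(1) by simp
  qed
  ultimately show ?case using c by auto
next
  case (insert v I t)
  note qD = prime_ideal_setD[OF q]
  let ?X = "MX v :: ('v, 'a) mpoly"
  obtain T where T: "coeffs_in I T" "t = poly T ?X" using poly_rep_ex[OF insert.prems(1)] by auto
  define good where "good P \<longleftrightarrow> coeffs_in I P \<and> lead_coeff P \<notin> q" for P :: "('v, 'a) mpoly poly"
  have trunc: "\<exists>P'. good P' \<and> degree P' \<le> degree P \<and> poly P ?X - poly P' ?X \<in> q"
    if P: "coeffs_in I P" "\<exists>i. coeff P i \<notin> q" for P
  proof -
    obtain P' where P': "coeffs_in I P'" "degree P' \<le> degree P" "lead_coeff P' \<notin> q"
      "\<forall>i. coeff (P - P') i \<in> q" using truncate_mod_ideal[OF q P] by blast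
    have "poly (P - P') ?X \<in> q" by (rule prime_ideal_poly[OF q]) (use P'(4) in blast)
    with P' show ?thesis unfolding good_def by (intro exI[of _ P']) simp
  qed
  have ev: "eval_mpoly (poly P ?X) (a(v := s)) = poly (ev_poly a P) s" if "coeffs_in I P" for P a s
  proof -
    have "ev_poly (a(v := s)) P = ev_poly a P"
      using insert.hyps(2) by (intro ev_poly_cong[OF that]) auto
    then show ?thesis by (simp add: eval_poly)
  qed
  have gen: "\<exists>G. coeffs_in I G \<and> g = poly G ?X" if "vars_in (insert v I) g" for g
    using poly_rep_ex[OF that] .
  have vX: "vars_in (insert v I) (poly P ?X)" if "coeffs_in I P" for P
    by (rule vars_in_poly[OF that]) auto
  show ?case
  proof (cases "\<exists>P. good P \<and> poly P ?X \<in> q")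
    \<comment> \<open>Here \<open>v\<close> is transcendental modulo \<open>q\<close>: members of
      \<open>q\<close> have all their coefficients in \<open>q\<close>, and some coefficient of
      \<open>t\<close> is outside \<open>q\<close>. The induction hypothesis keeps that coefficient
      nonzero, and all but finitely many values of \<open>v\<close> will do.\<close>
    case False
    have "\<exists>i. coeff T i \<notin> q" using prime_ideal_poly[OF q, of T ?X] insert.prems(2) T(2) by blast
    then obtain i where i: "coeff T i \<notin> q" by blast
    obtain a where a: "\<And>g. g \<in> q \<Longrightarrow> vars_in I g \<Longrightarrow> eval_mpoly g a = 0" "eval_mpoly (coeff T i) a \<noteq> 0"
      using insert.IH[OF _ i] T(1) unfolding coeffs_in_def by blast
    have "coeff (ev_poly a T) i \<noteq> 0" using a(2) by simp
    then have "ev_poly a T \<noteq> 0" by (metis coeff_0)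
    then obtain s where s: "poly (ev_poly a T) s \<noteq> 0" by (rule poly_nonroot)
    have "eval_mpoly g (a(v := s)) = 0" if g: "g \<in> q" "vars_in (insert v I) g" for g
    proof -
      obtain G where G: "coeffs_in I G" "g = poly G ?X" using gen[OF g(2)] by blast
      have "coeff G i \<in> q" for i
      proof (rule ccontr)
        assume "coeff G i \<notin> q"
        then obtain G' where G': "good G'" "poly G ?X - poly G' ?X \<in> q" using trunc[OF G(1)] by blast
        then have "poly G ?X - (poly G ?X - poly G' ?X) \<in> q" using qD(7) g(1) G(2) by blast
        then show False using False G'(1) by auto
      qed
      then have "ev_poly a G = 0"
        using a(1) G(1) by (intro poly_eqI) (simp add: coeffs_in_def)
      then show ?thesis using ev[OF G(1), of a s] G(2) by simp
    qed
    moreover have "eval_mpoly t (a(v := s)) \<noteq> 0" using s ev[OF T(1)] T(2) by simp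
    ultimately show ?thesis by blast
  next
    case True
    then obtain F where F: "good F" "poly F ?X \<in> q"
      and Fmin: "\<And>P. good P \<Longrightarrow> poly P ?X \<in> q \<Longrightarrow> degree F \<le> degree P"
      using ex_has_least_nat[of "\<lambda>P. good P \<and> poly P ?X \<in> q" _ degree] by blast
    have cF: "coeffs_in I F" "lead_coeff F \<notin> q" using F(1) by (auto simp: good_def)
    have degF: "degree F > 0"
    proof (rule ccontr)
      assume "\<not> degree F > 0"
      then obtain c where "F = [:c:]" by (metis degree_eq_zeroE gr0I)
      then show False using F(2) cF(2) by simp
    qed
    \<comment> \<open>The ideal generated by \<open>t\<close> and \<open>q\<close> among the
      polynomials in \<open>insert v I\<close>. As \<open>v\<close> is algebraic modulo
      \<open>q\<close>, this ideal contains an element outside \<open>q\<close> that is free of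
      \<open>v\<close>; it is found as the member \<open>R\<close> of least degree.\<close>
    define J where "J = {\<alpha> * t + g | \<alpha> g. vars_in (insert v I) \<alpha> \<and> vars_in (insert v I) g \<and> g \<in> q}"
    have J_add: "x + y \<in> J" if xy: "x \<in> J" "y \<in> J" for x y
    proof -
      obtain \<alpha> g \<beta> h where "x = \<alpha> * t + g" "y = \<beta> * t + h" "vars_in (insert v I) \<alpha>"
        "vars_in (insert v I) g" "g \<in> q" "vars_in (insert v I) \<beta>" "vars_in (insert v I) h" "h \<in> q"
        using xy unfolding J_def by blast
      then have "x + y = (\<alpha> + \<beta>) * t + (g + h)" "vars_in (insert v I) (\<alpha> + \<beta>)"
        "vars_in (insert v I) (g + h)" "g + h \<in> q"
        by (auto simp: algebra_simps intro: vars_in_add qD(2))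
      then show ?thesis unfolding J_def by blast
    qed
    have J_mult: "r * x \<in> J" if xr: "x \<in> J" "vars_in (insert v I) r" for x r
    proof -
      obtain \<alpha> g where "x = \<alpha> * t + g" "vars_in (insert v I) \<alpha>" "vars_in (insert v I) g" "g \<in> q"
        using xr unfolding J_def by blast
      then have "r * x = (r * \<alpha>) * t + r * g" "vars_in (insert v I) (r * \<alpha>)"
        "vars_in (insert v I) (r * g)" "r * g \<in> q"
        using xr(2) by (auto simp: algebra_simps intro: vars_in_mult qD(3,4))
      then show ?thesis unfolding J_def by blast
    qed
    have J_diff: "x - y \<in> J" if "x \<in> J" "y \<in> J" for x y
      using J_add[OF that(1) J_mult[OF that(2), of "-1"]] by simp
    have J_q: "g \<in> J" if "g \<in> q" "vars_in (insert v I) g" for g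
    proof -
      have "g = 0 * t + g" "vars_in (insert v I) (0 :: ('v, 'a) mpoly)" by simp_all
      then show ?thesis unfolding J_def using that by blast
    qed
    have J_t: "t \<in> J"
    proof -
      have "t = 1 * t + 0" "vars_in (insert v I) (1 :: ('v, 'a) mpoly)"
        "vars_in (insert v I) (0 :: ('v, 'a) mpoly)" by simp_all
      then show ?thesis unfolding J_def using qD(1) by blast
    qed
    have "good F \<and> poly F ?X \<in> J" using F(1) J_q[OF F(2)] vX cF(1) by blast
    then obtain R where R: "good R" "poly R ?X \<in> J"
      and Rmin: "\<And>P. good P \<Longrightarrow> poly P ?X \<in> J \<Longrightarrow> degree R \<le> degree P"
      using ex_has_least_nat[of "\<lambda>P. good P \<and> poly P ?X \<in> J" F degree] by blast
    have cR: "coeffs_in I R" "lead_coeff R \<notin> q" using R(1) by (auto simp: good_def)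
    have remq: "coeff S i \<in> q" if S: "coeffs_in I S" "poly S ?X \<in> J" "degree S < degree R" for S i
    proof (rule ccontr)
      assume "coeff S i \<notin> q"
      then obtain S' where S': "good S'" "degree S' \<le> degree S" "poly S ?X - poly S' ?X \<in> q"
        using trunc[OF S(1)] by blast
      have "poly S ?X - poly S' ?X \<in> J"
        using S' S(1) vX by (intro J_q vars_in_diff) (auto simp: good_def)
      then have "poly S ?X - (poly S ?X - poly S' ?X) \<in> J" using J_diff S(2) by blast
      then have "degree R \<le> degree S'" using Rmin S'(1) by simp
      then show False using S'(2) S(3) by simp
    qed
    have "degree R = 0"
    proof (rule ccontr)
      assume "degree R \<noteq> 0"
      then have degR: "degree R > 0" by simp
      obtain N H S where H: "coeffs_in I H" "coeffs_in I S"
        "smult (lead_coeff R ^ N) F = H * R + S" "degree S < degree R" "degree H \<le> degree F - degree R"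
        using pseudo_division[OF cF(1) cR(1) degR] by blast
      have vN: "vars_in I (lead_coeff R ^ N)" using cR(1) by (auto simp: coeffs_in_def intro: vars_in_power)
      have eq: "poly S ?X = lead_coeff R ^ N * poly F ?X - poly H ?X * poly R ?X"
        using arg_cong[OF H(3), of "\<lambda>P. poly P ?X"] by (simp add: algebra_simps)
      have "poly S ?X \<in> J" unfolding eq
        by (intro J_diff J_mult J_q F(2) R(2) vX cF(1) H(1) vars_in_mono[OF vN]) auto
      then have Sq: "coeff S i \<in> q" for i using remq H by blast
      then have "poly S ?X \<in> q" by (rule prime_ideal_poly[OF q])
      then have "lead_coeff R ^ N * poly F ?X - poly S ?X \<in> q" using qD(7) qD(3) F(2) by blast
      then have "poly H ?X * poly R ?X \<in> q" by (simp add: eq)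
      then consider "poly R ?X \<in> q" | "poly H ?X \<in> q" using qD(6) by blast
      then show False
      proof cases
        \<comment> \<open>Now \<open>R\<close> is no shorter than \<open>F\<close>, so the remainder
          of \<open>t\<close> on division by \<open>F\<close> is zero modulo \<open>q\<close>, and
          \<open>t\<close> would lie in \<open>q\<close>.\<close>
        case 1
        then have degRF: "degree R = degree F"
          using Fmin[OF R(1)] Rmin[OF F(1) J_q[OF F(2) vX[OF cF(1)]]] by simp
        obtain N H S where H: "coeffs_in I H" "coeffs_in I S"
          "smult (lead_coeff F ^ N) T = H * F + S" "degree S < degree F"
          using pseudo_division[OF T(1) cF(1) degF] by blast
        have vN: "vars_in I (lead_coeff F ^ N)" using cF(1) by (auto simp: coeffs_in_def intro: vars_in_power)
        have eq: "poly S ?X = lead_coeff F ^ N * t - poly H ?X * poly F ?X"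
          using arg_cong[OF H(3), of "\<lambda>P. poly P ?X"] T(2) by (simp add: algebra_simps)
        have "poly S ?X \<in> J" unfolding eq
          by (intro J_diff J_mult J_t J_q F(2) vX cF(1) H(1) vars_in_mono[OF vN]) auto
        then have "coeff S i \<in> q" for i using remq H degRF by simp
        then have "poly S ?X \<in> q" by (rule prime_ideal_poly[OF q])
        then have "poly S ?X + poly H ?X * poly F ?X \<in> q" using qD(2) qD(3) F(2) by blast
        then have "lead_coeff F ^ N * t \<in> q" by (simp add: eq)
        then show False using qD(6) prime_ideal_power[OF q] cF(2) insert.prems(2) by blast
      next
        \<comment> \<open>Now \<open>H\<close> would be a relation of \<open>v\<close> shorter than
          \<open>F\<close>. It is nontrivial modulo \<open>q\<close> because
          \<open>H * R + S\<close> has a coefficient outside \<open>q\<close> at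
          \<open>degree F\<close>.\<close>
        case 2
        have "\<exists>i. coeff H i \<notin> q"
        proof (rule ccontr)
          assume "\<not> (\<exists>i. coeff H i \<notin> q)"
          then have Hq: "coeff H i \<in> q" for i by blast
          have sumq: "(\<Sum>i\<in>A. coeff H i * coeff R (n - i)) \<in> q" for A :: "nat set" and n
            by (induction A rule: infinite_finite_induct) (auto intro: qD Hq)
          have "coeff (H * R + S) (degree F) \<in> q"
            unfolding coeff_add coeff_mult by (intro qD(2) sumq Sq)
          then have "lead_coeff R ^ N * lead_coeff F \<in> q" by (simp flip: H(3))
          then show False using qD(6) prime_ideal_power[OF q] cF(2) cR(2) by blast
        qed
        then obtain H' where H': "good H'" "degree H' \<le> degree H" "poly H ?X - poly H' ?X \<in> q"
          using trunc[OF H(1)] by blast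
        have "poly H ?X - (poly H ?X - poly H' ?X) \<in> q" using qD(7) 2 H'(3) by blast
        then have "degree F \<le> degree H'" using Fmin[OF H'(1)] by simp
        then show False using H'(2) H(5) degR degF by simp
      qed
    qed
    then obtain e where Re: "R = [:e:]" by (metis degree_eq_zeroE)
    then have e: "e \<notin> q" "vars_in I e" using cR by auto
    obtain \<alpha> g where ag: "e = \<alpha> * t + g" "g \<in> q" "vars_in (insert v I) g"
      using R(2) Re unfolding J_def by auto
    \<comment> \<open>A nonzero \<open>lead_coeff F\<close> preserves the degree of \<open>F\<close>
      and so provides a root. A nonzero \<open>e\<close> keeps \<open>t\<close> nonzero at this
      root, because \<open>e\<close> is a multiple of \<open>t\<close> modulo
      \<open>q\<close>.\<close>
    have "lead_coeff F * e \<notin> q" using qD(6) cF(2) e(1) by blast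
    moreover have "vars_in I (lead_coeff F * e)" using cF(1) e(2) by (auto simp: coeffs_in_def intro: vars_in_mult)
    ultimately obtain a where a: "\<And>g. g \<in> q \<Longrightarrow> vars_in I g \<Longrightarrow> eval_mpoly g a = 0"
      "eval_mpoly (lead_coeff F * e) a \<noteq> 0" using insert.IH[of "lead_coeff F * e"] by blast
    have lcF: "eval_mpoly (lead_coeff F) a \<noteq> 0" and ea: "eval_mpoly e a \<noteq> 0"
      using a(2) by (auto simp: eval_mpoly_mult)
    have "coeff (ev_poly a F) (degree F) \<noteq> 0" using lcF by simp
    then have "degree F \<le> degree (ev_poly a F)" by (rule le_degree)
    then have "degree (ev_poly a F) > 0" using degF by simp
    then obtain s where s: "poly (ev_poly a F) s = 0" using alg_closed_imp_poly_has_root by blast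
    have van: "eval_mpoly g (a(v := s)) = 0" if g: "g \<in> q" "vars_in (insert v I) g" for g
    proof -
      obtain G where G: "coeffs_in I G" "g = poly G ?X" using gen[OF g(2)] by blast
      obtain N H S where H: "coeffs_in I H" "coeffs_in I S"
        "smult (lead_coeff F ^ N) G = H * F + S" "degree S < degree F"
        using pseudo_division[OF G(1) cF(1) degF] by blast
      have eq: "poly S ?X = lead_coeff F ^ N * g - poly H ?X * poly F ?X"
        using arg_cong[OF H(3), of "\<lambda>P. poly P ?X"] G(2) by (simp add: algebra_simps)
      have Sq: "poly S ?X \<in> q" unfolding eq by (intro qD F(2) g(1))
      have "coeff S i \<in> q" for i
      proof (rule ccontr)
        assume "coeff S i \<notin> q"
        then obtain S' where S': "good S'" "degree S' \<le> degree S" "poly S ?X - poly S' ?X \<in> q"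
          using trunc[OF H(2)] by blast
        have "poly S ?X - (poly S ?X - poly S' ?X) \<in> q" using qD(7) Sq S'(3) by blast
        then show False using Fmin[OF S'(1)] S'(2) H(4) by simp
      qed
      then have "ev_poly a S = 0"
        using a(1) H(2) by (intro poly_eqI) (simp add: coeffs_in_def)
      moreover have "smult (eval_mpoly (lead_coeff F) a ^ N) (ev_poly a G) = ev_poly a H * ev_poly a F + ev_poly a S"
        using arg_cong[OF H(3), of "ev_poly a"] by (simp add: ev_poly_hom eval_mpoly_power)
      ultimately have "eval_mpoly (lead_coeff F) a ^ N * poly (ev_poly a G) s = 0"
        using s by (metis add.right_neutral mult_zero_right poly_mult poly_smult)
      then show ?thesis using lcF ev[OF G(1), of a s] G(2) by simp
    qed
    have "eval_mpoly e (a(v := s)) = eval_mpoly e a"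
      using e(2) insert.hyps(2) by (intro eval_mpoly_cong[OF e(2)]) auto
    then have "eval_mpoly t (a(v := s)) \<noteq> 0"
      using ag van[OF ag(2,3)] ea by (auto simp: eval_mpoly_hom)
    then show ?thesis using van by blast
  qed
qed

definition ideal_span :: "'r::comm_ring_1 set \<Rightarrow> 'r set" where
  "ideal_span S = {x. \<exists>T q. finite T \<and> T \<subseteq> S \<and> x = (\<Sum>g\<in>T. q g * g)}"

lemma ideal_spanI: "finite T \<Longrightarrow> T \<subseteq> S \<Longrightarrow> x = (\<Sum>g\<in>T. q g * g) \<Longrightarrow> x \<in> ideal_span S"
  unfolding ideal_span_def by (rule CollectI, rule exI[of _ T], rule exI[of _ q]) simp

lemma ideal_span_0: "0 \<in> ideal_span S"
  unfolding ideal_span_def by (auto intro!: exI[of _ "{}"])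

lemma ideal_span_base: "g \<in> S \<Longrightarrow> g \<in> ideal_span S"
  unfolding ideal_span_def by (auto intro!: exI[of _ "{g}"] exI[of _ "\<lambda>_. 1"])

lemma ideal_span_add:
  assumes "x \<in> ideal_span S" "y \<in> ideal_span S" shows "x + y \<in> ideal_span S"
proof -
  obtain T q where T: "finite T" "T \<subseteq> S" "x = (\<Sum>g\<in>T. q g * g)" using assms(1) unfolding ideal_span_def by auto
  obtain U r where U: "finite U" "U \<subseteq> S" "y = (\<Sum>g\<in>U. r g * g)" using assms(2) unfolding ideal_span_def by auto
  have "x = (\<Sum>g\<in>T \<union> U. (if g \<in> T then q g else 0) * g)"
    unfolding T(3) using T U by (intro sum.mono_neutral_cong_left) auto
  moreover have "y = (\<Sum>g\<in>T \<union> U. (if g \<in> U then r g else 0) * g)"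
    unfolding U(3) using T U by (intro sum.mono_neutral_cong_left) auto
  ultimately have eq: "x + y = (\<Sum>g\<in>T \<union> U. ((if g \<in> T then q g else 0) + (if g \<in> U then r g else 0)) * g)"
    by (simp add: sum.distrib[symmetric] algebra_simps)
  show ?thesis by (rule ideal_spanI[OF _ _ eq]) (use T U in auto)
qed

lemma ideal_span_mult:
  assumes "x \<in> ideal_span S" shows "r * x \<in> ideal_span S"
proof -
  obtain T q where T: "finite T" "T \<subseteq> S" "x = (\<Sum>g\<in>T. q g * g)" using assms(1) unfolding ideal_span_def by auto
  then have eq: "r * x = (\<Sum>g\<in>T. (r * q g) * g)" by (simp add: sum_distrib_left mult.assoc)
  show ?thesis by (rule ideal_spanI[OF T(1,2) eq])
qed

lemma ideal_in_prime:
  fixes S :: "'r::comm_ring_1 set"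
  assumes "1 \<notin> ideal_span S"
  shows "\<exists>q. prime_ideal_set q \<and> S \<subseteq> q"
proof -
  define A where "A = {J :: 'r set. ideal_span S \<subseteq> J \<and> (\<forall>a\<in>J. \<forall>b\<in>J. a + b \<in> J) \<and>
    (\<forall>a\<in>J. \<forall>r. r * a \<in> J) \<and> 1 \<notin> J}"
  have "ideal_span S \<in> A" unfolding A_def using assms ideal_span_add ideal_span_mult by blast
  then have ne: "A \<noteq> {}" by blast
  have "\<exists>M\<in>A. \<forall>X\<in>A. M \<subseteq> X \<longrightarrow> X = M"
  proof (rule subset_Zorn_nonempty[OF ne])
    fix \<C> assume C: "\<C> \<noteq> {}" "subset.chain A \<C>"
    have sub: "\<C> \<subseteq> A" and lin: "\<And>X Y. X \<in> \<C> \<Longrightarrow> Y \<in> \<C> \<Longrightarrow> X \<subseteq> Y \<or> Y \<subseteq> X"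
      using C(2) unfolding subset.chain_def by auto
    show "\<Union>\<C> \<in> A"
      unfolding A_def
    proof (intro CollectI conjI ballI allI)
      show "ideal_span S \<subseteq> \<Union>\<C>" using C(1) sub unfolding A_def by blast
      show "1 \<notin> \<Union>\<C>" using sub unfolding A_def by blast
      show "r * a \<in> \<Union>\<C>" if "a \<in> \<Union>\<C>" for a r using that sub unfolding A_def by blast
      show "a + b \<in> \<Union>\<C>" if ab: "a \<in> \<Union>\<C>" "b \<in> \<Union>\<C>" for a b
      proof -
        obtain X Y where XY: "X \<in> \<C>" "a \<in> X" "Y \<in> \<C>" "b \<in> Y" using ab by blast
        then obtain Z where "Z \<in> \<C>" "a \<in> Z" "b \<in> Z" using lin[of X Y] by blast
        then show ?thesis using sub unfolding A_def by blast
      qed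
    qed
  qed
  then obtain M where M: "M \<in> A" "\<And>X. X \<in> A \<Longrightarrow> M \<subseteq> X \<Longrightarrow> X = M" by blast
  then have M1: "ideal_span S \<subseteq> M" "\<And>a b. a \<in> M \<Longrightarrow> b \<in> M \<Longrightarrow> a + b \<in> M"
    "\<And>a r. a \<in> M \<Longrightarrow> r * a \<in> M" "1 \<notin> M" unfolding A_def by blast+
  have M0: "0 \<in> M" using M1(1) ideal_span_0 by blast
  have inv: "\<exists>r. \<exists>m\<in>M. 1 = r * a + m" if "a \<notin> M" for a
  proof -
    define X where "X = {r * a + m | r m. m \<in> M}"
    have sub: "M \<subseteq> X" unfolding X_def by (force intro: exI[of _ 0])
    have "1 * a + 0 \<in> X" unfolding X_def using M0 by blast
    then have "a \<in> X" by simp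
    then have "X \<notin> A" using M(2) sub that by blast
    moreover have "x + y \<in> X" if xy: "x \<in> X" "y \<in> X" for x y
    proof -
      obtain r m r' m' where "x = r * a + m" "y = r' * a + m'" "m \<in> M" "m' \<in> M"
        using xy X_def by blast
      then have "x + y = (r + r') * a + (m + m')" "m + m' \<in> M" using M1(2) by (auto simp: algebra_simps)
      then show ?thesis unfolding X_def by blast
    qed
    moreover have "s * x \<in> X" if x: "x \<in> X" for x s
    proof -
      obtain r m where "x = r * a + m" "m \<in> M" using x X_def by blast
      then have "s * x = (s * r) * a + s * m" "s * m \<in> M" using M1(3) by (auto simp: algebra_simps)
      then show ?thesis unfolding X_def by blast
    qed
    ultimately have "1 \<in> X" using sub M1(1) unfolding A_def by blast
    then show ?thesis unfolding X_def by blast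
  qed
  have "a \<in> M \<or> b \<in> M" if ab: "a * b \<in> M" for a b
  proof (rule ccontr)
    assume "\<not> (a \<in> M \<or> b \<in> M)"
    then obtain r m where m: "m \<in> M" "1 = r * a + m" using inv by blast
    have "b = r * (a * b) + b * m"
      using arg_cong[OF m(2), of "\<lambda>x. x * b"] by (simp add: algebra_simps)
    also have "\<dots> \<in> M" using M1(2,3) m(1) ab by blast
    finally show False using \<open>\<not> (a \<in> M \<or> b \<in> M)\<close> by blast
  qed
  then have "prime_ideal_set M" unfolding prime_ideal_set_def using M0 M1 by blast
  moreover have "S \<subseteq> M" using M1(1) ideal_span_base by blast
  ultimately show ?thesis by blast
qed

theorem weak_nullstellensatz:
  fixes S :: "('v, 'a::alg_closed_field) mpoly set"
  assumes "finite I" "\<And>g. g \<in> S \<Longrightarrow> vars_in I g"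
    and "\<And>a. \<exists>g\<in>S. eval_mpoly g a \<noteq> 0"
  shows "1 \<in> ideal_span S"
proof (rule ccontr)
  assume "1 \<notin> ideal_span S"
  then obtain q where q: "prime_ideal_set q" "S \<subseteq> q" using ideal_in_prime by blast
  then obtain a where "\<And>g. g \<in> q \<Longrightarrow> vars_in I g \<Longrightarrow> eval_mpoly g a = 0"
    using nullstellensatz_prime[OF assms(1) q(1), of 1] prime_ideal_setD(5)[OF q(1)] by auto
  then show False using assms(2,3) q(2) by blast
qed

section \<open>Unique factorization of multivariate polynomials\<close>

text \<open>The polynomial \<open>f(T x)\<close> in an extra variable \<open>T\<close>. Its
  coefficients are the homogeneous parts of \<open>f\<close> and its degree is the total degree; as
  it is multiplicative, questions about total degree become univariate.\<close>

definition gpoly :: "('v, 'a::comm_semiring_1) mpoly \<Rightarrow> ('v, 'a) mpoly poly" where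
  "gpoly f = (\<Sum>m\<in>Poly_Mapping.keys f. monom (Poly_Mapping.single m (Poly_Mapping.lookup f m)) (total_deg m))"

lemma gpoly_superset:
  assumes "finite S" "Poly_Mapping.keys f \<subseteq> S"
  shows "gpoly f = (\<Sum>m\<in>S. monom (Poly_Mapping.single m (Poly_Mapping.lookup f m)) (total_deg m))"
  unfolding gpoly_def using assms by (intro sum.mono_neutral_left) (auto simp: in_keys_iff)

lemma gpoly_add: "gpoly (f + g) = gpoly f + gpoly g"
proof -
  let ?S = "Poly_Mapping.keys f \<union> Poly_Mapping.keys g"
  have "gpoly (f + g) = (\<Sum>m\<in>?S. monom (Poly_Mapping.single m (Poly_Mapping.lookup (f + g) m)) (total_deg m))"
    by (rule gpoly_superset) (auto simp: Poly_Mapping.keys_add)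
  also have "\<dots> = gpoly f + gpoly g"
    by (subst (1 2) gpoly_superset[of ?S])
      (auto simp: lookup_add single_add add_monom[symmetric] sum.distrib)
  finally show ?thesis .
qed

lemma gpoly_0 [simp]: "gpoly 0 = 0"
  by (simp add: gpoly_def)

lemma gpoly_sum: "gpoly (\<Sum>i\<in>I. f i) = (\<Sum>i\<in>I. gpoly (f i))"
  by (induction I rule: infinite_finite_induct) (auto simp: gpoly_add)

lemma gpoly_single: "gpoly (Poly_Mapping.single m a) = monom (Poly_Mapping.single m a) (total_deg m)"
  by (subst gpoly_superset[of "{m}"]) auto

lemma gpoly_mult: "gpoly (f * g) = gpoly f * gpoly g"
proof -
  have "f * g = (\<Sum>m\<in>Poly_Mapping.keys f. \<Sum>m'\<in>Poly_Mapping.keys g.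
      Poly_Mapping.single (m + m') (Poly_Mapping.lookup f m * Poly_Mapping.lookup g m'))"
    by (subst mpoly_eq_sum_single[of f], subst mpoly_eq_sum_single[of g])
       (simp add: sum_product mult_single)
  then have "gpoly (f * g) = (\<Sum>m\<in>Poly_Mapping.keys f. \<Sum>m'\<in>Poly_Mapping.keys g.
      monom (Poly_Mapping.single (m + m') (Poly_Mapping.lookup f m * Poly_Mapping.lookup g m'))
        (total_deg m + total_deg m'))"
    by (simp add: gpoly_sum gpoly_single total_deg_add)
  then show ?thesis
    by (simp add: gpoly_def[of f] gpoly_def[of g] sum_product mult_monom mult_single)
qed

lemma poly_gpoly_1: "poly (gpoly f) 1 = f"
  using mpoly_eq_sum_single[of f] by (simp add: gpoly_def poly_sum poly_monom)

lemma coeff_gpoly: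
  "coeff (gpoly f) e = (\<Sum>m\<in>{m\<in>Poly_Mapping.keys f. total_deg m = e}. Poly_Mapping.single m (Poly_Mapping.lookup f m))"
  unfolding gpoly_def coeff_sum by (subst sum.inter_filter) (auto intro!: sum.cong)

lemma keys_coeff_gpoly: "Poly_Mapping.keys (coeff (gpoly f) e) \<subseteq> {m\<in>Poly_Mapping.keys f. total_deg m = e}"
proof
  fix k assume "k \<in> Poly_Mapping.keys (coeff (gpoly f) e)"
  then have ne: "(\<Sum>m\<in>{m\<in>Poly_Mapping.keys f. total_deg m = e}. if m = k then Poly_Mapping.lookup f m else 0) \<noteq> 0"
    by (simp add: coeff_gpoly in_keys_iff lookup_sum lookup_single when_def)
  show "k \<in> {m\<in>Poly_Mapping.keys f. total_deg m = e}"
  proof (rule ccontr)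
    assume "k \<notin> {m\<in>Poly_Mapping.keys f. total_deg m = e}"
    then have "(\<Sum>m\<in>{m\<in>Poly_Mapping.keys f. total_deg m = e}. if m = k then Poly_Mapping.lookup f m else 0) = 0"
      by (intro sum.neutral) auto
    then show False using ne by contradiction
  qed
qed

lemma homogeneous_coeff_gpoly: "homogeneous e (coeff (gpoly f) e)"
  using keys_coeff_gpoly unfolding homogeneous_def by blast

lemma vars_in_coeff_gpoly: "vars_in I f \<Longrightarrow> vars_in I (coeff (gpoly f) e)"
  using keys_coeff_gpoly[of f e] unfolding vars_in_def by blast

lemma gpoly_homogeneous:
  assumes "homogeneous e f" shows "gpoly f = monom f e"
proof -
  have "gpoly f = (\<Sum>m\<in>Poly_Mapping.keys f. monom (Poly_Mapping.single m (Poly_Mapping.lookup f m)) e)"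
    unfolding gpoly_def using assms by (intro sum.cong) (auto simp: homogeneous_def)
  also have "\<dots> = monom (\<Sum>m\<in>Poly_Mapping.keys f. Poly_Mapping.single m (Poly_Mapping.lookup f m)) e"
    by (rule poly_eqI) (simp add: coeff_sum coeff_monom)
  finally show ?thesis using mpoly_eq_sum_single[of f] by simp
qed

section \<open>Total degree, units and factors of homogeneous polynomials\<close>

definition mdeg :: "('v, 'a::comm_semiring_1) mpoly \<Rightarrow> nat" where
  "mdeg f = degree (gpoly f)"

lemma gpoly_eq_0_iff [simp]: "gpoly f = 0 \<longleftrightarrow> f = 0"
  by (metis gpoly_0 poly_0 poly_gpoly_1)

lemma mdeg_homogeneous: "homogeneous e f \<Longrightarrow> f \<noteq> 0 \<Longrightarrow> mdeg f = e"
  by (simp add: mdeg_def gpoly_homogeneous degree_monom_eq)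

lemma mdeg_mult:
  fixes f g :: "(nat, 'a::idom) mpoly"
  shows "f \<noteq> 0 \<Longrightarrow> g \<noteq> 0 \<Longrightarrow> mdeg (f * g) = mdeg f + mdeg g"
  by (simp add: mdeg_def gpoly_mult degree_mult_eq)

lemma homogeneous_0_MC:
  assumes "homogeneous 0 f" obtains c where "f = MC c"
proof (rule vars_in_emptyD[of f])
  have "Poly_Mapping.keys m = {}" if "m \<in> Poly_Mapping.keys f" for m
  proof (rule ccontr)
    assume "Poly_Mapping.keys m \<noteq> {}"
    then obtain i where "i \<in> Poly_Mapping.keys m" by blast
    then have "Poly_Mapping.lookup m i > 0" "Poly_Mapping.lookup m i \<le> total_deg m"
      unfolding total_deg_def by (auto simp: in_keys_iff intro!: member_le_sum)
    then show False using assms that by (auto simp: homogeneous_def)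
  qed
  then show "vars_in {} f" by (auto simp: vars_in_def)
qed

lemma homogeneous_MC: "homogeneous 0 (MC c)"
  by (auto simp: homogeneous_def MC_def total_deg_def)

lemma mdeg_0_MC:
  assumes "mdeg f = 0" obtains c where "f = MC c"
proof (rule homogeneous_0_MC[of f])
  obtain a where "gpoly f = [:a:]" using assms degree_eq_zeroE unfolding mdeg_def by blast
  then have "f = coeff (gpoly f) 0" using poly_gpoly_1[of f] by simp
  then show "homogeneous 0 f" by (metis homogeneous_coeff_gpoly)
qed

lemma mdeg_MC [simp]: "mdeg (MC c) = 0"
  by (cases "c = 0") (auto simp: mdeg_homogeneous[OF homogeneous_MC], simp add: mdeg_def)

lemma mpoly_unit_iff:
  fixes f :: "(nat, 'a::field) mpoly"
  shows "f dvd 1 \<longleftrightarrow> f \<noteq> 0 \<and> mdeg f = 0"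
proof
  assume "f dvd 1"
  then obtain g where g: "1 = f * g" by (elim dvdE)
  then have "f \<noteq> 0" "g \<noteq> 0" by auto
  then have "mdeg (1 :: (nat, 'a) mpoly) = mdeg f + mdeg g" using g mdeg_mult by metis
  moreover have "mdeg (MC 1 :: (nat, 'a) mpoly) = 0" by (rule mdeg_MC)
  ultimately show "f \<noteq> 0 \<and> mdeg f = 0" using \<open>f \<noteq> 0\<close> by simp
next
  assume f: "f \<noteq> 0 \<and> mdeg f = 0"
  then obtain c where c: "f = MC c" using mdeg_0_MC by blast
  then have "c \<noteq> 0" using f by auto
  then have "1 = f * MC (inverse c)" unfolding c by (simp flip: MC_mult)
  then show "f dvd 1" by (rule dvdI)
qed

lemma mpoly_unitE:
  fixes f :: "(nat, 'a::field) mpoly"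
  assumes "f dvd 1" obtains c where "f = MC c" "c \<noteq> 0"
proof -
  have f: "f \<noteq> 0" "mdeg f = 0" using assms mpoly_unit_iff by auto
  obtain c where c: "f = MC c" using f(2) by (rule mdeg_0_MC)
  then have "c \<noteq> 0" using f(1) by auto
  with c show thesis by (rule that)
qed

text \<open>Over a domain the lowest terms of the factors multiply to the lowest term of the
  product, and likewise the highest terms. In a monomial both coincide, hence also in each
  factor.\<close>

lemma monom_factor:
  fixes P Q :: "'r::idom poly"
  assumes "P * Q = monom c e" "c \<noteq> 0"
  shows "P = monom (lead_coeff P) (degree P)"
proof -
  have ne: "P \<noteq> 0" "Q \<noteq> 0" using assms by auto
  have ex: "\<exists>i. coeff R i \<noteq> 0 \<and> (\<forall>j<i. coeff R j = 0)" if "R \<noteq> 0" for R :: "'r poly"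
    using exists_least_iff[of "\<lambda>i. coeff R i \<noteq> 0"] that leading_coeff_neq_0 by blast
  obtain i where i: "coeff P i \<noteq> 0" "\<forall>k<i. coeff P k = 0" using ex[OF ne(1)] by blast
  obtain j where j: "coeff Q j \<noteq> 0" "\<forall>k<j. coeff Q k = 0" using ex[OF ne(2)] by blast
  have "coeff (P * Q) (i + j) = (\<Sum>k\<le>i + j. if k = i then coeff P i * coeff Q j else 0)"
    unfolding coeff_mult
  proof (rule sum.cong)
    fix k assume "k \<in> {..i + j}"
    then consider "k < i" | "k = i" | "i + j - k < j" by force
    then show "coeff P k * coeff Q (i + j - k) = (if k = i then coeff P i * coeff Q j else 0)"
      using i(2) j(2) by cases auto
  qed simp
  then have "coeff (P * Q) (i + j) \<noteq> 0" using i(1) j(1) by simp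
  then have "i + j = e" using assms(1) by (auto simp: coeff_monom split: if_splits)
  moreover have "degree P + degree Q = e"
    using degree_mult_eq[OF ne] assms by (simp add: degree_monom_eq)
  moreover have "i \<le> degree P" "j \<le> degree Q" using i(1) j(1) by (auto intro: le_degree)
  ultimately have "i = degree P" by simp
  then show ?thesis using i(2) by (intro poly_eqI) (auto simp: coeff_monom intro: coeff_eq_0 linorder_cases)
qed

lemma homogeneous_factor:
  fixes f g :: "(nat, 'a::idom) mpoly"
  assumes "homogeneous e (f * g)" "f * g \<noteq> 0"
  shows "homogeneous (mdeg f) f"
proof -
  have "gpoly f * gpoly g = monom (f * g) e" using gpoly_homogeneous[OF assms(1)] by (simp add: gpoly_mult)
  then have eq: "gpoly f = monom (lead_coeff (gpoly f)) (degree (gpoly f))"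
    using monom_factor assms(2) by blast
  have "f = lead_coeff (gpoly f)"
    using arg_cong[OF eq, of "\<lambda>p. poly p 1"] unfolding poly_gpoly_1 by (simp add: poly_monom)
  then show ?thesis unfolding mdeg_def by (metis homogeneous_coeff_gpoly)
qed

text \<open>The degree in a single variable \<open>u\<close> is additive, so a variable that is
  absent from a nonzero product is absent from its factors.\<close>

lemma vars_in_factor:
  fixes f g :: "(nat, 'a::alg_closed_field) mpoly"
  assumes "vars_in I (f * g)" "f * g \<noteq> 0"
  shows "vars_in I f"
proof -
  have "u \<notin> Poly_Mapping.keys m" if u: "u \<notin> I" and m: "m \<in> Poly_Mapping.keys f" for u m
  proof -
    let ?J = "UNIV - {u}"
    have ins: "insert u ?J = UNIV" by blast
    obtain P where P: "coeffs_in ?J P" "f = poly P (MX u)"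
      using poly_rep_ex[of u ?J f] unfolding ins by auto
    obtain Q where Q: "coeffs_in ?J Q" "g = poly Q (MX u)"
      using poly_rep_ex[of u ?J g] unfolding ins by auto
    have "P * Q = [:f * g:]"
    proof (rule poly_rep_unique[of ?J _ _ u])
      show "coeffs_in ?J [:f * g:]" using vars_in_mono[OF assms(1), of ?J] u by auto
    qed (use P Q coeffs_in_mult in auto)
    then have "degree (P * Q) = 0" by simp
    then have "degree P = 0" using degree_mult_eq[of P Q] P Q assms(2) by fastforce
    then obtain a where "P = [:a:]" by (metis degree_eq_zeroE)
    then have "vars_in ?J f" using P by simp
    then show ?thesis using m unfolding vars_in_def by blast
  qed
  then show ?thesis unfolding vars_in_def by blast
qed

section \<open>Factorizations, Gauss's lemma and elimination of a variable\<close>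

lemma irreducible_factorization_ex:
  fixes f :: "(nat, 'a::alg_closed_field) mpoly"
  assumes "f \<noteq> 0" "\<not> f dvd 1"
  shows "\<exists>M. (\<forall>p\<in>#M. irreducible p) \<and> prod_mset M = f"
  using assms
proof (induction "mdeg f" arbitrary: f rule: less_induct)
  case less
  show ?case
  proof (cases "irreducible f")
    case True
    then show ?thesis by (intro exI[of _ "{#f#}"]) simp
  next
    case False
    then obtain g h where gh: "f = g * h" "\<not> g dvd 1" "\<not> h dvd 1"
      using less.prems unfolding irreducible_def by blast
    then have ne: "g \<noteq> 0" "h \<noteq> 0" using less.prems by auto
    then have "mdeg g > 0" "mdeg h > 0"
      using gh(2,3) mpoly_unit_iff[of g] mpoly_unit_iff[of h] by auto
    then have "mdeg g < mdeg f" "mdeg h < mdeg f" using mdeg_mult[OF ne] gh(1) by auto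
    then obtain M N where "\<forall>p\<in>#M. irreducible p" "prod_mset M = g" "\<forall>p\<in>#N. irreducible p" "prod_mset N = h"
      using less.hyps[OF _ ne(1) gh(2)] less.hyps[OF _ ne(2) gh(3)] by blast
    then show ?thesis using gh(1) by (intro exI[of _ "M + N"]) auto
  qed
qed

lemma dvd_poly_iff:
  fixes p :: "(nat, 'a::alg_closed_field) mpoly"
  assumes p: "vars_in I p" and P: "coeffs_in I P" and v: "v \<notin> I"
  shows "p dvd poly P (MX v) \<longleftrightarrow> (\<forall>i. p dvd coeff P i)"
proof
  assume d: "p dvd poly P (MX v)"
  show "\<forall>i. p dvd coeff P i"
  proof (cases "P = 0")
    case False
    have ne: "poly P (MX v) \<noteq> 0"
      using poly_rep_unique[OF P coeffs_in_0 v] False by auto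
    obtain k where k: "poly P (MX v) = p * k" using d by (elim dvdE)
    have "vars_in (insert v I) (poly P (MX v))" by (rule vars_in_poly[OF P]) auto
    then have vk: "vars_in (insert v I) k"
      using vars_in_factor[of "insert v I" k p] k ne by (simp add: mult.commute)
    obtain K where K: "coeffs_in I K" "k = poly K (MX v)" using poly_rep_ex[OF vk] by blast
    have "P = Polynomial.smult p K"
      by (rule poly_rep_unique[OF P coeffs_in_smult[OF p K(1)] v]) (simp add: k K)
    then show ?thesis by simp
  qed simp
next
  assume "\<forall>i. p dvd coeff P i"
  then show "p dvd poly P (MX v)" unfolding poly_altdef by (intro dvd_sum dvd_mult2) blast
qed

text \<open>The invariant for adding one variable at a time. Irreducibility refers to the ring in
  all variables; by \<open>vars_in_factor\<close> the factors of a nonzero polynomial in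
  \<open>I\<close> stay in \<open>I\<close>, so this is also irreducibility in
  \<open>I\<close>.\<close>

definition euclid_on :: "nat set \<Rightarrow> 'a::comm_ring_1 itself \<Rightarrow> bool" where
  "euclid_on I _ \<longleftrightarrow> (\<forall>(f :: (nat, 'a) mpoly) g h. irreducible f \<and> vars_in I f \<and> vars_in I g \<and> vars_in I h \<and>
     f dvd g * h \<longrightarrow> f dvd g \<or> f dvd h)"

context
  fixes I :: "nat set" and v :: nat
  assumes E: "euclid_on I TYPE('a::alg_closed_field)" and v: "v \<notin> I"
begin

text \<open>Gauss's lemma: take the first coefficients of \<open>G\<close> and of \<open>H\<close>
  that \<open>p\<close> does not divide. Modulo \<open>p\<close>, the coefficient of
  \<open>G * H\<close> at the sum of their positions is their product.\<close>

lemma irreducible_coeff_prime: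
  fixes p :: "(nat, 'a) mpoly"
  assumes p: "irreducible p" "vars_in I p"
    and g: "vars_in (insert v I) g" and h: "vars_in (insert v I) h" and d: "p dvd g * h"
  shows "p dvd g \<or> p dvd h"
proof (rule ccontr)
  assume n: "\<not> (p dvd g \<or> p dvd h)"
  obtain G where G: "coeffs_in I G" "g = poly G (MX v)" using poly_rep_ex[OF g] by blast
  obtain H where H: "coeffs_in I H" "h = poly H (MX v)" using poly_rep_ex[OF h] by blast
  have GH: "\<forall>k. p dvd coeff (G * H) k"
    using d dvd_poly_iff[OF p(2) coeffs_in_mult[OF G(1) H(1)] v] G H by simp
  have ex: "\<exists>i. \<not> p dvd coeff R i \<and> (\<forall>j<i. p dvd coeff R j)" if "coeffs_in I R" "\<not> p dvd poly R (MX v)" for R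
    using exists_least_iff[of "\<lambda>i. \<not> p dvd coeff R i"] that dvd_poly_iff[OF p(2) that(1) v] by blast
  obtain i where i: "\<not> p dvd coeff G i" "\<forall>k<i. p dvd coeff G k" using ex[OF G(1)] n G(2) by blast
  obtain j where j: "\<not> p dvd coeff H j" "\<forall>k<j. p dvd coeff H k" using ex[OF H(1)] n H(2) by blast
  have split: "coeff (G * H) (i + j) = coeff G i * coeff H j + (\<Sum>k\<in>{..i + j} - {i}. coeff G k * coeff H (i + j - k))"
    unfolding coeff_mult by (subst sum.remove[of _ i]) auto
  have rest: "p dvd (\<Sum>k\<in>{..i + j} - {i}. coeff G k * coeff H (i + j - k))"
  proof (rule dvd_sum)
    fix k assume "k \<in> {..i + j} - {i}"
    then consider "k < i" | "i + j - k < j" by force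
    then show "p dvd coeff G k * coeff H (i + j - k)" using i(2) j(2) by cases (auto intro: dvd_mult dvd_mult2)
  qed
  have "p dvd coeff (G * H) (i + j)" using GH by blast
  then have "p dvd coeff G i * coeff H j" unfolding split using dvd_add_left_iff[OF rest] by blast
  then have "p dvd coeff G i \<or> p dvd coeff H j"
    using E p G(1) H(1) unfolding euclid_on_def coeffs_in_def by blast
  then show False using i(1) j(1) by blast
qed

text \<open>This replaces the passage to the field of fractions of the polynomials in
  \<open>I\<close>. The irreducible factors of \<open>c\<close> are prime by
  \<open>irreducible_coeff_prime\<close> and are removed one at a time, each from \<open>q\<close>
  or from \<open>r\<close>.\<close>

lemma cancel_content:
  fixes c f q r :: "(nat, 'a) mpoly"
  assumes c: "vars_in I c" "c \<noteq> 0" and f: "vars_in (insert v I) f" "f \<noteq> 0" and eq: "c * f = q * r"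
  shows "\<exists>c1 c2 q' r'. vars_in I c1 \<and> vars_in I c2 \<and> f = q' * r' \<and> q = c1 * q' \<and> r = c2 * r'"
proof -
  have main: "\<exists>c1 c2 q' r'. vars_in I c1 \<and> vars_in I c2 \<and> f = q' * r' \<and> q = c1 * q' \<and> r = c2 * r'"
    if "\<forall>p\<in>#M. irreducible p \<and> vars_in I p" "prod_mset M * f = q * r" for M q r
    using that
  proof (induction M arbitrary: q r)
    case empty
    then show ?case by (intro exI[of _ 1] exI[of _ q] exI[of _ r]) simp
  next
    case (add p M)
    have p: "irreducible p" "vars_in I p" using add.prems by auto
    have pM: "vars_in I (prod_mset M)" "prod_mset M \<noteq> 0"
      using add.prems(1) by (induction M) (auto intro: vars_in_mult simp: irreducible_def)
    have p0: "p \<noteq> 0" using p(1) by (simp add: irreducible_def)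
    have eq: "p * (prod_mset M * f) = q * r" using add.prems(2) by (simp add: mult.assoc)
    have ne: "q * r \<noteq> 0" using eq p0 pM(2) f(2) by auto
    have "vars_in (insert v I) (p * (prod_mset M * f))"
      using p(2) pM(1) f(1) by (intro vars_in_mult) (auto intro: vars_in_mono)
    then have "vars_in (insert v I) q" "vars_in (insert v I) r"
      using vars_in_factor[of "insert v I" q r] vars_in_factor[of "insert v I" r q] ne eq
      by (auto simp: mult.commute)
    moreover have "p dvd q * r" using eq by (metis dvd_triv_left)
    ultimately have "p dvd q \<or> p dvd r" using irreducible_coeff_prime[OF p] by blast
    then show ?case
    proof
      assume "p dvd q"
      then obtain q1 where q1: "q = p * q1" by (elim dvdE)
      then have "prod_mset M * f = q1 * r" using eq p0 by (simp add: mult.assoc)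
      then obtain c1 c2 q' r' where "vars_in I c1" "vars_in I c2" "f = q' * r'" "q1 = c1 * q'" "r = c2 * r'"
        using add.IH[of q1 r] add.prems(1) by auto
      then show ?thesis using p(2) q1
        by (intro exI[of _ "p * c1"] exI[of _ c2] exI[of _ q'] exI[of _ r']) (auto intro: vars_in_mult)
    next
      assume "p dvd r"
      then obtain r1 where r1: "r = p * r1" by (elim dvdE)
      then have "prod_mset M * f = q * r1" using eq p0 by (simp add: mult.left_commute)
      then obtain c1 c2 q' r' where "vars_in I c1" "vars_in I c2" "f = q' * r'" "q = c1 * q'" "r1 = c2 * r'"
        using add.IH[of q r1] add.prems(1) by auto
      then show ?thesis using p(2) r1
        by (intro exI[of _ c1] exI[of _ "p * c2"] exI[of _ q'] exI[of _ r']) (auto intro: vars_in_mult)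
    qed
  qed
  show ?thesis
  proof (cases "c dvd 1")
    case True
    then obtain a where a: "c = MC a" "a \<noteq> 0" by (rule mpoly_unitE)
    then have inv: "MC (inverse a) * c = 1" by (simp flip: MC_mult)
    have "f = MC (inverse a) * c * f" by (simp add: inv)
    then have "f = (MC (inverse a) * q) * r" using eq by (simp add: mult.assoc)
    moreover have "q = c * (MC (inverse a) * q)"
      using arg_cong[OF inv, of "\<lambda>x. x * q"] by (simp add: ac_simps)
    ultimately show ?thesis using c(1) by (intro exI[of _ c] exI[of _ 1] exI[of _ "MC (inverse a) * q"] exI[of _ r]) simp
  next
    case False
    then obtain M where M: "\<forall>p\<in>#M. irreducible p" "prod_mset M = c"
      using irreducible_factorization_ex[OF c(2)] by blast
    have "vars_in I p" if pM: "p \<in># M" for p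
    proof -
      obtain N where "M = add_mset p N" using multi_member_split[OF pM] by blast
      then have "c = p * prod_mset N" using M(2) by simp
      then show ?thesis using vars_in_factor[of I p "prod_mset N"] c by simp
    qed
    then show ?thesis using main[of M q r] M eq by blast
  qed
qed

text \<open>\<open>R\<close> is a nonzero element of least degree in \<open>v\<close> in the ideal
  of \<open>f\<close> and \<open>g\<close>. If it involved \<open>v\<close>, then \<open>f\<close>
  and \<open>g\<close> would both be multiples of it up to factors in \<open>I\<close>, and
  irreducibility of \<open>f\<close> would give \<open>f dvd g\<close>. So \<open>R\<close> is free
  of \<open>v\<close> and takes the place of the resultant.\<close>

lemma elimination:
  fixes f g :: "(nat, 'a) mpoly"
  assumes f: "irreducible f" "vars_in (insert v I) f" "\<not> vars_in I f"
    and g: "vars_in (insert v I) g" "\<not> f dvd g"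
  shows "\<exists>r \<alpha> \<beta>. r \<noteq> 0 \<and> vars_in I r \<and> r = \<alpha> * f + \<beta> * g"
proof -
  let ?X = "MX v :: (nat, 'a) mpoly"
  have f0: "f \<noteq> 0" using f(1) by (simp add: irreducible_def)
  have g0: "g \<noteq> 0" using g(2) by auto
  define J where "J = {\<alpha> * f + \<beta> * g | \<alpha> \<beta>. vars_in (insert v I) \<alpha> \<and> vars_in (insert v I) \<beta>}"
  have JI: "\<alpha> * f + \<beta> * g \<in> J" if "vars_in (insert v I) \<alpha>" "vars_in (insert v I) \<beta>" for \<alpha> \<beta>
    unfolding J_def using that by blast
  have fJ: "f \<in> J" using JI[of 1 0] by simp
  have gJ: "g \<in> J" using JI[of 0 1] by simp
  have J_comb: "a * x - b * y \<in> J"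
    if xy: "x \<in> J" "y \<in> J" and ab: "vars_in (insert v I) a" "vars_in (insert v I) b" for x y a b
  proof -
    obtain \<alpha> \<beta> where x: "x = \<alpha> * f + \<beta> * g" "vars_in (insert v I) \<alpha>" "vars_in (insert v I) \<beta>"
      using xy(1) unfolding J_def by blast
    obtain \<gamma> \<delta> where y: "y = \<gamma> * f + \<delta> * g" "vars_in (insert v I) \<gamma>" "vars_in (insert v I) \<delta>"
      using xy(2) unfolding J_def by blast
    have "(a * \<alpha> - b * \<gamma>) * f + (a * \<beta> - b * \<delta>) * g \<in> J"
      by (intro JI vars_in_diff vars_in_mult ab x y)
    then show ?thesis by (simp add: x y algebra_simps)
  qed
  obtain F where F: "coeffs_in I F" "f = poly F ?X" using poly_rep_ex[OF f(2)] by blast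
  obtain G where G: "coeffs_in I G" "g = poly G ?X" using poly_rep_ex[OF g(1)] by blast
  have vX: "vars_in (insert v I) (poly P ?X)" if "coeffs_in I P" for P by (rule vars_in_poly[OF that]) auto
  define K where "K P \<longleftrightarrow> coeffs_in I P \<and> P \<noteq> 0 \<and> poly P ?X \<in> J" for P
  have "K F" unfolding K_def using F fJ f0 by auto
  then obtain R where R: "K R" and Rmin: "\<And>P. K P \<Longrightarrow> degree R \<le> degree P"
    using ex_has_least_nat[of K F degree] by blast
  have cR: "coeffs_in I R" "R \<noteq> 0" "poly R ?X \<in> J" using R unfolding K_def by auto
  have degR: "degree R = 0"
  proof (rule ccontr)
    assume d: "degree R \<noteq> 0"
    have notI: "\<not> vars_in I (poly R ?X)"
    proof
      assume "vars_in I (poly R ?X)"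
      then have "R = [:poly R ?X:]" by (intro poly_rep_unique[OF cR(1) _ v]) auto
      then show False using d by (metis degree_pCons_0)
    qed
    have quot: "\<exists>c h. vars_in I c \<and> c \<noteq> 0 \<and> c * poly P ?X = h * poly R ?X"
      if P: "coeffs_in I P" "poly P ?X \<in> J" for P
    proof -
      obtain N H S where H: "coeffs_in I H" "coeffs_in I S"
        "Polynomial.smult (lead_coeff R ^ N) P = H * R + S" "degree S < degree R"
        using pseudo_division[OF P(1) cR(1)] d by blast
      have vN: "vars_in I (lead_coeff R ^ N)" using cR(1) by (auto simp: coeffs_in_def intro: vars_in_power)
      have eq: "poly S ?X = lead_coeff R ^ N * poly P ?X - poly H ?X * poly R ?X"
        using arg_cong[OF H(3), of "\<lambda>P. poly P ?X"] by (simp add: algebra_simps)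
      have "poly S ?X \<in> J" unfolding eq
        by (intro J_comb P(2) cR(3) vX H(1) vars_in_mono[OF vN]) auto
      then have "S = 0" using Rmin[of S] H(2,4) unfolding K_def by fastforce
      then have "lead_coeff R ^ N * poly P ?X = poly H ?X * poly R ?X" using eq by simp
      then show ?thesis using vN cR(2) by (intro exI[of _ "lead_coeff R ^ N"] exI[of _ "poly H ?X"]) auto
    qed
    obtain c h where ch: "vars_in I c" "c \<noteq> 0" "c * f = h * poly R ?X" using quot[OF F(1)] F(2) fJ by blast
    obtain c' h' where ch': "vars_in I c'" "c' \<noteq> 0" "c' * g = h' * poly R ?X" using quot[OF G(1)] G(2) gJ by blast
    obtain c1 c2 q r where cc: "vars_in I c1" "vars_in I c2" "f = q * r" "h = c1 * q" "poly R ?X = c2 * r"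
      using cancel_content[OF ch(1,2) f(2) f0 ch(3)] by blast
    have "\<not> r dvd 1"
    proof
      assume "r dvd 1"
      then obtain a where "r = MC a" by (rule mpoly_unitE)
      then have "vars_in I (poly R ?X)" using cc(2,5) by (auto intro: vars_in_mult)
      then show False using notI by blast
    qed
    then have "q dvd 1" using f(1) cc(3) unfolding irreducible_def by blast
    then obtain a where a: "q = MC a" "a \<noteq> 0" by (rule mpoly_unitE)
    then have "r = MC (inverse a) * f" unfolding cc(3) by (simp add: mult.assoc[symmetric] flip: MC_mult)
    then have "c' * g = (h' * c2 * MC (inverse a)) * f" using ch'(3) cc(5) by (simp add: mult.assoc)
    from cancel_content[OF ch'(1,2) g(1) g0 this]
    obtain d2 s t where dd: "g = s * t" "f = d2 * t" "vars_in I d2"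
      by (elim exE conjE) (rule that)
    then have "d2 dvd 1 \<or> t dvd 1" using f(1) unfolding irreducible_def by blast
    then show False
    proof
      assume "d2 dvd 1"
      then obtain b where b: "d2 = MC b" "b \<noteq> 0" by (rule mpoly_unitE)
      then have "t = f * MC (inverse b)" using dd(2) by (simp add: mult.commute mult.left_commute flip: MC_mult)
      then show False using g(2) dd(1) by simp
    next
      assume "t dvd 1"
      then obtain b where "t = MC b" by (rule mpoly_unitE)
      then have "vars_in I f" using dd(2,3) by (auto intro: vars_in_mult)
      then show False using f(3) by blast
    qed
  qed
  then obtain r where r: "R = [:r:]" by (metis degree_eq_zeroE)
  then have "r \<noteq> 0" "vars_in I r" "r \<in> J" using cR by auto
  then show ?thesis unfolding J_def by blast
qed

text \<open>Multiply \<open>h\<close> by an eliminant \<open>r\<close> of \<open>f\<close> and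
  \<open>g\<close>: then \<open>f\<close> divides \<open>r * h\<close>, and \<open>r\<close>, being
  free of \<open>v\<close>, cancels against the irreducible \<open>f\<close>, which involves
  \<open>v\<close>.\<close>

lemma euclid_step: "euclid_on (insert v I) TYPE('a)"
  unfolding euclid_on_def
proof (intro allI impI, elim conjE)
  fix f g h :: "(nat, 'a) mpoly"
  assume f: "irreducible f" "vars_in (insert v I) f" and g: "vars_in (insert v I) g"
    and h: "vars_in (insert v I) h" and d: "f dvd g * h"
  show "f dvd g \<or> f dvd h"
  proof (cases "vars_in I f \<or> h = 0 \<or> f dvd g")
    case True
    then show ?thesis using irreducible_coeff_prime[OF f(1) _ g h d] by auto
  next
    case False
    then obtain r \<alpha> \<beta> where r: "r \<noteq> 0" "vars_in I r" "r = \<alpha> * f + \<beta> * g"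
      using elimination[OF f _ g] by blast
    obtain k where k: "g * h = f * k" using d by (elim dvdE)
    have "r * h = \<alpha> * f * h + \<beta> * (g * h)" by (simp add: r(3) algebra_simps)
    also have "\<dots> = f * (\<alpha> * h + \<beta> * k)" by (simp add: k algebra_simps)
    finally have rh: "r * h = f * (\<alpha> * h + \<beta> * k)" .
    have "h \<noteq> 0" using False by blast
    from cancel_content[OF r(2,1) h this rh]
    obtain c1 q' r' where cc: "h = q' * r'" "f = c1 * q'" "vars_in I c1"
      by (elim exE conjE) (rule that)
    then have "c1 dvd 1 \<or> q' dvd 1" using f(1) unfolding irreducible_def by blast
    then show ?thesis
    proof
      assume "c1 dvd 1"
      then obtain b where b: "c1 = MC b" "b \<noteq> 0" by (rule mpoly_unitE)
      then have "q' = f * MC (inverse b)" using cc(2) by (simp add: mult.commute mult.left_commute flip: MC_mult)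
      then show ?thesis using cc(1) by simp
    next
      assume "q' dvd 1"
      then obtain b where "q' = MC b" by (rule mpoly_unitE)
      then have "vars_in I f" using cc(2,3) by (auto intro: vars_in_mult)
      then show ?thesis using False by blast
    qed
  qed
qed

end

lemma euclid_on_finite: "finite I \<Longrightarrow> euclid_on I TYPE('a::alg_closed_field)"
proof (induction I rule: finite_induct)
  case empty
  have "\<not> irreducible f" if f: "vars_in {} f" for f :: "(nat, 'a) mpoly"
  proof -
    obtain c where "f = MC c" using f by (rule vars_in_emptyD)
    then show ?thesis using mpoly_unit_iff[of f] by (auto simp: irreducible_def)
  qed
  then show ?case unfolding euclid_on_def by blast
next
  case (insert v I)
  then show ?case using euclid_step by blast
qed

theorem irreducible_imp_prime_mpoly:
  fixes f :: "(nat, 'a::alg_closed_field) mpoly"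
  assumes "irreducible f" "f dvd g * h"
  shows "f dvd g \<or> f dvd h"
proof -
  have "euclid_on (mvars f \<union> mvars g \<union> mvars h) TYPE('a)" by (rule euclid_on_finite) simp
  moreover have "vars_in (mvars f \<union> mvars g \<union> mvars h) f" "vars_in (mvars f \<union> mvars g \<union> mvars h) g"
    "vars_in (mvars f \<union> mvars g \<union> mvars h) h" by (auto intro: vars_in_mono[OF vars_in_mvars])
  ultimately show ?thesis using assms unfolding euclid_on_def by blast
qed

theorem irreducible_nullstellensatz:
  fixes f :: "(nat, 'a::alg_closed_field) mpoly"
  assumes "irreducible f" "finite I" "vars_in I f" "vars_in I g" "\<not> f dvd g"
  obtains x where "eval_mpoly f x = 0" "eval_mpoly g x \<noteq> 0"
proof -
  define q where "q = {h. f dvd h}"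
  have "prime_ideal_set q"
    unfolding prime_ideal_set_def q_def
    using assms(1) irreducible_imp_prime_mpoly[OF assms(1)] by (auto simp: irreducible_def)
  moreover have "g \<notin> q" "f \<in> q" using assms(5) by (auto simp: q_def)
  ultimately obtain a where "eval_mpoly f a = 0" "eval_mpoly g a \<noteq> 0"
    using nullstellensatz_prime[OF assms(2) _ assms(4)] assms(3) by blast
  then show thesis by (rule that)
qed

section \<open>Growth of algebras generated by functions\<close>

text \<open>The rings below consist of functions on a set of configurations. Relations are checked
  pointwise, and no quotient has to be formed.\<close>

definition fscale :: "'a::field \<Rightarrow> ('b \<Rightarrow> 'a) \<Rightarrow> ('b \<Rightarrow> 'a)" where
  "fscale c f = (\<lambda>x. c * f x)"

global_interpretation fs: vector_space "fscale :: 'a::field \<Rightarrow> ('b \<Rightarrow> 'a) \<Rightarrow> _"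
  by unfold_locales (auto simp: fscale_def fun_eq_iff algebra_simps)

lemma sum_fun_apply: "(\<Sum>i\<in>I. f i) x = (\<Sum>i\<in>I. f i x :: 'a::comm_monoid_add)"
  by (induction I rule: infinite_finite_induct) auto

lemma prod_fun_apply: "(\<Prod>i\<in>I. f i) x = (\<Prod>i\<in>I. f i x :: 'a::comm_monoid_mult)"
  by (induction I rule: infinite_finite_induct) auto

lemma power_fun_apply: "(f ^ k) x = (f x ^ k :: 'a::comm_semiring_1)"
  by (induction k) auto

lemma card_le_span:
  fixes F :: "'e \<Rightarrow> 'b \<Rightarrow> 'a::field"
  assumes "finite E" "finite T" "\<And>e. e \<in> E \<Longrightarrow> F e \<in> fs.span T"
    and indep: "\<And>c. (\<And>x. (\<Sum>e\<in>E. c e * F e x) = 0) \<Longrightarrow> \<forall>e\<in>E. c e = 0"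
  shows "card E \<le> card T"
proof -
  have inj: "inj_on F E"
  proof (rule inj_onI, rule ccontr)
    fix e e' assume e: "e \<in> E" "e' \<in> E" "F e = F e'" "e \<noteq> e'"
    define c where "c = (\<lambda>i. if i = e then 1 else if i = e' then -1 else (0::'a))"
    have "(\<Sum>i\<in>E. c i * F i x) = 0" for x
    proof -
      have "(\<Sum>i\<in>E. c i * F i x) = (\<Sum>i\<in>{e, e'}. c i * F i x)"
        using assms(1) e by (intro sum.mono_neutral_right) (auto simp: c_def)
      then show ?thesis using e by (simp add: c_def)
    qed
    then have "c e = 0" using indep[of c] e(1) by blast
    then show False by (simp add: c_def)
  qed
  have "\<not> fs.dependent (F ` E)"
  proof
    assume "fs.dependent (F ` E)"
    then obtain u where u: "\<exists>v\<in>F ` E. u v \<noteq> 0" "(\<Sum>v\<in>F ` E. fscale (u v) v) = 0"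
      using fs.dependent_finite[of "F ` E"] assms(1) by auto
    have "(\<Sum>e\<in>E. u (F e) * F e x) = 0" for x
    proof -
      have "(\<Sum>e\<in>E. u (F e) * F e x) = (\<Sum>e\<in>E. fscale (u (F e)) (F e)) x"
        by (simp add: sum_fun_apply fscale_def)
      also have "\<dots> = (\<Sum>v\<in>F ` E. fscale (u v) v) x"
        by (subst sum.reindex[OF inj]) simp
      finally show ?thesis using u(2) by simp
    qed
    then show False using indep[of "\<lambda>e. u (F e)"] u(1) by blast
  qed
  moreover have "F ` E \<subseteq> fs.span T" using assms(3) by blast
  ultimately have "card (F ` E) \<le> card T"
    using fs.independent_span_bound[OF assms(2)] by blast
  then show ?thesis by (simp add: card_image[OF inj])
qed

lemma span_mult:
  fixes f g :: "'b \<Rightarrow> 'a::field"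
  assumes "f \<in> fs.span S" "g \<in> fs.span T" "\<And>x y. x \<in> S \<Longrightarrow> y \<in> T \<Longrightarrow> x * y \<in> fs.span U"
  shows "f * g \<in> fs.span U"
proof -
  have 1: "x * g \<in> fs.span U" if x: "x \<in> S" for x
    using assms(2)
  proof (induction rule: fs.span_induct_alt)
    case (step c y w)
    have "x * (fscale c y + w) = fscale c (x * y) + x * w"
      by (auto simp: fscale_def fun_eq_iff algebra_simps)
    moreover have "fscale c (x * y) \<in> fs.span U" using assms(3)[OF x step(1)] by (rule fs.span_scale)
    ultimately show ?case using step(2) fs.span_add by metis
  next
    case base
    have "x * 0 = 0" by (rule mult_zero_right)
    then show ?case using fs.span_zero by metis
  qed
  show ?thesis
    using assms(1)
  proof (induction rule: fs.span_induct_alt)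
    case (step c y w)
    have "(fscale c y + w) * g = fscale c (y * g) + w * g"
      by (auto simp: fscale_def fun_eq_iff algebra_simps)
    moreover have "fscale c (y * g) \<in> fs.span U" using 1[OF step(1)] by (rule fs.span_scale)
    ultimately show ?case using step(2) fs.span_add by metis
  next
    case base
    have "0 * g = 0" by (rule mult_zero_left)
    then show ?case using fs.span_zero by metis
  qed
qed

section \<open>Bigraded pieces of an algebra of functions\<close>

definition gens :: "('b \<Rightarrow> 'a::field) set \<Rightarrow> ('b \<Rightarrow> 'a) set \<Rightarrow> nat \<Rightarrow> nat \<Rightarrow> ('b \<Rightarrow> 'a) set" where
  "gens A B s t = {prod_mset X * prod_mset Y | X Y. set_mset X \<subseteq> A \<and> size X = s \<and> set_mset Y \<subseteq> B \<and> size Y = t}"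

text \<open>The piece of bidegree \<open>(s, t)\<close> of the algebra generated by \<open>A\<close>
  in bidegree \<open>(1, 0)\<close> and \<open>B\<close> in bidegree \<open>(0, 1)\<close>.\<close>

definition PC :: "('b \<Rightarrow> 'a::field) set \<Rightarrow> ('b \<Rightarrow> 'a) set \<Rightarrow> nat \<Rightarrow> nat \<Rightarrow> ('b \<Rightarrow> 'a) set" where
  "PC A B s t = fs.span (gens A B s t)"

lemma gens_PC: "f \<in> gens A B s t \<Longrightarrow> f \<in> PC A B s t"
  unfolding PC_def by (rule fs.span_base)

lemma gensI: "set_mset X \<subseteq> A \<Longrightarrow> size X = s \<Longrightarrow> set_mset Y \<subseteq> B \<Longrightarrow> size Y = t \<Longrightarrow>
    prod_mset X * prod_mset Y \<in> gens A B s t"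
  unfolding gens_def by blast

lemma finite_msets: "finite A \<Longrightarrow> finite {X. set_mset X \<subseteq> A \<and> size X = s}"
proof -
  assume "finite A"
  then have "finite (mset ` {xs. set xs \<subseteq> A \<and> length xs = s})" by (simp add: finite_lists_length_eq)
  moreover have "{X. set_mset X \<subseteq> A \<and> size X = s} \<subseteq> mset ` {xs. set xs \<subseteq> A \<and> length xs = s}"
  proof
    fix X assume X: "X \<in> {X. set_mset X \<subseteq> A \<and> size X = s}"
    obtain xs where "mset xs = X" using ex_mset by blast
    with X show "X \<in> mset ` {xs. set xs \<subseteq> A \<and> length xs = s}" by (intro image_eqI[of _ _ xs]) auto
  qed
  ultimately show ?thesis by (rule finite_subset[rotated])
qed

lemma finite_gens:
  assumes "finite A" "finite B" shows "finite (gens A B s t)"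
proof -
  have "gens A B s t = (\<lambda>(X, Y). prod_mset X * prod_mset Y) `
      ({X. set_mset X \<subseteq> A \<and> size X = s} \<times> {Y. set_mset Y \<subseteq> B \<and> size Y = t})"
    unfolding gens_def by force
  then show ?thesis using finite_msets[OF assms(1)] finite_msets[OF assms(2)] by simp
qed

lemma PC_mult:
  assumes "f \<in> PC A B s t" "g \<in> PC A B s' t'"
  shows "f * g \<in> PC A B (s + s') (t + t')"
  unfolding PC_def
proof (rule span_mult[OF assms[unfolded PC_def]])
  fix x y assume "x \<in> gens A B s t" "y \<in> gens A B s' t'"
  then obtain X Y X' Y' where XY: "x = prod_mset X * prod_mset Y" "set_mset X \<subseteq> A" "size X = s"
      "set_mset Y \<subseteq> B" "size Y = t"
    and XY': "y = prod_mset X' * prod_mset Y'" "set_mset X' \<subseteq> A" "size X' = s'"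
      "set_mset Y' \<subseteq> B" "size Y' = t'" unfolding gens_def by blast
  have "x * y = prod_mset (X + X') * prod_mset (Y + Y')"
    by (simp add: XY(1) XY'(1) ac_simps)
  moreover have "\<dots> \<in> gens A B (s + s') (t + t')"
    by (rule gensI) (use XY XY' in auto)
  ultimately show "x * y \<in> fs.span (gens A B (s + s') (t + t'))" by (simp add: fs.span_base)
qed

lemma PC_1: "1 \<in> PC A B 0 0"
  using gens_PC[OF gensI[of "{#}" A 0 "{#}" B 0]] by simp

lemma PC_A: "x \<in> A \<Longrightarrow> x \<in> PC A B 1 0"
  using gens_PC[OF gensI[of "{#x#}" A 1 "{#}" B 0]] by simp

lemma PC_B: "x \<in> B \<Longrightarrow> x \<in> PC A B 0 1"
  using gens_PC[OF gensI[of "{#}" A 0 "{#x#}" B 1]] by simp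

lemma PC_add: "f \<in> PC A B s t \<Longrightarrow> g \<in> PC A B s t \<Longrightarrow> f + g \<in> PC A B s t"
  and PC_scale: "f \<in> PC A B s t \<Longrightarrow> fscale c f \<in> PC A B s t"
  and PC_0: "0 \<in> PC A B s t"
  and PC_sum: "(\<And>i. i \<in> I \<Longrightarrow> h i \<in> PC A B s t) \<Longrightarrow> (\<Sum>i\<in>I. h i) \<in> PC A B s t"
  unfolding PC_def by (auto intro: fs.span_add fs.span_scale fs.span_zero fs.span_sum)

lemma PC_power: "f \<in> PC A B s t \<Longrightarrow> f ^ k \<in> PC A B (k * s) (k * t)"
  by (induction k) (auto simp: PC_1 intro: PC_mult)

lemma PC_prod:
  assumes "finite I" "\<And>i. i \<in> I \<Longrightarrow> h i \<in> PC A B (s i) (t i)"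
  shows "(\<Prod>i\<in>I. h i) \<in> PC A B (\<Sum>i\<in>I. s i) (\<Sum>i\<in>I. t i)"
  using assms by (induction I rule: finite_induct) (auto simp: PC_1 intro: PC_mult)

lemma mset_pigeonhole:
  assumes "finite A" "set_mset X \<subseteq> A" "size X > card A * K"
  obtains x X' where "x \<in> A" "X = replicate_mset (Suc K) x + X'"
proof -
  have "\<exists>x\<in>A. count X x > K"
  proof (rule ccontr)
    assume "\<not> (\<exists>x\<in>A. count X x > K)"
    then have "(\<Sum>x\<in>A. count X x) \<le> card A * K" using sum_bounded_above[of A "count X" K] by force
    moreover have "size X = (\<Sum>x\<in>A. count X x)"
      unfolding size_multiset_overloaded_eq using assms(1,2)
      by (intro sum.mono_neutral_left) (auto simp: count_eq_zero_iff)
    ultimately show False using assms(3) by simp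
  qed
  then obtain x where x: "x \<in> A" "count X x \<ge> Suc K" by auto
  have "replicate_mset (Suc K) x \<subseteq># X" by (rule x(2)[unfolded count_le_replicate_mset_subset_eq])
  then obtain X' where "X = replicate_mset (Suc K) x + X'" by (auto simp: subset_mset.le_iff_add)
  with x(1) show thesis by (rule that)
qed

text \<open>
  The \<open>c s\<close> are the coordinates of a point in the chart \<open>p s \<noteq> 0\<close>; \<open>H1\<close> are the transition
  formulas between charts. By the Nullstellensatz, \<open>H2\<close> says that the \<open>l i\<close> have no common zero.
  Then the homogeneous ring is finite over \<open>N\<close> elements, so its part of degree \<open>t\<close> has dimension
  at most a constant times \<open>t ^ (N - 1)\<close>, which is too small for \<open>N + 1\<close> independent elements.
\<close>

locale growth =
  fixes p :: "'s \<Rightarrow> 'b \<Rightarrow> 'a::alg_closed_field" and c :: "'s \<Rightarrow> 'c \<Rightarrow> 'b \<Rightarrow> 'a"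
    and l :: "nat \<Rightarrow> 'b \<Rightarrow> 'a" and z :: "'v \<Rightarrow> 'b \<Rightarrow> 'a"
    and Sg :: "'s set" and Mo :: "'c set" and B :: "('b \<Rightarrow> 'a) set" and N d :: nat and Ix :: "'v set" and s0 :: 's
  assumes fin: "finite Sg" "finite Mo" "finite B" and N: "N > 0"
    and cB: "\<And>s \<alpha>. s \<in> Sg \<Longrightarrow> \<alpha> \<in> Mo \<Longrightarrow> c s \<alpha> \<in> B" and lB: "\<And>i. i < N \<Longrightarrow> l i \<in> B"
    and H1: "\<And>s g. s \<in> Sg \<Longrightarrow> g \<in> B \<Longrightarrow> p s ^ d * g \<in> PC (p ` Sg) (c s ` Mo) d 1"
    and H2: "\<And>s \<alpha>. s \<in> Sg \<Longrightarrow> \<alpha> \<in> Mo \<Longrightarrow> \<exists>M E. (\<forall>i<N. E i \<in> PC (p ` Sg) B M M) \<and>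
      p s ^ M * c s \<alpha> ^ Suc M = (\<Sum>i<N. l i * E i)"
    and Ix: "finite Ix" "card Ix = Suc N" and zB: "\<And>v. v \<in> Ix \<Longrightarrow> z v \<in> B" and s0: "s0 \<in> Sg"
    and indep: "\<And>P. P \<noteq> 0 \<Longrightarrow> vars_in Ix P \<Longrightarrow> \<exists>w. p s0 w \<noteq> 0 \<and> eval_mpoly P (\<lambda>v. z v w) \<noteq> 0"
begin

abbreviation "A \<equiv> p ` Sg"

text \<open>The \<open>l i\<close> have bidegree \<open>(0, 1)\<close>, so this is the part of
  bidegree \<open>(s, t + 1)\<close> of the ideal that they generate.\<close>

definition LI :: "nat \<Rightarrow> nat \<Rightarrow> ('b \<Rightarrow> 'a) set" where
  "LI s t = {f. \<exists>E. (\<forall>i<N. E i \<in> PC A B s t) \<and> f = (\<Sum>i<N. l i * E i)}"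

lemma LI_subspace: "fs.subspace (LI s t)"
  unfolding fs.subspace_def
proof (intro conjI ballI allI)
  show "0 \<in> LI s t" unfolding LI_def by (rule CollectI, rule exI[of _ "\<lambda>_. 0"]) (auto simp: PC_0)
  show "x + y \<in> LI s t" if xy: "x \<in> LI s t" "y \<in> LI s t" for x y
  proof -
    obtain E where E: "\<forall>i<N. E i \<in> PC A B s t" "x = (\<Sum>i<N. l i * E i)" using xy(1) unfolding LI_def by auto
    obtain G where G: "\<forall>i<N. G i \<in> PC A B s t" "y = (\<Sum>i<N. l i * G i)" using xy(2) unfolding LI_def by auto
    show ?thesis unfolding LI_def E G
      by (rule CollectI, rule exI[of _ "\<lambda>i. E i + G i"])
        (use E G in \<open>auto simp: sum.distrib distrib_left intro: PC_add\<close>)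
  qed
  show "fscale a x \<in> LI s t" if x: "x \<in> LI s t" for a x
  proof -
    obtain E where E: "\<forall>i<N. E i \<in> PC A B s t" "x = (\<Sum>i<N. l i * E i)" using x unfolding LI_def by auto
    have "fscale a x = (\<Sum>i<N. l i * fscale a (E i))"
      by (auto simp: E fscale_def fun_eq_iff sum_fun_apply sum_distrib_left algebra_simps)
    then show ?thesis unfolding LI_def
      by (intro CollectI exI[of _ "\<lambda>i. fscale a (E i)"]) (use E in \<open>auto intro: PC_scale\<close>)
  qed
qed

lemma LI_mult:
  assumes "f \<in> LI s t" "g \<in> PC A B s' t'" shows "f * g \<in> LI (s + s') (t + t')"
proof -
  obtain E where E: "\<forall>i<N. E i \<in> PC A B s t" "f = (\<Sum>i<N. l i * E i)" using assms(1) unfolding LI_def by auto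
  have "f * g = (\<Sum>i<N. l i * (E i * g))" by (simp add: E sum_distrib_right mult.assoc)
  then show ?thesis unfolding LI_def
    by (intro CollectI exI[of _ "\<lambda>i. E i * g"]) (use E assms(2) in \<open>auto intro: PC_mult\<close>)
qed

lemma H2_uniform: "\<exists>M. \<forall>s\<in>Sg. \<forall>\<alpha>\<in>Mo. p s ^ M * c s \<alpha> ^ Suc M \<in> LI M M"
proof -
  have "\<exists>M. p s ^ M * c s \<alpha> ^ Suc M \<in> LI M M" if "s \<in> Sg" "\<alpha> \<in> Mo" for s \<alpha>
    using H2[OF that] unfolding LI_def by blast
  then obtain f where f: "\<And>s \<alpha>. s \<in> Sg \<Longrightarrow> \<alpha> \<in> Mo \<Longrightarrow> p s ^ f s \<alpha> * c s \<alpha> ^ Suc (f s \<alpha>) \<in> LI (f s \<alpha>) (f s \<alpha>)"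
    by metis
  define M where "M = (\<Sum>s\<in>Sg. \<Sum>\<alpha>\<in>Mo. f s \<alpha>)"
  have "p s ^ M * c s \<alpha> ^ Suc M \<in> LI M M" if sa: "s \<in> Sg" "\<alpha> \<in> Mo" for s \<alpha>
  proof -
    have "f s \<alpha> \<le> (\<Sum>\<alpha>\<in>Mo. f s \<alpha>)" by (rule member_le_sum) (use sa fin in auto)
    also have "\<dots> \<le> M" unfolding M_def by (rule member_le_sum) (use sa fin in auto)
    finally obtain k where k: "M = f s \<alpha> + k" by (auto simp: le_iff_add)
    have "p s ^ k * c s \<alpha> ^ k \<in> PC A B (k * 1 + k * 0) (k * 0 + k * 1)"
      by (intro PC_mult PC_power PC_A PC_B cB sa imageI)
    then have "(p s ^ f s \<alpha> * c s \<alpha> ^ Suc (f s \<alpha>)) * (p s ^ k * c s \<alpha> ^ k) \<in> LI M M"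
      using LI_mult[OF f[OF sa]] k by simp
    then show ?thesis by (simp add: k power_add mult_ac)
  qed
  then show ?thesis by blast
qed

lemma H1_prod:
  assumes s: "s \<in> Sg" and Y: "set_mset Y \<subseteq> B"
  shows "p s ^ (d * size Y) * prod_mset Y \<in> PC A (c s ` Mo) (d * size Y) (size Y)"
  using Y
proof (induction Y)
  case (add g Y)
  have "p s ^ (d * size Y) * prod_mset Y \<in> PC A (c s ` Mo) (d * size Y) (size Y)"
    by (rule add.IH) (use add.prems in auto)
  moreover have "g \<in> B" using add.prems by auto
  ultimately have "(p s ^ d * g) * (p s ^ (d * size Y) * prod_mset Y) \<in> PC A (c s ` Mo) (d + d * size Y) (1 + size Y)"
    by (intro PC_mult H1[OF s])
  moreover have "p s ^ (d * size (add_mset g Y)) * prod_mset (add_mset g Y)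
      = (p s ^ d * g) * (p s ^ (d * size Y) * prod_mset Y)"
    unfolding size_add_mset mult_Suc_right power_add prod_mset.add_mset by (simp only: mult_ac)
  ultimately show ?case unfolding size_add_mset mult_Suc_right by (simp only: plus_1_eq_Suc)
qed (simp only: size_empty prod_mset.empty power_0 mult_1 mult_0_right PC_1)

text \<open>Two applications of the pigeonhole principle. Among many factors from \<open>A\<close>
  some \<open>p s\<close> is frequent, and its powers turn all factors from \<open>B\<close> into
  factors \<open>c s \<alpha>\<close> of a single chart. Among these, one is frequent enough for
  \<open>H2\<close>.\<close>

lemma PC_in_LI: "\<exists>s t. PC A B s (Suc t) \<subseteq> LI s t"
proof -
  obtain M where M: "\<And>s \<alpha>. s \<in> Sg \<Longrightarrow> \<alpha> \<in> Mo \<Longrightarrow> p s ^ M * c s \<alpha> ^ Suc M \<in> LI M M"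
    using H2_uniform by blast
  \<comment> \<open>Among \<open>Suc t0\<close> factors \<open>c s \<alpha>\<close> one occurs
    \<open>M + 1\<close> times. \<open>K\<close> is the number of factors \<open>p s\<close> that
    are spent: \<open>d\<close> for each of the \<open>Suc t0\<close> factors from \<open>B\<close>,
    and \<open>M\<close> for \<open>H2\<close>. Among \<open>s1\<close> factors some
    \<open>p s\<close> occurs \<open>K + 1\<close> times. All that is spent reappears in the result,
    so the first degree stays \<open>s1\<close>.\<close>
  define t0 where "t0 = card Mo * M"
  define K where "K = d * Suc t0 + M"
  define s1 where "s1 = card A * K + 1"
  have "gens A B s1 (Suc t0) \<subseteq> LI s1 t0"
  proof
    fix f assume "f \<in> gens A B s1 (Suc t0)"
    then obtain X Y where XY: "f = prod_mset X * prod_mset Y" "set_mset X \<subseteq> A" "size X = s1"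
      "set_mset Y \<subseteq> B" "size Y = Suc t0" unfolding gens_def by blast
    obtain x X' where X': "x \<in> A" "X = replicate_mset (Suc K) x + X'"
      by (rule mset_pigeonhole[of A X K]) (use fin XY in \<open>auto simp: s1_def\<close>)
    obtain s where s: "s \<in> Sg" "x = p s" using X'(1) by blast
    let ?g = "p s * prod_mset X'"
    have g: "?g \<in> PC A B (s1 - K) 0"
    proof -
      have "prod_mset (add_mset (p s) X') * prod_mset {#} \<in> gens A B (s1 - K) 0"
        by (rule gensI) (use XY X' s in auto)
      then show ?thesis using gens_PC by fastforce
    qed
    have f_eq: "f = p s ^ M * (p s ^ (d * size Y) * prod_mset Y) * ?g"
      by (simp add: XY(1) X'(2) s K_def XY(5) power_add mult_ac)
    have "p s ^ M * h * ?g \<in> LI s1 t0" if h: "h \<in> PC A (c s ` Mo) (d * Suc t0) (Suc t0)" for h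
      using h unfolding PC_def
    proof (induction rule: fs.span_induct_alt)
      case base
      have "p s ^ M * 0 * ?g = 0" by (simp only: mult_zero_right mult_zero_left)
      then show ?case using fs.subspace_0[OF LI_subspace] by metis
    next
      case (step a y h)
      then obtain X2 Z where Z: "y = prod_mset X2 * prod_mset Z" "set_mset X2 \<subseteq> A" "size X2 = d * Suc t0"
        "set_mset Z \<subseteq> c s ` Mo" "size Z = Suc t0" unfolding gens_def by blast
      have "card (c s ` Mo) * M < size Z"
        using card_image_le[OF fin(2), of "c s"] Z(5) by (auto simp: t0_def less_Suc_eq_le intro: mult_right_mono)
      then obtain w Z' where w: "w \<in> c s ` Mo" "Z = replicate_mset (Suc M) w + Z'"
        using mset_pigeonhole[of "c s ` Mo" Z M] fin(2) Z(4) by blast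
      obtain \<alpha> where \<alpha>: "\<alpha> \<in> Mo" "w = c s \<alpha>" using w(1) by blast
      have ZB: "set_mset Z' \<subseteq> B" using Z(4) w(2) cB[OF s(1)] by auto
      have "prod_mset X2 * prod_mset Z' \<in> PC A B (d * Suc t0) (t0 - M)"
        by (rule gens_PC, rule gensI) (use Z w ZB in auto)
      then have "(prod_mset X2 * prod_mset Z') * ?g \<in> PC A B (d * Suc t0 + (s1 - K)) (t0 - M + 0)"
        by (rule PC_mult) (rule g)
      then have "(p s ^ M * c s \<alpha> ^ Suc M) * ((prod_mset X2 * prod_mset Z') * ?g)
          \<in> LI (M + (d * Suc t0 + (s1 - K))) (M + (t0 - M + 0))"
        by (rule LI_mult[OF M[OF s(1) \<alpha>(1)]])
      moreover have "M + (d * Suc t0 + (s1 - K)) = s1"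
      proof -
        have "K \<le> s1"
        proof -
          have "A \<noteq> {}" using X'(1) by blast
          then have "0 < card A" using fin(1) by (simp add: card_gt_0_iff)
          then have "1 * K \<le> card A * K" by (intro mult_right_mono) linarith+
          then show ?thesis unfolding s1_def by linarith
        qed
        then show ?thesis by (simp add: K_def)
      qed
      moreover have "M + (t0 - M + 0) = t0" using Z(5) w(2) by auto
      ultimately have "p s ^ M * y * ?g \<in> LI s1 t0" by (simp add: Z(1) w(2) \<alpha>(2) mult_ac)
      then have "fscale a (p s ^ M * y * ?g) + p s ^ M * h * ?g \<in> LI s1 t0"
        using fs.subspace_add[OF LI_subspace] fs.subspace_scale[OF LI_subspace] step(2) by blast
      moreover have eq: "fscale a (p s ^ M * y * ?g) + p s ^ M * h * ?g = p s ^ M * (fscale a y + h) * ?g"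
        by (auto simp: fscale_def fun_eq_iff algebra_simps)
      ultimately show ?case unfolding eq by blast
    qed
    then show "f \<in> LI s1 t0" unfolding f_eq using H1_prod[OF s(1) XY(4)] XY(5) by simp
  qed
  then have "PC A B s1 (Suc t0) \<subseteq> LI s1 t0"
    unfolding PC_def by (rule fs.span_minimal[OF _ LI_subspace])
  then show ?thesis by blast
qed

section \<open>Growth: monomials in the \<open>l i\<close> against monomials in the
  \<open>z v\<close>\<close>

definition lmon :: "nat \<Rightarrow> (nat \<Rightarrow> nat) set" where
  "lmon r = {b \<in> {..<N} \<rightarrow>\<^sub>E {..r}. (\<Sum>i<N. b i) = r}"

text \<open>The last exponent is determined by the other \<open>N - 1\<close>, which is what lowers
  the order of growth by one.\<close>

lemma lmon_bound: "finite (lmon r)" "card (lmon r) \<le> (r + 1) ^ (N - 1)"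
proof -
  show fin: "finite (lmon r)" unfolding lmon_def by (rule finite_subset[OF _ finite_PiE[of "{..<N}" "\<lambda>_. {..r}"]]) auto
  have "inj_on (\<lambda>b. restrict b {..<N - 1}) (lmon r)"
  proof (rule inj_onI)
    fix b b' assume b: "b \<in> lmon r" "b' \<in> lmon r" and eq: "restrict b {..<N - 1} = restrict b' {..<N - 1}"
    have eq': "b i = b' i" if "i < N - 1" for i using fun_cong[OF eq, of i] that by simp
    have N1: "{..<N} = insert (N - 1) {..<N - 1}" using N by auto
    have "b (N - 1) = b' (N - 1)"
    proof -
      have "(\<Sum>i<N. b i) = b (N - 1) + (\<Sum>i<N - 1. b i)" "(\<Sum>i<N. b' i) = b' (N - 1) + (\<Sum>i<N - 1. b' i)"
        unfolding N1 by (auto intro: sum.insert)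
      moreover have "(\<Sum>i<N - 1. b i) = (\<Sum>i<N - 1. b' i)" using eq' by (intro sum.cong) auto
      ultimately show ?thesis using b by (simp add: lmon_def)
    qed
    then have "b i = b' i" if "i < N" for i using eq' that by (cases "i = N - 1") auto
    then show "b = b'" using b unfolding lmon_def by (intro PiE_ext[of b "{..<N}" _ b']) auto
  qed
  moreover have "(\<lambda>b. restrict b {..<N - 1}) ` lmon r \<subseteq> {..<N - 1} \<rightarrow>\<^sub>E {..r}"
  proof (rule image_subsetI, rule restrict_PiE_iff[THEN iffD2], rule ballI)
    fix b i assume "b \<in> lmon r" "i \<in> {..<N - 1}"
    then show "b i \<in> {..r}" unfolding lmon_def by (auto simp: PiE_iff)
  qed
  ultimately have "card (lmon r) \<le> card ({..<N - 1} \<rightarrow>\<^sub>E {..r})"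
    by (intro card_inj_on_le[of "\<lambda>b. restrict b {..<N - 1}"]) (auto intro: finite_PiE)
  then show "card (lmon r) \<le> (r + 1) ^ (N - 1)" by (simp add: card_PiE)
qed

text \<open>Any \<open>Suc t\<close> factors from \<open>B\<close> can be traded for one
  \<open>l i\<close> and an element of second degree \<open>t\<close>, by the assumption. This is
  repeated \<open>r\<close> times while the first degree remains \<open>s\<close>.\<close>

lemma growth_bound:
  assumes "PC A B s (Suc t) \<subseteq> LI s t"
  shows "PC A B s (t + r) \<subseteq> fs.span ((\<lambda>(b, g). (\<Prod>i<N. l i ^ b i) * g) ` (lmon r \<times> gens A B s t))"
    (is "_ \<subseteq> fs.span (?S r)")
proof (induction r)
  case 0
  have "gens A B s t \<subseteq> ?S 0"
  proof
    fix g assume "g \<in> gens A B s t"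
    moreover have "restrict (\<lambda>_. 0) {..<N} \<in> lmon 0" by (auto simp: lmon_def)
    moreover have "(\<Prod>i<N. l i ^ restrict (\<lambda>_. 0) {..<N} i) * g = g" by simp
    ultimately show "g \<in> ?S 0" by (intro image_eqI[of _ _ "(restrict (\<lambda>_. 0) {..<N}, g)"]) auto
  qed
  then show ?case unfolding PC_def by (simp add: fs.span_mono)
next
  case (Suc r)
  have l_mult: "l i * f \<in> fs.span (?S (Suc r))" if i: "i < N" and f: "f \<in> fs.span (?S r)" for i f
  proof (rule span_mult[OF _ f])
    show "l i \<in> fs.span {l i}" by (rule fs.span_base) simp
    fix x y assume x: "x \<in> {l i}" and "y \<in> ?S r"
    then obtain b g where b: "b \<in> lmon r" "g \<in> gens A B s t" "y = (\<Prod>i<N. l i ^ b i) * g"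
      by (elim imageE, clarify) (rule that)
    define b' where "b' = b(i := Suc (b i))"
    have sum_b': "(\<Sum>j<N. b' j) = Suc r"
    proof -
      have "(\<Sum>j<N. b' j) = b' i + (\<Sum>j\<in>{..<N} - {i}. b' j)" using i by (intro sum.remove) auto
      also have "(\<Sum>j\<in>{..<N} - {i}. b' j) = (\<Sum>j\<in>{..<N} - {i}. b j)" by (intro sum.cong) (auto simp: b'_def)
      also have "b' i + \<dots> = Suc (\<Sum>j<N. b j)" using i by (subst sum.remove[of _ i]) (auto simp: b'_def)
      finally show ?thesis using b(1) by (simp add: lmon_def)
    qed
    have "b' \<in> lmon (Suc r)" using b(1) i sum_b' unfolding lmon_def b'_def
      by (auto simp: PiE_iff extensional_def intro: le_SucI)
    moreover have "x * y = (\<Prod>j<N. l j ^ b' j) * g"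
    proof -
      have "(\<Prod>j<N. l j ^ b' j) = l i ^ b' i * (\<Prod>j\<in>{..<N} - {i}. l j ^ b' j)" using i by (intro prod.remove) auto
      also have "(\<Prod>j\<in>{..<N} - {i}. l j ^ b' j) = (\<Prod>j\<in>{..<N} - {i}. l j ^ b j)" by (intro prod.cong) (auto simp: b'_def)
      also have "l i ^ b' i * \<dots> = l i * (\<Prod>j<N. l j ^ b j)" using i by (subst prod.remove[of _ i]) (auto simp: b'_def mult_ac)
      finally show ?thesis using x b(3) by (simp add: mult_ac)
    qed
    ultimately show "x * y \<in> fs.span (?S (Suc r))" using b(2) by (intro fs.span_base) force
  qed
  have "gens A B s (t + Suc r) \<subseteq> fs.span (?S (Suc r))"
  proof
    fix f assume "f \<in> gens A B s (t + Suc r)"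
    then obtain X Y where XY: "f = prod_mset X * prod_mset Y" "set_mset X \<subseteq> A" "size X = s"
      "set_mset Y \<subseteq> B" "size Y = t + Suc r" unfolding gens_def by blast
    obtain ys where ys: "mset ys = Y" using ex_mset by blast
    define Y1 Y2 where "Y1 = mset (take (Suc t) ys)" and "Y2 = mset (drop (Suc t) ys)"
    have Y12: "Y = Y1 + Y2" unfolding Y1_def Y2_def ys[symmetric] by (simp flip: mset_append)
    have len: "length ys = t + Suc r" using XY(5) ys by auto
    have sz: "size Y1 = Suc t" "size Y2 = r" unfolding Y1_def Y2_def using len by simp_all
    have "prod_mset X * prod_mset Y1 \<in> PC A B s (Suc t)"
      by (rule gens_PC, rule gensI) (use XY Y12 sz in auto)
    then obtain E where E: "\<forall>i<N. E i \<in> PC A B s t" "prod_mset X * prod_mset Y1 = (\<Sum>i<N. l i * E i)"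
      using assms unfolding LI_def by blast
    have Y2: "prod_mset Y2 \<in> PC A B 0 r"
      using gens_PC[OF gensI[of "{#}" A 0 Y2 B r]] XY Y12 sz by auto
    have "f = (prod_mset X * prod_mset Y1) * prod_mset Y2" by (simp add: XY(1) Y12 mult.assoc)
    also have "\<dots> = (\<Sum>i<N. l i * (E i * prod_mset Y2))" by (simp add: E(2) sum_distrib_right mult.assoc)
    also have "\<dots> \<in> fs.span (?S (Suc r))"
    proof (intro fs.span_sum l_mult)
      fix i assume "i \<in> {..<N}"
      then have "E i * prod_mset Y2 \<in> PC A B (s + 0) (t + r)" using E(1) by (intro PC_mult Y2) auto
      then show "E i * prod_mset Y2 \<in> fs.span (?S r)" using Suc.IH by auto
    qed auto
    finally show "f \<in> fs.span (?S (Suc r))" .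
  qed
  then show ?case unfolding PC_def by (rule fs.span_minimal[OF _ fs.subspace_span])
qed

lemma contradiction: False
proof -
  obtain s t where st: "PC A B s (Suc t) \<subseteq> LI s t" using PC_in_LI by blast
  define G where "G = card (gens A B s t)"
  \<comment> \<open>\<open>N\<close> of the independent elements receive arbitrary exponents up to
    \<open>K\<close>, and \<open>z v0\<close> fills up to the total degree
    \<open>\<tau> = N * K\<close>; these are \<open>(K + 1) ^ N\<close> products. The
    \<open>l i\<close> allow at most \<open>N ^ (N - 1) * G * (K + 1) ^ (N - 1)\<close>, which is
    smaller because \<open>K + 1 > N ^ (N - 1) * G\<close>. The summand \<open>t\<close> ensures
    \<open>t \<le> \<tau>\<close>.\<close>
  define K where "K = N ^ (N - 1) * G + t"
  define \<tau> where "\<tau> = N * K"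
  have Nt: "K \<le> \<tau>" using N by (simp add: \<tau>_def)
  then have tt: "t \<le> \<tau>" by (simp add: K_def)
  define r where "r = \<tau> - t"
  have r: "t + r = \<tau>" "r \<le> \<tau>" using tt by (auto simp: r_def)
  let ?T = "(\<lambda>(b, g). (\<Prod>i<N. l i ^ b i) * g) ` (lmon r \<times> gens A B s t)"
  have "finite A" using fin by simp
  then have finT: "finite ?T" using lmon_bound(1)[of r] finite_gens[of A B s t] fin(3) by simp
  obtain v0 where v0: "v0 \<in> Ix" using Ix by fastforce
  define E where "E = (Ix - {v0}) \<rightarrow>\<^sub>E {..K}"
  have cardE: "card E = (K + 1) ^ N" unfolding E_def using Ix v0 by (simp add: card_PiE)
  define mon where "mon e = (\<Sum>v\<in>Ix - {v0}. Poly_Mapping.single v (e v)) + Poly_Mapping.single v0 (\<tau> - (\<Sum>v\<in>Ix - {v0}. e v))"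
    for e :: "'v \<Rightarrow> nat"
  have lk: "Poly_Mapping.lookup (mon e) v = (if v = v0 then \<tau> - (\<Sum>v\<in>Ix - {v0}. e v) else if v \<in> Ix then e v else 0)" for e v
    using Ix(1) by (auto simp: mon_def lookup_add lookup_sum lookup_single when_def)
  have inj: "inj_on mon E"
  proof (rule inj_onI)
    fix e e' assume e: "e \<in> E" "e' \<in> E" "mon e = mon e'"
    have "e v = e' v" if "v \<in> Ix - {v0}" for v
      using arg_cong[OF e(3), of "\<lambda>m. Poly_Mapping.lookup m v"] that by (simp add: lk)
    then show "e = e'" using e(1,2) unfolding E_def by (intro PiE_ext[of e "Ix - {v0}" _ e']) auto
  qed
  \<comment> \<open>The factor \<open>p s0 ^ s\<close> brings the product to first degree
    \<open>s\<close>. It preserves independence, since the independence of the \<open>z v\<close> is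
    witnessed at points where \<open>p s0\<close> is nonzero.\<close>
  define F where "F e = (p s0 ^ s * (\<Prod>v\<in>Ix. z v ^ Poly_Mapping.lookup (mon e) v))" for e
  have sum_le: "(\<Sum>v\<in>Ix - {v0}. e v) \<le> \<tau>" if "e \<in> E" for e
  proof -
    have "(\<Sum>v\<in>Ix - {v0}. e v) \<le> card (Ix - {v0}) * K"
      using that sum_bounded_above[of "Ix - {v0}" e K] unfolding E_def by (auto simp: PiE_iff)
    then show ?thesis using Ix v0 by (simp add: \<tau>_def)
  qed
  have FP: "F e \<in> PC A B s (t + r)" if e: "e \<in> E" for e
  proof -
    have "(\<Prod>v\<in>Ix. z v ^ Poly_Mapping.lookup (mon e) v) \<in> PC A B (\<Sum>v\<in>Ix. Poly_Mapping.lookup (mon e) v * 0) (\<Sum>v\<in>Ix. Poly_Mapping.lookup (mon e) v * 1)"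
      by (intro PC_prod PC_power PC_B zB Ix)
    moreover have "(\<Sum>v\<in>Ix. Poly_Mapping.lookup (mon e) v) = \<tau>"
    proof -
      have "(\<Sum>v\<in>Ix. Poly_Mapping.lookup (mon e) v) = Poly_Mapping.lookup (mon e) v0 + (\<Sum>v\<in>Ix - {v0}. Poly_Mapping.lookup (mon e) v)"
        using Ix v0 by (intro sum.remove) auto
      also have "(\<Sum>v\<in>Ix - {v0}. Poly_Mapping.lookup (mon e) v) = (\<Sum>v\<in>Ix - {v0}. e v)"
        by (intro sum.cong) (auto simp: lk)
      finally show ?thesis using sum_le[OF e] by (simp add: lk)
    qed
    ultimately have "(\<Prod>v\<in>Ix. z v ^ Poly_Mapping.lookup (mon e) v) \<in> PC A B 0 (t + r)" using r by simp
    moreover have "p s0 ^ s \<in> PC A B (s * 1) (s * 0)" by (intro PC_power PC_A imageI s0)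
    ultimately show ?thesis unfolding F_def using PC_mult[of "p s0 ^ s" A B s 0 _ 0 "t + r"] by simp
  qed
  have "card E \<le> card ?T"
  proof (rule card_le_span[of _ _ F])
    show "finite E" unfolding E_def using Ix by (intro finite_PiE) auto
    show "F e \<in> fs.span ?T" if "e \<in> E" for e using FP[OF that] growth_bound[OF st, of r] by blast
    fix a assume a: "\<And>x. (\<Sum>e\<in>E. a e * F e x) = 0"
    define P where "P = (\<Sum>e\<in>E. Poly_Mapping.single (mon e) (a e))"
    have finE: "finite E" unfolding E_def using Ix by (intro finite_PiE) auto
    have kmon: "Poly_Mapping.keys (mon e) \<subseteq> Ix" for e
      by (auto simp: in_keys_iff lk v0 split: if_splits)
    have ev: "p s0 x ^ s * eval_mpoly P (\<lambda>v. z v x) = 0" for x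
    proof -
      have "p s0 x ^ s * eval_mpoly P (\<lambda>v. z v x) = (\<Sum>e\<in>E. a e * F e x)"
        unfolding P_def eval_mpoly_sum eval_mpoly_single sum_distrib_left
      proof (rule sum.cong)
        fix e
        have "eval_monom (mon e) (\<lambda>v. z v x) = (\<Prod>v\<in>Ix. z v x ^ Poly_Mapping.lookup (mon e) v)"
          by (rule eval_monom_superset[OF Ix(1) kmon])
        then show "p s0 x ^ s * (a e * eval_monom (mon e) (\<lambda>v. z v x)) = a e * F e x"
          by (simp add: F_def prod_fun_apply power_fun_apply)
      qed simp
      then show ?thesis using a by simp
    qed
    have "P = 0"
    proof (rule ccontr)
      assume "P \<noteq> 0"
      moreover have "vars_in Ix P" unfolding P_def
        by (rule vars_in_sum) (use kmon in \<open>auto simp: vars_in_def\<close>)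
      ultimately obtain w where "p s0 w \<noteq> 0" "eval_mpoly P (\<lambda>v. z v w) \<noteq> 0" using indep by blast
      then show False using ev[of w] by simp
    qed
    show "\<forall>e\<in>E. a e = 0"
    proof
      fix e assume e: "e \<in> E"
      have "Poly_Mapping.lookup P (mon e) = (\<Sum>e'\<in>E. if e' = e then a e' else 0)"
        unfolding P_def lookup_sum
        by (intro sum.cong) (use inj e in \<open>auto simp: lookup_single when_def inj_on_def\<close>)
      then show "a e = 0" using \<open>P = 0\<close> finE e by simp
    qed
  qed (rule finT)
  also have "card ?T \<le> card (lmon r \<times> gens A B s t)"
    using lmon_bound(1)[of r] finite_gens[of A B s t] fin by (intro card_image_le) auto
  also have "\<dots> \<le> (r + 1) ^ (N - 1) * G"
    unfolding card_cartesian_product G_def by (intro mult_right_mono lmon_bound) auto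
  also have "\<dots> \<le> (N * (K + 1)) ^ (N - 1) * G"
  proof (intro mult_right_mono power_mono)
    show "r + 1 \<le> N * (K + 1)" using r(2) N by (simp add: \<tau>_def)
  qed auto
  also have "\<dots> = (N ^ (N - 1) * G) * (K + 1) ^ (N - 1)" unfolding power_mult_distrib by (simp only: mult_ac)
  also have "\<dots> < (K + 1) * (K + 1) ^ (N - 1)"
    by (intro mult_strict_right_mono) (auto simp: K_def)
  also have "\<dots> = (K + 1) ^ N" using N by (metis Suc_diff_1 power_Suc)
  finally show False using cardE by simp
qed

end

section \<open>Determinants of function matrices\<close>

definition dt :: "nat \<Rightarrow> (nat \<Rightarrow> nat \<Rightarrow> 'a::comm_ring_1) \<Rightarrow> 'a" where
  "dt N M = Determinant.det (Matrix.mat N N (\<lambda>(i, j). M i j))"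

definition adjf :: "nat \<Rightarrow> (nat \<Rightarrow> nat \<Rightarrow> 'a::comm_ring_1) \<Rightarrow> nat \<Rightarrow> nat \<Rightarrow> 'a" where
  "adjf N M i j = cofactor (Matrix.mat N N (\<lambda>(i, j). M i j)) j i"

lemma dt_cong: "(\<And>i j. i < N \<Longrightarrow> j < N \<Longrightarrow> M i j = M' i j) \<Longrightarrow> dt N M = dt N M'"
  unfolding dt_def by (rule arg_cong[of _ _ Determinant.det]) (auto intro!: eq_matI)

lemma dt_leibniz:
  "dt N M = (\<Sum>p | p permutes {0..<N}. of_int (sign p) * (\<Prod>j<N. M (p j) j))"
proof -
  have "Matrix.mat N N (\<lambda>(i, j). M i j) $$ (p j, j) = M (p j) j" if "p permutes {0..<N}" "j < N" for p j
  proof -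
    have "p j \<in> {0..<N}" using that by (simp only: permutes_in_image atLeastLessThan_iff) simp
    then show ?thesis using that(2) by simp
  qed
  then show ?thesis unfolding dt_def by (subst det_col[of _ N]) (auto intro!: sum.cong prod.cong)
qed

text \<open>Cramer's rule: expand along column \<open>i\<close>, whose cofactors do not see that
  column.\<close>

lemma adjf_replace:
  assumes i: "i < N"
  shows "(\<Sum>j<N. b j * adjf N M i j) = dt N (\<lambda>r c. if c = i then b r else M r c)"
proof -
  let ?A = "Matrix.mat N N (\<lambda>(i, j). M i j)"
  let ?B = "Matrix.mat N N (\<lambda>(r, c). if c = i then b r else M r c)"
  have del: "mat_delete ?B j i = mat_delete ?A j i" for j
    unfolding mat_delete_def by (rule eq_matI) (auto split: if_splits)
  have "Determinant.det ?B = (\<Sum>j<N. ?B $$ (j, i) * cofactor ?B j i)"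
    by (rule laplace_expansion_column) (use i in auto)
  also have "\<dots> = (\<Sum>j<N. b j * adjf N M i j)"
    by (intro sum.cong) (use i in \<open>auto simp: adjf_def cofactor_def del\<close>)
  finally show ?thesis by (simp add: dt_def)
qed

lemma adjf_left:
  assumes "i < N" "j < N"
  shows "(\<Sum>l<N. adjf N M i l * M l j) = (if i = j then dt N M else 0)"
proof -
  let ?A = "Matrix.mat N N (\<lambda>(i, j). M i j)"
  have "(adj_mat ?A * ?A) $$ (i, j) = (Determinant.det ?A \<cdot>\<^sub>m 1\<^sub>m N) $$ (i, j)"
    by (subst adj_mat(3)[of ?A N]) auto
  moreover have "(adj_mat ?A * ?A) $$ (i, j) = (\<Sum>l<N. adjf N M i l * M l j)"
    using assms by (simp add: adj_mat_def adjf_def scalar_prod_def lessThan_atLeast0)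
  ultimately show ?thesis using assms by (simp add: dt_def)
qed

lemma adjf_right:
  assumes "i < N" "j < N"
  shows "(\<Sum>l<N. M i l * adjf N M l j) = (if i = j then dt N M else 0)"
proof -
  let ?A = "Matrix.mat N N (\<lambda>(i, j). M i j)"
  have "(?A * adj_mat ?A) $$ (i, j) = (Determinant.det ?A \<cdot>\<^sub>m 1\<^sub>m N) $$ (i, j)"
    by (subst adj_mat(2)[of ?A N]) auto
  moreover have "(?A * adj_mat ?A) $$ (i, j) = (\<Sum>l<N. M i l * adjf N M l j)"
    using assms by (simp add: adj_mat_def adjf_def scalar_prod_def lessThan_atLeast0)
  ultimately show ?thesis using assms by (simp add: dt_def)
qed

lemma dt_mult: "dt N (\<lambda>i j. \<Sum>l<N. M i l * M' l j) = dt N M * dt N M'"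
proof -
  let ?A = "Matrix.mat N N (\<lambda>(i, j). M i j)" and ?B = "Matrix.mat N N (\<lambda>(i, j). M' i j)"
  have "Matrix.mat N N (\<lambda>(i, j). \<Sum>l<N. M i l * M' l j) = ?A * ?B"
    by (rule eq_matI) (auto simp: scalar_prod_def lessThan_atLeast0)
  then show ?thesis unfolding dt_def by (simp add: det_mult[of _ N])
qed

lemma dt_identical_columns:
  assumes "i < N" "j < N" "i \<noteq> j" "\<And>r. r < N \<Longrightarrow> M r i = M r j"
  shows "dt N M = 0"
  unfolding dt_def
  by (rule det_identical_columns[of _ N i j]) (use assms in \<open>auto intro!: eq_vecI\<close>)

lemma dt_one: "dt N (\<lambda>i j. if i = j then 1 else 0) = 1"
proof -
  have "Matrix.mat N N (\<lambda>(i, j). if i = j then 1 else (0::'a)) = 1\<^sub>m N" by (rule eq_matI) auto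
  then show ?thesis unfolding dt_def by simp
qed

lemma dt_zero_kernel:
  fixes M :: "nat \<Rightarrow> nat \<Rightarrow> 'a::field"
  assumes "dt N M = 0"
  obtains y where "\<exists>i<N. y i \<noteq> 0" "\<And>c. c < N \<Longrightarrow> (\<Sum>i<N. y i * M i c) = 0"
proof -
  let ?A = "Matrix.mat N N (\<lambda>(i, j). M i j)"
  have "Determinant.det ?A\<^sup>T = 0" using assms by (subst det_transpose[of _ N]) (auto simp: dt_def)
  then obtain v where v: "v \<in> carrier_vec N" "v \<noteq> 0\<^sub>v N" "?A\<^sup>T *\<^sub>v v = 0\<^sub>v N"
    using det_0_iff_vec_prod_zero[of "?A\<^sup>T" N] by auto
  show thesis
  proof (rule that[of "\<lambda>i. v $ i"])
    show "\<exists>i<N. v $ i \<noteq> 0"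
    proof (rule ccontr)
      assume "\<not> (\<exists>i<N. v $ i \<noteq> 0)"
      then have "v = 0\<^sub>v N" using v(1) by (intro eq_vecI) auto
      then show False using v(2) by contradiction
    qed
    fix c assume c: "c < N"
    have "(?A\<^sup>T *\<^sub>v v) $ c = 0" using v(3) c by simp
    then show "(\<Sum>i<N. v $ i * M i c) = 0"
      using c v(1) by (simp add: scalar_prod_def lessThan_atLeast0 mult.commute)
  qed
qed

text \<open>Multilinear expansion in the columns. The sum runs over all maps \<open>s\<close>
  instead of increasing ones, so that orderings and signs need not be tracked; maps that are not
  injective contribute zero.\<close>

lemma dt_cauchy_binet:
  assumes "finite L"
  shows "dt N (\<lambda>i c. \<Sum>l\<in>L. u i l * G l c)
    = (\<Sum>s\<in>{..<N} \<rightarrow>\<^sub>E L. (\<Prod>c<N. G (s c) c) * dt N (\<lambda>i c. u i (s c)))"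
proof -
  have "dt N (\<lambda>i c. \<Sum>l\<in>L. u i l * G l c) = (\<Sum>p | p permutes {0..<N}. of_int (sign p) *
      (\<Sum>s\<in>{..<N} \<rightarrow>\<^sub>E L. \<Prod>j<N. u (p j) (s j) * G (s j) j))"
    unfolding dt_leibniz by (subst prod_sum_PiE) (use assms in auto)
  also have "\<dots> = (\<Sum>s\<in>{..<N} \<rightarrow>\<^sub>E L. \<Sum>p | p permutes {0..<N}. of_int (sign p) * (\<Prod>j<N. u (p j) (s j) * G (s j) j))"
    unfolding sum_distrib_left by (rule sum.swap)
  also have "\<dots> = (\<Sum>s\<in>{..<N} \<rightarrow>\<^sub>E L. (\<Prod>c<N. G (s c) c) * dt N (\<lambda>i c. u i (s c)))"
    unfolding dt_leibniz sum_distrib_left prod.distrib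
    by (intro sum.cong refl) (simp add: mult_ac)
  finally show ?thesis .
qed

text \<open>The signed maximal minors of an \<open>N \<times> (N - 1)\<close> matrix: a vector in its left kernel.\<close>

definition yv :: "nat \<Rightarrow> (nat \<Rightarrow> nat \<Rightarrow> 'a::comm_ring_1) \<Rightarrow> nat \<Rightarrow> 'a" where
  "yv N Q j = adjf N (\<lambda>r c. Q r (c - 1)) 0 j"

lemma yv_dt: "N > 0 \<Longrightarrow> (\<Sum>j<N. b j * yv N Q j) = dt N (\<lambda>r c. if c = 0 then b r else Q r (c - 1))"
  unfolding yv_def by (rule adjf_replace)

lemma yv_kernel:
  assumes "Suc c < N" shows "(\<Sum>j<N. yv N Q j * Q j c) = 0"
proof -
  have "(\<Sum>j<N. Q j c * yv N Q j) = 0"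
    unfolding yv_dt[OF less_trans[OF zero_less_Suc assms]]
    by (rule dt_identical_columns[of 0 _ "Suc c"]) (use assms in auto)
  then show ?thesis by (simp add: mult.commute)
qed

text \<open>Prepend the \<open>j\<close>-th unit column to \<open>Q\<close> and multiply by
  \<open>g\<close>: the determinant acquires the factor \<open>dt N g\<close>, and expansion along
  the first column gives both sides.\<close>

lemma yv_transform:
  assumes "N > 0" "j < N"
  shows "(\<Sum>i<N. yv N (\<lambda>i c. \<Sum>l<N. g i l * Q l c) i * g i j) = dt N g * yv N Q j"
proof -
  have "(\<Sum>i<N. yv N (\<lambda>i c. \<Sum>l<N. g i l * Q l c) i * g i j)
      = (\<Sum>i<N. g i j * yv N (\<lambda>i c. \<Sum>l<N. g i l * Q l c) i)" by (simp add: mult.commute)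
  also have "\<dots> = dt N (\<lambda>r c. \<Sum>l<N. g r l * (if c = 0 then (if l = j then 1 else 0) else Q l (c - 1)))"
    unfolding yv_dt[OF assms(1)]
    by (rule dt_cong) (use assms in \<open>auto simp: if_distrib[of "\<lambda>x. _ * x"] cong: if_cong\<close>)
  also have "\<dots> = dt N g * dt N (\<lambda>l c. if c = 0 then (if l = j then 1 else 0) else Q l (c - 1))"
    by (rule dt_mult)
  also have "dt N (\<lambda>l c. if c = 0 then (if l = j then 1 else 0) else Q l (c - 1)) = (\<Sum>l<N. (if l = j then 1 else 0) * yv N Q l)"
    by (subst yv_dt[OF assms(1)]) simp
  also have "\<dots> = yv N Q j" using assms(2) by (simp add: if_distrib[of "\<lambda>x. x * _"] cong: if_cong)
  finally show ?thesis .
qed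

lemma yv_cong: "(\<And>i c. i < N \<Longrightarrow> c < N - 1 \<Longrightarrow> Q i c = Q' i c) \<Longrightarrow> j < N \<Longrightarrow> yv N Q j = yv N Q' j"
proof -
  assume Q: "\<And>i c. i < N \<Longrightarrow> c < N - 1 \<Longrightarrow> Q i c = Q' i c" and j: "j < N"
  then have N: "N > 0" by simp
  have eq: "yv N Q j = dt N (\<lambda>r c. if c = 0 then (if r = j then 1 else 0) else Q r (c - 1))" for Q :: "nat \<Rightarrow> nat \<Rightarrow> 'a"
    using yv_dt[OF N, of "\<lambda>l. if l = j then 1 else 0" Q] j
    by (simp add: if_distrib[of "\<lambda>x. x * _"] cong: if_cong)
  show "yv N Q j = yv N Q' j" unfolding eq by (rule dt_cong) (auto intro!: Q)
qed

section \<open>Polynomial functions\<close>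

text \<open>Only values of polynomials matter in what follows. Polynomiality is therefore a property
  of functions that is closed under the usual operations, and representing polynomials are extracted
  only where the Nullstellensatz or a genericity condition asks for one.\<close>

definition pfun :: "'v set \<Rightarrow> (('v \<Rightarrow> 'a::comm_ring_1) \<Rightarrow> 'a) \<Rightarrow> bool" where
  "pfun I g \<longleftrightarrow> (\<exists>f. vars_in I f \<and> (\<forall>x. eval_mpoly f x = g x))"

lemma pfunE:
  assumes "pfun I g" obtains f where "vars_in I f" "\<And>x. eval_mpoly f x = g x"
  using assms unfolding pfun_def by auto

lemma pfunI: "vars_in I f \<Longrightarrow> (\<And>x. eval_mpoly f x = g x) \<Longrightarrow> pfun I g"
  unfolding pfun_def by (rule exI[of _ f]) simp

lemma pfun_const: "pfun I (\<lambda>x. c)"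
  by (rule pfunI[of _ "MC c"]) auto

lemma pfun_var: "v \<in> I \<Longrightarrow> pfun I (\<lambda>x. x v)"
  by (rule pfunI[of _ "MX v"]) auto

lemma pfun_eval: "vars_in I f \<Longrightarrow> pfun I (\<lambda>x. eval_mpoly f x)"
  by (rule pfunI[of _ f]) auto

lemma pfun_add:
  assumes "pfun I g" "pfun I h" shows "pfun I (\<lambda>x. g x + h x)"
proof -
  obtain f where f: "vars_in I f" "\<And>x. eval_mpoly f x = g x" using assms(1) by (rule pfunE) blast
  obtain f' where f': "vars_in I f'" "\<And>x. eval_mpoly f' x = h x" using assms(2) by (rule pfunE) blast
  show ?thesis by (rule pfunI[of _ "f + f'"]) (use f f' in \<open>auto simp: eval_mpoly_hom intro: vars_in_intros\<close>)
qed

lemma pfun_mult: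
  assumes "pfun I g" "pfun I h" shows "pfun I (\<lambda>x. g x * h x)"
proof -
  obtain f where f: "vars_in I f" "\<And>x. eval_mpoly f x = g x" using assms(1) by (rule pfunE) blast
  obtain f' where f': "vars_in I f'" "\<And>x. eval_mpoly f' x = h x" using assms(2) by (rule pfunE) blast
  show ?thesis by (rule pfunI[of _ "f * f'"]) (use f f' in \<open>auto simp: eval_mpoly_hom intro: vars_in_intros\<close>)
qed

lemma pfun_sum: "(\<And>i. i \<in> A \<Longrightarrow> pfun I (g i)) \<Longrightarrow> pfun I (\<lambda>x. \<Sum>i\<in>A. g i x)"
  by (induction A rule: infinite_finite_induct) (auto intro: pfun_add pfun_const)

lemma pfun_prod: "(\<And>i. i \<in> A \<Longrightarrow> pfun I (g i)) \<Longrightarrow> pfun I (\<lambda>x. \<Prod>i\<in>A. g i x)"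
  by (induction A rule: infinite_finite_induct) (auto intro: pfun_mult pfun_const)

lemma pfun_power: "pfun I g \<Longrightarrow> pfun I (\<lambda>x. g x ^ k)"
  by (induction k) (auto intro: pfun_mult pfun_const)

lemma pfun_uminus: "pfun I g \<Longrightarrow> pfun I (\<lambda>x. - g x)"
  using pfun_mult[OF pfun_const[of I "-1"]] by fastforce

lemma pfun_diff: "pfun I g \<Longrightarrow> pfun I h \<Longrightarrow> pfun I (\<lambda>x. g x - h x)"
  using pfun_add[OF _ pfun_uminus] by fastforce

lemma pfun_compose:
  assumes "vars_in J f" "\<And>v. v \<in> J \<Longrightarrow> pfun I (\<lambda>x. g x v)"
  shows "pfun I (\<lambda>x. eval_mpoly f (g x))"
  using assms(1)
  by (induction rule: mpoly_ring_induct)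
    (auto simp: eval_mpoly_hom intro: pfun_const assms(2) pfun_add pfun_mult)

lemma pfun_dt:
  assumes "\<And>i j. i < N \<Longrightarrow> j < N \<Longrightarrow> pfun I (\<lambda>x. M x i j)"
  shows "pfun I (\<lambda>x. dt N (M x))"
  unfolding dt_leibniz
proof (intro pfun_sum pfun_mult pfun_prod pfun_const)
  fix p j assume p: "p \<in> {p. p permutes {0..<N}}" and j: "j \<in> {..<N}"
  have "p j \<in> {0..<N}" using p j by (simp only: mem_Collect_eq permutes_in_image) simp
  then show "pfun I (\<lambda>x. M x (p j) j)" using assms j by auto
qed

lemma adjf_dt:
  assumes "i < N" "j < N"
  shows "adjf N M i j = dt N (\<lambda>r c. if c = i then (if r = j then 1 else 0) else M r c)"
  using adjf_replace[OF assms(1), of "\<lambda>r. if r = j then 1 else 0" M] assms(2)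
  by (simp add: if_distrib[of "\<lambda>x. x * _"] cong: if_cong)

lemma pfun_adjf:
  assumes "\<And>r c. r < N \<Longrightarrow> c < N \<Longrightarrow> c \<noteq> i \<Longrightarrow> pfun I (\<lambda>x. M x r c)" "i < N" "j < N"
  shows "pfun I (\<lambda>x. adjf N (M x) i j)"
  unfolding adjf_dt[OF assms(2,3)]
proof (rule pfun_dt)
  fix r c assume "r < N" "c < N"
  then show "pfun I (\<lambda>x. if c = i then if r = j then 1 else 0 else M x r c)"
    by (cases "c = i") (simp_all add: assms(1) pfun_const)
qed

section \<open>Forms of fixed degree\<close>

definition Mon :: "nat \<Rightarrow> nat \<Rightarrow> (nat \<Rightarrow>\<^sub>0 nat) set" where
  "Mon m d = {a. Poly_Mapping.keys a \<subseteq> {..m} \<and> total_deg a = d}"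

definition fm :: "nat \<Rightarrow> nat \<Rightarrow> ((nat \<Rightarrow>\<^sub>0 nat) \<Rightarrow> 'a::comm_ring_1) \<Rightarrow> (nat \<Rightarrow> 'a) \<Rightarrow> 'a" where
  "fm m d a y = (\<Sum>\<alpha>\<in>Mon m d. a \<alpha> * eval_monom \<alpha> y)"

definition fmP :: "nat \<Rightarrow> nat \<Rightarrow> ((nat \<Rightarrow>\<^sub>0 nat) \<Rightarrow> 'a::comm_ring_1) \<Rightarrow> (nat, 'a) mpoly" where
  "fmP m d a = (\<Sum>\<alpha>\<in>Mon m d. Poly_Mapping.single \<alpha> (a \<alpha>))"

lemma eval_fmP: "eval_mpoly (fmP m d a) y = fm m d a y"
  by (simp add: fmP_def fm_def eval_mpoly_sum eval_mpoly_single)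

lemma total_deg_single: "total_deg (Poly_Mapping.single v e) = e"
  by (simp add: total_deg_def)

lemma total_deg_0_iff: "total_deg a = 0 \<longleftrightarrow> a = 0"
proof
  assume "total_deg a = 0"
  then have "Poly_Mapping.lookup a i = 0" for i
    by (cases "i \<in> Poly_Mapping.keys a") (auto simp: total_deg_def in_keys_iff)
  then show "a = 0" by (intro poly_mapping_eqI) simp
qed (simp add: total_deg_def)

lemma monom_split:
  assumes "v \<in> Poly_Mapping.keys a"
  obtains b where "a = Poly_Mapping.single v 1 + (b :: 'v \<Rightarrow>\<^sub>0 nat)"
proof
  show "a = Poly_Mapping.single v 1 + (a - Poly_Mapping.single v 1)"
  proof (rule poly_mapping_eqI)
    fix k
    have "Poly_Mapping.lookup a v > 0" using assms by (simp add: in_keys_iff)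
    then show "Poly_Mapping.lookup a k = Poly_Mapping.lookup (Poly_Mapping.single v 1 + (a - Poly_Mapping.single v 1)) k"
      by (cases "k = v") (auto simp: lookup_add lookup_minus lookup_single)
  qed
qed

lemma keys_add_nat: "Poly_Mapping.keys (a + b) = Poly_Mapping.keys a \<union> Poly_Mapping.keys (b :: 'v \<Rightarrow>\<^sub>0 nat)"
  by (auto simp: in_keys_iff lookup_add)

lemma word_ex:
  fixes a :: "'v \<Rightarrow>\<^sub>0 nat"
  assumes "total_deg a = d"
  shows "\<exists>w. (\<forall>r<d. w r \<in> Poly_Mapping.keys a) \<and> a = (\<Sum>r<d. Poly_Mapping.single (w r) 1)"
  using assms
proof (induction d arbitrary: a)
  case 0
  then show ?case by (simp add: total_deg_0_iff)
next
  case (Suc d)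
  then have "a \<noteq> 0" by (metis total_deg_0_iff nat.distinct(1))
  then obtain v where v: "v \<in> Poly_Mapping.keys a" by (metis keys_eq_empty ex_in_conv)
  then obtain b where b: "a = Poly_Mapping.single v 1 + b" by (rule monom_split)
  then have "total_deg b = d" using Suc.prems by (simp add: total_deg_add total_deg_single)
  then obtain w where w: "\<forall>r<d. w r \<in> Poly_Mapping.keys b" "b = (\<Sum>r<d. Poly_Mapping.single (w r) 1)"
    using Suc.IH by blast
  show ?case
  proof (intro exI[of _ "w(d := v)"] conjI)
    show "\<forall>r<Suc d. (w(d := v)) r \<in> Poly_Mapping.keys a"
      using w(1) v b by (auto simp: less_Suc_eq keys_add_nat)
    have "(\<Sum>r<d. Poly_Mapping.single ((w(d := v)) r) (1::nat)) = b" unfolding w(2) by (intro sum.cong) auto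
    then show "a = (\<Sum>r<Suc d. Poly_Mapping.single ((w(d := v)) r) 1)"
      by (simp add: b add.commute)
  qed
qed

text \<open>A monomial as a chosen word of variables. A linear substitution turns it into a product
  of as many sums as the word has letters, which distributes over all words.\<close>

definition wd :: "('v \<Rightarrow>\<^sub>0 nat) \<Rightarrow> nat \<Rightarrow> 'v" where
  "wd a = (SOME w. (\<forall>r<total_deg a. w r \<in> Poly_Mapping.keys a) \<and> a = (\<Sum>r<total_deg a. Poly_Mapping.single (w r) 1))"

lemma wd: "r < total_deg a \<Longrightarrow> wd a r \<in> Poly_Mapping.keys a"
  "(\<Sum>r<total_deg a. Poly_Mapping.single (wd a r) 1) = a"
proof -
  have *: "(\<forall>r<total_deg a. wd a r \<in> Poly_Mapping.keys a) \<and> a = (\<Sum>r<total_deg a. Poly_Mapping.single (wd a r) 1)"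
    unfolding wd_def[of a] by (rule someI_ex[OF word_ex[OF refl]])
  show "r < total_deg a \<Longrightarrow> wd a r \<in> Poly_Mapping.keys a" using * by blast
  show "(\<Sum>r<total_deg a. Poly_Mapping.single (wd a r) 1) = a" using * by metis
qed

lemma eval_monom_0 [simp]: "eval_monom 0 y = 1"
  by (simp add: eval_monom_def)

lemma eval_monom_single: "eval_monom (Poly_Mapping.single v e) y = y v ^ e"
  by (cases "e = 0") (auto simp: eval_monom_def)

lemma eval_monom_word: "eval_monom (\<Sum>r\<in>R. Poly_Mapping.single (w r) 1) y = (\<Prod>r\<in>R. y (w r))"
  by (induction R rule: infinite_finite_induct) (auto simp: eval_monom_add eval_monom_single)

lemma eval_monom_wd: "eval_monom a y = (\<Prod>r<total_deg a. y (wd a r))"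
  using eval_monom_word[of "wd a" "{..<total_deg a}" y] unfolding wd(2) .

lemma wd_Mon: "a \<in> Mon m d \<Longrightarrow> r < d \<Longrightarrow> wd a r \<le> m"
  using wd(1)[of r a] by (auto simp: Mon_def)

lemma word_Mon:
  assumes "\<And>r. r < d \<Longrightarrow> w r \<le> m" shows "(\<Sum>r<d. Poly_Mapping.single (w r) 1) \<in> Mon m d"
  using assms
proof (induction d)
  case (Suc d)
  then show ?case
    by (auto simp: Mon_def keys_add_nat total_deg_add total_deg_single)
qed (simp add: Mon_def total_deg_def)

lemma Mon_0: "Mon 0 d = {Poly_Mapping.single 0 d}"
proof -
  have "a = Poly_Mapping.single 0 d" if "a \<in> Mon 0 d" for a
  proof -
    have "total_deg a = Poly_Mapping.lookup a 0"
      using total_deg_superset[of "{..0}" a] that by (simp add: Mon_def)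
    moreover have "Poly_Mapping.lookup a i = 0" if "i \<noteq> 0" for i
      using \<open>a \<in> Mon 0 d\<close> that by (auto simp: Mon_def in_keys_iff)
    ultimately show ?thesis using that
      by (intro poly_mapping_eqI) (auto simp: lookup_single when_def Mon_def)
  qed
  then show ?thesis by (auto simp: Mon_def total_deg_single split: if_splits)
qed

lemma Mon_Suc:
  "Mon (Suc m) d = (\<Union>e\<le>d. (\<lambda>a. a + Poly_Mapping.single (Suc m) e) ` Mon m (d - e))"
proof (intro equalityI subsetI)
  fix a assume a: "a \<in> Mon (Suc m) d"
  define e where "e = Poly_Mapping.lookup a (Suc m)"
  define b where "b = a - Poly_Mapping.single (Suc m) e"
  have ab: "a = b + Poly_Mapping.single (Suc m) e"
    by (rule poly_mapping_eqI) (auto simp: b_def e_def lookup_add lookup_minus lookup_single when_def)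
  have "Poly_Mapping.lookup b i = 0" if "i \<notin> {..m}" for i
  proof (cases "i = Suc m")
    case False
    then have "i \<notin> Poly_Mapping.keys a" using a that by (auto simp: Mon_def)
    then show ?thesis using False by (simp add: b_def lookup_minus in_keys_iff)
  qed (simp add: b_def e_def lookup_minus)
  then have kb: "Poly_Mapping.keys b \<subseteq> {..m}" by (auto simp: in_keys_iff)
  have "total_deg b + e = d" using a unfolding ab Mon_def by (simp add: total_deg_add total_deg_single)
  then have "e \<le> d" "b \<in> Mon m (d - e)" using kb by (auto simp: Mon_def)
  then show "a \<in> (\<Union>e\<le>d. (\<lambda>a. a + Poly_Mapping.single (Suc m) e) ` Mon m (d - e))" using ab by blast
next
  fix a assume "a \<in> (\<Union>e\<le>d. (\<lambda>a. a + Poly_Mapping.single (Suc m) e) ` Mon m (d - e))"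
  then obtain e b where "e \<le> d" "b \<in> Mon m (d - e)" "a = b + Poly_Mapping.single (Suc m) e" by blast
  then show "a \<in> Mon (Suc m) d"
    by (auto simp: Mon_def keys_add_nat total_deg_add total_deg_single split: if_splits)
qed

lemma card_Mon_aux: "finite (Mon m d) \<and> card (Mon m d) = (m + d) choose m"
proof (induction m arbitrary: d)
  case 0
  show ?case by (simp add: Mon_0)
next
  case (Suc m)
  have inj: "inj_on (\<lambda>a. a + Poly_Mapping.single (Suc m) e) (Mon m k)" for e k by (rule inj_onI) simp
  have "finite (Mon (Suc m) d)" unfolding Mon_Suc using Suc.IH by auto
  moreover have "card (Mon (Suc m) d) = (\<Sum>e\<le>d. card ((\<lambda>a. a + Poly_Mapping.single (Suc m) e) ` Mon m (d - e)))"
    unfolding Mon_Suc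
  proof (rule card_UN_disjoint)
    show "\<forall>i\<in>{..d}. \<forall>j\<in>{..d}. i \<noteq> j \<longrightarrow> (\<lambda>a. a + Poly_Mapping.single (Suc m) i) ` Mon m (d - i) \<inter>
        (\<lambda>a. a + Poly_Mapping.single (Suc m) j) ` Mon m (d - j) = {}"
    proof (intro ballI impI equals0I)
      fix i j x assume "i \<noteq> j" and x: "x \<in> (\<lambda>a. a + Poly_Mapping.single (Suc m) i) ` Mon m (d - i) \<inter>
        (\<lambda>a. a + Poly_Mapping.single (Suc m) j) ` Mon m (d - j)"
      have z: "Poly_Mapping.lookup b (Suc m) = 0" if "b \<in> Mon m k" for b k
        using that by (auto simp: Mon_def in_keys_iff)
      obtain b b' where "b \<in> Mon m (d - i)" "x = b + Poly_Mapping.single (Suc m) i"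
        "b' \<in> Mon m (d - j)" "x = b' + Poly_Mapping.single (Suc m) j" using x by blast
      then have "Poly_Mapping.lookup x (Suc m) = i" "Poly_Mapping.lookup x (Suc m) = j"
        by (metis lookup_add z add_0 lookup_single_eq)+
      then show False using \<open>i \<noteq> j\<close> by simp
    qed
  qed (use Suc.IH in auto)
  moreover have "\<dots> = (\<Sum>e\<le>d. (m + (d - e)) choose m)"
    using Suc.IH by (intro sum.cong) (auto simp: card_image[OF inj])
  moreover have "\<dots> = (\<Sum>e\<le>d. (m + e) choose m)"
    by (rule sum.reindex_bij_witness[of _ "\<lambda>e. d - e" "\<lambda>e. d - e"]) auto
  moreover have "\<dots> = Suc (m + d) choose Suc m"
    using choose_rising_sum(1)[of m d] by (simp add: add.commute)
  ultimately show ?case by simp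
qed

lemma finite_Mon [simp]: "finite (Mon m d)" and card_Mon: "card (Mon m d) = (d + m) choose d"
  using card_Mon_aux[of m d] binomial_symmetric[of m "m + d"] by (auto simp: add.commute)

lemma vars_in_fmP: "vars_in {..m} (fmP m d a)"
  unfolding fmP_def by (rule vars_in_sum) (auto simp: vars_in_def Mon_def)

lemma lookup_fmP: "Poly_Mapping.lookup (fmP m d a) \<alpha> = (if \<alpha> \<in> Mon m d then a \<alpha> else 0)"
  by (simp add: fmP_def lookup_sum lookup_single when_def)

lemma homogeneous_fmP: "homogeneous d (fmP m d a)"
  unfolding homogeneous_def by (auto simp: in_keys_iff lookup_fmP Mon_def split: if_splits)

lemma fm_unique:
  fixes a b :: "(nat \<Rightarrow>\<^sub>0 nat) \<Rightarrow> 'a::alg_closed_field"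
  assumes "\<And>y. fm m d a y = fm m d b y" "\<alpha> \<in> Mon m d"
  shows "a \<alpha> = b \<alpha>"
proof -
  have "fmP m d a = fmP m d b" by (rule mpoly_eqI) (simp add: eval_fmP assms(1))
  then show ?thesis using lookup_fmP[of m d a \<alpha>] lookup_fmP[of m d b \<alpha>] assms(2) by simp
qed

lemma fm_cong: "(\<And>j. j \<le> m \<Longrightarrow> y j = y' j) \<Longrightarrow> fm m d a y = fm m d a y'"
  unfolding eval_fmP[symmetric] by (rule eval_mpoly_cong[OF vars_in_fmP]) auto

lemma fm_scale: "fm m d a (\<lambda>j. c * y j) = c ^ d * fm m d a y"
  unfolding eval_fmP[symmetric] by (rule eval_mpoly_smult[OF homogeneous_fmP])

lemma fm_scale_coeff: "fm m d (\<lambda>\<alpha>. c * a \<alpha>) y = c * fm m d a y"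
  by (simp add: fm_def sum_distrib_left mult.assoc)

text \<open>The coefficient of the monomial \<open>b\<close> in \<open>\<alpha>\<close> after each
  variable \<open>y j\<close> is replaced by \<open>\<Sum>i\<le>m. y i * T i j\<close>: a sum over
  the words that spell \<open>b\<close>. The resulting action of \<open>T\<close> on the
  coefficients of a form is \<open>cop\<close>.\<close>

definition Kc :: "nat \<Rightarrow> nat \<Rightarrow> (nat \<Rightarrow> nat \<Rightarrow> 'a::comm_ring_1) \<Rightarrow> (nat \<Rightarrow>\<^sub>0 nat) \<Rightarrow> (nat \<Rightarrow>\<^sub>0 nat) \<Rightarrow> 'a" where
  "Kc m d T b \<alpha> = (\<Sum>w\<in>{w \<in> {..<d} \<rightarrow>\<^sub>E {..m}. (\<Sum>r<d. Poly_Mapping.single (w r) 1) = b}. \<Prod>r<d. T (w r) (wd \<alpha> r))"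

definition cop :: "nat \<Rightarrow> nat \<Rightarrow> (nat \<Rightarrow> nat \<Rightarrow> 'a::comm_ring_1) \<Rightarrow> ((nat \<Rightarrow>\<^sub>0 nat) \<Rightarrow> 'a) \<Rightarrow> (nat \<Rightarrow>\<^sub>0 nat) \<Rightarrow> 'a" where
  "cop m d T a b = (\<Sum>\<alpha>\<in>Mon m d. a \<alpha> * Kc m d T b \<alpha>)"

lemma fm_cop: "fm m d (cop m d T a) y = fm m d a (\<lambda>j. \<Sum>i\<le>m. y i * T i j)"
proof -
  have mono: "eval_monom \<alpha> (\<lambda>j. \<Sum>i\<le>m. y i * T i j) = (\<Sum>b\<in>Mon m d. Kc m d T b \<alpha> * eval_monom b y)"
    if \<alpha>: "\<alpha> \<in> Mon m d" for \<alpha>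
  proof -
    have d: "total_deg \<alpha> = d" using \<alpha> by (simp add: Mon_def)
    let ?W = "{..<d} \<rightarrow>\<^sub>E {..m}" and ?ty = "\<lambda>w. \<Sum>r<d. Poly_Mapping.single (w r) (1::nat)"
    define h where "h w = (\<Prod>r<d. T (w r) (wd \<alpha> r)) * eval_monom (?ty w) y" for w
    have fW: "finite ?W" by (intro finite_PiE) auto
    have ty: "?ty ` ?W \<subseteq> Mon m d"
    proof (rule image_subsetI)
      fix w assume w: "w \<in> ?W"
      show "?ty w \<in> Mon m d"
        by (rule word_Mon) (use PiE_mem[OF w] in auto)
    qed
    have "eval_monom \<alpha> (\<lambda>j. \<Sum>i\<le>m. y i * T i j) = (\<Prod>r<d. \<Sum>i\<le>m. y i * T i (wd \<alpha> r))"
      by (simp add: eval_monom_wd d)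
    also have "\<dots> = (\<Sum>w\<in>?W. \<Prod>r<d. y (w r) * T (w r) (wd \<alpha> r))"
      by (subst prod_sum_PiE) auto
    also have "\<dots> = (\<Sum>w\<in>?W. h w)"
      unfolding h_def by (intro sum.cong refl) (simp only: eval_monom_word prod.distrib mult.commute)
    also have "\<dots> = (\<Sum>b\<in>Mon m d. sum h {w\<in>?W. ?ty w = b})"
      by (rule sum.group[symmetric, OF fW finite_Mon ty])
    also have "\<dots> = (\<Sum>b\<in>Mon m d. Kc m d T b \<alpha> * eval_monom b y)"
      unfolding Kc_def sum_distrib_right h_def by (intro sum.cong) auto
    finally show ?thesis .
  qed
  have "fm m d (cop m d T a) y = (\<Sum>b\<in>Mon m d. \<Sum>\<alpha>\<in>Mon m d. a \<alpha> * (Kc m d T b \<alpha> * eval_monom b y))"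
    by (simp add: fm_def cop_def sum_distrib_right mult.assoc)
  also have "\<dots> = (\<Sum>\<alpha>\<in>Mon m d. a \<alpha> * (\<Sum>b\<in>Mon m d. Kc m d T b \<alpha> * eval_monom b y))"
    unfolding sum_distrib_left by (rule sum.swap)
  also have "\<dots> = fm m d a (\<lambda>j. \<Sum>i\<le>m. y i * T i j)"
    unfolding fm_def by (intro sum.cong) (simp_all add: mono)
  finally show ?thesis .
qed

text \<open>Along the direction \<open>q\<close> the form is a polynomial in \<open>s\<close>, and
  it suffices that this is not constant. Were it a constant \<open>c\<close>, then the reversed
  polynomial \<open>f(q + s z)\<close> would be \<open>c * s ^ d\<close>, which vanishes at
  \<open>s = 0\<close>, against \<open>f(q) \<noteq> 0\<close>.\<close>

lemma homogeneous_line_surj: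
  fixes f :: "('v, 'a::alg_closed_field) mpoly"
  assumes f: "homogeneous d f" "d > 0" and q: "eval_mpoly f q \<noteq> 0"
  shows "\<exists>s. eval_mpoly f (\<lambda>i. z i + s * q i) = t"
proof -
  obtain p where p: "\<forall>s. poly p s = eval_mpoly f (\<lambda>i. z i + s * q i)" using eval_line_poly[of f z q] by blast
  obtain r where r: "\<forall>s. poly r s = eval_mpoly f (\<lambda>i. q i + s * z i)" using eval_line_poly[of f q z] by blast
  have "degree p \<noteq> 0"
  proof
    assume "degree p = 0"
    then obtain c where c: "p = [:c:]" by (rule degree_eq_zeroE)
    have rc: "poly r s = c * s ^ d" if "s \<noteq> 0" for s
    proof -
      have "poly r s = eval_mpoly f (\<lambda>i. s * (z i + inverse s * q i))"
        using r that by (simp add: distrib_left mult.assoc[symmetric] add.commute)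
      also have "\<dots> = s ^ d * poly p (inverse s)" using p by (simp add: eval_mpoly_smult[OF f(1)])
      finally show ?thesis by (simp add: c)
    qed
    have "[:0, 1:] * (r - monom c d) = 0"
    proof (rule ccontr)
      assume "[:0, 1:] * (r - monom c d) \<noteq> 0"
      then obtain s where "poly ([:0, 1:] * (r - monom c d)) s \<noteq> 0" by (rule poly_nonroot)
      then have "s \<noteq> 0" "poly r s \<noteq> c * s ^ d" by (auto simp: poly_monom)
      then show False using rc by blast
    qed
    then have "r = monom c d" by simp
    then have "poly r 0 = 0" using f(2) by (simp add: poly_monom)
    then show False using r q by simp
  qed
  then have "degree [:- t:] < degree p" by simp
  then have "degree (p + [:- t:]) > 0" by (subst degree_add_eq_left) auto
  then obtain s where "poly (p + [:- t:]) s = 0" using alg_closed_imp_poly_has_root by blast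
  then show ?thesis using p by auto
qed

section \<open>Subspaces carrying a form that meets many given subspaces\<close>

text \<open>
  A configuration is a pair of \<open>m + 1\<close> vectors, spanning a linear subspace, and the coefficients of
  a form of degree \<open>d\<close> in the coordinates of this subspace. The \<open>pf m s\<close> are the Pluecker coordinates
  of the subspace. The \<open>cf m d s\<close> are the coefficients of the form with respect to the basis whose
  columns \<open>s\<close> are the unit matrix, multiplied by a power of \<open>pf m s\<close> to clear denominators.
  The linear forms \<open>g\<close> cut out a point of the subspace, with coordinates \<open>yv (Suc m) (Qh n g \<omega>)\<close>,
  and \<open>lf n m d g\<close> is the value of the form at this point.
\<close>

type_synonym 'a conf = "(nat \<Rightarrow> nat \<Rightarrow> 'a) \<times> ((nat \<Rightarrow>\<^sub>0 nat) \<Rightarrow> 'a)"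

definition us :: "(nat \<Rightarrow> nat) \<Rightarrow> 'a conf \<Rightarrow> nat \<Rightarrow> nat \<Rightarrow> 'a::comm_ring_1" where
  "us s \<omega> = (\<lambda>i c. fst \<omega> i (s c))"

definition pf :: "nat \<Rightarrow> (nat \<Rightarrow> nat) \<Rightarrow> 'a conf \<Rightarrow> 'a::comm_ring_1" where
  "pf m s \<omega> = dt (Suc m) (us s \<omega>)"

definition cf :: "nat \<Rightarrow> nat \<Rightarrow> (nat \<Rightarrow> nat) \<Rightarrow> (nat \<Rightarrow>\<^sub>0 nat) \<Rightarrow> 'a conf \<Rightarrow> 'a::comm_ring_1" where
  "cf m d s b \<omega> = cop m d (adjf (Suc m) (us s \<omega>)) (snd \<omega>) b"

definition Qh :: "nat \<Rightarrow> (nat \<Rightarrow> nat \<Rightarrow> 'a) \<Rightarrow> 'a conf \<Rightarrow> nat \<Rightarrow> nat \<Rightarrow> 'a::comm_ring_1" where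
  "Qh n g \<omega> = (\<lambda>i c. \<Sum>j\<le>n. fst \<omega> i j * g c j)"

definition lf :: "nat \<Rightarrow> nat \<Rightarrow> nat \<Rightarrow> (nat \<Rightarrow> nat \<Rightarrow> 'a) \<Rightarrow> 'a conf \<Rightarrow> 'a::comm_ring_1" where
  "lf n m d g \<omega> = fm m d (snd \<omega>) (yv (Suc m) (Qh n g \<omega>))"

section \<open>Transition formulas between the charts\<close>

lemma fm_cf: "fm m d (\<lambda>b. cf m d s b \<omega>) y = fm m d (snd \<omega>) (\<lambda>j. \<Sum>i\<le>m. y i * adjf (Suc m) (us s \<omega>) i j)"
  unfolding cf_def using fm_cop[of m d "adjf (Suc m) (us s \<omega>)" "snd \<omega>" y] .

text \<open>In the basis of the chart \<open>s\<close> the point \<open>y\<close> has as coordinates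
  its entries in the columns \<open>s\<close>. The adjugate takes these back to
  \<open>pf m s \<omega> * y\<close>, and a form of degree \<open>d\<close> takes out the
  \<open>d\<close>-th power of the factor.\<close>

lemma fm_cf_us: "fm m d (\<lambda>b. cf m d s b \<omega>) (\<lambda>j. \<Sum>i\<le>m. y i * fst \<omega> i (s j)) = pf m s \<omega> ^ d * fm m d (snd \<omega>) y"
proof -
  have "(\<Sum>j\<le>m. (\<Sum>i\<le>m. y i * fst \<omega> i (s j)) * adjf (Suc m) (us s \<omega>) j l) = pf m s \<omega> * y l" if l: "l \<le> m" for l
  proof -
    have "(\<Sum>j\<le>m. (\<Sum>i\<le>m. y i * fst \<omega> i (s j)) * adjf (Suc m) (us s \<omega>) j l)
        = (\<Sum>i\<le>m. y i * (\<Sum>j<Suc m. us s \<omega> i j * adjf (Suc m) (us s \<omega>) j l))"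
      unfolding sum_distrib_left sum_distrib_right us_def lessThan_Suc_atMost mult.assoc by (rule sum.swap)
    also have "\<dots> = (\<Sum>i\<le>m. y i * (if i = l then pf m s \<omega> else 0))"
      unfolding pf_def using l by (intro sum.cong refl arg_cong2[of _ _ _ _ "(*)"] adjf_right) auto
    also have "\<dots> = (\<Sum>i\<le>m. if i = l then pf m s \<omega> * y l else 0)" by (intro sum.cong) auto
    finally show ?thesis using l by simp
  qed
  then have "fm m d (\<lambda>b. cf m d s b \<omega>) (\<lambda>j. \<Sum>i\<le>m. y i * fst \<omega> i (s j)) = fm m d (snd \<omega>) (\<lambda>l. pf m s \<omega> * y l)"
    unfolding fm_cf by (intro fm_cong) simp
  then show ?thesis by (simp add: fm_scale)
qed

text \<open>By Cramer's rule, the matrix normalized on the columns \<open>s\<close> has Pluecker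
  coordinates as entries, up to the common denominator \<open>pf m s \<omega>\<close>.\<close>

lemma adjf_us:
  assumes "i \<le> m"
  shows "(\<Sum>l\<le>m. adjf (Suc m) (us s \<omega>) i l * fst \<omega> l j) = pf m (s(i := j)) \<omega>"
proof -
  have "(\<Sum>l<Suc m. fst \<omega> l j * adjf (Suc m) (us s \<omega>) i l) = dt (Suc m) (\<lambda>r c. if c = i then fst \<omega> r j else us s \<omega> r c)"
    by (rule adjf_replace) (use assms in simp)
  also have "\<dots> = pf m (s(i := j)) \<omega>"
    unfolding pf_def us_def by (rule dt_cong) auto
  finally show ?thesis by (simp add: lessThan_Suc_atMost mult.commute)
qed

text \<open>Evaluate the form of chart \<open>t\<close> through that of chart \<open>s\<close>. The
  change of basis has Pluecker coordinates as entries, so the right-hand side has degree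
  \<open>d\<close> in these and is linear in the coefficients. Coefficients are compared through
  values, which determine a form over an infinite field.\<close>

lemma cf_transition:
  fixes \<omega> :: "'a::alg_closed_field conf"
  assumes "b \<in> Mon m d"
  shows "pf m s \<omega> ^ d * cf m d t b \<omega> = cop m d (\<lambda>i j. pf m (t(i := s j)) \<omega>) (\<lambda>\<alpha>. cf m d s \<alpha> \<omega>) b"
proof (rule fm_unique[OF _ assms])
  fix y
  have "fm m d (\<lambda>b. pf m s \<omega> ^ d * cf m d t b \<omega>) y
      = pf m s \<omega> ^ d * fm m d (snd \<omega>) (\<lambda>j. \<Sum>i\<le>m. y i * adjf (Suc m) (us t \<omega>) i j)"
    by (simp only: fm_scale_coeff fm_cf)
  also have "\<dots> = fm m d (\<lambda>b. cf m d s b \<omega>) (\<lambda>j. \<Sum>l\<le>m. (\<Sum>i\<le>m. y i * adjf (Suc m) (us t \<omega>) i l) * fst \<omega> l (s j))"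
    by (rule fm_cf_us[symmetric])
  also have "\<dots> = fm m d (\<lambda>b. cf m d s b \<omega>) (\<lambda>j. \<Sum>i\<le>m. y i * pf m (t(i := s j)) \<omega>)"
  proof (rule fm_cong)
    fix j
    have "(\<Sum>l\<le>m. (\<Sum>i\<le>m. y i * adjf (Suc m) (us t \<omega>) i l) * fst \<omega> l (s j))
        = (\<Sum>i\<le>m. y i * (\<Sum>l\<le>m. adjf (Suc m) (us t \<omega>) i l * fst \<omega> l (s j)))"
      unfolding sum_distrib_left sum_distrib_right mult.assoc by (rule sum.swap)
    also have "\<dots> = (\<Sum>i\<le>m. y i * pf m (t(i := s j)) \<omega>)"
      by (intro sum.cong refl) (simp add: adjf_us)
    finally show "(\<Sum>l\<le>m. (\<Sum>i\<le>m. y i * adjf (Suc m) (us t \<omega>) i l) * fst \<omega> l (s j)) = \<dots>" .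
  qed
  also have "\<dots> = fm m d (cop m d (\<lambda>i j. pf m (t(i := s j)) \<omega>) (\<lambda>\<alpha>. cf m d s \<alpha> \<omega>)) y"
    by (rule fm_cop[symmetric])
  finally show "fm m d (\<lambda>b. pf m s \<omega> ^ d * cf m d t b \<omega>) y = \<dots>" .
qed

text \<open>By Cauchy-Binet the coordinates of the point cut out by \<open>g\<close> are linear in
  the Pluecker coordinates, with coefficients that depend on \<open>g\<close> alone.\<close>

lemma sum_yv_us:
  assumes "c \<le> n"
  shows "(\<Sum>i\<le>m. yv (Suc m) (Qh n g \<omega>) i * fst \<omega> i c)
    = (\<Sum>t\<in>{..<Suc m} \<rightarrow>\<^sub>E {..n}. (\<Prod>e<Suc m. if e = 0 then (if t e = c then 1 else 0) else g (e - 1) (t e)) * pf m t \<omega>)"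
proof -
  have "(\<Sum>i\<le>m. yv (Suc m) (Qh n g \<omega>) i * fst \<omega> i c) = (\<Sum>i<Suc m. fst \<omega> i c * yv (Suc m) (Qh n g \<omega>) i)"
    by (simp add: lessThan_Suc_atMost mult.commute)
  also have "\<dots> = dt (Suc m) (\<lambda>r e. if e = 0 then fst \<omega> r c else Qh n g \<omega> r (e - 1))"
    by (rule yv_dt) simp
  also have "\<dots> = dt (Suc m) (\<lambda>r e. \<Sum>l\<le>n. fst \<omega> r l * (if e = 0 then (if l = c then 1 else 0) else g (e - 1) l))"
    by (rule dt_cong) (use assms in \<open>auto simp: Qh_def if_distrib[of "\<lambda>x. _ * x"] cong: if_cong\<close>)
  also have "\<dots> = (\<Sum>t\<in>{..<Suc m} \<rightarrow>\<^sub>E {..n}. (\<Prod>e<Suc m. if e = 0 then (if t e = c then 1 else 0) else g (e - 1) (t e))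
      * dt (Suc m) (\<lambda>r e. fst \<omega> r (t e)))"
    by (rule dt_cauchy_binet) simp
  finally show ?thesis by (simp only: pf_def us_def)
qed

lemma lf_transition:
  "pf m s \<omega> ^ d * lf n m d g \<omega> = fm m d (\<lambda>b. cf m d s b \<omega>) (\<lambda>j. \<Sum>i\<le>m. yv (Suc m) (Qh n g \<omega>) i * fst \<omega> i (s j))"
  unfolding lf_def by (rule fm_cf_us[symmetric])

text \<open>All maps, not only increasing ones: an exchange of columns never leaves this set, and
  the Pluecker coordinate of a map that is not injective vanishes.\<close>

definition Sg :: "nat \<Rightarrow> nat \<Rightarrow> (nat \<Rightarrow> nat) set" where
  "Sg n m = {..<Suc m} \<rightarrow>\<^sub>E {..n}"

lemma Sg_upd: "s \<in> Sg n m \<Longrightarrow> i \<le> m \<Longrightarrow> j \<le> n \<Longrightarrow> s(i := j) \<in> Sg n m"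
  unfolding Sg_def by (auto simp: PiE_iff extensional_def)

lemma Sg_le: "s \<in> Sg n m \<Longrightarrow> j \<le> m \<Longrightarrow> s j \<le> n"
  unfolding Sg_def by (auto simp: PiE_iff)

lemma finite_Sg [simp]: "finite (Sg n m)"
  unfolding Sg_def by (intro finite_PiE) auto

lemma PC_c0:
  assumes "f \<in> PC A B d 0" "c \<in> B" shows "c * f \<in> PC A B d 1"
  using PC_mult[OF PC_B[OF assms(2)] assms(1)] by simp

lemma PC_prod_d:
  assumes "\<And>r. r < d \<Longrightarrow> f r \<in> PC A B 1 0" shows "(\<Prod>r<d. f r) \<in> PC A B d 0"
proof -
  have "(\<Prod>r\<in>{..<d}. f r) \<in> PC A B (\<Sum>r\<in>{..<d}. 1) (\<Sum>r\<in>{..<d}. 0)"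
    by (rule PC_prod[of "{..<d}" f A B "\<lambda>_. 1" "\<lambda>_. 0"]) (use assms in auto)
  then show ?thesis by simp
qed

lemma H1_cf:
  fixes A :: "('a::alg_closed_field conf \<Rightarrow> 'a) set"
  assumes s: "s \<in> Sg n m" and t: "t \<in> Sg n m" and b: "b \<in> Mon m d" and A: "pf m ` Sg n m \<subseteq> A"
  shows "pf m s ^ d * cf m d t b \<in> PC A (cf m d s ` Mon m d) d 1"
proof -
  let ?W = "{w \<in> {..<d} \<rightarrow>\<^sub>E {..m}. (\<Sum>r<d. Poly_Mapping.single (w r) 1) = b}"
  have eq: "(pf m s ^ d * cf m d t b :: 'a conf \<Rightarrow> 'a) = (\<Sum>\<alpha>\<in>Mon m d. cf m d s \<alpha> * (\<Sum>w\<in>?W. \<Prod>r<d. pf m (t(w r := s (wd \<alpha> r)))))"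
  proof
    fix \<omega> :: "'a conf"
    show "(pf m s ^ d * cf m d t b) \<omega> = (\<Sum>\<alpha>\<in>Mon m d. cf m d s \<alpha> * (\<Sum>w\<in>?W. \<Prod>r<d. pf m (t(w r := s (wd \<alpha> r))))) \<omega>"
      using cf_transition[OF b, of s \<omega> t]
      by (simp add: power_fun_apply sum_fun_apply prod_fun_apply cop_def Kc_def)
  qed
  show ?thesis unfolding eq
  proof (intro PC_sum PC_c0 imageI PC_prod_d PC_A)
    fix \<alpha> w r assume a: "\<alpha> \<in> Mon m d" and w: "w \<in> ?W" and r: "r < d"
    have "w r \<le> m" using w r by (auto simp: PiE_iff)
    moreover have "s (wd \<alpha> r) \<le> n" using Sg_le[OF s] wd_Mon[OF a r] by blast
    ultimately have "t(w r := s (wd \<alpha> r)) \<in> Sg n m" using Sg_upd[OF t] by blast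
    then show "pf m (t(w r := s (wd \<alpha> r))) \<in> A" using A by blast
  qed
qed

lemma H1_lf:
  fixes A :: "('a::alg_closed_field conf \<Rightarrow> 'a) set"
  assumes s: "s \<in> Sg n m" and A: "pf m ` Sg n m \<subseteq> A"
  shows "pf m s ^ d * lf n m d g \<in> PC A (cf m d s ` Mon m d) d 1"
proof -
  define Y where "Y c = (\<Sum>t\<in>Sg n m. fscale (\<Prod>e<Suc m. if e = 0 then (if t e = c then 1 else 0) else g (e - 1) (t e)) (pf m t))" for c
  have Y: "Y c \<in> PC A (cf m d s ` Mon m d) 1 0" for c
    unfolding Y_def using A by (intro PC_sum PC_scale PC_A) blast
  have Yeq: "(\<Sum>i\<le>m. yv (Suc m) (Qh n g \<omega>) i * fst \<omega> i c) = Y c \<omega>" if "c \<le> n" for c \<omega>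
    unfolding sum_yv_us[OF that] Y_def Sg_def sum_fun_apply fscale_def ..
  have eq: "pf m s ^ d * lf n m d g = (\<Sum>\<alpha>\<in>Mon m d. cf m d s \<alpha> * (\<Prod>r<d. Y (s (wd \<alpha> r))))"
  proof
    fix \<omega> :: "'a conf"
    have "(pf m s ^ d * lf n m d g) \<omega> = fm m d (\<lambda>b. cf m d s b \<omega>) (\<lambda>j. \<Sum>i\<le>m. yv (Suc m) (Qh n g \<omega>) i * fst \<omega> i (s j))"
      by (simp add: power_fun_apply lf_transition)
    also have "\<dots> = fm m d (\<lambda>b. cf m d s b \<omega>) (\<lambda>j. Y (s j) \<omega>)"
      by (rule fm_cong) (simp add: Yeq Sg_le[OF s])
    also have "\<dots> = (\<Sum>\<alpha>\<in>Mon m d. cf m d s \<alpha> \<omega> * (\<Prod>r<d. Y (s (wd \<alpha> r)) \<omega>))"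
      unfolding fm_def by (intro sum.cong refl) (simp add: eval_monom_wd Mon_def)
    finally show "(pf m s ^ d * lf n m d g) \<omega> = (\<Sum>\<alpha>\<in>Mon m d. cf m d s \<alpha> * (\<Prod>r<d. Y (s (wd \<alpha> r)))) \<omega>"
      by (simp add: sum_fun_apply prod_fun_apply)
  qed
  show ?thesis unfolding eq by (intro PC_sum PC_c0 imageI PC_prod_d Y)
qed

text \<open>Normalizing the columns selected by \<open>s\<close> to the identity and one coefficient to \<open>1\<close>.\<close>

definition nrm :: "nat \<Rightarrow> nat \<Rightarrow> nat \<Rightarrow> (nat \<Rightarrow> nat) \<Rightarrow> (nat \<Rightarrow>\<^sub>0 nat) \<Rightarrow> 'a::field conf \<Rightarrow> 'a conf" where
  "nrm n m d s \<alpha> \<omega> = (\<lambda>i j. if i \<le> m \<and> j \<le> n then pf m (s(i := j)) \<omega> / pf m s \<omega> else 0,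
     \<lambda>b. if b \<in> Mon m d then cf m d s b \<omega> / cf m d s \<alpha> \<omega> else 0)"

lemma nrm_us:
  assumes "pf m s \<omega> \<noteq> 0" "s \<in> Sg n m" "i \<le> m" "j \<le> m"
  shows "fst (nrm n m d s \<alpha> \<omega>) i (s j) = (if i = j then 1 else 0)"
proof -
  have "pf m (s(i := s j)) \<omega> = (\<Sum>l<Suc m. adjf (Suc m) (us s \<omega>) i l * us s \<omega> l j)"
    using adjf_us[OF assms(3), of s \<omega> "s j"] by (simp add: us_def lessThan_Suc_atMost)
  also have "\<dots> = (if i = j then pf m s \<omega> else 0)"
    unfolding pf_def by (rule adjf_left) (use assms in auto)
  finally show ?thesis using assms Sg_le[OF assms(2,4)] by (simp add: nrm_def)
qed

text \<open>The passage to the basis of the chart multiplies the cut-out vector by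
  \<open>pf m s \<omega>\<close>. The factor \<open>pf m s \<omega> ^ d\<close> of the form
  compensates this, and only the normalizing coefficient remains.\<close>

lemma lf_nrm:
  fixes \<omega> :: "'a::alg_closed_field conf"
  assumes p: "pf m s \<omega> \<noteq> 0" and c: "cf m d s \<alpha> \<omega> \<noteq> 0" and s: "s \<in> Sg n m"
  shows "lf n m d g (nrm n m d s \<alpha> \<omega>) = lf n m d g \<omega> / cf m d s \<alpha> \<omega>"
proof -
  let ?u = "fst (nrm n m d s \<alpha> \<omega>)" and ?p = "pf m s \<omega>"
  have us_u: "(\<Sum>l<Suc m. us s \<omega> i l * ?u l j) = fst \<omega> i j" if ij: "i \<le> m" "j \<le> n" for i j
  proof -
    have "?p * (\<Sum>l<Suc m. us s \<omega> i l * ?u l j) = (\<Sum>l\<le>m. us s \<omega> i l * pf m (s(l := j)) \<omega>)"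
      unfolding sum_distrib_left lessThan_Suc_atMost by (intro sum.cong refl) (use ij p in \<open>simp add: nrm_def\<close>)
    also have "\<dots> = (\<Sum>l\<le>m. us s \<omega> i l * (\<Sum>e\<le>m. adjf (Suc m) (us s \<omega>) l e * fst \<omega> e j))"
      by (intro sum.cong refl) (simp add: adjf_us)
    also have "\<dots> = (\<Sum>e\<le>m. (\<Sum>l<Suc m. us s \<omega> i l * adjf (Suc m) (us s \<omega>) l e) * fst \<omega> e j)"
      unfolding sum_distrib_left sum_distrib_right mult.assoc lessThan_Suc_atMost by (rule sum.swap)
    also have "\<dots> = (\<Sum>e\<le>m. (if i = e then ?p else 0) * fst \<omega> e j)"
      unfolding pf_def using ij by (intro sum.cong refl arg_cong2[of _ _ _ _ "(*)"] adjf_right) auto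
    also have "\<dots> = ?p * fst \<omega> i j" using ij by (simp add: if_distrib[of "\<lambda>x. x * _"] cong: if_cong)
    finally show ?thesis using p by simp
  qed
  let ?y = "yv (Suc m) (Qh n g (nrm n m d s \<alpha> \<omega>))"
  have Q: "Qh n g \<omega> i c = (\<Sum>l<Suc m. us s \<omega> i l * Qh n g (nrm n m d s \<alpha> \<omega>) l c)" if "i \<le> m" for i c
  proof -
    have "(\<Sum>l<Suc m. us s \<omega> i l * Qh n g (nrm n m d s \<alpha> \<omega>) l c) = (\<Sum>j\<le>n. (\<Sum>l<Suc m. us s \<omega> i l * ?u l j) * g c j)"
      unfolding Qh_def sum_distrib_left sum_distrib_right mult.assoc by (rule sum.swap)
    also have "\<dots> = (\<Sum>j\<le>n. fst \<omega> i j * g c j)"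
      by (intro sum.cong refl arg_cong2[of _ _ _ _ "(*)"] us_u) (use that in auto)
    finally show ?thesis by (simp add: Qh_def)
  qed
  have y: "(\<Sum>i\<le>m. yv (Suc m) (Qh n g \<omega>) i * fst \<omega> i (s j)) = ?p * ?y j" if j: "j \<le> m" for j
  proof -
    have "(\<Sum>i\<le>m. yv (Suc m) (Qh n g \<omega>) i * fst \<omega> i (s j))
        = (\<Sum>i<Suc m. yv (Suc m) (\<lambda>i c. \<Sum>l<Suc m. us s \<omega> i l * Qh n g (nrm n m d s \<alpha> \<omega>) l c) i * us s \<omega> i j)"
      unfolding us_def[of s \<omega>, THEN fun_cong, THEN fun_cong, of _ j] lessThan_Suc_atMost
      by (intro sum.cong refl arg_cong2[of _ _ _ _ "(*)"] yv_cong) (auto simp: Q[unfolded lessThan_Suc_atMost])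
    also have "\<dots> = ?p * ?y j" unfolding pf_def by (rule yv_transform) (use j in auto)
    finally show ?thesis .
  qed
  have "?p ^ d * lf n m d g \<omega> = fm m d (\<lambda>b. cf m d s b \<omega>) (\<lambda>j. ?p * ?y j)"
    unfolding lf_transition by (rule fm_cong) (rule y)
  also have "\<dots> = ?p ^ d * fm m d (\<lambda>b. cf m d s b \<omega>) ?y" by (rule fm_scale)
  finally have "lf n m d g \<omega> = fm m d (\<lambda>b. cf m d s b \<omega>) ?y" using p by simp
  also have "\<dots> = cf m d s \<alpha> \<omega> * fm m d (snd (nrm n m d s \<alpha> \<omega>)) ?y"
    unfolding fm_def sum_distrib_left by (intro sum.cong refl) (simp add: nrm_def c)
  finally show ?thesis using c by (simp add: lf_def)
qed

section \<open>Chart coordinates, denominators and the Nullstellensatz in a chart\<close>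

definition pt :: "'a conf \<Rightarrow> (nat \<times> nat) + (nat \<Rightarrow>\<^sub>0 nat) \<Rightarrow> 'a" where
  "pt \<omega> v = (case v of Inl (i, j) \<Rightarrow> fst \<omega> i j | Inr b \<Rightarrow> snd \<omega> b)"

context
  fixes n m d :: nat and s :: "nat \<Rightarrow> nat" and \<alpha> :: "nat \<Rightarrow>\<^sub>0 nat" and A B :: "('a::alg_closed_field conf \<Rightarrow> 'a) set"
  assumes s: "s \<in> Sg n m" and A: "pf m ` Sg n m \<subseteq> A" and B: "cf m d s ` Mon m d \<subseteq> B" and \<alpha>: "\<alpha> \<in> Mon m d"
begin

abbreviation "pc \<equiv> pf m s * cf m d s \<alpha>"

lemma pc_PC: "pc ^ k \<in> PC A B k k"
proof -
  have "pf m s \<in> A" "cf m d s \<alpha> \<in> B" using s A B \<alpha> by blast+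
  then have "pf m s * cf m d s \<alpha> \<in> PC A B (1 + 0) (0 + 1)" by (intro PC_mult PC_A PC_B)
  then have "pc ^ k \<in> PC A B (k * (1 + 0)) (k * (0 + 1))" by (rule PC_power)
  then show ?thesis by simp
qed

text \<open>A normalized coordinate has denominator \<open>pf m s\<close> or
  \<open>cf m d s \<alpha>\<close>. Multiplying always by the product \<open>pc\<close> keeps both
  degrees equal, so that the summands of a polynomial can be adjusted to one bidegree by a single
  exponent.\<close>

lemma clear_denominators:
  fixes g :: "((nat \<times> nat) + (nat \<Rightarrow>\<^sub>0 nat), 'a) mpoly"
  shows "\<exists>M. \<exists>E\<in>PC A B M M. \<forall>\<omega>. pc \<omega> \<noteq> 0 \<longrightarrow> pc \<omega> ^ M * eval_mpoly g (pt (nrm n m d s \<alpha> \<omega>)) = E \<omega>"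
proof -
  have "vars_in UNIV g" by simp
  then show ?thesis
  proof (induction rule: mpoly_ring_induct)
    case (const c)
    have "fscale c 1 \<in> PC A B 0 0" by (intro PC_scale PC_1)
    then show ?case by (intro exI[of _ 0] bexI[of _ "fscale c 1"]) (auto simp: fscale_def)
  next
    case (var v)
    show ?case
    proof (cases v)
      case (Inl ij)
      obtain i j where ij: "ij = (i, j)" by fastforce
      show ?thesis
      proof (cases "i \<le> m \<and> j \<le> n")
        case True
        have "pf m (s(i := j)) \<in> A" "cf m d s \<alpha> \<in> B" using True Sg_upd[OF s] A B \<alpha> by blast+
        then have "pf m (s(i := j)) * cf m d s \<alpha> \<in> PC A B (1 + 0) (0 + 1)" by (intro PC_mult PC_A PC_B)
        then have "pf m (s(i := j)) * cf m d s \<alpha> \<in> PC A B 1 1" by simp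
        then show ?thesis
          by (intro exI[of _ 1] bexI[of _ "pf m (s(i := j)) * cf m d s \<alpha>"])
            (use True in \<open>auto simp: Inl ij pt_def nrm_def\<close>)
      next
        case False
        then show ?thesis
          by (intro exI[of _ 0] bexI[of _ 0]) (auto simp: Inl ij pt_def nrm_def intro: PC_0)
      qed
    next
      case (Inr b)
      show ?thesis
      proof (cases "b \<in> Mon m d")
        case True
        have "pf m s \<in> A" "cf m d s b \<in> B" using s True A B by blast+
        then have "pf m s * cf m d s b \<in> PC A B (1 + 0) (0 + 1)" by (intro PC_mult PC_A PC_B)
        then have "pf m s * cf m d s b \<in> PC A B 1 1" by simp
        then show ?thesis
          by (intro exI[of _ 1] bexI[of _ "pf m s * cf m d s b"])
            (use True in \<open>auto simp: Inr pt_def nrm_def\<close>)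
      next
        case False
        then show ?thesis
          by (intro exI[of _ 0] bexI[of _ 0]) (auto simp: Inr pt_def nrm_def intro: PC_0)
      qed
    qed
  next
    case (add f g)
    obtain M E where E: "E \<in> PC A B M M" "\<forall>\<omega>. pc \<omega> \<noteq> 0 \<longrightarrow> pc \<omega> ^ M * eval_mpoly f (pt (nrm n m d s \<alpha> \<omega>)) = E \<omega>"
      using add.IH(1) by blast
    obtain M' E' where E': "E' \<in> PC A B M' M'" "\<forall>\<omega>. pc \<omega> \<noteq> 0 \<longrightarrow> pc \<omega> ^ M' * eval_mpoly g (pt (nrm n m d s \<alpha> \<omega>)) = E' \<omega>"
      using add.IH(2) by blast
    have "pc ^ M' * E \<in> PC A B (M' + M) (M' + M)" by (intro PC_mult pc_PC E)
    moreover have "pc ^ M * E' \<in> PC A B (M' + M) (M' + M)"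
      using PC_mult[OF pc_PC[of M] E'(1)] by (simp add: add.commute)
    ultimately have "pc ^ M' * E + pc ^ M * E' \<in> PC A B (M' + M) (M' + M)" by (rule PC_add)
    moreover have "pc \<omega> ^ (M' + M) * eval_mpoly (f + g) (pt (nrm n m d s \<alpha> \<omega>)) = (pc ^ M' * E + pc ^ M * E') \<omega>" if nz: "pc \<omega> \<noteq> 0" for \<omega>
    proof -
      have "E \<omega> = pc \<omega> ^ M * eval_mpoly f (pt (nrm n m d s \<alpha> \<omega>))" "E' \<omega> = pc \<omega> ^ M' * eval_mpoly g (pt (nrm n m d s \<alpha> \<omega>))"
        by (rule E(2)[rule_format, OF nz, symmetric], rule E'(2)[rule_format, OF nz, symmetric])
      then show ?thesis by (simp add: power_fun_apply power_add eval_mpoly_add algebra_simps)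
    qed
    ultimately show ?case by (intro exI[of _ "M' + M"]) blast
  next
    case (mult f g)
    obtain M E where E: "E \<in> PC A B M M" "\<forall>\<omega>. pc \<omega> \<noteq> 0 \<longrightarrow> pc \<omega> ^ M * eval_mpoly f (pt (nrm n m d s \<alpha> \<omega>)) = E \<omega>"
      using mult.IH(1) by blast
    obtain M' E' where E': "E' \<in> PC A B M' M'" "\<forall>\<omega>. pc \<omega> \<noteq> 0 \<longrightarrow> pc \<omega> ^ M' * eval_mpoly g (pt (nrm n m d s \<alpha> \<omega>)) = E' \<omega>"
      using mult.IH(2) by blast
    have "E * E' \<in> PC A B (M + M') (M + M')" by (intro PC_mult E E')
    moreover have "pc \<omega> ^ (M + M') * eval_mpoly (f * g) (pt (nrm n m d s \<alpha> \<omega>)) = (E * E') \<omega>" if nz: "pc \<omega> \<noteq> 0" for \<omega>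
    proof -
      have "E \<omega> = pc \<omega> ^ M * eval_mpoly f (pt (nrm n m d s \<alpha> \<omega>))" "E' \<omega> = pc \<omega> ^ M' * eval_mpoly g (pt (nrm n m d s \<alpha> \<omega>))"
        by (rule E(2)[rule_format, OF nz, symmetric], rule E'(2)[rule_format, OF nz, symmetric])
      then show ?thesis by (simp add: power_fun_apply power_add eval_mpoly_mult mult_ac)
    qed
    ultimately show ?case by (intro exI[of _ "M + M'"]) blast
  qed
qed

lemma clear_denominators_family:
  fixes g :: "nat \<Rightarrow> ((nat \<times> nat) + (nat \<Rightarrow>\<^sub>0 nat), 'a) mpoly"
  shows "\<exists>M E. (\<forall>i<N. E i \<in> PC A B M M) \<and>
    (\<forall>i<N. \<forall>\<omega>. pc \<omega> \<noteq> 0 \<longrightarrow> pc \<omega> ^ M * eval_mpoly (g i) (pt (nrm n m d s \<alpha> \<omega>)) = E i \<omega>)"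
proof -
  have "\<forall>i. \<exists>M E. E \<in> PC A B M M \<and> (\<forall>\<omega>. pc \<omega> \<noteq> 0 \<longrightarrow> pc \<omega> ^ M * eval_mpoly (g i) (pt (nrm n m d s \<alpha> \<omega>)) = E \<omega>)"
    using clear_denominators by blast
  then obtain M E where ME: "\<And>i. E i \<in> PC A B (M i) (M i)"
    "\<And>i \<omega>. pc \<omega> \<noteq> 0 \<Longrightarrow> pc \<omega> ^ M i * eval_mpoly (g i) (pt (nrm n m d s \<alpha> \<omega>)) = E i \<omega>" by metis
  define M' where "M' = (\<Sum>i<N. M i)"
  show ?thesis
  proof (intro exI[of _ M'] exI[of _ "\<lambda>i. pc ^ (M' - M i) * E i"] conjI allI impI)
    fix i assume i: "i < N"
    have le: "M i \<le> M'" unfolding M'_def by (rule member_le_sum) (use i in auto)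
    have "pc ^ (M' - M i) * E i \<in> PC A B (M' - M i + M i) (M' - M i + M i)" by (intro PC_mult pc_PC ME)
    then show "pc ^ (M' - M i) * E i \<in> PC A B M' M'" using le by simp
    fix \<omega> :: "'a conf" assume nz: "pc \<omega> \<noteq> 0"
    have "pc \<omega> ^ M' = pc \<omega> ^ (M' - M i) * pc \<omega> ^ M i" using le by (simp add: power_add[symmetric])
    then show "pc \<omega> ^ M' * eval_mpoly (g i) (pt (nrm n m d s \<alpha> \<omega>)) = (pc ^ (M' - M i) * E i) \<omega>"
      using ME(2)[OF nz, of i] by (simp add: power_fun_apply mult.assoc)
  qed
qed

end

lemma pfun_lf:
  fixes g :: "nat \<Rightarrow> nat \<Rightarrow> 'a::alg_closed_field"
  shows "pfun (Inl ` ({..m} \<times> {..n}) \<union> Inr ` Mon m d)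
    (\<lambda>x. lf n m d g (\<lambda>i j. x (Inl (i, j)), \<lambda>b. x (Inr b)))"
proof -
  let ?I = "Inl ` ({..m} \<times> {..n}) \<union> Inr ` Mon m d"
  have Q: "pfun ?I (\<lambda>x. Qh n g (\<lambda>i j. x (Inl (i, j)), \<lambda>b. x (Inr b)) r c)" if "r < Suc m" for r c
    unfolding Qh_def fst_conv using that by (intro pfun_sum pfun_mult pfun_const pfun_var) auto
  have y: "pfun ?I (\<lambda>x. yv (Suc m) (Qh n g (\<lambda>i j. x (Inl (i, j)), \<lambda>b. x (Inr b))) j)" if "j \<le> m" for j
    unfolding yv_def by (rule pfun_adjf) (use that in \<open>auto intro: Q\<close>)
  have mono: "pfun {..m} (\<lambda>y :: nat \<Rightarrow> 'a. eval_monom \<alpha> y)" if "\<alpha> \<in> Mon m d" for \<alpha> :: "nat \<Rightarrow>\<^sub>0 nat"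
  proof -
    have "pfun {..m} (\<lambda>y. eval_mpoly (Poly_Mapping.single \<alpha> (1::'a)) y)"
      using that by (intro pfun_eval) (auto simp: vars_in_def Mon_def)
    then show ?thesis by (simp add: eval_mpoly_single)
  qed
  have "pfun ?I (\<lambda>x. eval_monom \<alpha> (\<lambda>j. yv (Suc m) (Qh n g (\<lambda>i j. x (Inl (i, j)), \<lambda>b. x (Inr b))) j))"
    if \<alpha>: "\<alpha> \<in> Mon m d" for \<alpha>
  proof -
    obtain f where f: "vars_in {..m} f" "\<And>y :: nat \<Rightarrow> 'a. eval_mpoly f y = eval_monom \<alpha> y" using mono[OF \<alpha>] by (rule pfunE) blast
    show ?thesis unfolding f(2)[symmetric] by (rule pfun_compose[OF f(1)]) (use y in auto)
  qed
  then show ?thesis unfolding lf_def fm_def snd_conv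
    by (intro pfun_sum pfun_mult pfun_var) auto
qed

text \<open>The Nullstellensatz is applied on the affine chart where the columns \<open>s\<close>
  are the identity and the coefficient at \<open>\<alpha>\<close> is \<open>1\<close>; the set
  \<open>D\<close> consists of these equations. The certificate for \<open>1\<close> is evaluated at
  normalized configurations, where \<open>D\<close> vanishes, and is then cleared of
  denominators.\<close>

lemma H2_lf:
  fixes h :: "nat \<Rightarrow> nat \<Rightarrow> nat \<Rightarrow> 'a::alg_closed_field"
  assumes s: "s \<in> Sg n m" and A: "pf m ` Sg n m \<subseteq> A" and B: "cf m d s ` Mon m d \<subseteq> B" and \<alpha>: "\<alpha> \<in> Mon m d"
    and NC: "\<And>u a. (\<And>i j. i \<le> m \<Longrightarrow> j \<le> m \<Longrightarrow> u i (s j) = (if i = j then 1 else 0)) \<Longrightarrow> a \<alpha> \<noteq> 0 \<Longrightarrow>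
      \<exists>i<N. lf n m d (h i) (u, a) \<noteq> 0"
  shows "\<exists>M E. (\<forall>i<N. E i \<in> PC A B M M) \<and> pf m s ^ M * cf m d s \<alpha> ^ Suc M = (\<Sum>i<N. lf n m d (h i) * E i)"
proof -
  let ?I = "Inl ` ({..m} \<times> {..n}) \<union> Inr ` Mon m d :: ((nat \<times> nat) + (nat \<Rightarrow>\<^sub>0 nat)) set"
  have "\<forall>i. \<exists>f. vars_in ?I f \<and> (\<forall>x. eval_mpoly f x = lf n m d (h i) (\<lambda>i j. x (Inl (i, j)), \<lambda>b. x (Inr b)))"
    using pfun_lf[of m n d] unfolding pfun_def by blast
  then obtain R where R: "\<And>i. vars_in ?I (R i)"
    "\<And>i x. eval_mpoly (R i) x = lf n m d (h i) (\<lambda>i j. x (Inl (i, j)), \<lambda>b. x (Inr b))" by metis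
  define D where "D = {MX (Inl (i, s j)) - MC (if i = j then 1 else 0) | i j. i \<le> m \<and> j \<le> m} \<union> {MX (Inr \<alpha>) - MC (1::'a)}"
  define S where "S = R ` {..<N} \<union> D"
  have one: "1 \<in> ideal_span S"
  proof (rule weak_nullstellensatz[of ?I])
    show "finite ?I" by simp
    show "vars_in ?I g" if "g \<in> S" for g
      using that R(1) \<alpha> Sg_le[OF s] unfolding S_def D_def by (auto intro!: vars_in_diff)
    fix x :: "(nat \<times> nat) + (nat \<Rightarrow>\<^sub>0 nat) \<Rightarrow> 'a"
    show "\<exists>g\<in>S. eval_mpoly g x \<noteq> 0"
    proof (rule ccontr)
      assume "\<not> (\<exists>g\<in>S. eval_mpoly g x \<noteq> 0)"
      then have z: "\<And>g. g \<in> S \<Longrightarrow> eval_mpoly g x = 0" by blast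
      have "x (Inl (i, s j)) = (if i = j then 1 else 0)" if "i \<le> m" "j \<le> m" for i j
      proof -
        have "MX (Inl (i, s j)) - MC (if i = j then 1 else 0) \<in> S" using that unfolding S_def D_def by blast
        from z[OF this] show ?thesis by simp
      qed
      moreover have "x (Inr \<alpha>) \<noteq> 0"
      proof -
        have "MX (Inr \<alpha>) - MC 1 \<in> S" unfolding S_def D_def by blast
        from z[OF this] show ?thesis by simp
      qed
      ultimately obtain i where "i < N" "lf n m d (h i) (\<lambda>i j. x (Inl (i, j)), \<lambda>b. x (Inr b)) \<noteq> 0"
        using NC[of "\<lambda>i j. x (Inl (i, j))" "\<lambda>b. x (Inr b)"] by blast
      moreover have "R i \<in> S" using \<open>i < N\<close> unfolding S_def by blast
      ultimately show False using z[of "R i"] R(2) by simp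
    qed
  qed
  obtain T q where T: "finite T" "T \<subseteq> S" "1 = (\<Sum>g\<in>T. q g * g)" using one unfolding ideal_span_def by auto
  define T1 where "T1 = {g\<in>T. g \<in> R ` {..<N}}"
  have "\<forall>g\<in>T1. \<exists>i. i < N \<and> g = R i" unfolding T1_def by blast
  then obtain \<iota> where \<iota>: "\<And>g. g \<in> T1 \<Longrightarrow> \<iota> g < N" "\<And>g. g \<in> T1 \<Longrightarrow> g = R (\<iota> g)" by metis
  define G where "G i = (\<Sum>g\<in>{g\<in>T1. \<iota> g = i}. q g)" for i
  let ?pc = "pf m s * cf m d s \<alpha>" and ?x = "\<lambda>\<omega>. pt (nrm n m d s \<alpha> \<omega>)"
  have key: "1 = (\<Sum>i<N. eval_mpoly (G i) (?x \<omega>) * (lf n m d (h i) \<omega> / cf m d s \<alpha> \<omega>))"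
    if nz: "?pc \<omega> \<noteq> 0" for \<omega>
  proof -
    have p: "pf m s \<omega> \<noteq> 0" and c: "cf m d s \<alpha> \<omega> \<noteq> 0" using nz by auto
    have conf: "(\<lambda>i j. ?x \<omega> (Inl (i, j)), \<lambda>b. ?x \<omega> (Inr b)) = nrm n m d s \<alpha> \<omega>"
      by (rule prod_eqI) (auto simp: pt_def)
    have Rx: "eval_mpoly (R i) (?x \<omega>) = lf n m d (h i) \<omega> / cf m d s \<alpha> \<omega>" for i
      unfolding R(2) conf by (rule lf_nrm[OF p c s])
    have Dx: "eval_mpoly g (?x \<omega>) = 0" if "g \<in> D" for g
      using that unfolding D_def
    proof (elim UnE CollectE exE conjE singletonE)
      fix i j assume g: "g = MX (Inl (i, s j)) - MC (if i = j then 1 else 0)" "i \<le> m" "j \<le> m"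
      show ?thesis using nrm_us[OF p s g(2,3)] by (simp add: g(1) pt_def)
    next
      assume "g = MX (Inr \<alpha>) - MC 1"
      then show ?thesis using c \<alpha> by (simp add: pt_def nrm_def)
    qed
    have "1 = eval_mpoly (\<Sum>g\<in>T. q g * g) (?x \<omega>)" using T(3) by (metis eval_mpoly_one)
    also have "\<dots> = (\<Sum>g\<in>T. eval_mpoly (q g) (?x \<omega>) * eval_mpoly g (?x \<omega>))"
      by (simp add: eval_mpoly_hom)
    also have "\<dots> = (\<Sum>g\<in>T1. eval_mpoly (q g) (?x \<omega>) * eval_mpoly g (?x \<omega>))"
    proof (rule sum.mono_neutral_right[OF T(1)])
      show "\<forall>g\<in>T - T1. eval_mpoly (q g) (?x \<omega>) * eval_mpoly g (?x \<omega>) = 0"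
        using T(2) Dx unfolding T1_def S_def by auto
    qed (auto simp: T1_def)
    also have "\<dots> = (\<Sum>i<N. \<Sum>g\<in>{g\<in>T1. \<iota> g = i}. eval_mpoly (q g) (?x \<omega>) * eval_mpoly g (?x \<omega>))"
      by (rule sum.group[symmetric]) (use T(1) \<iota>(1) in \<open>auto simp: T1_def\<close>)
    also have "\<dots> = (\<Sum>i<N. eval_mpoly (G i) (?x \<omega>) * (lf n m d (h i) \<omega> / cf m d s \<alpha> \<omega>))"
      unfolding G_def eval_mpoly_sum sum_distrib_right
    proof (intro sum.cong refl)
      fix i g assume "g \<in> {g\<in>T1. \<iota> g = i}"
      then have "g = R i" using \<iota>(2)[of g] by auto
      then show "eval_mpoly (q g) (?x \<omega>) * eval_mpoly g (?x \<omega>) = eval_mpoly (q g) (?x \<omega>) * (lf n m d (h i) \<omega> / cf m d s \<alpha> \<omega>)"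
        using Rx by metis
    qed
    finally show ?thesis .
  qed
  obtain M E where E: "\<forall>i<N. E i \<in> PC A B M M"
    "\<forall>i<N. \<forall>\<omega>. ?pc \<omega> \<noteq> 0 \<longrightarrow> ?pc \<omega> ^ M * eval_mpoly (G i) (?x \<omega>) = E i \<omega>"
    using clear_denominators_family[OF s A B \<alpha>, of N G] by blast
  \<comment> \<open>The additional factor \<open>pc\<close> makes both sides vanish where
    \<open>pc\<close> is zero, so the identity holds for all configurations and not only on the
    chart.\<close>
  show ?thesis
  proof (intro exI[of _ "Suc M"] exI[of _ "\<lambda>i. ?pc * E i"] conjI)
    show "\<forall>i<N. ?pc * E i \<in> PC A B (Suc M) (Suc M)"
      using PC_mult[OF pc_PC[OF s A B \<alpha>, of 1]] E(1) by simp
    show "pf m s ^ Suc M * cf m d s \<alpha> ^ Suc (Suc M) = (\<Sum>i<N. lf n m d (h i) * (?pc * E i))"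
    proof
      fix \<omega> :: "'a conf"
      show "(pf m s ^ Suc M * cf m d s \<alpha> ^ Suc (Suc M)) \<omega> = (\<Sum>i<N. lf n m d (h i) * (?pc * E i)) \<omega>"
      proof (cases "?pc \<omega> = 0")
        case True
        then show ?thesis by (auto simp: sum_fun_apply power_fun_apply)
      next
        case False
        have c: "cf m d s \<alpha> \<omega> \<noteq> 0" using False by auto
        have "?pc \<omega> ^ M * cf m d s \<alpha> \<omega> = ?pc \<omega> ^ M * cf m d s \<alpha> \<omega> *
            (\<Sum>i<N. eval_mpoly (G i) (?x \<omega>) * (lf n m d (h i) \<omega> / cf m d s \<alpha> \<omega>))"
          using key[OF False] by simp
        also have "\<dots> = (\<Sum>i<N. lf n m d (h i) \<omega> * (?pc \<omega> ^ M * eval_mpoly (G i) (?x \<omega>)))"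
          unfolding sum_distrib_left by (intro sum.cong refl) (use c in \<open>simp add: field_simps\<close>)
        also have "\<dots> = (\<Sum>i<N. lf n m d (h i) \<omega> * E i \<omega>)"
          by (intro sum.cong refl arg_cong2[of _ _ _ _ "(*)"] E(2)[rule_format, OF _ False]) simp
        finally have eq: "?pc \<omega> ^ M * cf m d s \<alpha> \<omega> = (\<Sum>i<N. lf n m d (h i) \<omega> * E i \<omega>)" .
        have "(pf m s ^ Suc M * cf m d s \<alpha> ^ Suc (Suc M)) \<omega> = ?pc \<omega> * (?pc \<omega> ^ M * cf m d s \<alpha> \<omega>)"
          by (simp add: power_fun_apply power_mult_distrib mult_ac)
        also have "\<dots> = (\<Sum>i<N. lf n m d (h i) * (?pc * E i)) \<omega>"
          unfolding eq sum_distrib_left sum_fun_apply by (intro sum.cong refl) (simp add: mult_ac)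
        finally show ?thesis .
      qed
    qed
  qed
qed

section \<open>Coefficients in charts adjacent to the standard chart\<close>

lemma adjf_elementary:
  assumes M: "\<And>r c. r \<le> m \<Longrightarrow> c \<le> m \<Longrightarrow> M r c = (if c = 0 then y r else if r = c then 1 else (0::'a::comm_ring_1))"
    and r: "r \<le> m" and c: "c \<le> m"
  shows "adjf (Suc m) M r c = (if c = 0 then (if r = 0 then 1 else - y r) else if r = c then y 0 else 0)"
proof -
  define I where "I = (\<lambda>r c :: nat. if r = c then 1 else (0::'a))"
  have adI: "adjf (Suc m) I i j = (if i = j then 1 else 0)" if "i \<le> m" "j \<le> m" for i j
  proof -
    have "(\<Sum>l<Suc m. adjf (Suc m) I i l * I l j) = (if i = j then dt (Suc m) I else 0)"
      by (rule adjf_left) (use that in auto)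
    moreover have "(\<Sum>l<Suc m. adjf (Suc m) I i l * I l j) = adjf (Suc m) I i j"
      using that unfolding I_def by (simp add: if_distrib[of "\<lambda>x. _ * x"] sum.delta' cong: if_cong del: sum.lessThan_Suc)
    moreover have "dt (Suc m) I = 1" unfolding I_def by (rule dt_one)
    ultimately show ?thesis by (simp del: sum.lessThan_Suc)
  qed
  have row0: "adjf (Suc m) M 0 j = (if 0 = j then 1 else 0)" if "j \<le> m" for j
  proof -
    have "adjf (Suc m) M 0 j = adjf (Suc m) I 0 j"
      unfolding adjf_dt[of 0 "Suc m" j M, OF zero_less_Suc le_imp_less_Suc[OF that]]
        adjf_dt[of 0 "Suc m" j I, OF zero_less_Suc le_imp_less_Suc[OF that]]
      by (rule dt_cong) (auto simp: M I_def)
    then show ?thesis using adI[of 0 j] that by simp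
  qed
  have dM: "dt (Suc m) M = y 0"
  proof -
    have "(\<Sum>j<Suc m. y j * adjf (Suc m) I 0 j) = dt (Suc m) (\<lambda>r c. if c = 0 then y r else I r c)"
      by (rule adjf_replace) simp
    also have "\<dots> = dt (Suc m) M" by (rule dt_cong) (auto simp: M I_def)
    finally have "dt (Suc m) M = (\<Sum>j<Suc m. y j * adjf (Suc m) I 0 j)" by (rule sym)
    also have "\<dots> = (\<Sum>j<Suc m. y j * (if 0 = j then 1 else 0))"
      by (intro sum.cong refl) (simp add: adI del: sum.lessThan_Suc)
    finally have "dt (Suc m) M = (\<Sum>j<Suc m. y j * (if 0 = j then 1 else 0))" .
    then show ?thesis by (simp add: if_distrib[of "\<lambda>x. _ * x"] cong: if_cong del: sum.lessThan_Suc)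
  qed
  show ?thesis
  proof (cases "c = 0")
    case False
    have "(\<Sum>l<Suc m. adjf (Suc m) M r l * M l c) = (if r = c then dt (Suc m) M else 0)"
      by (rule adjf_left) (use r c in auto)
    moreover have "(\<Sum>l<Suc m. adjf (Suc m) M r l * M l c) = (\<Sum>l<Suc m. if l = c then adjf (Suc m) M r c else 0)"
      by (intro sum.cong refl) (use False c in \<open>auto simp: M\<close>)
    ultimately show ?thesis using False c dM by (simp del: sum.lessThan_Suc)
  next
    case True
    show ?thesis
    proof (cases "r = 0")
      case True
      then show ?thesis using row0[of c] \<open>c = 0\<close> by simp
    next
      case False
      have "(\<Sum>l<Suc m. M r l * adjf (Suc m) M l 0) = (if r = 0 then dt (Suc m) M else 0)"
        by (rule adjf_right) (use r in auto)
      moreover have "(\<Sum>l<Suc m. M r l * adjf (Suc m) M l 0)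
          = (\<Sum>l<Suc m. (if l = 0 then y r * adjf (Suc m) M 0 0 else 0) + (if l = r then adjf (Suc m) M r 0 else 0))"
        by (intro sum.cong refl) (use False r in \<open>auto simp: M\<close>)
      moreover have "\<dots> = y r * adjf (Suc m) M 0 0 + adjf (Suc m) M r 0"
        using r by (simp add: sum.distrib del: sum.lessThan_Suc)
      ultimately have "y r * adjf (Suc m) M 0 0 + adjf (Suc m) M r 0 = 0" using False by simp
      then show ?thesis using row0[of 0] False \<open>c = 0\<close> by (simp add: eq_neg_iff_add_eq_0 add.commute)
    qed
  qed
qed

lemma eval_monom_unit:
  assumes "a \<in> Mon m d" "l \<le> m"
  shows "eval_monom a (\<lambda>j. if j = l then 1 else (0::'a::comm_ring_1)) = (if a = Poly_Mapping.single l d then 1 else 0)"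
proof (cases "Poly_Mapping.keys a \<subseteq> {l}")
  case True
  have "total_deg a = Poly_Mapping.lookup a l" using total_deg_superset[of "{l}" a] True by simp
  then have "a = Poly_Mapping.single l d"
    using True assms(1) by (intro poly_mapping_eqI) (auto simp: lookup_single when_def Mon_def in_keys_iff)
  then show ?thesis by (simp add: eval_monom_single)
next
  case False
  then obtain i where i: "i \<in> Poly_Mapping.keys a" "i \<noteq> l" by blast
  have "eval_monom a (\<lambda>j. if j = l then 1 else (0::'a)) = 0"
    unfolding eval_monom_def
    by (rule prod_zero) (use i in \<open>auto intro!: bexI[of _ i] simp: in_keys_iff zero_power\<close>)
  moreover have "a \<noteq> Poly_Mapping.single l d" using False by (auto split: if_splits)
  ultimately show ?thesis by simp
qed

lemma single_Mon: "l \<le> m \<Longrightarrow> Poly_Mapping.single l d \<in> Mon m d"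
  by (simp add: Mon_def total_deg_single)

lemma fm_unit:
  assumes "l \<le> m" shows "fm m d b (\<lambda>j. if j = l then 1 else (0::'a::comm_ring_1)) = b (Poly_Mapping.single l d)"
proof -
  have "fm m d b (\<lambda>j. if j = l then 1 else 0) = (\<Sum>a\<in>Mon m d. if a = Poly_Mapping.single l d then b a else 0)"
    unfolding fm_def by (intro sum.cong refl) (simp add: eval_monom_unit[OF _ assms])
  then show ?thesis using single_Mon[OF assms] by simp
qed

definition b01 :: "nat \<Rightarrow> nat \<Rightarrow>\<^sub>0 nat" where
  "b01 d = Poly_Mapping.single 0 (d - 1) + Poly_Mapping.single 1 1"

lemma b01_Mon: "m > 0 \<Longrightarrow> d > 0 \<Longrightarrow> b01 d \<in> Mon m d"
  by (auto simp: b01_def Mon_def keys_add_nat total_deg_add total_deg_single split: if_splits)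

lemma lookup_b01: "Poly_Mapping.lookup (b01 d) i = (if i = 0 then d - 1 else if i = 1 then 1 else 0)"
  by (simp add: b01_def lookup_add lookup_single when_def)

lemma eval_monom_two:
  assumes "a \<in> Mon m d"
  shows "eval_monom a (\<lambda>j. if j = 0 then p else if j = 1 then q else (0::'a::comm_ring_1))
    = (if Poly_Mapping.keys a \<subseteq> {0, 1} then p ^ Poly_Mapping.lookup a 0 * q ^ Poly_Mapping.lookup a 1 else 0)"
proof (cases "Poly_Mapping.keys a \<subseteq> {0, 1}")
  case True
  then show ?thesis by (subst eval_monom_superset[of "{0, 1}"]) auto
next
  case False
  then obtain i where i: "i \<in> Poly_Mapping.keys a" "i \<noteq> 0" "i \<noteq> 1" by blast
  then have "eval_monom a (\<lambda>j. if j = 0 then p else if j = 1 then q else (0::'a)) = 0"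
    unfolding eval_monom_def by (intro prod_zero) (auto intro!: bexI[of _ i] simp: in_keys_iff zero_power)
  then show ?thesis using False by simp
qed

lemma coeff_linear_power:
  "coeff ([:1, c:] ^ e) 0 = 1" "coeff ([:1, c:] ^ e) 1 = of_nat e * (c :: 'a::comm_ring_1)"
  by (induction e) (auto simp: coeff_pCons split: nat.splits, simp add: algebra_simps)

text \<open>Only the monomials \<open>y0 ^ d\<close> and \<open>y0 ^ (d - 1) * y1\<close> contribute
  to the linear term in \<open>t\<close> on a line through the first unit vector. Applied on both
  sides of a change of chart, this reads off the coefficient at \<open>b01 d\<close>.\<close>

lemma form_line_coeff:
  fixes a :: "(nat \<Rightarrow>\<^sub>0 nat) \<Rightarrow> 'a::comm_ring_1"
  assumes "m > 0" "d > 0"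
  shows "\<exists>R. (\<forall>t. poly R t = fm m d a (\<lambda>j. if j = 0 then 1 - t * y1 else if j = 1 then t * y0 else 0)) \<and>
    coeff R 1 = y0 * a (b01 d) - of_nat d * y1 * a (Poly_Mapping.single 0 d)"
proof -
  define U where "U \<alpha> = (if Poly_Mapping.keys \<alpha> \<subseteq> {0, 1} then Polynomial.smult (a \<alpha>)
      (monom (y0 ^ Poly_Mapping.lookup \<alpha> 1) (Poly_Mapping.lookup \<alpha> 1) * [:1, - y1:] ^ Poly_Mapping.lookup \<alpha> 0) else 0)"
    for \<alpha> :: "nat \<Rightarrow>\<^sub>0 nat"
  define R where "R = (\<Sum>\<alpha>\<in>Mon m d. U \<alpha>)"
  have 1: "poly R t = fm m d a (\<lambda>j. if j = 0 then 1 - t * y1 else if j = 1 then t * y0 else 0)" for t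
  proof -
    have "poly (U \<alpha>) t = a \<alpha> * eval_monom \<alpha> (\<lambda>j. if j = 0 then 1 - t * y1 else if j = 1 then t * y0 else 0)"
      if "\<alpha> \<in> Mon m d" for \<alpha>
      unfolding eval_monom_two[OF that] U_def
      by (simp add: poly_monom power_mult_distrib mult_ac)
    then show ?thesis unfolding R_def poly_sum fm_def by (intro sum.cong) auto
  qed
  let ?s = "Poly_Mapping.single 0 d :: nat \<Rightarrow>\<^sub>0 nat"
  have ne: "?s \<noteq> b01 d"
  proof
    assume "?s = b01 d"
    then have "Poly_Mapping.lookup ?s 1 = Poly_Mapping.lookup (b01 d) 1" by simp
    then show False by (simp add: lookup_b01 lookup_single)
  qed
  have "coeff (U \<alpha>) 1 = 0" if a: "\<alpha> \<in> Mon m d" and n: "\<alpha> \<noteq> ?s" "\<alpha> \<noteq> b01 d" for \<alpha>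
  proof (cases "Poly_Mapping.keys \<alpha> \<subseteq> {0, 1}")
    case True
    have td: "Poly_Mapping.lookup \<alpha> 0 + Poly_Mapping.lookup \<alpha> 1 = d"
      using total_deg_superset[of "{0, 1}" \<alpha>] True a by (simp add: Mon_def)
    have out: "Poly_Mapping.lookup \<alpha> i = 0" if "i \<noteq> 0" "i \<noteq> 1" for i
      using True that by (metis in_keys_iff insertE singletonD subsetD)
    have "Poly_Mapping.lookup \<alpha> 1 \<noteq> 0"
    proof
      assume "Poly_Mapping.lookup \<alpha> 1 = 0"
      then have "Poly_Mapping.lookup \<alpha> i = Poly_Mapping.lookup ?s i" for i
        using td out[of i] by (cases "i = 0"; cases "i = 1") (auto simp: lookup_single)
      then have "\<alpha> = ?s" by (rule poly_mapping_eqI)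
      then show False using n by simp
    qed
    moreover have "Poly_Mapping.lookup \<alpha> 1 \<noteq> 1"
    proof
      assume "Poly_Mapping.lookup \<alpha> 1 = 1"
      then have "\<alpha> = b01 d" using td out by (intro poly_mapping_eqI) (auto simp: lookup_b01)
      then show False using n by simp
    qed
    ultimately show ?thesis by (simp add: U_def coeff_monom_mult)
  qed (simp add: U_def)
  then have "(\<Sum>\<alpha>\<in>Mon m d. coeff (U \<alpha>) 1) = (\<Sum>\<alpha>\<in>{?s, b01 d}. coeff (U \<alpha>) 1)"
    using single_Mon[of 0 m d] b01_Mon[OF assms] by (intro sum.mono_neutral_right) auto
  also have "\<dots> = coeff (U ?s) 1 + coeff (U (b01 d)) 1" using ne by simp
  also have "coeff (U ?s) 1 = - of_nat d * y1 * a ?s"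
    using coeff_linear_power(2)[of "- y1" d] by (simp add: U_def lookup_single coeff_monom_mult mult_ac)
  also have "coeff (U (b01 d)) 1 = y0 * a (b01 d)"
  proof -
    have "Poly_Mapping.keys (b01 d) \<subseteq> {0, 1}" by (auto simp: in_keys_iff lookup_b01 split: if_splits)
    then show ?thesis using coeff_linear_power(1)[of "- y1" "d - 1"]
      by (simp add: U_def lookup_b01 coeff_monom_mult mult_ac)
  qed
  finally have "coeff R 1 = y0 * a (b01 d) - of_nat d * y1 * a ?s" by (simp add: R_def coeff_sum)
  with 1 show ?thesis by blast
qed

text \<open>A general point of the standard chart: the columns up to \<open>m\<close> are the
  identity, and column \<open>Suc m + j\<close> is the free vector \<open>x j\<close>.\<close>

definition cnf :: "nat \<Rightarrow> (nat \<Rightarrow> nat \<Rightarrow> 'a) \<Rightarrow> ((nat \<Rightarrow>\<^sub>0 nat) \<Rightarrow> 'a) \<Rightarrow> 'a::comm_ring_1 conf" where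
  "cnf m x a = (\<lambda>i j. if j \<le> m then (if i = j then 1 else 0) else x (j - Suc m) i, a)"

definition sid :: "nat \<Rightarrow> nat \<Rightarrow> nat" where
  "sid m = restrict (\<lambda>i. i) {..<Suc m}"

definition tau :: "nat \<Rightarrow> nat \<Rightarrow> nat \<Rightarrow> nat" where
  "tau m j = (sid m)(0 := Suc m + j)"

lemma sid_Sg: "sid m \<in> Sg (m + k) m"
  unfolding Sg_def sid_def by auto

lemma tau_Sg: "j < k \<Longrightarrow> tau m j \<in> Sg (m + k) m"
  unfolding tau_def by (rule Sg_upd[OF sid_Sg]) auto

lemma pf_sid: "pf m (sid m) (cnf m x a) = 1"
proof -
  have "pf m (sid m) (cnf m x a) = dt (Suc m) (\<lambda>i j. if i = j then 1 else 0)"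
    unfolding pf_def us_def by (rule dt_cong) (simp add: cnf_def sid_def)
  then show ?thesis by (simp add: dt_one)
qed

lemma cf_sid:
  fixes a :: "(nat \<Rightarrow>\<^sub>0 nat) \<Rightarrow> 'a::alg_closed_field"
  assumes "b \<in> Mon m d" shows "cf m d (sid m) b (cnf m x a) = a b"
proof (rule fm_unique[of m d "\<lambda>b. cf m d (sid m) b (cnf m x a)" a, OF _ assms])
  fix y
  let ?w = "cnf m x a"
  have "fm m d (\<lambda>b. cf m d (sid m) b ?w) y = fm m d (\<lambda>b. cf m d (sid m) b ?w) (\<lambda>j. \<Sum>i\<le>m. y i * fst ?w i (sid m j))"
    by (rule fm_cong) (simp add: cnf_def sid_def if_distrib[of "\<lambda>x. _ * x"] cong: if_cong)
  also have "\<dots> = fm m d a y" unfolding fm_cf_us pf_sid by (simp add: cnf_def)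
  finally show "fm m d (\<lambda>b. cf m d (sid m) b ?w) y = fm m d a y" .
qed

lemma fm_cf_tau:
  fixes a :: "(nat \<Rightarrow>\<^sub>0 nat) \<Rightarrow> 'a::alg_closed_field"
  shows "fm m d (\<lambda>b. cf m d (tau m j) b (cnf m x a)) y
    = fm m d a (\<lambda>l. if l = 0 then y 0 - (\<Sum>i\<in>{1..m}. y i * x j i) else y l * x j 0)"
proof -
  have "snd (cnf m x a) = a" by (simp add: cnf_def)
  moreover have "fm m d a (\<lambda>l. \<Sum>i\<le>m. y i * adjf (Suc m) (us (tau m j) (cnf m x a)) i l)
      = fm m d a (\<lambda>l. if l = 0 then y 0 - (\<Sum>i\<in>{1..m}. y i * x j i) else y l * x j 0)"
proof (rule fm_cong)
  fix l assume l: "l \<le> m"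
  have ad: "adjf (Suc m) (us (tau m j) (cnf m x a)) r c
      = (if c = 0 then (if r = 0 then 1 else - x j r) else if r = c then x j 0 else 0)" if "r \<le> m" "c \<le> m" for r c
    by (rule adjf_elementary) (use that in \<open>auto simp: us_def tau_def sid_def cnf_def\<close>)
  have ins: "{..m} = insert 0 {1..m}" by auto
  show "(\<Sum>i\<le>m. y i * adjf (Suc m) (us (tau m j) (cnf m x a)) i l)
      = (if l = 0 then y 0 - (\<Sum>i\<in>{1..m}. y i * x j i) else y l * x j 0)"
  proof (cases "l = 0")
    case True
    have "(\<Sum>i\<in>{1..m}. y i * adjf (Suc m) (us (tau m j) (cnf m x a)) i l) = (\<Sum>i\<in>{1..m}. - (y i * x j i))"
      by (intro sum.cong refl) (simp add: ad True)
    then show ?thesis unfolding ins by (simp add: True ad sum_negf)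
  next
    case False
    have "(\<Sum>i\<le>m. y i * adjf (Suc m) (us (tau m j) (cnf m x a)) i l) = (\<Sum>i\<le>m. if i = l then y l * x j 0 else 0)"
      by (intro sum.cong refl) (use False l in \<open>simp add: ad\<close>)
    then show ?thesis using False l by simp
  qed
qed
  ultimately show ?thesis unfolding fm_cf by simp
qed

text \<open>The coefficient of a pure power is a value at a unit vector. In the new chart it
  involves only the entries \<open>x j 0\<close> and \<open>x j i\<close> of the column, which makes
  the equations for this column triangular.\<close>

lemma cf_tau_single:
  fixes a :: "(nat \<Rightarrow>\<^sub>0 nat) \<Rightarrow> 'a::alg_closed_field"
  assumes "1 \<le> i" "i \<le> m"
  shows "cf m d (tau m j) (Poly_Mapping.single i d) (cnf m x a)
    = fm m d a (\<lambda>l. if l = 0 then - x j i else if l = i then x j 0 else 0)"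
proof -
  have "cf m d (tau m j) (Poly_Mapping.single i d) (cnf m x a)
      = fm m d (\<lambda>b. cf m d (tau m j) b (cnf m x a)) (\<lambda>l. if l = i then 1 else 0)"
    by (rule fm_unit[symmetric]) (rule assms(2))
  also have "\<dots> = fm m d a (\<lambda>l. if l = 0 then - x j i else if l = i then x j 0 else 0)"
    unfolding fm_cf_tau
    by (rule fm_cong) (use assms in \<open>auto simp: if_distrib[of "\<lambda>x. x * _"] cong: if_cong\<close>)
  finally show ?thesis .
qed

lemma cf_tau_b01:
  fixes a :: "(nat \<Rightarrow>\<^sub>0 nat) \<Rightarrow> 'a::alg_closed_field"
  assumes "m > 0" "d > 0"
  shows "cf m d (tau m j) (b01 d) (cnf m x a) = x j 0 * a (b01 d) - of_nat d * x j 1 * a (Poly_Mapping.single 0 d)"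
proof -
  let ?b = "\<lambda>b. cf m d (tau m j) b (cnf m x a)"
  obtain R where R: "\<forall>t. poly R t = fm m d a (\<lambda>l. if l = 0 then 1 - t * x j 1 else if l = 1 then t * x j 0 else 0)"
    "coeff R 1 = x j 0 * a (b01 d) - of_nat d * x j 1 * a (Poly_Mapping.single 0 d)"
    using form_line_coeff[OF assms] by blast
  obtain R' where R': "\<forall>t. poly R' t = fm m d ?b (\<lambda>l. if l = 0 then 1 - t * 0 else if l = 1 then t * 1 else 0)"
    "coeff R' 1 = 1 * ?b (b01 d) - of_nat d * 0 * ?b (Poly_Mapping.single 0 d)"
    using form_line_coeff[OF assms] by blast
  have "poly (R - R') t = 0" for t
  proof -
    have "poly R' t = fm m d ?b (\<lambda>l. if l = 0 then 1 else if l = 1 then t else 0)"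
      using R'(1) by (simp cong: if_cong)
    also have "\<dots> = fm m d a (\<lambda>l. if l = 0 then 1 - t * x j 1 else if l = 1 then t * x j 0 else 0)"
      unfolding fm_cf_tau
    proof (rule fm_cong)
      fix l
      have "(\<Sum>i = 1..m. (if i = 0 then 1 else if i = 1 then t else 0) * x j i) = (\<Sum>i = 1..m. if i = 1 then t * x j 1 else 0)"
        by (intro sum.cong refl) auto
      also have "\<dots> = t * x j 1" using assms by simp
      finally show "(if l = 0 then (if (0::nat) = 0 then 1 else if (0::nat) = 1 then t else 0) -
          (\<Sum>i = 1..m. (if i = 0 then 1 else if i = 1 then t else 0) * x j i)
          else (if l = 0 then 1 else if l = 1 then t else 0) * x j 0) =
          (if l = 0 then 1 - t * x j 1 else if l = 1 then t * x j 0 else 0)" by simp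
    qed
    finally show ?thesis using R(1) by simp
  qed
  then have "R - R' = 0" using poly_nonroot[of "R - R'"] by metis
  then have "coeff R 1 = coeff R' 1" by simp
  then show ?thesis using R(2) R'(2) by simp
qed

text \<open>The algebraically independent sections: all coefficients of the form, and for each column \<open>j\<close>
  outside the chart some coefficients in the chart where column \<open>0\<close> is exchanged for it.\<close>

definition Js :: "nat \<Rightarrow> nat \<Rightarrow> nat set" where
  "Js m d = (if d = 1 then {1..m} else {0..m})"

definition Ix :: "nat \<Rightarrow> nat \<Rightarrow> nat \<Rightarrow> ((nat \<Rightarrow>\<^sub>0 nat) + nat \<times> nat) set" where
  "Ix m k d = Inl ` Mon m d \<union> Inr ` ({..<k} \<times> Js m d)"

text \<open>The index \<open>i = 0\<close> stands for the mixed monomial \<open>b01 d\<close>. For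
  \<open>d = 1\<close> this monomial is the first power of variable \<open>1\<close>, which
  \<open>i = 1\<close> already provides; hence \<open>Js\<close> then starts at \<open>1\<close>,
  and each column contributes one section less.\<close>

definition zf :: "nat \<Rightarrow> nat \<Rightarrow> (nat \<Rightarrow>\<^sub>0 nat) + nat \<times> nat \<Rightarrow> 'a conf \<Rightarrow> 'a::comm_ring_1" where
  "zf m d v = (case v of Inl b \<Rightarrow> cf m d (sid m) b
     | Inr (j, i) \<Rightarrow> cf m d (tau m j) (if i = 0 then b01 d else Poly_Mapping.single i d))"

lemma finite_Ix: "finite (Ix m k d)"
  by (simp add: Ix_def Js_def)

lemma card_Ix: "card (Ix m k d) = card (Mon m d) + k * (if d = 1 then m else Suc m)"
proof -
  have "card (Ix m k d) = card (Inl ` Mon m d :: ((nat \<Rightarrow>\<^sub>0 nat) + nat \<times> nat) set) + card (Inr ` ({..<k} \<times> Js m d) :: ((nat \<Rightarrow>\<^sub>0 nat) + nat \<times> nat) set)"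
    unfolding Ix_def by (rule card_Un_disjoint) (auto simp: Js_def)
  then show ?thesis by (simp add: card_image card_cartesian_product Js_def)
qed

section \<open>Algebraic independence of the sections\<close>

lemma solve_coordinate:
  fixes a :: "(nat \<Rightarrow>\<^sub>0 nat) \<Rightarrow> 'a::alg_closed_field"
  assumes d: "d > 0" and a: "a (Poly_Mapping.single 0 d) \<noteq> 0" and i: "1 \<le> i"
  shows "\<exists>s. fm m d a (\<lambda>l. if l = 0 then - s else if l = i then y0 else 0) = t"
proof -
  have "fm m d a (\<lambda>l. if l = 0 then -1 else 0) = fm m d a (\<lambda>l. (-1) * (if l = 0 then 1 else 0))"
    by (intro fm_cong) auto
  also have "\<dots> = (-1) ^ d * a (Poly_Mapping.single 0 d)" unfolding fm_scale by (simp add: fm_unit)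
  finally have "eval_mpoly (fmP m d a) (\<lambda>l. if l = 0 then -1 else 0) \<noteq> 0" using a by (simp add: eval_fmP)
  from homogeneous_line_surj[OF homogeneous_fmP d this, of "\<lambda>l. if l = i then y0 else 0" t]
  obtain s where s: "fm m d a (\<lambda>l. (if l = i then y0 else 0) + s * (if l = 0 then -1 else 0)) = t"
    by (auto simp: eval_fmP)
  have "(\<lambda>l. (if l = i then y0 else 0) + s * (if l = 0 then -1 else 0)) = (\<lambda>l. if l = 0 then - s else if l = i then y0 else 0)"
    using i by auto
  then show ?thesis using s by auto
qed

text \<open>For fixed coefficients \<open>a\<close> the equations for one column are solved
  successively. If \<open>d = 1\<close>, set \<open>y 0 = 1\<close> and solve for each
  \<open>y i\<close>. Otherwise the equations for \<open>i = 0\<close> and \<open>i = 1\<close>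
  involve only \<open>y 0\<close> and \<open>y 1\<close>: the first is linear and describes a line,
  on which the second takes every value by \<open>homogeneous_line_surj\<close>. Assumption
  \<open>T\<close> says that the form does not vanish in the direction of this line. Each further
  \<open>y i\<close> has an equation of its own.\<close>

lemma zf_surj_col:
  fixes t :: "(nat \<Rightarrow>\<^sub>0 nat) + nat \<times> nat \<Rightarrow> 'a::alg_closed_field"
  assumes m: "m > 0" and d: "d > 0" and a0: "a (Poly_Mapping.single 0 d) \<noteq> 0"
    and a1: "d \<noteq> 1 \<Longrightarrow> a (b01 d) \<noteq> 0"
    and T: "d \<noteq> 1 \<Longrightarrow> fm m d a (\<lambda>l. if l = 0 then - a (b01 d) else if l = 1 then of_nat d * a (Poly_Mapping.single 0 d) else 0) \<noteq> 0"
  shows "\<exists>y. \<forall>i\<in>Js m d. (if i = 0 then y 0 * a (b01 d) - of_nat d * y 1 * a (Poly_Mapping.single 0 d)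
     else fm m d a (\<lambda>l. if l = 0 then - y i else if l = i then y 0 else 0)) = t (Inr (j, i))"
proof (cases "d = 1")
  case True
  have "\<forall>i. \<exists>s. 1 \<le> i \<longrightarrow> fm m d a (\<lambda>l. if l = 0 then - s else if l = i then 1 else 0) = t (Inr (j, i))"
    using solve_coordinate[where a = a and d = d, OF d a0] by blast
  then obtain y where y: "\<And>i. 1 \<le> i \<Longrightarrow> fm m d a (\<lambda>l. if l = 0 then - y i else if l = i then 1 else 0) = t (Inr (j, i))" by metis
  show ?thesis
  proof (intro exI[of _ "y(0 := 1)"] ballI)
    fix i assume "i \<in> Js m d"
    then have "1 \<le> i" using True by (simp add: Js_def)
    then show "(if i = 0 then (y(0 := 1)) 0 * a (b01 d) - of_nat d * (y(0 := 1)) 1 * a (Poly_Mapping.single 0 d)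
     else fm m d a (\<lambda>l. if l = 0 then - (y(0 := 1)) i else if l = i then (y(0 := 1)) 0 else 0)) = t (Inr (j, i))"
      using y by (simp cong: if_cong)
  qed
next
  case False
  define A0 A1 where "A0 = a (Poly_Mapping.single 0 d)" and "A1 = a (b01 d)"
  have A1: "A1 \<noteq> 0" using a1 False by (simp add: A1_def)
  \<comment> \<open>The direction of the line of solutions of the linear equation, expressed in the
    arguments \<open>(- y 1, y 0)\<close> of the form.\<close>
  define q where "q = (\<lambda>l. if l = 0 then -1 else if l = (1::nat) then of_nat d * A0 / A1 else 0)"
  have "fm m d a (\<lambda>l. A1 * q l) \<noteq> 0"
  proof -
    have "(\<lambda>l. A1 * q l) = (\<lambda>l. if l = 0 then - A1 else if l = 1 then of_nat d * A0 else 0)"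
      using A1 by (auto simp: q_def)
    then show ?thesis using T False unfolding A0_def A1_def by simp
  qed
  then have "eval_mpoly (fmP m d a) q \<noteq> 0" unfolding fm_scale by (simp add: eval_fmP)
  from homogeneous_line_surj[OF homogeneous_fmP d this, of "\<lambda>l. if l = 1 then t (Inr (j, 0)) / A1 else 0" "t (Inr (j, 1))"]
  obtain s where s: "fm m d a (\<lambda>l. (if l = 1 then t (Inr (j, 0)) / A1 else 0) + s * q l) = t (Inr (j, 1))"
    by (auto simp: eval_fmP)
  define y0 where "y0 = t (Inr (j, 0)) / A1 + s * (of_nat d * A0 / A1)"
  have "(\<lambda>l. (if l = 1 then t (Inr (j, 0)) / A1 else 0) + s * q l) = (\<lambda>l. if l = 0 then - s else if l = 1 then y0 else 0)"
    by (auto simp: q_def y0_def)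
  then have s1: "fm m d a (\<lambda>l. if l = 0 then - s else if l = 1 then y0 else 0) = t (Inr (j, 1))" using s by simp
  have s0: "y0 * A1 - of_nat d * s * A0 = t (Inr (j, 0))" using A1 by (simp add: y0_def field_simps)
  have "\<forall>i. \<exists>s. 1 \<le> i \<longrightarrow> fm m d a (\<lambda>l. if l = 0 then - s else if l = i then y0 else 0) = t (Inr (j, i))"
    using solve_coordinate[where a = a and d = d, OF d a0] by blast
  then obtain y where y: "\<And>i. 1 \<le> i \<Longrightarrow> fm m d a (\<lambda>l. if l = 0 then - y i else if l = i then y0 else 0) = t (Inr (j, i))" by metis
  show ?thesis
  proof (intro exI[of _ "y(0 := y0, 1 := s)"] ballI)
    fix i assume "i \<in> Js m d"
    consider "i = 0" | "i = 1" | "i > 1" by linarith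
    then show "(if i = 0 then (y(0 := y0, 1 := s)) 0 * a (b01 d) - of_nat d * (y(0 := y0, 1 := s)) 1 * a (Poly_Mapping.single 0 d)
     else fm m d a (\<lambda>l. if l = 0 then - (y(0 := y0, 1 := s)) i else if l = i then (y(0 := y0, 1 := s)) 0 else 0)) = t (Inr (j, i))"
      by cases (use s0 s1 y[of i] in \<open>simp_all add: A0_def A1_def cong: if_cong\<close>)
  qed
qed

text \<open>A witness that assumption \<open>T\<close> of \<open>zf_surj_col\<close> can be met: the
  form \<open>y0 ^ d + y0 ^ (d - 1) * y1 + c * y1 ^ d\<close> at the vector \<open>(-1, d)\<close>.
  The parameter \<open>c\<close> is there for characteristics in which \<open>d\<close> equals
  \<open>1\<close>.\<close>

lemma special_form_value:
  fixes c :: "'a::comm_ring_1"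
  assumes "m > 0" "d > 1"
  defines "\<beta> \<equiv> Poly_Mapping.single (1::nat) d"
  defines "a \<equiv> (\<lambda>b. if b = Poly_Mapping.single 0 d then 1 else if b = b01 d then 1 else if b = \<beta> then c else 0)"
  shows "fm m d a (\<lambda>l. if l = 0 then - 1 else if l = 1 then of_nat d else 0)
    = (-1) ^ d * (1 - of_nat d) + c * of_nat d ^ d" (is "_ = ?rhs") and "Poly_Mapping.single 0 d \<noteq> b01 d"
proof -
  let ?s = "Poly_Mapping.single 0 d :: nat \<Rightarrow>\<^sub>0 nat"
  have l: "Poly_Mapping.lookup ?s 1 = 0" "Poly_Mapping.lookup (b01 d) 1 = 1" "Poly_Mapping.lookup \<beta> 1 = d"
    "Poly_Mapping.lookup ?s 0 = d" "Poly_Mapping.lookup (b01 d) 0 = d - 1" "Poly_Mapping.lookup \<beta> 0 = 0"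
    by (simp_all add: lookup_b01 lookup_single \<beta>_def)
  have ne: "?s \<noteq> b01 d" "?s \<noteq> \<beta>" "b01 d \<noteq> \<beta>" using l assms(2) by (metis zero_neq_one less_irrefl not_one_less_zero)+
  then show "Poly_Mapping.single 0 d \<noteq> b01 d" by blast
  have inM: "?s \<in> Mon m d" "b01 d \<in> Mon m d" "\<beta> \<in> Mon m d"
    using assms(1,2) by (auto simp: \<beta>_def intro!: single_Mon b01_Mon)
  have k: "Poly_Mapping.keys ?s \<subseteq> {0, 1}" "Poly_Mapping.keys (b01 d) \<subseteq> {0, 1}" "Poly_Mapping.keys \<beta> \<subseteq> {0, 1}"
    by (auto simp: in_keys_iff lookup_b01 lookup_single \<beta>_def when_def split: if_splits)
  have "fm m d a (\<lambda>l. if l = 0 then - 1 else if l = 1 then of_nat d else 0)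
      = (\<Sum>b\<in>{?s, b01 d, \<beta>}. a b * eval_monom b (\<lambda>l. if l = 0 then - 1 else if l = 1 then of_nat d else 0))"
    unfolding fm_def by (rule sum.mono_neutral_right) (use inM in \<open>auto simp: a_def\<close>)
  also have "\<dots> = (-1) ^ d + ((-1) ^ (d - 1) * of_nat d + c * of_nat d ^ d)"
  proof -
    let ?e = "\<lambda>b. eval_monom b (\<lambda>l. if l = 0 then - 1 else if l = 1 then of_nat d else (0::'a))"
    have "?e ?s = (-1) ^ d" "?e (b01 d) = (-1) ^ (d - 1) * of_nat d" "?e \<beta> = of_nat d ^ d"
      by (simp_all only: eval_monom_two[OF inM(1)] eval_monom_two[OF inM(2)] eval_monom_two[OF inM(3)] k l
        if_True power_0 power_one_right mult_1_left mult_1_right)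
    then show ?thesis using ne by (simp add: a_def)
  qed
  also have "(-1) ^ d = (-1) * (-1 :: 'a) ^ (d - 1)" using assms(2) by (simp flip: power_Suc)
  finally show "fm m d a (\<lambda>l. if l = 0 then - 1 else if l = 1 then of_nat d else 0) = ?rhs"
    using power_Suc[of "-1 :: 'a" "d - 1"] assms(2) by (simp add: algebra_simps)
qed

text \<open>The values at \<open>Inl\<close> prescribe the form, and then every column is solved for
  separately. \<open>Q\<close> collects the conditions on the form. Taking almost all values is what
  yields algebraic independence.\<close>

lemma zf_dominant:
  assumes m: "m > 0" and d: "d > 0"
  shows "\<exists>Q :: ((nat \<Rightarrow>\<^sub>0 nat) + nat \<times> nat, 'a::alg_closed_field) mpoly. Q \<noteq> 0 \<and>
    (\<forall>t. eval_mpoly Q t \<noteq> 0 \<longrightarrow> (\<exists>w. pf m (sid m) w \<noteq> 0 \<and> (\<forall>v\<in>Ix m k d. zf m d v w = t v)))"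
proof -
  let ?s = "Poly_Mapping.single 0 d :: nat \<Rightarrow>\<^sub>0 nat"
  let ?F = "\<lambda>t :: (nat \<Rightarrow>\<^sub>0 nat) + nat \<times> nat \<Rightarrow> 'a. fm m d (\<lambda>b. t (Inl b)) (\<lambda>l. if l = 0 then - t (Inl (b01 d)) else if l = 1 then of_nat d * t (Inl ?s) else 0)"
  have "\<exists>Q :: ((nat \<Rightarrow>\<^sub>0 nat) + nat \<times> nat, 'a) mpoly. Q \<noteq> 0 \<and> (\<forall>t. eval_mpoly Q t \<noteq> 0 \<longrightarrow>
      t (Inl ?s) \<noteq> 0 \<and> (d \<noteq> 1 \<longrightarrow> t (Inl (b01 d)) \<noteq> 0 \<and> ?F t \<noteq> 0))"
  proof (cases "d = 1")
    case True
    have "MX (Inl ?s) \<noteq> (0 :: ((nat \<Rightarrow>\<^sub>0 nat) + nat \<times> nat, 'a) mpoly)"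
    proof
      assume "MX (Inl ?s) = (0 :: ((nat \<Rightarrow>\<^sub>0 nat) + nat \<times> nat, 'a) mpoly)"
      then have "eval_mpoly (MX (Inl ?s) :: ((nat \<Rightarrow>\<^sub>0 nat) + nat \<times> nat, 'a) mpoly) (\<lambda>_. 1) = 0" by simp
      then show False by simp
    qed
    then show ?thesis using True by (intro exI[of _ "MX (Inl ?s)"]) simp
  next
    case False
    have pv: "pfun UNIV (\<lambda>t. t v :: 'a)" for v :: "(nat \<Rightarrow>\<^sub>0 nat) + nat \<times> nat" by (rule pfun_var) simp
    have pl: "pfun UNIV (\<lambda>t :: (nat \<Rightarrow>\<^sub>0 nat) + nat \<times> nat \<Rightarrow> 'a. if l = (0::nat) then - t (Inl (b01 d)) else if l = 1 then of_nat d * t (Inl ?s) else (0::'a))" for l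
    proof -
      consider "l = 0" | "l = 1" | "l > 1" by linarith
      then show ?thesis
        by cases (simp_all only: if_True if_False zero_neq_one one_neq_zero not_one_less_zero less_irrefl
          gr_implies_not_zero less_numeral_extra neq_iff simp_thms,
          auto intro!: pfun_uminus pfun_mult pfun_const pv)
    qed
    have "pfun UNIV ?F"
      unfolding fm_def eval_monom_def by (intro pfun_sum pfun_mult pfun_prod pfun_power pl pv)
    then have "pfun UNIV (\<lambda>t. t (Inl ?s) * t (Inl (b01 d)) * ?F t)" by (intro pfun_mult pv)
    then obtain Q where Q: "\<And>t. eval_mpoly Q t = t (Inl ?s) * t (Inl (b01 d)) * ?F t" by (rule pfunE) blast
    \<comment> \<open>If \<open>d\<close> is \<open>1\<close> in the field, the first summand of the
      special value vanishes and the second is \<open>1\<close>. Otherwise the second vanishes and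
      the first is nonzero.\<close>
    define c :: 'a where "c = (if of_nat d = (1::'a) then 1 else 0)"
    define t where "t v = (case v of Inl b \<Rightarrow> if b = ?s then 1 else if b = b01 d then 1 else if b = Poly_Mapping.single (1::nat) d then c else 0 | Inr _ \<Rightarrow> (0::'a))"
      for v :: "(nat \<Rightarrow>\<^sub>0 nat) + nat \<times> nat"
    have d1: "d > 1" using d False by simp
    have t1: "t (Inl ?s) = 1" "t (Inl (b01 d)) = 1" by (simp_all add: t_def)
    have "?F t = fm m d (\<lambda>b. t (Inl b)) (\<lambda>l. if l = 0 then - 1 else if l = 1 then of_nat d else 0)"
      unfolding t1 mult_1_right ..
    also have "\<dots> = (-1) ^ d * (1 - of_nat d) + c * of_nat d ^ d"
      unfolding t_def sum.case by (rule special_form_value(1)[OF m d1])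
    also have "\<dots> \<noteq> 0" by (auto simp: c_def)
    finally have "eval_mpoly Q t \<noteq> 0" unfolding Q t1 by simp
    then have "Q \<noteq> 0" by auto
    then show ?thesis using Q by (intro exI[of _ Q]) auto
  qed
  then obtain Q :: "((nat \<Rightarrow>\<^sub>0 nat) + nat \<times> nat, 'a) mpoly" where Q: "Q \<noteq> 0" "\<And>t. eval_mpoly Q t \<noteq> 0 \<Longrightarrow>
      t (Inl ?s) \<noteq> 0 \<and> (d \<noteq> 1 \<longrightarrow> t (Inl (b01 d)) \<noteq> 0 \<and> ?F t \<noteq> 0)" by blast
  have "\<exists>w. pf m (sid m) w \<noteq> 0 \<and> (\<forall>v\<in>Ix m k d. zf m d v w = t v)" if nz: "eval_mpoly Q t \<noteq> 0" for t
  proof -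
    define a where "a = (\<lambda>b. t (Inl b))"
    have "\<forall>j. \<exists>y. \<forall>i\<in>Js m d. (if i = 0 then y 0 * a (b01 d) - of_nat d * y 1 * a ?s
       else fm m d a (\<lambda>l. if l = 0 then - y i else if l = i then y 0 else 0)) = t (Inr (j, i))"
      using Q(2)[OF nz] unfolding a_def by (intro allI zf_surj_col m d) blast+
    then obtain x where x: "\<And>j i. i \<in> Js m d \<Longrightarrow> (if i = 0 then x j 0 * a (b01 d) - of_nat d * x j 1 * a ?s
       else fm m d a (\<lambda>l. if l = 0 then - x j i else if l = i then x j 0 else 0)) = t (Inr (j, i))" by metis
    show ?thesis
    proof (intro exI[of _ "cnf m x a"] conjI ballI)
      show "pf m (sid m) (cnf m x a) \<noteq> 0" by (simp add: pf_sid)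
      fix v assume "v \<in> Ix m k d"
      then consider b where "v = Inl b" "b \<in> Mon m d" | j i where "v = Inr (j, i)" "i \<in> Js m d"
        unfolding Ix_def by blast
      then show "zf m d v (cnf m x a) = t v"
      proof cases
        case 1
        then show ?thesis by (simp add: zf_def cf_sid a_def)
      next
        case 2
        then have "i \<le> m" by (auto simp: Js_def split: if_splits)
        then show ?thesis using x[OF 2(2), of j] 2(1)
          by (cases "i = 0") (simp_all add: zf_def cf_tau_b01[OF m d] cf_tau_single)
      qed
    qed
  qed
  then show ?thesis using Q(1) by blast
qed

text \<open>The supposed absence of a common solution enters only through the assumption
  \<open>NC\<close> of \<open>H2_lf\<close>. Independence is witnessed at a common nonroot of the
  given polynomial and of the \<open>Q\<close> of \<open>zf_dominant\<close>. That \<open>N\<close>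
  is positive follows from the presence of two pure powers among the monomials.\<close>

theorem form_through_subspaces:
  fixes h :: "nat \<Rightarrow> nat \<Rightarrow> nat \<Rightarrow> 'a::alg_closed_field"
  assumes m: "m > 0" and d: "d > 0" and N: "Suc N = card (Mon m d) + k * (if d = 1 then m else Suc m)"
  shows "\<exists>u a s. s \<in> Sg (m + k) m \<and> (\<forall>i\<le>m. \<forall>j\<le>m. u i (s j) = (if i = j then 1 else 0)) \<and>
    (\<exists>\<alpha>\<in>Mon m d. a \<alpha> \<noteq> 0) \<and> (\<forall>i<N. lf (m + k) m d (h i) (u, a) = 0)"
proof (rule ccontr)
  assume nex: "\<not> ?thesis"
  let ?Sg = "Sg (m + k) m"
  define B where "B = (\<Union>s\<in>?Sg. cf m d s ` Mon m d) \<union> (\<lambda>i. lf (m + k) m d (h i)) ` {..<N}"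
  have cB: "cf m d s ` Mon m d \<subseteq> B" if "s \<in> ?Sg" for s unfolding B_def using that by blast
  obtain Q :: "((nat \<Rightarrow>\<^sub>0 nat) + nat \<times> nat, 'a) mpoly" where Q: "Q \<noteq> 0"
    "\<And>t. eval_mpoly Q t \<noteq> 0 \<Longrightarrow> \<exists>w. pf m (sid m) w \<noteq> 0 \<and> (\<forall>v\<in>Ix m k d. zf m d v w = t v)"
    using zf_dominant[OF m d, of k] by blast
  interpret growth "pf m" "cf m d" "\<lambda>i. lf (m + k) m d (h i)" "zf m d" ?Sg "Mon m d" B N d "Ix m k d" "sid m"
  proof
    show "finite ?Sg" "finite (Mon m d)" "finite B" unfolding B_def by auto
    show "finite (Ix m k d)" by (rule finite_Ix)
    show "card (Ix m k d) = Suc N" using card_Ix N by simp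
    show "sid m \<in> ?Sg" by (rule sid_Sg)
    show "N > 0"
    proof -
      have "Poly_Mapping.single 0 d \<noteq> (Poly_Mapping.single 1 d :: nat \<Rightarrow>\<^sub>0 nat)"
        using d by (metis lookup_single_eq lookup_single_not_eq less_numeral_extra(3) zero_neq_one)
      then have "2 \<le> card {Poly_Mapping.single 0 d, Poly_Mapping.single 1 d :: nat \<Rightarrow>\<^sub>0 nat}" by simp
      also have "\<dots> \<le> card (Mon m d)" by (rule card_mono) (use m in \<open>auto intro!: single_Mon\<close>)
      finally show ?thesis using N by simp
    qed
    show "cf m d s \<alpha> \<in> B" if "s \<in> ?Sg" "\<alpha> \<in> Mon m d" for s \<alpha> using cB that by blast
    show "lf (m + k) m d (h i) \<in> B" if "i < N" for i using that unfolding B_def by blast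
    show "pf m s ^ d * g \<in> PC (pf m ` ?Sg) (cf m d s ` Mon m d) d 1" if s: "s \<in> ?Sg" and g: "g \<in> B" for s g
      using g unfolding B_def
    proof (elim UnE UN_E imageE)
      fix t b assume "t \<in> ?Sg" "g = cf m d t b" "b \<in> Mon m d"
      then show ?thesis using H1_cf[OF s] by blast
    next
      fix i assume "g = lf (m + k) m d (h i)"
      then show ?thesis using H1_lf[OF s] by blast
    qed
    show "\<exists>M E. (\<forall>i<N. E i \<in> PC (pf m ` ?Sg) B M M) \<and>
        pf m s ^ M * cf m d s \<alpha> ^ Suc M = (\<Sum>i<N. lf (m + k) m d (h i) * E i)" if s: "s \<in> ?Sg" and \<alpha>: "\<alpha> \<in> Mon m d" for s \<alpha>
    proof (rule H2_lf[OF s subset_refl cB[OF s] \<alpha>])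
      fix u :: "nat \<Rightarrow> nat \<Rightarrow> 'a" and a :: "(nat \<Rightarrow>\<^sub>0 nat) \<Rightarrow> 'a"
      assume "\<And>i j. i \<le> m \<Longrightarrow> j \<le> m \<Longrightarrow> u i (s j) = (if i = j then 1 else 0)" "a \<alpha> \<noteq> 0"
      then show "\<exists>i<N. lf (m + k) m d (h i) (u, a) \<noteq> 0" using nex s \<alpha> by blast
    qed
    show "zf m d v \<in> B" if vI: "v \<in> Ix m k d" for v
    proof -
      consider b where "v = Inl b" "b \<in> Mon m d" | j i where "v = Inr (j, i)" "j < k" "i \<in> Js m d"
        using vI unfolding Ix_def by blast
      then show ?thesis
      proof cases
        case 1
        then show ?thesis using cB[OF sid_Sg] by (auto simp: zf_def)
      next
        case 2
        then have "i \<le> m" by (auto simp: Js_def split: if_splits)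
        then have "(if i = 0 then b01 d else Poly_Mapping.single i d) \<in> Mon m d"
          using b01_Mon[OF m d] single_Mon by simp
        then show ?thesis using cB[OF tau_Sg[OF 2(2)]] by (auto simp: zf_def 2)
      qed
    qed
    show "\<exists>w. pf m (sid m) w \<noteq> 0 \<and> eval_mpoly P (\<lambda>v. zf m d v w) \<noteq> 0"
      if P: "P \<noteq> 0" "vars_in (Ix m k d) P" for P :: "((nat \<Rightarrow>\<^sub>0 nat) + nat \<times> nat, 'a) mpoly"
    proof -
      obtain t where t: "eval_mpoly P t \<noteq> 0" "eval_mpoly Q t \<noteq> 0" using P(1) Q(1) by (rule mpoly_common_nonroot)
      obtain w where w: "pf m (sid m) w \<noteq> 0" "\<forall>v\<in>Ix m k d. zf m d v w = t v" using Q(2)[OF t(2)] by blast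
      have "eval_mpoly P (\<lambda>v. zf m d v w) = eval_mpoly P t" by (rule eval_mpoly_cong[OF P(2)]) (use w(2) in blast)
      then show ?thesis using w(1) t(1) by (intro exI[of _ w]) simp
    qed
  qed
  show False by (rule contradiction)
qed

text \<open>If the signed minors do not all vanish, they are the common point. If they do, the
  linear forms cut out at least a line in the subspace, and a form of positive degree has a zero on
  this line.\<close>

lemma lf_zeroD:
  fixes u :: "nat \<Rightarrow> nat \<Rightarrow> 'a::alg_closed_field"
  assumes z: "lf n m d g (u, a) = 0" and d: "d > 0"
  shows "\<exists>y. (\<exists>i\<le>m. y i \<noteq> 0) \<and> (\<forall>c<m. (\<Sum>j\<le>n. (\<Sum>i\<le>m. y i * u i j) * g c j) = 0) \<and> fm m d a y = 0"
proof -
  let ?Q = "Qh n g (u, a)"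
  have ker: "(\<Sum>j\<le>n. (\<Sum>i\<le>m. y i * u i j) * g c j) = (\<Sum>i<Suc m. y i * ?Q i c)" for y c
    unfolding Qh_def fst_conv sum_distrib_left sum_distrib_right lessThan_Suc_atMost mult.assoc by (rule sum.swap)
  show ?thesis
  proof (cases "\<exists>i\<le>m. yv (Suc m) ?Q i \<noteq> 0")
    case True
    then show ?thesis using z yv_kernel[of _ "Suc m" ?Q]
      by (intro exI[of _ "yv (Suc m) ?Q"]) (auto simp: ker lf_def simp del: sum.lessThan_Suc)
  next
    case False
    have D: "dt (Suc m) (\<lambda>r c. if c = 0 then b r else ?Q r (c - 1)) = 0" for b
    proof -
      have "(\<Sum>j<Suc m. b j * yv (Suc m) ?Q j) = 0" by (rule sum.neutral) (use False in auto)
      then show ?thesis by (subst (asm) yv_dt) auto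
    qed
    obtain y1 where y1: "\<exists>i<Suc m. y1 i \<noteq> 0"
      "\<And>c. c < Suc m \<Longrightarrow> (\<Sum>i<Suc m. y1 i * (if c = 0 then 0 else ?Q i (c - 1))) = 0"
      using dt_zero_kernel[OF D[of "\<lambda>_. 0"]] by blast
    then obtain i0 where i0: "i0 < Suc m" "y1 i0 \<noteq> 0" by blast
    \<comment> \<open>The extra column makes the coordinate \<open>i0\<close> of \<open>y2\<close>
      zero, so that \<open>y1 + s * y2\<close> is nonzero for every \<open>s\<close>.\<close>
    obtain y2 where y2: "\<exists>i<Suc m. y2 i \<noteq> 0"
      "\<And>c. c < Suc m \<Longrightarrow> (\<Sum>i<Suc m. y2 i * (if c = 0 then (if i = i0 then 1 else 0) else ?Q i (c - 1))) = 0"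
      using dt_zero_kernel[OF D[of "\<lambda>i. if i = i0 then 1 else 0"]] by blast
    have k1: "(\<Sum>i<Suc m. y1 i * ?Q i c) = 0" and k2: "(\<Sum>i<Suc m. y2 i * ?Q i c) = 0" if "c < m" for c
      using y1(2)[of "Suc c"] y2(2)[of "Suc c"] that by simp_all
    have y20: "y2 i0 = 0"
      using y2(2)[of 0] i0(1) by (simp add: if_distrib[of "\<lambda>x. _ * x"] del: sum.lessThan_Suc cong: if_cong)
    show ?thesis
    proof (cases "fm m d a y2 = 0")
      case True
      then show ?thesis using y2(1) k2
        by (intro exI[of _ y2]) (auto simp: ker less_Suc_eq_le simp del: sum.lessThan_Suc)
    next
      case False
      then obtain s where s: "fm m d a (\<lambda>i. y1 i + s * y2 i) = 0"
        using homogeneous_line_surj[OF homogeneous_fmP d, of m a y2 y1 0] by (auto simp: eval_fmP)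
      have "(\<Sum>i<Suc m. (y1 i + s * y2 i) * ?Q i c) = 0" if "c < m" for c
      proof -
        have "(\<Sum>i<Suc m. (y1 i + s * y2 i) * ?Q i c) = (\<Sum>i<Suc m. y1 i * ?Q i c) + s * (\<Sum>i<Suc m. y2 i * ?Q i c)"
          by (simp only: sum_distrib_left sum.distrib[symmetric]) (simp only: algebra_simps)
        then show ?thesis by (simp only: k1[OF that] k2[OF that]) simp
      qed
      moreover have "y1 i0 + s * y2 i0 \<noteq> 0" "i0 \<le> m" using i0 y20 by auto
      ultimately show ?thesis using s
        by (intro exI[of _ "\<lambda>i. y1 i + s * y2 i"]) (auto simp: ker simp del: sum.lessThan_Suc)
    qed
  qed
qed

section \<open>Points of projective space\<close>

definition pl :: "(nat \<Rightarrow> 'a::field) \<Rightarrow> 'a point" where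
  "pl v = vec.span {v}"

lemma pl_eq: "pl v = range (\<lambda>c. vscale c v)"
  unfolding pl_def vec.span_singleton by auto

lemma coord_space_subspace: "vec.subspace (coord_space n)"
  by (auto simp: vec.subspace_def coord_space_def vscale_def)

lemma pl_in_proj_space:
  assumes "v \<in> coord_space n" "v \<noteq> 0" shows "pl v \<in> proj_space n"
proof -
  have "vec.independent {v}" using assms(2) by simp
  then have "vec.dim (pl v) = 1" unfolding pl_def using vec.dim_span_eq_card_independent[of "{v}"] by simp
  moreover have "pl v \<subseteq> coord_space n" unfolding pl_def
    using vec.span_minimal[OF _ coord_space_subspace, of "{v}"] assms(1) by simp
  ultimately show ?thesis unfolding proj_space_def pl_def by auto
qed

lemma proj_spaceE:
  assumes "p \<in> proj_space n"
  obtains v where "v \<in> coord_space n" "v \<noteq> 0" "p = pl v"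
proof -
  have p: "vec.subspace p" "p \<subseteq> coord_space n" "vec.dim p = 1" using assms by (auto simp: proj_space_def)
  obtain v where v: "v \<in> p" "\<And>x. x \<in> p \<Longrightarrow> \<exists>c. x = (\<lambda>i. c * v i)"
    using proj_space_generator[OF assms] by blast
  have pv: "p = pl v"
  proof
    show "p \<subseteq> pl v" using v(2) by (auto simp: pl_eq vscale_def)
    show "pl v \<subseteq> p" unfolding pl_def using v(1) p(1) by (intro vec.span_minimal) auto
  qed
  moreover have "v \<noteq> 0"
  proof
    assume "v = 0"
    then have "p \<subseteq> vec.span {}" using pv by (simp add: pl_def)
    then have "vec.dim p \<le> card ({} :: (nat \<Rightarrow> 'a) set)" by (intro vec.dim_le_card) auto
    then show False using p(3) by simp
  qed
  ultimately show thesis using that v(1) p(2) by blast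
qed

lemma v_in_pl: "v \<in> pl v"
  unfolding pl_def by (simp add: vec.span_base)

lemma pl_subset_iff: "vec.subspace U \<Longrightarrow> pl v \<subseteq> U \<longleftrightarrow> v \<in> U"
  unfolding pl_def using vec.span_minimal[of "{v}" U] vec.span_base[of v "{v}"] by blast

lemma pl_scale: "c \<noteq> 0 \<Longrightarrow> pl (vscale c v) = pl v"
proof -
  assume c: "c \<noteq> 0"
  have "pl (vscale c v) \<subseteq> pl v"
    by (auto simp: pl_eq vscale_def mult.assoc[symmetric] intro: range_eqI)
  moreover have "pl v \<subseteq> pl (vscale c v)"
  proof
    fix x assume "x \<in> pl v"
    then obtain d where "x = vscale d v" by (auto simp: pl_eq)
    then have "x = vscale (d / c) (vscale c v)" using c by (simp add: vscale_def)
    then show "x \<in> pl (vscale c v)" unfolding pl_eq by blast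
  qed
  ultimately show ?thesis by blast
qed

lemma pl_eqD:
  assumes "pl v = pl w" "v \<noteq> 0" obtains c where "c \<noteq> 0" "v = vscale c w"
proof -
  obtain c where c: "v = vscale c w" using v_in_pl[of v] assms(1) by (auto simp: pl_eq)
  then have "c \<noteq> 0" using assms(2) by (auto simp: vscale_def zero_fun_def)
  with c show thesis by (rule that[rotated])
qed

section \<open>Vanishing on irreducible sets\<close>

lemma eval_scale_poly: "eval_mpoly f (\<lambda>i. c * x i) = poly (map_poly (\<lambda>g. eval_mpoly g x) (gpoly f)) (c :: 'a::comm_ring_1)"
proof -
  have f: "f = (\<Sum>e\<le>mdeg f. coeff (gpoly f) e)"
    using poly_gpoly_1[of f] by (simp add: poly_altdef mdeg_def)
  have "eval_mpoly f (\<lambda>i. c * x i) = (\<Sum>e\<le>mdeg f. eval_mpoly (coeff (gpoly f) e) (\<lambda>i. c * x i))"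
    by (subst f) (simp add: eval_mpoly_sum)
  also have "\<dots> = (\<Sum>e\<le>mdeg f. eval_mpoly (coeff (gpoly f) e) x * c ^ e)"
    by (intro sum.cong refl) (simp add: eval_mpoly_smult[OF homogeneous_coeff_gpoly] mult.commute)
  also have "\<dots> = poly (map_poly (\<lambda>g. eval_mpoly g x) (gpoly f)) c"
  proof -
    have "degree (map_poly (\<lambda>g. eval_mpoly g x) (gpoly f)) \<le> mdeg f" unfolding mdeg_def by (rule degree_le) (simp add: coeff_map_poly coeff_eq_0)
    then have "poly (map_poly (\<lambda>g. eval_mpoly g x) (gpoly f)) c
        = (\<Sum>e\<le>mdeg f. coeff (map_poly (\<lambda>g. eval_mpoly g x) (gpoly f)) e * c ^ e)"
      unfolding poly_altdef by (intro sum.mono_neutral_left) (auto simp: coeff_eq_0)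
    then show ?thesis by (simp add: coeff_map_poly)
  qed
  finally show ?thesis .
qed

text \<open>Vanishing on the affine cone over \<open>Z\<close>, which makes sense for inhomogeneous
  \<open>f\<close> as well.\<close>

definition van :: "(nat, 'a::field) mpoly \<Rightarrow> 'a point set \<Rightarrow> bool" where
  "van f Z \<longleftrightarrow> (\<forall>p\<in>Z. \<forall>x\<in>p. eval_mpoly f x = 0)"

lemma van_pl:
  assumes "homogeneous e f" shows "(\<forall>x\<in>pl v. eval_mpoly f x = 0) \<longleftrightarrow> eval_mpoly f v = 0"
proof
  assume "eval_mpoly f v = 0"
  then have "eval_mpoly f (vscale c v) = 0" for c
    using eval_mpoly_smult[OF assms, of c v] by (simp add: vscale_def)
  then show "\<forall>x\<in>pl v. eval_mpoly f x = 0" by (auto simp: pl_eq)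
qed (use v_in_pl in blast)

lemma van_mult: "van (f * g) Z \<longleftrightarrow> (\<forall>p\<in>Z. \<forall>x\<in>p. eval_mpoly f x = 0 \<or> eval_mpoly g x = 0)"
  by (simp add: van_def eval_mpoly_mult)

lemma zero_locus_van: "Z \<subseteq> proj_space n \<Longrightarrow> Z \<subseteq> zero_locus n S \<longleftrightarrow> (\<forall>f\<in>S. van f Z)"
  by (auto simp: zero_locus_def van_def)

lemma closedin_zero_locus: "S \<subseteq> hom_polys n \<Longrightarrow> closedin (zariski n) (zero_locus n S)"
  unfolding closedin_zariski by blast

lemma irreducible_prime:
  assumes Z: "irreducible_in (zariski n) Z" and fg: "f \<in> hom_polys n" "g \<in> hom_polys n" and v: "van (f * g) Z"
  shows "van f Z \<or> van g Z"
proof -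
  have sub: "Z \<subseteq> proj_space n" using Z by (simp add: irreducible_in_def)
  have "zero_locus n {f} \<union> zero_locus n {g} = zero_locus n {f * g}"
    using zero_locus_Un[of "{f}" n "{g}"] fg by simp
  then have "Z \<subseteq> zero_locus n {f} \<union> zero_locus n {g}" using zero_locus_van[OF sub, of "{f * g}"] v by simp
  then have "Z \<subseteq> zero_locus n {f} \<or> Z \<subseteq> zero_locus n {g}"
    using Z fg closedin_zero_locus[of "{f}" n] closedin_zero_locus[of "{g}" n] unfolding irreducible_in_def by simp
  then show ?thesis using zero_locus_van[OF sub] by simp
qed

lemma irreducible_inI:
  assumes "Z \<subseteq> proj_space n" "Z \<noteq> {}"
    and "\<And>f g. f \<in> hom_polys n \<Longrightarrow> g \<in> hom_polys n \<Longrightarrow> van (f * g) Z \<Longrightarrow> van f Z \<or> van g Z"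
  shows "irreducible_in (zariski n) Z"
  unfolding irreducible_in_def
proof (intro conjI allI impI)
  fix A B :: "'a point set"
  assume AB: "closedin (zariski n) A \<and> closedin (zariski n) B \<and> Z \<subseteq> A \<union> B"
  then obtain S T where S: "S \<subseteq> hom_polys n" "A = zero_locus n S" and T: "T \<subseteq> hom_polys n" "B = zero_locus n T"
    unfolding closedin_zariski by blast
  show "Z \<subseteq> A \<or> Z \<subseteq> B"
  proof (rule ccontr)
    assume n: "\<not> (Z \<subseteq> A \<or> Z \<subseteq> B)"
    then obtain f g where fg: "f \<in> S" "\<not> van f Z" "g \<in> T" "\<not> van g Z"
      using S(2) T(2) zero_locus_van[OF assms(1)] by blast
    have "van (f * g) Z"
      unfolding van_mult
    proof (intro ballI)
      fix p x assume "p \<in> Z" "x \<in> p"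
      then show "eval_mpoly f x = 0 \<or> eval_mpoly g x = 0"
        using AB S(2) T(2) fg by (auto simp: zero_locus_def)
    qed
    then show False using assms(3)[of f g] fg S(1) T(1) by blast
  qed
qed (use assms in auto)

text \<open>Irreducibility in the Zariski topology concerns homogeneous polynomials. As the cone
  over \<open>Z\<close> is closed under scaling and \<open>g\<close> is homogeneous, the product
  with \<open>f\<close> splits into homogeneous parts, and \<open>g\<close> is cancelled from
  each.\<close>

lemma van_cancel:
  fixes f :: "(nat, 'a::alg_closed_field) mpoly"
  assumes Z: "irreducible_in (zariski n) Z" and f: "vars_in {..n} f" and g: "g \<in> hom_polys n" "\<not> van g Z" and v: "van (f * g) Z"
  shows "van f Z"
proof -
  obtain d where d: "homogeneous d g" using g(1) by (auto simp: hom_polys_def)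
  have sub: "Z \<subseteq> proj_space n" using Z by (simp add: irreducible_in_def)
  have part: "van (coeff (gpoly f) e) Z" for e
  proof -
    have "van (coeff (gpoly f) e * g) Z"
      unfolding van_def
    proof (intro ballI)
      fix p x assume px: "p \<in> Z" "x \<in> p"
      then obtain w where w: "p = pl w" using sub proj_spaceE by blast
      let ?P = "Polynomial.smult (eval_mpoly g x) (map_poly (\<lambda>h. eval_mpoly h x) (gpoly f))"
      have "poly (monom 1 d * ?P) c = 0" for c
      proof -
        have "(\<lambda>i. c * x i) \<in> p" using px(2) unfolding w pl_eq by (auto simp: vscale_def mult.assoc[symmetric] intro: range_eqI)
        then have "eval_mpoly (f * g) (\<lambda>i. c * x i) = 0" using v px(1) unfolding van_def by blast
        then show ?thesis unfolding eval_mpoly_mult eval_scale_poly[of f] eval_mpoly_smult[OF d]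
          by (auto simp: poly_monom)
      qed
      then have "monom 1 d * ?P = 0" using poly_nonroot[of "monom 1 d * ?P"] by blast
      then have "?P = 0" by (simp add: monom_eq_0_iff)
      then have "coeff ?P e = 0" by (simp only: coeff_0)
      moreover have "coeff ?P e = eval_mpoly g x * eval_mpoly (coeff (gpoly f) e) x" by (simp add: coeff_map_poly)
      ultimately have "eval_mpoly g x * eval_mpoly (coeff (gpoly f) e) x = 0" by (rule trans[OF sym, rotated])
      then show "eval_mpoly (coeff (gpoly f) e * g) x = 0" unfolding eval_mpoly_mult by (simp only: mult.commute)
    qed
    moreover have "coeff (gpoly f) e \<in> hom_polys n"
      unfolding hom_polys_def using vars_in_coeff_gpoly[OF f] homogeneous_coeff_gpoly by blast
    ultimately show ?thesis using irreducible_prime[OF Z _ g(1)] g(2) by blast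
  qed
  show ?thesis
    unfolding van_def
  proof (intro ballI)
    fix p x assume px: "p \<in> Z" "x \<in> p"
    have "eval_mpoly f x = (\<Sum>e\<le>mdeg f. eval_mpoly (coeff (gpoly f) e) x)"
      using poly_gpoly_1[of f] by (simp add: poly_altdef mdeg_def flip: eval_mpoly_sum)
    also have "\<dots> = 0" using part px by (intro sum.neutral) (auto simp: van_def)
    finally show "eval_mpoly f x = 0" .
  qed
qed

section \<open>Dimension\<close>

definition zchain :: "nat \<Rightarrow> 'a::field point set \<Rightarrow> nat \<Rightarrow> (nat \<Rightarrow> 'a point set) \<Rightarrow> bool" where
  "zchain n V r Z \<longleftrightarrow> (\<forall>i\<le>r. closedin (zariski n) (Z i) \<and> irreducible_in (zariski n) (Z i) \<and> Z i \<subseteq> V) \<and>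
     (\<forall>i<r. Z i \<subset> Z (Suc i))"

lemma krull_dim_zchain: "proj_dim n V = Sup {ereal (real r) | r. \<exists>Z. zchain n V r Z}"
  unfolding krull_dim_def zchain_def ..

lemma proj_dim_le: "(\<And>r Z. zchain n V r Z \<Longrightarrow> r \<le> m) \<Longrightarrow> proj_dim n V \<le> ereal (real m)"
  unfolding krull_dim_zchain by (rule Sup_least) auto

lemma proj_dim_ge: "zchain n V r Z \<Longrightarrow> ereal (real r) \<le> proj_dim n V"
  unfolding krull_dim_zchain by (rule Sup_upper) blast

lemma zchain_snoc:
  assumes "zchain n V r Z" "closedin (zariski n) Y" "irreducible_in (zariski n) Y" "V \<subset> Y"
  shows "zchain n Y (Suc r) (Z(Suc r := Y))"
  using assms unfolding zchain_def by (auto simp: less_Suc_eq le_Suc_eq)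

definition alg_indep_on :: "nat set \<Rightarrow> (nat \<Rightarrow> 'b \<Rightarrow> 'a::alg_closed_field) \<Rightarrow> 'b set \<Rightarrow> bool" where
  "alg_indep_on I g S \<longleftrightarrow> (\<forall>Q. Q \<noteq> 0 \<and> vars_in I Q \<longrightarrow> (\<exists>x\<in>S. eval_mpoly Q (\<lambda>j. g j x) \<noteq> 0))"

lemma alg_indep_onE:
  assumes "alg_indep_on I g S" "Q \<noteq> 0" "vars_in I Q"
  obtains x where "x \<in> S" "eval_mpoly Q (\<lambda>j. g j x) \<noteq> 0"
  using assms unfolding alg_indep_on_def by auto

text \<open>
  A form that vanishes on a member of the chain but not on the next one is algebraically
  independent from the forms chosen before.
\<close>

lemma zchain_alg_indep:
  fixes Z :: "nat \<Rightarrow> 'a::alg_closed_field point set"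
  assumes "zchain n V r Z"
  shows "\<exists>g. (\<forall>j\<le>r. vars_in {..n} (g j)) \<and> alg_indep_on {..r} (\<lambda>j. eval_mpoly (g j)) (\<Union>(Z r))"
  using assms
proof (induction r)
  case 0
  then have irr: "irreducible_in (zariski n) (Z 0)" by (simp add: zchain_def)
  then obtain p where p: "p \<in> Z 0" "p \<in> proj_space n" by (auto simp: irreducible_in_def)
  obtain v where v: "v \<in> coord_space n" "v \<noteq> 0" "p = pl v" using p(2) by (rule proj_spaceE)
  obtain i where i: "v i \<noteq> 0" using v(2) by (auto simp: fun_eq_iff)
  have "\<forall>i>n. v i = 0" using v(1) by (simp add: coord_space_def)
  then have "i \<le> n" using i by (meson not_le)
  \<comment> \<open>A coordinate that is nonzero at the point takes every value along the line
    \<open>p\<close>. This accounts for one polynomial more than the length of the chain.\<close>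
  have "alg_indep_on {..0} (\<lambda>j. eval_mpoly (MX i)) (\<Union>(Z 0))"
    unfolding alg_indep_on_def
  proof (intro allI impI, elim conjE)
    fix Q :: "(nat, 'a) mpoly" assume Q: "Q \<noteq> 0" "vars_in {..0} Q"
    obtain y where y: "eval_mpoly Q y \<noteq> 0" using Q(1) by (rule mpoly_nonroot)
    define x where "x = vscale (y 0 / v i) v"
    have "x \<in> p" unfolding v(3) pl_eq x_def by blast
    moreover have "eval_mpoly Q (\<lambda>j. eval_mpoly (MX i) x) = eval_mpoly Q y"
      by (rule eval_mpoly_cong[OF Q(2)]) (use i in \<open>simp add: x_def vscale_def\<close>)
    ultimately show "\<exists>x\<in>\<Union>(Z 0). eval_mpoly Q (\<lambda>j. eval_mpoly (MX i) x) \<noteq> 0"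
      using y p(1) by (intro bexI[of _ x]) auto
  qed
  moreover have "\<forall>j\<le>0::nat. vars_in {..n} (MX i :: (nat, 'a) mpoly)" using \<open>i \<le> n\<close> by simp
  ultimately show ?case by (intro exI[of _ "\<lambda>_. MX i"] conjI)
next
  case (Suc r)
  then have ch: "zchain n V r Z" by (simp add: zchain_def)
  obtain g where g: "\<forall>j\<le>r. vars_in {..n} (g j)" "alg_indep_on {..r} (\<lambda>j. eval_mpoly (g j)) (\<Union>(Z r))"
    using Suc.IH[OF ch] by blast
  have Z: "closedin (zariski n) (Z r)" "irreducible_in (zariski n) (Z (Suc r))" "Z r \<subset> Z (Suc r)"
    using Suc.prems by (auto simp: zchain_def)
  obtain S where S: "S \<subseteq> hom_polys n" "Z r = zero_locus n S" using Z(1) unfolding closedin_zariski by blast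
  have sub: "Z (Suc r) \<subseteq> proj_space n" using Z(2) by (simp add: irreducible_in_def)
  obtain f where f: "f \<in> S" "\<not> van f (Z (Suc r))" using Z(3) S(2) zero_locus_van[OF sub, of S] by blast
  have fZ: "van f (Z r)" using f(1) S(2) by (auto simp: van_def zero_locus_def)
  have fh: "f \<in> hom_polys n" using f S by blast
  then have fv: "vars_in {..n} f" by (simp add: hom_polys_def)
  define g' where "g' = g(Suc r := f)"
  have vg': "vars_in {..n} (g' j)" if "j \<le> Suc r" for j using that g(1) fv by (auto simp: g'_def le_Suc_eq)
  let ?X = "MX (Suc r) :: (nat, 'a) mpoly"
  have comp: "\<exists>q. vars_in {..n} q \<and> (\<forall>x. eval_mpoly q x = eval_mpoly Q (\<lambda>j. eval_mpoly (g' j) x))"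
    if "vars_in {..Suc r} Q" for Q
    using pfun_compose[OF that, of "{..n}" "\<lambda>x j. eval_mpoly (g' j) x"] vg' pfun_eval unfolding pfun_def by blast
  \<comment> \<open>Induction on the polynomial in the new variable. A nonzero constant coefficient
    is detected on \<open>Z r\<close>, where \<open>f\<close> vanishes; otherwise a factor
    \<open>f\<close> is cancelled on the irreducible set \<open>Z (Suc r)\<close>.\<close>
  have main: "\<exists>x\<in>\<Union>(Z (Suc r)). eval_mpoly (poly P ?X) (\<lambda>j. eval_mpoly (g' j) x) \<noteq> 0"
    if "P \<noteq> 0" "coeffs_in {..r} P" for P
    using that
  proof (induction P)
    case (pCons c P)
    show ?case
    proof (cases "c = 0")
      case False
      have "vars_in {..r} c" using pCons.prems by simp
      obtain x where x: "x \<in> \<Union>(Z r)" "eval_mpoly c (\<lambda>j. eval_mpoly (g j) x) \<noteq> 0"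
        by (rule alg_indep_onE[OF g(2) False \<open>vars_in {..r} c\<close>])
      have "eval_mpoly c (\<lambda>j. eval_mpoly (g' j) x) = eval_mpoly c (\<lambda>j. eval_mpoly (g j) x)"
        by (rule eval_mpoly_cong[OF \<open>vars_in {..r} c\<close>]) (simp add: g'_def)
      moreover have "eval_mpoly f x = 0" using fZ x(1) by (auto simp: van_def)
      ultimately have "eval_mpoly (poly (pCons c P) ?X) (\<lambda>j. eval_mpoly (g' j) x) \<noteq> 0"
        using x(2) by (simp add: eval_mpoly_hom g'_def)
      then show ?thesis using x(1) Z(3) by blast
    next
      case True
      then have P: "P \<noteq> 0" "coeffs_in {..r} P" using pCons.prems by auto
      have "vars_in {..Suc r} (poly P ?X)" by (rule vars_in_poly[OF P(2)]) auto
      then obtain q where q: "vars_in {..n} q" "\<And>x. eval_mpoly q x = eval_mpoly (poly P ?X) (\<lambda>j. eval_mpoly (g' j) x)"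
        using comp by blast
      show ?thesis
      proof (rule ccontr)
        assume n: "\<not> ?thesis"
        have "van (q * f) (Z (Suc r))"
          unfolding van_def
        proof (intro ballI)
          fix p x assume "p \<in> Z (Suc r)" "x \<in> p"
          then have "eval_mpoly (poly (pCons c P) ?X) (\<lambda>j. eval_mpoly (g' j) x) = 0" using n by blast
          then show "eval_mpoly (q * f) x = 0"
            by (simp add: True eval_mpoly_hom q(2)) (auto simp: g'_def)
        qed
        then have "van q (Z (Suc r))" by (rule van_cancel[OF Z(2) q(1) fh f(2)])
        then show False using pCons.IH[OF P] q(2) unfolding van_def by auto
      qed
    qed
  qed simp
  have "alg_indep_on {..Suc r} (\<lambda>j. eval_mpoly (g' j)) (\<Union>(Z (Suc r)))"
    unfolding alg_indep_on_def
  proof (intro allI impI, elim conjE)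
    fix Q :: "(nat, 'a) mpoly" assume Q: "Q \<noteq> 0" "vars_in {..Suc r} Q"
    have "vars_in (insert (Suc r) {..r}) Q" using Q(2) by (simp add: atMost_Suc)
    then obtain P where P: "coeffs_in {..r} P" "Q = poly P ?X" using poly_rep_ex[of "Suc r" "{..r}" Q] by auto
    then have "P \<noteq> 0" using Q(1) by auto
    then show "\<exists>x\<in>\<Union>(Z (Suc r)). eval_mpoly Q (\<lambda>j. eval_mpoly (g' j) x) \<noteq> 0" using main P by blast
  qed
  then show ?case using vg' by blast
qed

text \<open>Each exponent is bounded separately, instead of the total degree: the bounds add up
  under multiplication, and the count is immediate.\<close>

definition boxmon :: "nat \<Rightarrow> nat \<Rightarrow> ((nat \<Rightarrow> 'a::field) \<Rightarrow> 'a) set" where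
  "boxmon m E = (\<lambda>e y. \<Prod>i\<le>m. y i ^ e i) ` ({..m} \<rightarrow>\<^sub>E {..E})"

lemma boxmon_card: "finite (boxmon m E)" "card (boxmon m E) \<le> (E + 1) ^ Suc m"
proof -
  show "finite (boxmon m E)" unfolding boxmon_def by (intro finite_imageI finite_PiE) auto
  have "card (boxmon m E) \<le> card ({..m} \<rightarrow>\<^sub>E {..E})" unfolding boxmon_def by (intro card_image_le finite_PiE) auto
  then show "card (boxmon m E) \<le> (E + 1) ^ Suc m" by (simp add: card_PiE)
qed

lemma boxmon_memI:
  assumes "\<And>i. i \<le> m \<Longrightarrow> e i \<le> E" shows "(\<lambda>y. \<Prod>i\<le>m. y i ^ e i) \<in> boxmon m E"
  unfolding boxmon_def
  by (rule image_eqI[of _ _ "restrict e {..m}"]) (use assms in auto)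

lemma boxspan_mult:
  assumes "f \<in> fs.span (boxmon m E)" "g \<in> fs.span (boxmon m E')"
  shows "f * g \<in> fs.span (boxmon m (E + E'))"
proof (rule span_mult[OF assms])
  fix x y :: "(nat \<Rightarrow> 'a) \<Rightarrow> 'a" assume "x \<in> boxmon m E" "y \<in> boxmon m E'"
  then obtain e e' where e: "e \<in> {..m} \<rightarrow>\<^sub>E {..E}" "x = (\<lambda>y. \<Prod>i\<le>m. y i ^ e i)"
    and e': "e' \<in> {..m} \<rightarrow>\<^sub>E {..E'}" "y = (\<lambda>y. \<Prod>i\<le>m. y i ^ e' i)" unfolding boxmon_def by blast
  have "x * y = (\<lambda>y. \<Prod>i\<le>m. y i ^ (e i + e' i))"
    by (simp add: e(2) e'(2) fun_eq_iff power_add prod.distrib)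
  moreover have "(\<lambda>y. \<Prod>i\<le>m. y i ^ (e i + e' i)) \<in> boxmon m (E + E')"
    by (rule boxmon_memI) (use e(1) e'(1) in \<open>auto simp: PiE_iff intro!: add_mono\<close>)
  ultimately have "x * y \<in> boxmon m (E + E')" by (simp only:)
  then show "x * y \<in> fs.span (boxmon m (E + E'))" by (rule fs.span_base)
qed

lemma boxspan_mono: "E \<le> E' \<Longrightarrow> fs.span (boxmon m E) \<subseteq> fs.span (boxmon m E')"
  unfolding boxmon_def by (intro fs.span_mono image_mono PiE_mono) auto

lemma boxspan_1: "1 \<in> fs.span (boxmon m 0)"
proof -
  have "(\<lambda>y :: nat \<Rightarrow> 'a. \<Prod>i\<le>m. y i ^ 0) \<in> boxmon m 0" by (rule boxmon_memI) simp
  moreover have "(\<lambda>y :: nat \<Rightarrow> 'a. \<Prod>i\<le>m. y i ^ 0) = 1" by (simp add: fun_eq_iff)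
  ultimately show ?thesis by (metis fs.span_base)
qed

lemma boxspan_power: "f \<in> fs.span (boxmon m E) \<Longrightarrow> f ^ k \<in> fs.span (boxmon m (k * E))"
proof (induction k)
  case 0 then show ?case using boxspan_1 by (simp only: power_0 mult_0)
next
  case (Suc k)
  then have "f * f ^ k \<in> fs.span (boxmon m (E + k * E))" by (intro boxspan_mult)
  then show ?case by (simp only: power_Suc mult_Suc)
qed

lemma boxspan_prod:
  assumes "finite J" "\<And>j. j \<in> J \<Longrightarrow> f j \<in> fs.span (boxmon m E)"
  shows "(\<Prod>j\<in>J. f j) \<in> fs.span (boxmon m (card J * E))"
  using assms
proof (induction J rule: finite_induct)
  case empty then show ?case using boxspan_1 by (simp only: prod.empty card.empty mult_0)
next
  case (insert j J)
  then have "f j * (\<Prod>j\<in>J. f j) \<in> fs.span (boxmon m (E + card J * E))" by (intro boxspan_mult) auto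
  then show ?case using insert.hyps by (simp only: prod.insert card_insert_disjoint mult_Suc not_False_eq_True)
qed

lemma eval_mpoly_boxspan:
  fixes f :: "(nat, 'a::field) mpoly"
  assumes "vars_in {..m} f" shows "\<exists>E. eval_mpoly f \<in> fs.span (boxmon m E)"
proof -
  define E where "E = (\<Sum>a\<in>Poly_Mapping.keys f. total_deg a)"
  have "eval_mpoly f = (\<Sum>a\<in>Poly_Mapping.keys f. fscale (Poly_Mapping.lookup f a) (eval_monom a))"
    by (rule ext) (simp add: eval_mpoly_def sum_fun_apply fscale_def)
  also have "\<dots> \<in> fs.span (boxmon m E)"
  proof (intro fs.span_sum fs.span_scale fs.span_base)
    fix a assume a: "a \<in> Poly_Mapping.keys f"
    have ka: "Poly_Mapping.keys a \<subseteq> {..m}" using assms a by (auto simp: vars_in_def)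
    have "total_deg a \<le> E" unfolding E_def by (rule member_le_sum) (use a in auto)
    moreover have "Poly_Mapping.lookup a i \<le> total_deg a" for i
      by (cases "i \<in> Poly_Mapping.keys a") (auto simp: total_deg_def in_keys_iff intro!: member_le_sum)
    ultimately have "(\<lambda>y :: nat \<Rightarrow> 'a. \<Prod>i\<le>m. y i ^ Poly_Mapping.lookup a i) \<in> boxmon m E"
      by (intro boxmon_memI) (meson order_trans)
    moreover have "(\<lambda>y :: nat \<Rightarrow> 'a. \<Prod>i\<le>m. y i ^ Poly_Mapping.lookup a i) = eval_monom a"
      by (rule ext) (rule eval_monom_superset[OF _ ka, symmetric], simp)
    ultimately show "(eval_monom a :: (nat \<Rightarrow> 'a) \<Rightarrow> 'a) \<in> boxmon m E" by (simp only:)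
  qed
  finally show ?thesis by blast
qed

text \<open>Count the monomials of degree at most \<open>t\<close> in each of the \<open>g j\<close> against those in the variables.\<close>

theorem alg_indep_card:
  fixes g :: "nat \<Rightarrow> (nat, 'a::alg_closed_field) mpoly"
  assumes v: "\<And>j. j \<le> r \<Longrightarrow> vars_in {..m} (g j)" and ind: "alg_indep_on {..r} (\<lambda>j. eval_mpoly (g j)) UNIV"
  shows "r \<le> m"
proof (rule ccontr)
  assume "\<not> r \<le> m"
  then have r: "Suc m \<le> r" by simp
  have "\<forall>j. \<exists>E. j \<le> r \<longrightarrow> eval_mpoly (g j) \<in> fs.span (boxmon m E)"
    using eval_mpoly_boxspan v by blast
  then obtain Ef where Ef: "\<And>j. j \<le> r \<Longrightarrow> eval_mpoly (g j) \<in> fs.span (boxmon m (Ef j))" by metis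
  define E where "E = (\<Sum>j\<le>r. Ef j)"
  have E: "eval_mpoly (g j) \<in> fs.span (boxmon m E)" if "j \<le> r" for j
  proof -
    have "Ef j \<le> E" unfolding E_def by (rule member_le_sum) (use that in auto)
    then show ?thesis using Ef[OF that] boxspan_mono by blast
  qed
  \<comment> \<open>With these choices the variables provide at most
    \<open>(C * (t + 1)) ^ Suc m = t * (t + 1) ^ Suc m\<close> functions, whereas the
    \<open>g j\<close> provide \<open>(t + 1) ^ Suc r\<close>, and \<open>Suc r\<close> is at least
    \<open>m + 2\<close>.\<close>
  define C where "C = Suc r * E + 1"
  define t where "t = C ^ Suc m"
  define Ex where "Ex = {..r} \<rightarrow>\<^sub>E {..t}"
  define mon where "mon e = (\<Sum>j\<le>r. Poly_Mapping.single j (e j))" for e :: "nat \<Rightarrow> nat"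
  have lk: "Poly_Mapping.lookup (mon e) j = (if j \<le> r then e j else 0)" for e j
    by (simp add: mon_def lookup_sum lookup_single when_def)
  define F where "F e = (\<Prod>j\<le>r. eval_mpoly (g j) ^ e j)" for e :: "nat \<Rightarrow> nat"
  have finEx: "finite Ex" unfolding Ex_def by (intro finite_PiE) auto
  have "card Ex \<le> card (boxmon m (card {..r} * (t * E)) :: ((nat \<Rightarrow> 'a) \<Rightarrow> 'a) set)"
  proof (rule card_le_span[OF finEx boxmon_card(1), of F])
    fix e assume e: "e \<in> Ex"
    show "F e \<in> fs.span (boxmon m (card {..r} * (t * E)))"
      unfolding F_def
    proof (rule boxspan_prod)
      fix j assume j: "j \<in> {..r}"
      then have "e j \<le> t" using e unfolding Ex_def by (auto simp: PiE_iff)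
      then have "e j * E \<le> t * E" by (rule mult_right_mono) simp
      then show "eval_mpoly (g j) ^ e j \<in> fs.span (boxmon m (t * E))"
        using boxspan_power[OF E, of j "e j"] boxspan_mono j by blast
    qed simp
  next
    fix c :: "(nat \<Rightarrow> nat) \<Rightarrow> 'a" assume c: "\<And>x. (\<Sum>e\<in>Ex. c e * F e x) = 0"
    define Q where "Q = (\<Sum>e\<in>Ex. Poly_Mapping.single (mon e) (c e))"
    have km: "Poly_Mapping.keys (mon e) \<subseteq> {..r}" for e by (auto simp: in_keys_iff lk split: if_splits)
    have evQ: "eval_mpoly Q (\<lambda>j. eval_mpoly (g j) x) = 0" for x
    proof -
      have "eval_mpoly Q (\<lambda>j. eval_mpoly (g j) x) = (\<Sum>e\<in>Ex. c e * F e x)"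
        unfolding Q_def eval_mpoly_sum eval_mpoly_single
      proof (intro sum.cong refl arg_cong2[of _ _ _ _ "(*)"])
        fix e
        have "eval_monom (mon e) (\<lambda>j. eval_mpoly (g j) x) = (\<Prod>j\<le>r. eval_mpoly (g j) x ^ Poly_Mapping.lookup (mon e) j)"
          by (rule eval_monom_superset[OF _ km]) simp
        then show "eval_monom (mon e) (\<lambda>j. eval_mpoly (g j) x) = F e x"
          by (simp add: F_def prod_fun_apply power_fun_apply lk)
      qed
      then show ?thesis using c by simp
    qed
    have "vars_in {..r} Q" unfolding Q_def
      by (rule vars_in_sum) (use km in \<open>auto simp: vars_in_def\<close>)
    then have Q0: "Q = 0" using ind evQ unfolding alg_indep_on_def by blast
    have inj: "mon e = mon e' \<Longrightarrow> e = e'" if "e \<in> Ex" "e' \<in> Ex" for e e'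
    proof -
      assume eq: "mon e = mon e'"
      have "e j = e' j" if "j \<le> r" for j using arg_cong[OF eq, of "\<lambda>m. Poly_Mapping.lookup m j"] that by (simp add: lk)
      then show "e = e'" using \<open>e \<in> Ex\<close> \<open>e' \<in> Ex\<close> unfolding Ex_def by (intro PiE_ext[of e "{..r}" _ e']) auto
    qed
    show "\<forall>e\<in>Ex. c e = 0"
    proof
      fix e assume e: "e \<in> Ex"
      have "Poly_Mapping.lookup Q (mon e) = (\<Sum>e'\<in>Ex. if e' = e then c e else 0)"
        unfolding Q_def lookup_sum by (intro sum.cong refl) (use inj e in \<open>auto simp: lookup_single when_def\<close>)
      then show "c e = 0" using Q0 finEx e by simp
    qed
  qed
  also have "\<dots> \<le> (card {..r} * (t * E) + 1) ^ Suc m" by (rule boxmon_card)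
  also have "\<dots> \<le> (C * (t + 1)) ^ Suc m"
    by (rule power_mono) (auto simp: C_def algebra_simps)
  also have "\<dots> = t * (t + 1) ^ Suc m" unfolding power_mult_distrib t_def ..
  also have "\<dots> < (t + 1) * (t + 1) ^ Suc m" by (rule mult_strict_right_mono) auto
  also have "\<dots> = (t + 1) ^ Suc (Suc m)" by simp
  also have "\<dots> \<le> (t + 1) ^ Suc r" using r by (intro power_increasing) auto
  also have "\<dots> = card Ex" by (simp add: Ex_def card_PiE)
  finally show False by simp
qed

definition phi :: "nat \<Rightarrow> (nat \<Rightarrow> nat \<Rightarrow> 'a::field) \<Rightarrow> (nat \<Rightarrow> 'a) \<Rightarrow> nat \<Rightarrow> 'a" where
  "phi m w y = (\<lambda>j. \<Sum>i\<le>m. y i * w i j)"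

text \<open>Pulled back along \<open>phi m w\<close>, the independent polynomials of the chain
  become \<open>r + 1\<close> independent polynomials in \<open>m + 1\<close> variables.\<close>

lemma zchain_length:
  fixes w :: "nat \<Rightarrow> nat \<Rightarrow> 'a::alg_closed_field"
  assumes "zchain n V r Z" "\<Union>V \<subseteq> range (phi m w)"
  shows "r \<le> m"
proof -
  obtain g where g: "\<forall>j\<le>r. vars_in {..n} (g j)" "alg_indep_on {..r} (\<lambda>j. eval_mpoly (g j)) (\<Union>(Z r))"
    using zchain_alg_indep[OF assms(1)] by blast
  have ph: "pfun {..m} (\<lambda>y. phi m w y v)" for v
    unfolding phi_def by (intro pfun_sum pfun_mult pfun_const pfun_var) auto
  have "\<forall>j. \<exists>h. j \<le> r \<longrightarrow> vars_in {..m} h \<and> (\<forall>y. eval_mpoly h y = eval_mpoly (g j) (phi m w y))"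
  proof (intro allI)
    fix j
    show "\<exists>h. j \<le> r \<longrightarrow> vars_in {..m} h \<and> (\<forall>y. eval_mpoly h y = eval_mpoly (g j) (phi m w y))"
    proof (cases "j \<le> r")
      case True
      then have "pfun {..m} (\<lambda>y. eval_mpoly (g j) (phi m w y))" using g(1) ph by (intro pfun_compose[of "{..n}"]) auto
      then show ?thesis unfolding pfun_def by blast
    qed simp
  qed
  then obtain h where h: "\<And>j. j \<le> r \<Longrightarrow> vars_in {..m} (h j)"
    "\<And>j y. j \<le> r \<Longrightarrow> eval_mpoly (h j) y = eval_mpoly (g j) (phi m w y)" by metis
  have ZV: "\<Union>(Z r) \<subseteq> range (phi m w)" using assms unfolding zchain_def by blast
  have "alg_indep_on {..r} (\<lambda>j. eval_mpoly (h j)) UNIV"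
    unfolding alg_indep_on_def
  proof (intro allI impI, elim conjE)
    fix Q :: "(nat, 'a) mpoly" assume Q: "Q \<noteq> 0" "vars_in {..r} Q"
    obtain x where x: "x \<in> \<Union>(Z r)" "eval_mpoly Q (\<lambda>j. eval_mpoly (g j) x) \<noteq> 0"
      by (rule alg_indep_onE[OF g(2) Q])
    then obtain y where y: "x = phi m w y" using ZV by blast
    have "eval_mpoly Q (\<lambda>j. eval_mpoly (h j) y) = eval_mpoly Q (\<lambda>j. eval_mpoly (g j) x)"
      by (rule eval_mpoly_cong[OF Q(2)]) (simp add: h y)
    then show "\<exists>x\<in>UNIV. eval_mpoly Q (\<lambda>j. eval_mpoly (h j) x) \<noteq> 0" using x(2) by (intro bexI[of _ y]) auto
  qed
  then show ?thesis using alg_indep_card h(1) by blast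
qed

section \<open>Hypersurfaces in linear subspaces\<close>

lemma hom_poly_of_pfun:
  fixes g :: "(nat \<Rightarrow> 'a::alg_closed_field) \<Rightarrow> 'a"
  assumes "pfun I g" "\<And>c x. g (\<lambda>i. c * x i) = c ^ e * g x"
  obtains h where "vars_in I h" "homogeneous e h" "\<And>x. eval_mpoly h x = g x"
proof -
  obtain f where f: "vars_in I f" "\<And>x. eval_mpoly f x = g x" using assms(1) by (rule pfunE) blast
  have "eval_mpoly (coeff (gpoly f) e) x = g x" for x
  proof -
    let ?P = "map_poly (\<lambda>h. eval_mpoly h x) (gpoly f)"
    have "poly (?P - monom (g x) e) c = 0" for c
      using assms(2)[of c x] unfolding f(2)[symmetric] eval_scale_poly by (simp add: poly_monom f(2) mult.commute)
    then have "?P - monom (g x) e = 0" using poly_nonroot[of "?P - monom (g x) e"] by blast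
    then have "coeff ?P e = coeff (monom (g x) e) e" by simp
    then show ?thesis by (simp add: coeff_map_poly)
  qed
  then show thesis using that[of "coeff (gpoly f) e"] vars_in_coeff_gpoly[OF f(1)] homogeneous_coeff_gpoly by blast
qed

lemma closedin_pfun:
  fixes G :: "((nat \<Rightarrow> 'a::alg_closed_field) \<Rightarrow> 'a) set"
  assumes "\<And>g. g \<in> G \<Longrightarrow> pfun {..n} g \<and> (\<exists>e. \<forall>c x. g (\<lambda>i. c * x i) = c ^ e * g x)"
  shows "closedin (zariski n) {p \<in> proj_space n. \<forall>x\<in>p. \<forall>g\<in>G. g x = 0}"
proof -
  have "\<exists>h. h \<in> hom_polys n \<and> (\<forall>x. eval_mpoly h x = g x)" if g: "g \<in> G" for g
  proof -
    obtain e where e: "\<And>c x. g (\<lambda>i. c * x i) = c ^ e * g x" using assms[OF g] by blast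
    obtain h where "vars_in {..n} h" "homogeneous e h" "\<And>x. eval_mpoly h x = g x"
      by (rule hom_poly_of_pfun[OF conjunct1[OF assms[OF g]] e]) auto
    then show ?thesis unfolding hom_polys_def by blast
  qed
  then obtain H where H: "\<And>g. g \<in> G \<Longrightarrow> H g \<in> hom_polys n" "\<And>g x. g \<in> G \<Longrightarrow> eval_mpoly (H g) x = g x" by metis
  have "{p \<in> proj_space n. \<forall>x\<in>p. \<forall>g\<in>G. g x = 0} = zero_locus n (H ` G)"
    unfolding zero_locus_def using H(2) by auto
  moreover have "H ` G \<subseteq> hom_polys n" using H(1) by blast
  ultimately show ?thesis using closedin_zero_locus[of "H ` G" n] by simp
qed

lemma phi_scale: "phi m w (\<lambda>i. c * y i) = (\<lambda>i. c * phi m w y i)"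
  by (simp add: phi_def sum_distrib_left mult.assoc)

lemma phi_cong: "(\<And>i. i \<le> m \<Longrightarrow> y i = y' i) \<Longrightarrow> phi m w y = phi m w y'"
  by (simp add: phi_def)

lemma pfun_phi: "(\<And>i. i \<le> m \<Longrightarrow> pfun I (\<lambda>x. g x i)) \<Longrightarrow> pfun I (\<lambda>x. phi m w (g x) j)"
  unfolding phi_def by (intro pfun_sum pfun_mult pfun_const) auto

definition lc :: "nat \<Rightarrow> (nat \<Rightarrow> nat \<Rightarrow> 'a::field) \<Rightarrow> (nat \<Rightarrow> 'a) \<Rightarrow> nat \<Rightarrow> 'a" where
  "lc n L x = (\<lambda>i. \<Sum>j\<le>n. L i j * x j)"

text \<open>\<open>L\<close> is dual to the basis \<open>w\<close>. It makes the coordinates of a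
  point of the subspace linear functions of the point, and it certifies that the vectors
  \<open>w\<close> are independent.\<close>

definition frame :: "nat \<Rightarrow> nat \<Rightarrow> (nat \<Rightarrow> nat \<Rightarrow> 'a::field) \<Rightarrow> (nat \<Rightarrow> nat \<Rightarrow> 'a) \<Rightarrow> bool" where
  "frame n m w L \<longleftrightarrow> (\<forall>i\<le>m. w i \<in> coord_space n) \<and>
    (\<forall>i\<le>m. \<forall>k\<le>m. (\<Sum>j\<le>n. L i j * w k j) = (if i = k then 1 else 0))"

lemma phi_coord_space: "frame n m w L \<Longrightarrow> phi m w y \<in> coord_space n"
  by (auto simp: frame_def phi_def coord_space_def)

lemma lc_phi:
  assumes "frame n m w L" "i \<le> m" shows "lc n L (phi m w y) i = y i"
proof -
  have "lc n L (phi m w y) i = (\<Sum>k\<le>m. y k * (\<Sum>j\<le>n. L i j * w k j))"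
    unfolding lc_def phi_def sum_distrib_left
    by (subst sum.swap) (simp add: mult_ac)
  also have "\<dots> = y i" using assms by (simp add: frame_def if_distrib[of "\<lambda>x. _ * x"] cong: if_cong)
  finally show ?thesis .
qed

lemma phi_inj:
  assumes "frame n m w L" "phi m w y = phi m w y'" "i \<le> m" shows "y i = y' i"
  using lc_phi[OF assms(1,3), of y] lc_phi[OF assms(1,3), of y'] assms(2) by simp

lemma phi_0 [simp]: "phi m w (\<lambda>i. 0) = 0"
  by (simp add: phi_def fun_eq_iff)

lemma phi_eq_0_iff:
  assumes "frame n m w L" shows "phi m w y = 0 \<longleftrightarrow> (\<forall>i\<le>m. y i = 0)"
  using phi_inj[OF assms, of y "\<lambda>i. 0"] by (auto simp: phi_def fun_eq_iff)

text \<open>The zero polynomial gives the whole linear subspace.\<close>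

definition Zset :: "nat \<Rightarrow> (nat \<Rightarrow> nat \<Rightarrow> 'a::field) \<Rightarrow> (nat, 'a) mpoly \<Rightarrow> 'a point set" where
  "Zset m w f = {pl (phi m w y) | y. phi m w y \<noteq> 0 \<and> eval_mpoly f y = 0}"

lemma pl_phi_eqE:
  assumes "frame n m w L" "pl (phi m w y) = pl (phi m w y')" "phi m w y \<noteq> 0"
  obtains c where "c \<noteq> 0" "\<And>i. i \<le> m \<Longrightarrow> y i = c * y' i"
proof -
  obtain c where c: "c \<noteq> 0" "phi m w y = vscale c (phi m w y')" using assms(2,3) by (rule pl_eqD)
  have "phi m w y = phi m w (\<lambda>i. c * y' i)" using c(2) by (simp add: phi_scale vscale_def)
  then have "\<And>i. i \<le> m \<Longrightarrow> y i = c * y' i" by (rule phi_inj[OF assms(1)])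
  with c(1) show thesis by (rule that)
qed

lemma pl_phi_in_Zset:
  fixes f :: "(nat, 'a::field) mpoly"
  assumes "frame n m w L" "vars_in {..m} f" "homogeneous e f" "phi m w y \<noteq> 0"
  shows "pl (phi m w y) \<in> Zset m w f \<longleftrightarrow> eval_mpoly f y = 0"
proof
  assume "pl (phi m w y) \<in> Zset m w f"
  then obtain y' where y': "pl (phi m w y) = pl (phi m w y')" "eval_mpoly f y' = 0" by (auto simp: Zset_def)
  obtain c where c: "\<And>i. i \<le> m \<Longrightarrow> y i = c * y' i" using pl_phi_eqE[OF assms(1) y'(1) assms(4)] by blast
  have "eval_mpoly f y = eval_mpoly f (\<lambda>i. c * y' i)" by (rule eval_mpoly_cong[OF assms(2)]) (simp add: c)
  then show "eval_mpoly f y = 0" using y'(2) by (simp add: eval_mpoly_smult[OF assms(3)])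
qed (use assms in \<open>auto simp: Zset_def\<close>)

lemma Zset_closed:
  fixes f :: "(nat, 'a::alg_closed_field) mpoly"
  assumes fr: "frame n m w L" and f: "vars_in {..m} f" "homogeneous e f"
  shows "closedin (zariski n) (Zset m w f)"
proof -
  \<comment> \<open>The equation of the hypersurface in the coordinates read off by
    \<open>L\<close>, together with the linear equations that put \<open>x\<close> into the range of
    \<open>phi m w\<close>.\<close>
  define G where "G = insert (\<lambda>x. eval_mpoly f (lc n L x)) ((\<lambda>j x. x j - phi m w (lc n L x) j) ` {..n})"
  have lcp: "pfun {..n} (\<lambda>x. lc n L x i)" for i
    unfolding lc_def by (intro pfun_sum pfun_mult pfun_const pfun_var) auto
  have lcs: "lc n L (\<lambda>i. c * x i) = (\<lambda>i. c * lc n L x i)" for c x by (simp add: lc_def sum_distrib_left mult_ac)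
  have "closedin (zariski n) {p \<in> proj_space n. \<forall>x\<in>p. \<forall>g\<in>G. g x = 0}"
  proof (rule closedin_pfun)
    fix g assume "g \<in> G"
    then consider "g = (\<lambda>x. eval_mpoly f (lc n L x))" | j where "j \<le> n" "g = (\<lambda>x. x j - phi m w (lc n L x) j)"
      unfolding G_def by auto
    then show "pfun {..n} g \<and> (\<exists>e. \<forall>c x. g (\<lambda>i. c * x i) = c ^ e * g x)"
    proof cases
      case 1
      have "pfun {..n} g" unfolding 1 by (rule pfun_compose[OF f(1) lcp])
      moreover have "g (\<lambda>i. c * x i) = c ^ e * g x" for c x unfolding 1 lcs by (rule eval_mpoly_smult[OF f(2)])
      ultimately show ?thesis by blast
    next
      case 2
      have "pfun {..n} g" unfolding 2(2) by (intro pfun_diff pfun_var pfun_phi lcp) (use 2 in simp)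
      moreover have "g (\<lambda>i. c * x i) = c ^ 1 * g x" for c x unfolding 2(2) lcs phi_scale by (simp add: algebra_simps)
      ultimately show ?thesis by blast
    qed
  qed
  moreover have "{p \<in> proj_space n. \<forall>x\<in>p. \<forall>g\<in>G. g x = 0} = Zset m w f"
  proof (intro equalityI subsetI)
    fix p assume "p \<in> {p \<in> proj_space n. \<forall>x\<in>p. \<forall>g\<in>G. g x = 0}"
    then have p: "p \<in> proj_space n" "\<And>x g. x \<in> p \<Longrightarrow> g \<in> G \<Longrightarrow> g x = 0" by auto
    obtain v where v: "v \<in> coord_space n" "v \<noteq> 0" "p = pl v" using p(1) by (rule proj_spaceE)
    have "v j = phi m w (lc n L v) j" for j
    proof (cases "j \<le> n")
      case True
      then show ?thesis using p(2)[of v "\<lambda>x. x j - phi m w (lc n L x) j"] v_in_pl[of v] unfolding v(3) G_def by auto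
    next
      case False
      then show ?thesis using v(1) phi_coord_space[OF fr, of "lc n L v"] by (simp add: coord_space_def)
    qed
    then have "v = phi m w (lc n L v)" by (rule ext)
    moreover have "eval_mpoly f (lc n L v) = 0"
      using p(2)[of v "\<lambda>x. eval_mpoly f (lc n L x)"] v_in_pl[of v] unfolding v(3) G_def by auto
    ultimately show "p \<in> Zset m w f" unfolding Zset_def v(3) using v(2)
      by (intro CollectI exI[of _ "lc n L v"]) simp
  next
    fix p assume "p \<in> Zset m w f"
    then obtain y where y: "p = pl (phi m w y)" "phi m w y \<noteq> 0" "eval_mpoly f y = 0" by (auto simp: Zset_def)
    have "g x = 0" if "x \<in> p" "g \<in> G" for x g
    proof -
      obtain c where c: "x = phi m w (\<lambda>i. c * y i)" using \<open>x \<in> p\<close> unfolding y(1) pl_eq by (auto simp: vscale_def phi_scale)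
      have l: "lc n L x i = c * y i" if "i \<le> m" for i unfolding c by (rule lc_phi[OF fr that])
      then have "phi m w (lc n L x) = x" unfolding c by (intro phi_cong) auto
      moreover have "eval_mpoly f (lc n L x) = eval_mpoly f (\<lambda>i. c * y i)" by (rule eval_mpoly_cong[OF f(1)]) (simp add: l)
      ultimately show ?thesis using \<open>g \<in> G\<close> y(3) unfolding G_def by (auto simp: eval_mpoly_smult[OF f(2)])
    qed
    then show "p \<in> {p \<in> proj_space n. \<forall>x\<in>p. \<forall>g\<in>G. g x = 0}"
      using pl_in_proj_space[OF phi_coord_space[OF fr] y(2)] y(1) by auto
  qed
  ultimately show ?thesis by simp
qed

lemma Zset_irreducible:
  fixes f :: "(nat, 'a::alg_closed_field) mpoly"
  assumes fr: "frame n m w L" and ne: "Zset m w f \<noteq> {}"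
    and pr: "\<And>g h. vars_in {..m} g \<Longrightarrow> vars_in {..m} h \<Longrightarrow>
      (\<And>y. eval_mpoly f y = 0 \<Longrightarrow> eval_mpoly g y * eval_mpoly h y = 0) \<Longrightarrow>
      (\<forall>y. eval_mpoly f y = 0 \<longrightarrow> eval_mpoly g y = 0) \<or> (\<forall>y. eval_mpoly f y = 0 \<longrightarrow> eval_mpoly h y = 0)"
  shows "irreducible_in (zariski n) (Zset m w f)"
proof (rule irreducible_inI)
  show "Zset m w f \<subseteq> proj_space n"
    unfolding Zset_def using pl_in_proj_space[OF phi_coord_space[OF fr]] by auto
  fix A B assume A: "A \<in> hom_polys n" and B: "B \<in> hom_polys n" and v: "van (A * B) (Zset m w f)"
  obtain a b where ab: "homogeneous a A" "homogeneous b B" using A B by (auto simp: hom_polys_def)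
  have P: "pfun {..m} (\<lambda>y. eval_mpoly C (phi m w y))" if "C \<in> hom_polys n" for C
    by (rule pfun_compose[of "{..n}"]) (use that in \<open>auto simp: hom_polys_def intro!: pfun_phi pfun_var\<close>)
  obtain g where g: "vars_in {..m} g" "\<And>y. eval_mpoly g y = eval_mpoly A (phi m w y)" using P[OF A] by (rule pfunE) blast
  obtain h where h: "vars_in {..m} h" "\<And>y. eval_mpoly h y = eval_mpoly B (phi m w y)" using P[OF B] by (rule pfunE) blast
  have AB: "eval_mpoly A (phi m w y) * eval_mpoly B (phi m w y) = 0" if "eval_mpoly f y = 0" "phi m w y \<noteq> 0" for y
  proof -
    have "pl (phi m w y) \<in> Zset m w f" using that by (auto simp: Zset_def)
    then have "eval_mpoly (A * B) (phi m w y) = 0" using v v_in_pl unfolding van_def by blast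
    then show ?thesis by (simp only: eval_mpoly_mult)
  qed
  \<comment> \<open>Primality is tested on the affine cone, which contains the origin. There a form
    vanishes unless its degree is zero, in which case it has the same value as at a point of the
    cone.\<close>
  have AB0: "eval_mpoly A 0 * eval_mpoly B 0 = 0"
  proof -
    obtain y where y: "eval_mpoly f y = 0" "phi m w y \<noteq> 0" using ne by (auto simp: Zset_def)
    have "eval_mpoly A (\<lambda>i. 0 * phi m w y i) = 0 ^ a * eval_mpoly A (phi m w y)"
      "eval_mpoly B (\<lambda>i. 0 * phi m w y i) = 0 ^ b * eval_mpoly B (phi m w y)"
      by (rule eval_mpoly_smult[OF ab(1)], rule eval_mpoly_smult[OF ab(2)])
    then show ?thesis using AB[OF y] by (auto simp: zero_fun_def)
  qed
  have "eval_mpoly g y * eval_mpoly h y = 0" if "eval_mpoly f y = 0" for y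
    unfolding g(2) h(2) using AB[OF that] AB0 by (cases "phi m w y = 0") auto
  then have or: "(\<forall>y. eval_mpoly f y = 0 \<longrightarrow> eval_mpoly g y = 0) \<or> (\<forall>y. eval_mpoly f y = 0 \<longrightarrow> eval_mpoly h y = 0)"
    by (rule pr[OF g(1) h(1)])
  have *: "van C (Zset m w f)" if C: "homogeneous c C" and z: "\<forall>y. eval_mpoly f y = 0 \<longrightarrow> eval_mpoly C (phi m w y) = 0" for C c
    unfolding van_def
  proof (intro ballI)
    fix p x assume "p \<in> Zset m w f" and x: "x \<in> p"
    then obtain y where y: "p = pl (phi m w y)" "eval_mpoly f y = 0" by (auto simp: Zset_def)
    then have "eval_mpoly C (phi m w y) = 0" using z by blast
    then show "eval_mpoly C x = 0" using van_pl[OF C, of "phi m w y"] x y(1) by blast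
  qed
  show "van A (Zset m w f) \<or> van B (Zset m w f)"
    using or *[OF ab(1)] *[OF ab(2)] unfolding g(2) h(2) by blast
qed (rule ne)

section \<open>Irreducible forms and coordinate hyperplanes\<close>

lemma MX_irreducible: "irreducible (MX i :: (nat, 'a::alg_closed_field) mpoly)"
proof (rule irreducibleI)
  have h: "homogeneous 1 (MX i :: (nat, 'a) mpoly)" by (simp add: MX_def homogeneous_def total_deg_single)
  have n0: "(MX i :: (nat, 'a) mpoly) \<noteq> 0"
  proof
    assume "(MX i :: (nat, 'a) mpoly) = 0"
    then have "eval_mpoly (MX i :: (nat, 'a) mpoly) (\<lambda>_. 1) = 0" by simp
    then show False by simp
  qed
  have deg: "mdeg (MX i :: (nat, 'a) mpoly) = 1" by (rule mdeg_homogeneous[OF h n0])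
  show "(MX i :: (nat, 'a) mpoly) \<noteq> 0" "\<not> (MX i :: (nat, 'a) mpoly) dvd 1" using n0 deg mpoly_unit_iff[of "MX i"] by auto
  fix a b :: "(nat, 'a) mpoly" assume ab: "MX i = a * b"
  then have ne: "a \<noteq> 0" "b \<noteq> 0" using n0 by auto
  then have "mdeg a + mdeg b = 1" using deg ab mdeg_mult by metis
  then show "a dvd 1 \<or> b dvd 1" using ne mpoly_unit_iff[of a] mpoly_unit_iff[of b] by auto
qed

lemma irreducible_dvd_cases:
  assumes "irreducible p" "irreducible q" "p dvd q" shows "q dvd (p :: 'b::comm_ring_1)"
proof -
  obtain h where h: "q = p * h" using assms(3) by (elim dvdE)
  then have "h dvd 1" using assms(1,2) by (auto simp: irreducible_def)
  then obtain u where "1 = h * u" by (elim dvdE)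
  then have "p = q * u" unfolding h by (metis mult.assoc mult.right_neutral)
  then show ?thesis by (rule dvdI)
qed

text \<open>Two variables that divide an irreducible polynomial would be associated to it and to
  each other. This supplies the hyperplane for the sections below.\<close>

lemma irreducible_not_dvd_MX:
  fixes f :: "(nat, 'a::alg_closed_field) mpoly"
  assumes "irreducible f" obtains i where "i \<le> 1" "\<not> MX i dvd f"
proof (cases "MX 0 dvd f")
  case True
  have "\<not> MX 1 dvd f"
  proof
    assume 1: "MX 1 dvd f"
    have "f dvd MX 0" using irreducible_dvd_cases[OF MX_irreducible assms True] .
    then obtain h where h: "(MX 0 :: (nat, 'a) mpoly) = MX 1 * h" using 1 by (meson dvdE dvd_trans)
    have "eval_mpoly (MX 0 :: (nat, 'a) mpoly) (\<lambda>j. if j = 0 then 1 else 0) = 0"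
      unfolding h eval_mpoly_mult by simp
    then show False by simp
  qed
  then show ?thesis using that[of 1] by simp
qed (use that[of 0] in simp)

lemma irreducible_zero_off_hyperplane:
  fixes f :: "(nat, 'a::alg_closed_field) mpoly"
  assumes "irreducible f" "vars_in {..m} f" "i \<le> m" "\<not> MX i dvd f"
  obtains y where "eval_mpoly f y = 0" "y i \<noteq> 0"
proof -
  have n: "\<not> f dvd MX i" using irreducible_dvd_cases[OF assms(1) MX_irreducible] assms(4) by blast
  obtain y where "eval_mpoly f y = 0" "eval_mpoly (MX i) y \<noteq> 0"
    by (rule irreducible_nullstellensatz[OF assms(1) _ assms(2) _ n]) (use assms(3) in auto)
  then show thesis using that by simp
qed

locale hyper =
  fixes n m :: nat and w L :: "nat \<Rightarrow> nat \<Rightarrow> 'a::alg_closed_field" and f :: "(nat, 'a) mpoly" and e :: nat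
  assumes fr: "frame n m w L" and m: "m \<ge> 1" and e: "e \<ge> 1"
    and f: "irreducible f" "vars_in {..m} f" "homogeneous e f"
begin

lemma Z_nonempty: "Zset m w f \<noteq> {}"
proof -
  obtain i where i: "i \<le> 1" "\<not> MX i dvd f" by (rule irreducible_not_dvd_MX[OF f(1)])
  have im: "i \<le> m" using i m by simp
  obtain y where y: "eval_mpoly f y = 0" "y i \<noteq> 0" by (rule irreducible_zero_off_hyperplane[OF f(1,2) im i(2)])
  then have "phi m w y \<noteq> 0" using phi_eq_0_iff[OF fr] im by blast
  then show ?thesis using y by (auto simp: Zset_def)
qed

lemma Z_irreducible: "irreducible_in (zariski n) (Zset m w f)"
proof (rule Zset_irreducible[OF fr Z_nonempty])
  fix g h :: "(nat, 'a) mpoly" assume v: "vars_in {..m} g" "vars_in {..m} h"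
    and z: "\<And>y. eval_mpoly f y = 0 \<Longrightarrow> eval_mpoly g y * eval_mpoly h y = 0"
  have "f dvd g * h"
  proof (rule ccontr)
    assume n: "\<not> f dvd g * h"
    obtain y where "eval_mpoly f y = 0" "eval_mpoly (g * h) y \<noteq> 0"
      by (rule irreducible_nullstellensatz[OF f(1) _ f(2) vars_in_mult[OF v] n]) simp
    then show False using z by (simp add: eval_mpoly_mult)
  qed
  then have "f dvd g \<or> f dvd h" by (rule irreducible_imp_prime_mpoly[OF f(1)])
  then show "(\<forall>y. eval_mpoly f y = 0 \<longrightarrow> eval_mpoly g y = 0) \<or> (\<forall>y. eval_mpoly f y = 0 \<longrightarrow> eval_mpoly h y = 0)"
    by (auto elim!: dvdE simp: eval_mpoly_mult)
qed

lemma Z_closed: "closedin (zariski n) (Zset m w f)"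
  by (rule Zset_closed[OF fr f(2,3)])

lemma f_0: "eval_mpoly f (\<lambda>i. 0) = 0"
  using eval_mpoly_smult[OF f(3), of 0 "\<lambda>i. 0"] e by (simp add: power_0_left)

lemma Z_proper: "Zset m w f \<subset> Zset m w 0"
proof
  show "Zset m w f \<subseteq> Zset m w 0" by (auto simp: Zset_def)
  have "f \<noteq> 0" using f(1) by auto
  then obtain y where y: "eval_mpoly f y \<noteq> 0" by (rule mpoly_nonroot)
  have "phi m w y \<noteq> 0"
  proof
    assume "phi m w y = 0"
    then have "eval_mpoly f y = eval_mpoly f (\<lambda>i. 0)"
      using phi_eq_0_iff[OF fr] by (intro eval_mpoly_cong[OF f(2)]) auto
    then show False using y f_0 by simp
  qed
  then have "pl (phi m w y) \<notin> Zset m w f" "pl (phi m w y) \<in> Zset m w 0"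
    using pl_phi_in_Zset[OF fr f(2,3)] y by (auto simp: Zset_def)
  then show "Zset m w f \<noteq> Zset m w 0" by blast
qed

lemma span_irreducible: "irreducible_in (zariski n) (Zset m w 0)"
proof (rule Zset_irreducible[OF fr])
  show "Zset m w 0 \<noteq> {}" using Z_nonempty Z_proper by blast
  fix g h :: "(nat, 'a) mpoly" assume z: "\<And>y. eval_mpoly 0 y = (0::'a) \<Longrightarrow> eval_mpoly g y * eval_mpoly h y = 0"
  have "g = 0 \<or> h = 0"
  proof (rule ccontr)
    assume "\<not> (g = 0 \<or> h = 0)"
    then have gh: "g \<noteq> 0" "h \<noteq> 0" by auto
    obtain y where "eval_mpoly g y \<noteq> 0" "eval_mpoly h y \<noteq> 0" by (rule mpoly_common_nonroot[OF gh])
    then show False using z[of y] by simp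
  qed
  then show "(\<forall>y. eval_mpoly 0 y = (0::'a) \<longrightarrow> eval_mpoly g y = 0) \<or> (\<forall>y. eval_mpoly 0 y = (0::'a) \<longrightarrow> eval_mpoly h y = 0)"
    by auto
qed

text \<open>The whole subspace \<open>Zset m w 0\<close> lengthens the chain by one, and
  \<open>zchain_length\<close> bounds the longer chain by \<open>m\<close>.\<close>

lemma chain_length: assumes "zchain n (Zset m w f) r Y" shows "r \<le> m - 1"
proof -
  have "closedin (zariski n) (Zset m w 0)" by (rule Zset_closed[OF fr, of _ 0]) (auto simp: homogeneous_def)
  then have "zchain n (Zset m w 0) (Suc r) (Y(Suc r := Zset m w 0))"
    by (rule zchain_snoc[OF assms _ span_irreducible Z_proper])
  moreover have "\<Union>(Zset m w 0) \<subseteq> range (phi m w)"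
  proof
    fix x assume "x \<in> \<Union>(Zset m w 0)"
    then obtain y where "x \<in> pl (phi m w y)" by (auto simp: Zset_def)
    then obtain c where "x = phi m w (\<lambda>i. c * y i)" by (auto simp: pl_eq vscale_def phi_scale)
    then show "x \<in> range (phi m w)" by blast
  qed
  ultimately have "Suc r \<le> m" by (rule zchain_length)
  then show ?thesis by simp
qed

end

section \<open>Sections by coordinate hyperplanes\<close>

definition skip :: "nat \<Rightarrow> nat \<Rightarrow> nat" where
  "skip i j = (if j < i then j else Suc j)"

lemma skip_neq [simp]: "skip i j \<noteq> i" "i \<noteq> skip i j" by (auto simp: skip_def)
lemma skip_inj: "skip i j = skip i j' \<longleftrightarrow> j = j'" by (auto simp: skip_def)
lemma skip_le: "j \<le> m \<Longrightarrow> skip i j \<le> Suc m" by (auto simp: skip_def)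

definition ins :: "nat \<Rightarrow> (nat \<Rightarrow> 'a::zero) \<Rightarrow> nat \<Rightarrow> 'a" where
  "ins i y j = (if j = i then 0 else y (if j < i then j else j - 1))"

lemma ins_skip [simp]: "ins i y (skip i j) = y j" and ins_same [simp]: "ins i y i = 0"
  by (auto simp: ins_def skip_def)

lemma phi_ins:
  assumes "i \<le> Suc m" shows "phi (Suc m) w (ins i y) = phi m (\<lambda>j. w (skip i j)) y"
proof
  fix v
  have im: "{..Suc m} = insert i (skip i ` {..m})"
  proof (intro equalityI subsetI)
    fix j assume "j \<in> {..Suc m}"
    then have "j = i \<or> j = skip i (if j < i then j else j - 1) \<and> (if j < i then j else j - 1) \<le> m"
      using assms by (auto simp: skip_def)
    then show "j \<in> insert i (skip i ` {..m})" by blast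
  qed (use assms skip_le in auto)
  have "phi (Suc m) w (ins i y) v = (\<Sum>j\<in>skip i ` {..m}. ins i y j * w j v)"
    unfolding phi_def im by (subst sum.insert) auto
  also have "\<dots> = phi m (\<lambda>j. w (skip i j)) y v"
    unfolding phi_def by (subst sum.reindex) (auto simp: inj_on_def skip_inj)
  finally show "phi (Suc m) w (ins i y) v = phi m (\<lambda>j. w (skip i j)) y v" .
qed

text \<open>As \<open>MX i\<close> does not divide \<open>f\<close>, the restriction of
  \<open>f\<close> to the hyperplane \<open>y i = 0\<close> is nonzero, and \<open>f\<close> has a
  zero off the hyperplane. So any irreducible factor of the restriction defines a hypersurface in a
  subspace of one dimension less, properly contained in the given one.\<close>

lemma (in hyper) section_factor:
  assumes m2: "m = Suc m'" "m' \<ge> 1" and i: "i \<le> 1" "\<not> MX i dvd f"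
  obtains g d where "hyper n m' (\<lambda>j. w (skip i j)) (\<lambda>j. L (skip i j)) g d" "Zset m' (\<lambda>j. w (skip i j)) g \<subset> Zset m w f"
proof -
  have im: "i \<le> m" "i \<le> Suc m'" using i m m2 by auto
  have P: "pfun {..m'} (\<lambda>y. eval_mpoly f (ins i y))"
  proof (rule pfun_compose[OF f(2)])
    fix v assume v: "v \<in> {..m}"
    show "pfun {..m'} (\<lambda>y. ins i y v)"
    proof (cases "v = i")
      case True then show ?thesis by (simp add: ins_def pfun_const)
    next
      case False
      then have "(if v < i then v else v - 1) \<le> m'" using v m2 im by auto
      then show ?thesis using False by (simp add: ins_def pfun_var)
    qed
  qed
  have insc: "ins i (\<lambda>j. c * y j) = (\<lambda>j. c * ins i y j)" for c :: 'a and y by (auto simp: ins_def)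
  have "eval_mpoly f (ins i (\<lambda>j. c * y j)) = c ^ e * eval_mpoly f (ins i y)" for c y
    unfolding insc by (rule eval_mpoly_smult[OF f(3)])
  note hp = hom_poly_of_pfun[OF P this]
  obtain f' where f': "vars_in {..m'} f'" "homogeneous e f'" "\<And>y. eval_mpoly f' y = eval_mpoly f (ins i y)"
    by (rule hp) (rule that)
  have "f' \<noteq> 0"
  proof -
    obtain y where y: "eval_mpoly (MX i) y = 0" "eval_mpoly f y \<noteq> 0"
      by (rule irreducible_nullstellensatz[OF MX_irreducible _ _ f(2) i(2)]) (use im in auto)
    have "ins i (\<lambda>j. y (skip i j)) = y" using y(1) by (auto simp: ins_def skip_def fun_eq_iff)
    then have "eval_mpoly f' (\<lambda>j. y (skip i j)) \<noteq> 0" using y(2) f'(3) by simp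
    then show ?thesis by auto
  qed
  moreover have "\<not> f' dvd 1" using mdeg_homogeneous[OF f'(2) \<open>f' \<noteq> 0\<close>] e mpoly_unit_iff[of f'] by simp
  ultimately obtain M where M: "\<forall>p\<in>#M. irreducible p" "prod_mset M = f'" using irreducible_factorization_ex by blast
  have "M \<noteq> {#}" using M \<open>\<not> f' dvd 1\<close> by auto
  then obtain g where g: "g \<in># M" by blast
  then have gi: "irreducible g" using M(1) by blast
  have "g dvd f'" using g M(2) by (metis dvd_prod_mset)
  then obtain h where h: "f' = g * h" by (elim dvdE)
  have vg: "vars_in {..m'} g" using vars_in_factor f'(1) \<open>f' \<noteq> 0\<close> unfolding h by blast
  have hg: "homogeneous (mdeg g) g" using homogeneous_factor f'(2) \<open>f' \<noteq> 0\<close> unfolding h by blast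
  have "mdeg g \<ge> 1" using gi mpoly_unit_iff[of g] by (auto simp: irreducible_def)
  moreover have fr': "frame n m' (\<lambda>j. w (skip i j)) (\<lambda>j. L (skip i j))"
    using fr skip_le[of _ m' i] unfolding frame_def m2(1) by (simp add: skip_inj)
  ultimately have 1: "hyper n m' (\<lambda>j. w (skip i j)) (\<lambda>j. L (skip i j)) g (mdeg g)"
    using m2(2) gi vg hg by unfold_locales auto
  have ph: "phi m' (\<lambda>j. w (skip i j)) y = phi m w (ins i y)" for y
    unfolding m2(1) by (rule phi_ins[OF im(2), symmetric])
  have sub: "Zset m' (\<lambda>j. w (skip i j)) g \<subseteq> Zset m w f"
  proof
    fix p assume "p \<in> Zset m' (\<lambda>j. w (skip i j)) g"
    then obtain y where y: "p = pl (phi m w (ins i y))" "phi m w (ins i y) \<noteq> 0" "eval_mpoly g y = 0"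
      unfolding Zset_def ph by blast
    have "eval_mpoly f (ins i y) = 0" unfolding f'(3)[symmetric] h eval_mpoly_mult using y(3) by simp
    then show "p \<in> Zset m w f" using y by (auto simp: Zset_def)
  qed
  obtain y where y: "eval_mpoly f y = 0" "y i \<noteq> 0" by (rule irreducible_zero_off_hyperplane[OF f(1,2) im(1) i(2)])
  have y0: "phi m w y \<noteq> 0" using y(2) im(1) phi_eq_0_iff[OF fr] by blast
  have "pl (phi m w y) \<notin> Zset m' (\<lambda>j. w (skip i j)) g"
  proof
    assume "pl (phi m w y) \<in> Zset m' (\<lambda>j. w (skip i j)) g"
    then obtain y' where y': "pl (phi m w y) = pl (phi m w (ins i y'))" unfolding Zset_def ph by blast
    obtain c where "\<And>j. j \<le> m \<Longrightarrow> y j = c * ins i y' j" using pl_phi_eqE[OF fr y' y0] by blast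
    then show False using y(2) im(1) by fastforce
  qed
  moreover have "pl (phi m w y) \<in> Zset m w f" using y y0 by (auto simp: Zset_def)
  ultimately have "Zset m' (\<lambda>j. w (skip i j)) g \<subset> Zset m w f" using sub by blast
  with 1 show thesis by (rule that)
qed

lemma hyper_chain: "hyper n m w L f e \<Longrightarrow> \<exists>Y. zchain n (Zset m w f) (m - 1) Y"
proof (induction m arbitrary: w L f e)
  case 0 then show ?case by (simp add: hyper_def)
next
  case (Suc m')
  interpret hyper n "Suc m'" w L f e by fact
  show ?case
  proof (cases "m' = 0")
    case True
    then have "zchain n (Zset (Suc m') w f) (Suc m' - 1) (\<lambda>_. Zset (Suc m') w f)"
      unfolding zchain_def using Z_closed Z_irreducible by simp
    then show ?thesis by blast
  next
    case False
    then have m': "m' \<ge> 1" by simp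
    obtain i where i: "i \<le> 1" "\<not> MX i dvd f" by (rule irreducible_not_dvd_MX[OF f(1)])
    obtain g d where g: "hyper n m' (\<lambda>j. w (skip i j)) (\<lambda>j. L (skip i j)) g d" "Zset m' (\<lambda>j. w (skip i j)) g \<subset> Zset (Suc m') w f"
      by (rule section_factor[OF refl m' i])
    obtain Y where "zchain n (Zset m' (\<lambda>j. w (skip i j)) g) (m' - 1) Y" using Suc.IH[OF g(1)] by blast
    then have "zchain n (Zset (Suc m') w f) (Suc (m' - 1)) (Y(Suc (m' - 1) := Zset (Suc m') w f))"
      using g(2) by (intro zchain_snoc Z_closed Z_irreducible)
    then show ?thesis using m' by auto
  qed
qed

lemma (in hyper) dim_Z: "proj_dim n (Zset m w f) = ereal (real (m - 1))"
proof (rule antisym)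
  show "proj_dim n (Zset m w f) \<le> ereal (real (m - 1))" by (rule proj_dim_le) (rule chain_length)
  obtain Y where "zchain n (Zset m w f) (m - 1) Y" using hyper_chain[OF hyper_axioms] by blast
  then show "ereal (real (m - 1)) \<le> proj_dim n (Zset m w f)" by (rule proj_dim_ge)
qed

section \<open>Restriction of a polynomial to a line\<close>

definition lin :: "(nat, 'a::alg_closed_field) mpoly \<Rightarrow> (nat \<Rightarrow> 'a) \<Rightarrow> (nat \<Rightarrow> 'a) \<Rightarrow> 'a poly" where
  "lin f z q = (SOME p. \<forall>t. poly p t = eval_mpoly f (\<lambda>v. z v + t * q v))"

lemma poly_lin [simp]: "poly (lin f z q) t = eval_mpoly f (\<lambda>v. z v + t * q v)"
  using someI_ex[OF eval_line_poly[of f z q]] unfolding lin_def by simp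

lemma poly_ext:
  fixes p p' :: "'a::alg_closed_field poly"
  assumes "\<And>t. poly p t = poly p' t" shows "p = p'"
  using poly_nonroot[of "p - p'"] assms by (metis diff_eq_diff_eq diff_self poly_diff right_minus_eq)

lemma lin_eqI: "(\<And>t. poly p t = eval_mpoly f (\<lambda>v. z v + t * q v)) \<Longrightarrow> lin f z q = p"
  by (rule poly_ext) simp

lemma lin_hom:
  "lin (MC c) z q = [:c:]" "lin (MX v) z q = [:z v, q v:]"
  "lin (f + g) z q = lin f z q + lin g z q" "lin (f * g) z q = lin f z q * lin g z q"
  by (rule lin_eqI, simp add: eval_mpoly_hom)+

lemma lin_cong:
  assumes "vars_in I f" "\<And>i. i \<in> I \<Longrightarrow> z i = z' i" "\<And>i. i \<in> I \<Longrightarrow> q i = q' i"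
  shows "lin f z q = lin f z' q'"
  by (rule lin_eqI) (auto intro: eval_mpoly_cong[OF assms(1)] simp: assms(2,3))

lemma pfun_lin:
  assumes "vars_in J f" "\<And>i. i \<in> J \<Longrightarrow> pfun I (\<lambda>x. b x i)" "\<And>i. i \<in> J \<Longrightarrow> pfun I (\<lambda>x. a x i)"
  shows "pfun I (\<lambda>x. coeff (lin f (b x) (a x)) k)"
  using assms(1)
proof (induction arbitrary: k rule: mpoly_ring_induct)
  case (var v)
  consider "k = 0" | "k = 1" | j where "k = Suc (Suc j)" by (cases k; cases "k - 1") auto
  then show ?case by cases (use var assms(2,3) in \<open>simp_all add: lin_hom pfun_const\<close>)
next
  case (mult f g) then show ?case by (auto simp: lin_hom coeff_mult intro!: pfun_sum pfun_mult)
qed (auto simp: lin_hom pfun_const intro: pfun_add)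

lemma prod_linear_coeff:
  fixes a b :: "nat \<Rightarrow> 'a::comm_ring_1"
  shows "degree (\<Prod>r<e. [:a r, b r:]) \<le> e \<and> coeff (\<Prod>r<e. [:a r, b r:]) e = (\<Prod>r<e. b r)"
proof (induction e)
  case (Suc e)
  let ?P = "\<Prod>r<e. [:a r, b r:]"
  have "degree (?P * [:a e, b e:]) \<le> degree ?P + degree [:a e, b e:]" by (rule degree_mult_le)
  also have "\<dots> \<le> Suc e" using Suc by (simp add: add_mono_thms_linordered_semiring(1) split: if_splits)
  finally have 1: "degree (?P * [:a e, b e:]) \<le> Suc e" .
  have "coeff (?P * [:a e, b e:]) (Suc e) = coeff ?P (Suc e) * a e + coeff ?P e * b e"
    by (simp add: mult.commute coeff_pCons)
  also have "coeff ?P (Suc e) = 0" using Suc by (intro coeff_eq_0) simp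
  finally show ?case using 1 Suc by simp
qed simp

lemma lin_homogeneous:
  assumes "homogeneous e f"
  shows "degree (lin f z q) \<le> e" "coeff (lin f z q) e = eval_mpoly f q"
proof -
  have eq: "lin f z q = (\<Sum>a\<in>Poly_Mapping.keys f. Polynomial.smult (Poly_Mapping.lookup f a) (\<Prod>r<e. [:z (wd a r), q (wd a r):]))"
  proof (rule lin_eqI)
    fix t
    show "poly (\<Sum>a\<in>Poly_Mapping.keys f. Polynomial.smult (Poly_Mapping.lookup f a) (\<Prod>r<e. [:z (wd a r), q (wd a r):])) t
        = eval_mpoly f (\<lambda>v. z v + t * q v)"
      using assms by (simp add: poly_sum poly_prod eval_mpoly_def eval_monom_wd homogeneous_def)
  qed
  show "degree (lin f z q) \<le> e" unfolding eq
    by (intro degree_sum_le) (auto intro: order_trans[OF degree_smult_le] simp: prod_linear_coeff)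
  show "coeff (lin f z q) e = eval_mpoly f q"
    unfolding eq using assms by (simp add: coeff_sum prod_linear_coeff eval_mpoly_def eval_monom_wd homogeneous_def)
qed

section \<open>Directional derivatives and separability\<close>

definition unit :: "nat \<Rightarrow> nat \<Rightarrow> 'a::zero_neq_one" where
  "unit i = (\<lambda>j. if j = i then 1 else 0)"

text \<open>The derivative of \<open>f\<close> at \<open>z\<close> in the direction
  \<open>q\<close>, as a coefficient, so that it has its meaning in every characteristic.\<close>

definition dd :: "(nat, 'a::alg_closed_field) mpoly \<Rightarrow> (nat \<Rightarrow> 'a) \<Rightarrow> (nat \<Rightarrow> 'a) \<Rightarrow> 'a" where
  "dd f z q = coeff (lin f z q) 1"

lemma coeff_lin_0: "coeff (lin f z q) 0 = eval_mpoly f z"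
  using poly_lin[of f z q 0] by (simp add: poly_0_coeff_0)

lemma dd_linear:
  assumes "vars_in {..m} f" shows "dd f z q = (\<Sum>i\<le>m. q i * dd f z (unit i))"
  using assms
proof (induction rule: mpoly_ring_induct)
  case (const c) then show ?case by (simp add: dd_def lin_hom)
next
  case (var v)
  then show ?case by (simp add: dd_def lin_hom unit_def if_distrib[of "\<lambda>x. _ * x"] cong: if_cong)
next
  case (add f g) then show ?case unfolding dd_def lin_hom by (simp add: algebra_simps sum.distrib)
next
  case (mult f g)
  have *: "dd (f * g) z q = eval_mpoly f z * dd g z q + dd f z q * eval_mpoly g z" for q
    unfolding dd_def lin_hom One_nat_def coeff_mult by (simp add: coeff_lin_0)
  show ?case unfolding * mult by (simp add: algebra_simps sum.distrib sum_distrib_left)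
qed

text \<open>This is the Euler operator of variable \<open>i\<close>. Unlike the partial derivative
  it preserves monomials and only multiplies each by its exponent, so its vanishing can be read off
  coefficient by coefficient.\<close>

lemma euler_dd:
  "dd f z (\<lambda>j. if j = i then z i else 0)
    = (\<Sum>a\<in>Poly_Mapping.keys f. Poly_Mapping.lookup f a * of_nat (Poly_Mapping.lookup a i) * eval_monom a z)"
proof -
  have m: "eval_monom a (\<lambda>j. z j + t * (if j = i then z i else 0)) = (1 + t) ^ Poly_Mapping.lookup a i * eval_monom a z" for a t
  proof -
    have "eval_monom a (\<lambda>j. z j + t * (if j = i then z i else 0))
        = (\<Prod>j\<in>insert i (Poly_Mapping.keys a). (if j = i then (1 + t) ^ Poly_Mapping.lookup a i else 1) * z j ^ Poly_Mapping.lookup a j)"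
      by (subst eval_monom_superset[of "insert i (Poly_Mapping.keys a)"])
        (auto intro!: prod.cong simp: power_mult_distrib[symmetric] algebra_simps)
    also have "\<dots> = (1 + t) ^ Poly_Mapping.lookup a i * eval_monom a z"
      by (subst eval_monom_superset[of "insert i (Poly_Mapping.keys a)" a z]) (auto simp: prod.distrib)
    finally show ?thesis .
  qed
  have "lin f z (\<lambda>j. if j = i then z i else 0)
      = (\<Sum>a\<in>Poly_Mapping.keys f. Polynomial.smult (Poly_Mapping.lookup f a * eval_monom a z) ([:1, 1:] ^ Poly_Mapping.lookup a i))"
    by (rule lin_eqI) (simp add: poly_sum poly_power eval_mpoly_def m mult_ac)
  moreover have "coeff ([:1, 1:] ^ k) (Suc 0) = (of_nat k :: 'a)" for k
  proof (induction k)
    case (Suc k)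
    have "coeff ([:1, 1:] ^ k) 0 = (1 :: 'a)" by (simp add: poly_0_coeff_0[symmetric] poly_power)
    then show ?case using Suc by (simp add: coeff_pCons)
  qed simp
  ultimately show ?thesis by (simp add: dd_def coeff_sum mult_ac)
qed

text \<open>Divide all exponents by \<open>p\<close>, take \<open>p\<close>-th roots of the
  coefficients in the algebraically closed field, and use that the \<open>p\<close>-th power is
  additive.\<close>

lemma frobenius_root:
  fixes f :: "(nat, 'a::alg_closed_field) mpoly"
  assumes p: "p = CHAR('a)" "p > 0" and d: "\<And>a i. a \<in> Poly_Mapping.keys f \<Longrightarrow> p dvd Poly_Mapping.lookup a i"
  obtains g where "f = g ^ p"
proof -
  have pp: "prime CHAR('a)" using prime_CHAR_semidom[where ?'a = 'a] p by simp
  have "\<forall>a. \<exists>c. c ^ p = Poly_Mapping.lookup f a" using nth_root_exists[OF p(2)] by blast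
  then obtain c where c: "\<And>a. c a ^ p = Poly_Mapping.lookup f a" by metis
  define r where "r a = (\<Sum>i\<in>Poly_Mapping.keys a. Poly_Mapping.single i (Poly_Mapping.lookup a i div p))" for a :: "nat \<Rightarrow>\<^sub>0 nat"
  have lk: "Poly_Mapping.lookup (r a) i = Poly_Mapping.lookup a i div p" for a i
    by (auto simp: r_def lookup_sum lookup_single when_def in_keys_iff)
  define g where "g = (\<Sum>a\<in>Poly_Mapping.keys f. Poly_Mapping.single (r a) (c a))"
  have "f = g ^ p"
  proof (rule mpoly_eqI)
    fix x :: "nat \<Rightarrow> 'a"
    have mon: "eval_monom (r a) x ^ p = eval_monom a x" if a: "a \<in> Poly_Mapping.keys f" for a
    proof -
      have "eval_monom (r a) x = (\<Prod>i\<in>Poly_Mapping.keys a. x i ^ (Poly_Mapping.lookup a i div p))"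
        by (subst eval_monom_superset[of "Poly_Mapping.keys a"]) (auto simp: lk in_keys_iff intro!: gr0I)
      then show ?thesis unfolding eval_monom_def using d[OF a]
        by (simp add: prod_power_distrib power_mult[symmetric])
    qed
    have "eval_mpoly (g ^ p) x = (\<Sum>a\<in>Poly_Mapping.keys f. c a * eval_monom (r a) x) ^ p"
      by (simp add: g_def eval_mpoly_power eval_mpoly_sum eval_mpoly_single)
    also have "\<dots> = (\<Sum>a\<in>Poly_Mapping.keys f. (c a * eval_monom (r a) x) ^ p)"
      by (rule freshmans_dream_sum[OF pp p(1)])
    also have "\<dots> = eval_mpoly f x"
      by (simp add: power_mult_distrib c mon eval_mpoly_def)
    finally show "eval_mpoly f x = eval_mpoly (g ^ p) x" by simp
  qed
  then show thesis by (rule that)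
qed

text \<open>
  If all partial derivatives vanish, then the Euler operators show that all exponents are divisible
  by the characteristic, and the polynomial is a power of another one.
\<close>

lemma irreducible_separable:
  fixes f :: "(nat, 'a::alg_closed_field) mpoly"
  assumes f: "irreducible f" "vars_in {..m} f"
  obtains z i where "i \<le> m" "dd f z (unit i) \<noteq> 0"
proof -
  have "\<exists>z. \<exists>i\<le>m. dd f z (unit i) \<noteq> 0"
  proof (rule ccontr)
    assume "\<not> ?thesis"
    then have z: "dd f z (unit i) = 0" if "i \<le> m" for z i using that by blast
    have of0: "of_nat (Poly_Mapping.lookup a i) = (0 :: 'a)" if a: "a \<in> Poly_Mapping.keys f" for a i
    proof -
      define E where "E = (\<Sum>a\<in>Poly_Mapping.keys f. Poly_Mapping.single a (Poly_Mapping.lookup f a * of_nat (Poly_Mapping.lookup a i)))"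
      have "E = 0"
      proof (rule mpoly_eqI)
        fix x
        have "eval_mpoly E x = dd f x (\<lambda>j. if j = i then x i else 0)"
          by (simp add: E_def eval_mpoly_sum eval_mpoly_single euler_dd)
        also have "\<dots> = 0" by (subst dd_linear[OF f(2)]) (simp add: z)
        finally show "eval_mpoly E x = eval_mpoly 0 x" by simp
      qed
      moreover have "Poly_Mapping.lookup E a = Poly_Mapping.lookup f a * of_nat (Poly_Mapping.lookup a i)"
        using a by (simp add: E_def lookup_sum lookup_single when_def)
      ultimately show ?thesis using a by (simp add: in_keys_iff)
    qed
    have nu: "\<not> f dvd 1" "f \<noteq> 0" using f(1) by (auto simp: irreducible_def)
    have "\<exists>a\<in>Poly_Mapping.keys f. a \<noteq> 0"
    proof (rule ccontr)
      assume "\<not> ?thesis"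
      then have "homogeneous 0 f" by (auto simp: homogeneous_def total_deg_0_iff)
      then show False using nu mdeg_homogeneous[of 0 f] mpoly_unit_iff[of f] by simp
    qed
    then obtain a i where a: "a \<in> Poly_Mapping.keys f" "Poly_Mapping.lookup a i \<noteq> 0"
      by (metis lookup_zero poly_mapping_eqI)
    define p where "p = CHAR('a)"
    have dv: "p dvd Poly_Mapping.lookup a i" if "a \<in> Poly_Mapping.keys f" for a i
      using of0[OF that] unfolding p_def of_nat_eq_0_iff_char_dvd .
    then have p0: "p > 0" using a by (metis dvd_0_left gr0I)
    obtain g where g: "f = g ^ p" using frobenius_root[OF p_def p0 dv] by blast
    have "prime p" using prime_CHAR_semidom[where ?'a = 'a] p0 unfolding p_def by simp
    then have "p \<ge> 2" by (rule prime_ge_2_nat)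
    then have fg: "f = g * g ^ (p - 1)" "g dvd g ^ (p - 1)" unfolding g by (auto simp: power_eq_if intro: dvd_power)
    have "g dvd 1 \<or> g ^ (p - 1) dvd 1" using f(1) fg(1) unfolding irreducible_def by blast
    then have "g dvd 1" using fg(2) dvd_trans by blast
    then have "f dvd 1" unfolding g using dvd_power_same[of g 1 p] by simp
    then show False using nu(1) by simp
  qed
  then show thesis using that by blast
qed

section \<open>Change of frame\<close>

text \<open>Converts coordinates for the basis in which \<open>w i\<close> is replaced by the vector
  with coordinates \<open>q\<close> into coordinates for \<open>w\<close>; this is invertible if
  \<open>q i\<close> is nonzero. Two such exchanges move a chosen direction and a chosen point to
  the first two basis vectors.\<close>

definition tr :: "nat \<Rightarrow> (nat \<Rightarrow> 'a::field) \<Rightarrow> (nat \<Rightarrow> 'a) \<Rightarrow> nat \<Rightarrow> 'a" where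
  "tr i q y = (\<lambda>j. if j = i then q i * y i else y j + q j * y i)"

definition trinv :: "nat \<Rightarrow> (nat \<Rightarrow> 'a::field) \<Rightarrow> (nat \<Rightarrow> 'a) \<Rightarrow> nat \<Rightarrow> 'a" where
  "trinv i q y = (\<lambda>j. if j = i then y i / q i else y j - q j * (y i / q i))"

lemma tr_trinv: "q i \<noteq> 0 \<Longrightarrow> tr i q (trinv i q y) = y" and trinv_tr: "q i \<noteq> 0 \<Longrightarrow> trinv i q (tr i q y) = y"
  by (auto simp: tr_def trinv_def fun_eq_iff)

lemma tr_scale: "tr i q (\<lambda>j. c * y j) = (\<lambda>j. c * tr i q y j)"
  by (auto simp: tr_def fun_eq_iff algebra_simps)

definition mtr :: "nat \<Rightarrow> (nat \<Rightarrow> nat \<Rightarrow> 'a::field) \<Rightarrow> nat \<Rightarrow> (nat \<Rightarrow> 'a) \<Rightarrow> nat \<Rightarrow> nat \<Rightarrow> 'a" where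
  "mtr m w i q = w(i := phi m w q)"

lemma phi_mtr:
  assumes "i \<le> m" shows "phi m (mtr m w i q) y = phi m w (tr i q y)"
proof
  fix v
  have s: "(\<Sum>j\<le>m. g j) = g i + (\<Sum>j\<in>{..m} - {i}. g j)" for g :: "nat \<Rightarrow> 'a" using assms by (simp add: sum.remove)
  have "phi m (mtr m w i q) y v = y i * (\<Sum>j\<le>m. q j * w j v) + (\<Sum>j\<in>{..m} - {i}. y j * w j v)"
    unfolding phi_def s[of "\<lambda>j. y j * _ j v"] by (simp add: mtr_def phi_def)
  also have "\<dots> = phi m w (tr i q y) v"
    unfolding phi_def tr_def s by (simp add: algebra_simps sum.distrib sum_distrib_left)
  finally show "phi m (mtr m w i q) y v = phi m w (tr i q y) v" .
qed

lemma frame_mtr: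
  assumes fr: "frame n m w L" and i: "i \<le> m" "q i \<noteq> 0"
  shows "frame n m (mtr m w i q) (\<lambda>j c. if j = i then L i c / q i else L j c - q j / q i * L i c)"
  unfolding frame_def
proof (intro conjI allI impI)
  fix k assume "k \<le> m"
  then show "mtr m w i q k \<in> coord_space n"
    using fr phi_coord_space[OF fr, of q] by (simp add: mtr_def frame_def)
next
  fix j k assume jk: "j \<le> m" "k \<le> m"
  have d: "(\<Sum>c\<le>n. L a c * w b c) = (if a = b then 1 else 0)" if "a \<le> m" "b \<le> m" for a b using fr that by (simp add: frame_def)
  have ph: "(\<Sum>c\<le>n. L a c * phi m w q c) = q a" if "a \<le> m" for a using lc_phi[OF fr that, of q] by (simp add: lc_def)
  have "(\<Sum>c\<le>n. (if j = i then L i c / q i else L j c - q j / q i * L i c) * x c)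
      = (if j = i then (\<Sum>c\<le>n. L i c * x c) / q i else (\<Sum>c\<le>n. L j c * x c) - q j / q i * (\<Sum>c\<le>n. L i c * x c))" for x
    by (auto simp: sum_divide_distrib sum_subtractf sum_distrib_left algebra_simps)
  then show "(\<Sum>c\<le>n. (if j = i then L i c / q i else L j c - q j / q i * L i c) * mtr m w i q k c) = (if j = k then 1 else 0)"
    using jk i by (cases "k = i") (auto simp: mtr_def d ph)
qed

lemma Zset_mtr:
  assumes "i \<le> m" "q i \<noteq> 0" "\<And>y. eval_mpoly f' y = eval_mpoly f (tr i q y)"
  shows "Zset m (mtr m w i q) f' = Zset m w f"
proof -
  have "Zset m (mtr m w i q) f' = {pl (phi m w (tr i q y)) | y. phi m w (tr i q y) \<noteq> 0 \<and> eval_mpoly f (tr i q y) = 0}"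
    unfolding Zset_def phi_mtr[OF assms(1)] assms(3) ..
  also have "\<dots> = Zset m w f"
    unfolding Zset_def using tr_trinv[of q i, OF assms(2)] by (auto, metis)
  finally show ?thesis .
qed

lemma pfun_tr: "i \<le> m \<Longrightarrow> v \<le> m \<Longrightarrow> pfun {..m} (\<lambda>y. tr i q y v)"
  and pfun_trinv: "i \<le> m \<Longrightarrow> v \<le> m \<Longrightarrow> pfun {..m} (\<lambda>y. trinv i q y v)"
proof -
  assume iv: "i \<le> m" "v \<le> m"
  have "pfun {..m} (\<lambda>y. q v * y i)" "pfun {..m} (\<lambda>y. y v + q v * y i)"
    by (intro pfun_add pfun_mult pfun_const pfun_var; use iv in simp)+
  then show "pfun {..m} (\<lambda>y. tr i q y v)" unfolding tr_def by (cases "v = i") simp_all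
  have "pfun {..m} (\<lambda>y. inverse (q i) * y i)" "pfun {..m} (\<lambda>y. y v - q v * (inverse (q i) * y i))"
    by (intro pfun_diff pfun_mult pfun_const pfun_var; use iv in simp)+
  then show "pfun {..m} (\<lambda>y. trinv i q y v)" unfolding trinv_def by (cases "v = i") (simp_all add: field_simps)
qed

lemma subst_tr:
  fixes f :: "(nat, 'a::alg_closed_field) mpoly"
  assumes "i \<le> m" "vars_in {..m} f" "homogeneous e f"
  obtains f' where "vars_in {..m} f'" "homogeneous e f'" "\<And>y. eval_mpoly f' y = eval_mpoly f (tr i q y)"
proof -
  have P: "pfun {..m} (\<lambda>y. eval_mpoly f (tr i q y))" by (rule pfun_compose[OF assms(2)]) (simp add: pfun_tr assms(1))
  have "eval_mpoly f (tr i q (\<lambda>j. c * y j)) = c ^ e * eval_mpoly f (tr i q y)" for c y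
    unfolding tr_scale by (rule eval_mpoly_smult[OF assms(3)])
  note hp = hom_poly_of_pfun[OF P this]
  show thesis by (rule hp) (rule that)
qed

lemma irreducible_subst:
  fixes f f' :: "(nat, 'a::alg_closed_field) mpoly"
  assumes i: "i \<le> m" "q i \<noteq> 0" and f: "irreducible f" "vars_in {..m} f" and f': "vars_in {..m} f'"
    and ev: "\<And>y. eval_mpoly f' y = eval_mpoly f (tr i q y)"
  shows "irreducible f'"
proof (rule irreducibleI)
  have f0: "f \<noteq> 0" and fu: "\<not> f dvd 1" using f(1) by (auto simp: irreducible_def)
  have ev': "eval_mpoly f y = eval_mpoly f' (trinv i q y)" for y unfolding ev tr_trinv[of q i, OF i(2)] ..
  have const: "g dvd 1" if g: "g \<noteq> 0" "\<And>y. eval_mpoly g y = c" for g :: "(nat, 'a) mpoly" and c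
  proof -
    have "g = MC c" by (rule mpoly_eqI) (simp add: g(2))
    then show ?thesis using g(1) mpoly_unit_iff[of g] by simp
  qed
  show f'0: "f' \<noteq> 0"
  proof
    assume "f' = 0"
    then have "f = 0" by (intro mpoly_eqI) (simp add: ev')
    then show False using f0 by simp
  qed
  show "\<not> f' dvd 1"
  proof
    assume "f' dvd 1"
    then obtain c where "f' = MC c" by (rule mpoly_unitE)
    then have "f dvd 1" using const[OF f0, of c] ev' by simp
    then show False using fu by simp
  qed
  fix a b assume ab: "f' = a * b"
  have va: "vars_in {..m} a" "vars_in {..m} b"
    using vars_in_factor[of "{..m}" a b] vars_in_factor[of "{..m}" b a] f' f'0 by (simp_all add: ab mult.commute)
  have "pfun {..m} (\<lambda>y. eval_mpoly a (trinv i q y))" by (rule pfun_compose[OF va(1)]) (simp add: pfun_trinv i)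
  then obtain a' where a': "\<And>y. eval_mpoly a' y = eval_mpoly a (trinv i q y)" by (rule pfunE) blast
  have "pfun {..m} (\<lambda>y. eval_mpoly b (trinv i q y))" by (rule pfun_compose[OF va(2)]) (simp add: pfun_trinv i)
  then obtain b' where b': "\<And>y. eval_mpoly b' y = eval_mpoly b (trinv i q y)" by (rule pfunE) blast
  have "f = a' * b'" by (rule mpoly_eqI) (simp add: eval_mpoly_mult a' b' ev' ab)
  then have or: "a' dvd 1 \<or> b' dvd 1" using f(1) by (auto simp: irreducible_def)
  have *: "g dvd 1" if g': "g' dvd 1" and e: "\<And>y. eval_mpoly g' y = eval_mpoly g (trinv i q y)" and g0: "g \<noteq> 0" for g g' :: "(nat, 'a) mpoly"
  proof -
    obtain c where c: "g' = MC c" using g' by (rule mpoly_unitE)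
    have "eval_mpoly g y = c" for y using e[of "tr i q y"] unfolding trinv_tr[of q i, OF i(2)] c by simp
    then show ?thesis by (rule const[OF g0])
  qed
  have "a \<noteq> 0" "b \<noteq> 0" using f'0 ab by auto
  then show "a dvd 1 \<or> b dvd 1" using or *[of a' a] *[of b' b] a' b' by blast
qed

section \<open>Degree\<close>

lemma degree_pderiv_le: "degree (pderiv p) \<le> degree p - 1"
  by (rule degree_le) (auto simp: coeff_pderiv coeff_eq_0)

lemma eval_mpoly_of_nat [simp]: "eval_mpoly (of_nat k) x = of_nat k"
  and vars_in_of_nat [simp]: "vars_in I (of_nat k)"
  by (induction k) (auto simp: eval_mpoly_add intro: vars_in_add)

lemma pderiv_ev_poly: "pderiv (ev_poly z P) = ev_poly z (pderiv P)"
  by (rule poly_eqI) (simp add: coeff_pderiv eval_mpoly_hom)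

lemma dd_mpoly:
  fixes f :: "(nat, 'a::alg_closed_field) mpoly"
  assumes "vars_in {..m} f" "i \<le> m" "dd f z (unit i) \<noteq> 0"
  obtains D where "D \<noteq> 0" "\<And>q. eval_mpoly D q = dd f z q"
proof -
  define D where "D = (\<Sum>i\<le>m. MX i * MC (dd f z (unit i)))"
  have D: "eval_mpoly D q = dd f z q" for q
    by (subst dd_linear[OF assms(1)]) (simp add: D_def eval_mpoly_hom)
  then have "D \<noteq> 0" using assms(3) by auto
  then show thesis using D by (rule that)
qed

text \<open>The derivative has smaller degree in \<open>v\<close>. That it is nonzero has to be
  assumed, since this can fail in positive characteristic.\<close>

lemma not_dvd_pderiv:
  fixes f :: "(nat, 'a::alg_closed_field) mpoly"
  assumes P: "coeffs_in I P" "f = poly P (MX v)" "v \<notin> I" "pderiv P \<noteq> 0"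
  shows "\<not> f dvd poly (pderiv P) (MX v)"
proof
  assume "f dvd poly (pderiv P) (MX v)"
  then obtain h where h: "poly (pderiv P) (MX v) = f * h" by (elim dvdE)
  have cp: "coeffs_in I (pderiv P)" using P(1) unfolding coeffs_in_def coeff_pderiv
    by (auto intro!: vars_in_mult vars_in_of_nat simp del: of_nat_Suc)
  have ne: "poly (pderiv P) (MX v) \<noteq> 0"
    using poly_rep_unique[OF cp coeffs_in_0 P(3)] P(4) by auto
  have "vars_in (insert v I) (h * f)"
    using vars_in_poly[OF cp, of "insert v I" "MX v"] by (auto simp: h mult.commute)
  then have "vars_in (insert v I) h" using ne unfolding h by (intro vars_in_factor[of _ h f]) (auto simp: mult.commute)
  then obtain H where H: "coeffs_in I H" "h = poly H (MX v)" using poly_rep_ex[of v I h] by auto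
  have "coeffs_in I (P * H)" using P(1) H(1) unfolding coeffs_in_def coeff_mult by (auto intro!: vars_in_intros)
  then have eq: "pderiv P = P * H" by (rule poly_rep_unique[OF cp _ P(3)]) (simp add: h P(2) H(2))
  then have PH: "P \<noteq> 0" "H \<noteq> 0" using P(4) by auto
  have "degree P \<noteq> 0" using P(4) by (metis degree_eq_zeroE pderiv_pCons pderiv_0 add_0 pCons_0_0)
  then have "degree (pderiv P) < degree P" using degree_pderiv_le[of P] by simp
  moreover have "degree (P * H) = degree P + degree H" by (rule degree_mult_eq[OF PH])
  ultimately show False using eq by simp
qed

lemma lin_unit_0:
  assumes "coeffs_in I P" "0 \<notin> I"
  shows "lin (poly P (MX 0)) z (unit 0) = pcompose (ev_poly z P) [:z 0, 1:]"
proof (rule lin_eqI)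
  fix t
  have "ev_poly (\<lambda>v. z v + t * unit 0 v) P = ev_poly z P"
    by (rule ev_poly_cong[OF assms(1)]) (use assms(2) in \<open>auto simp: unit_def\<close>)
  then show "poly (pcompose (ev_poly z P) [:z 0, 1:]) t = eval_mpoly (poly P (MX 0)) (\<lambda>v. z v + t * unit 0 v)"
    by (simp add: eval_poly poly_pcompose unit_def)
qed

text \<open>
  Eliminating the first variable between \<open>f\<close> and its derivative yields a line in the direction of the
  first unit vector on which \<open>f\<close> has only simple roots.
\<close>

context hyper
begin

lemma separable_frame:
  obtains w' L' f' where "frame n m w' L'" "vars_in {..m} f'" "homogeneous e f'" "Zset m w' f' = Zset m w f"
    "eval_mpoly f' (unit 0) \<noteq> 0"
    "\<And>s. poly (lin f' (unit 1) (unit 0)) s = 0 \<Longrightarrow> poly (pderiv (lin f' (unit 1) (unit 0))) s \<noteq> 0"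
proof -
  have f0: "f \<noteq> 0" using f(1) by auto
  obtain z0 i where i: "i \<le> m" "dd f z0 (unit i) \<noteq> 0" by (rule irreducible_separable[OF f(1,2)])
  obtain D where D: "D \<noteq> 0" "\<And>q. eval_mpoly D q = dd f z0 q" by (rule dd_mpoly[OF f(2) i]) auto
  have X: "MX j \<noteq> (0 :: (nat, 'a) mpoly)" for j using MX_irreducible[of j, where 'a = 'a] by (auto simp: irreducible_def)
  \<comment> \<open>The direction \<open>q\<close> needs \<open>f(q)\<close> nonzero, a nonzero
    derivative of \<open>f\<close> at \<open>z0\<close> along \<open>q\<close>, and
    \<open>q 0\<close> nonzero in order to replace the first basis vector.\<close>
  have "D * MX 0 \<noteq> 0" using D(1) X by simp
  then obtain q where q: "eval_mpoly f q \<noteq> 0" "eval_mpoly (D * MX 0) q \<noteq> 0" by (rule mpoly_common_nonroot[OF f0])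
  then have q': "dd f z0 q \<noteq> 0" "q 0 \<noteq> 0" by (auto simp: eval_mpoly_mult D(2))
  obtain f1 where f1: "vars_in {..m} f1" "homogeneous e f1" "\<And>y. eval_mpoly f1 y = eval_mpoly f (tr 0 q y)"
    by (rule subst_tr[OF le0 f(2,3), where q = q]) (rule that)
  have irr1: "irreducible f1" by (rule irreducible_subst[OF le0 q'(2) f(1,2) f1(1,3)])
  have tru: "tr 0 q (\<lambda>v. y v + t * unit 0 v) = (\<lambda>v. tr 0 q y v + t * q v)" for y t
    by (auto simp: tr_def unit_def fun_eq_iff algebra_simps)
  have lin1: "lin f1 y (unit 0) = lin f (tr 0 q y) q" for y by (rule lin_eqI) (simp add: f1(3) tru)
  have "tr 0 q (unit 0) = q" by (auto simp: tr_def unit_def fun_eq_iff)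
  then have u1: "eval_mpoly f1 (unit 0) \<noteq> 0" using q(1) f1(3) by simp
  have ins: "insert 0 {1..m} = {..m}" by auto
  obtain P where P: "coeffs_in {1..m} P" "f1 = poly P (MX 0)" using poly_rep_ex[of 0 "{1..m}" f1] f1(1) unfolding ins by auto
  \<comment> \<open>By the choice of \<open>q\<close>, the derivative of \<open>f1\<close> in the
    first variable is nonzero at \<open>trinv 0 q z0\<close>.\<close>
  have P': "pderiv P \<noteq> 0"
  proof
    assume "pderiv P = 0"
    then have "pderiv (lin f1 y (unit 0)) = 0" for y
      unfolding P(2) lin_unit_0[OF P(1), simplified] pderiv_pcompose pderiv_ev_poly by simp
    then have "coeff (pderiv (lin f1 (trinv 0 q z0) (unit 0))) 0 = 0" by simp
    then show False using q'(1) unfolding lin1 tr_trinv[of q 0, OF q'(2)] by (simp add: coeff_pderiv dd_def)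
  qed
  have nv: "\<not> vars_in {1..m} f1"
  proof
    assume "vars_in {1..m} f1"
    then have "eval_mpoly f1 (unit 0) = eval_mpoly f1 (\<lambda>i. 0 * 0)" by (rule eval_mpoly_cong) (auto simp: unit_def)
    also have "\<dots> = 0" using e by (simp only: eval_mpoly_smult[OF f1(2)]) (simp add: power_0_left)
    finally show False using u1 by simp
  qed
  have cp: "coeffs_in {1..m} (pderiv P)" using P(1) unfolding coeffs_in_def coeff_pderiv
    by (auto intro!: vars_in_mult vars_in_of_nat simp del: of_nat_Suc)
  define g where "g = poly (pderiv P) (MX 0)"
  have vg: "vars_in {..m} g" unfolding g_def by (rule vars_in_poly[OF cp]) auto
  have nd: "\<not> f1 dvd g" unfolding g_def by (rule not_dvd_pderiv[OF P _ P']) simp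
  have "\<exists>r \<alpha> \<beta>. r \<noteq> 0 \<and> vars_in {1..m} r \<and> r = \<alpha> * f1 + \<beta> * g"
  proof (rule elimination[OF euclid_on_finite _ irr1 _ nv _ nd])
    show "vars_in (insert 0 {1..m}) f1" "vars_in (insert 0 {1..m}) g" unfolding ins by (rule f1(1), rule vg)
  qed auto
  then obtain r \<alpha> \<beta> where r: "r \<noteq> 0" "vars_in {1..m} r" "r = \<alpha> * f1 + \<beta> * g" by blast
  \<comment> \<open>The eliminant \<open>r\<close> is free of the first variable, hence constant and
    nonzero on the line through \<open>z\<close> in the direction of the first basis vector; so
    \<open>f1\<close> and its derivative have no common root on it. \<open>z 1\<close> must be
    nonzero for \<open>z\<close> to become the second basis vector.\<close>
  obtain z1 where z1: "eval_mpoly r z1 \<noteq> 0" "eval_mpoly (MX 1) z1 \<noteq> 0" by (rule mpoly_common_nonroot[OF r(1) X])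
  define z where "z = z1(0 := 0)"
  have z: "z 1 \<noteq> 0" "z 0 = 0" using z1(2) by (auto simp: z_def)
  have rz: "eval_mpoly r (z(0 := s)) \<noteq> 0" for s
    using z1(1) eval_mpoly_cong[OF r(2), of "z(0 := s)" z1] by (simp add: z_def)
  have linz: "lin f1 z (unit 0) = ev_poly z P"
    using lin_unit_0[OF P(1), of z] unfolding P(2) z(2) by (simp add: pcompose_idR)
  have sep: "poly (pderiv (lin f1 z (unit 0))) s \<noteq> 0" if "poly (lin f1 z (unit 0)) s = 0" for s
  proof
    assume "poly (pderiv (lin f1 z (unit 0))) s = 0"
    then have 1: "poly (ev_poly z P) s = 0" "poly (ev_poly z (pderiv P)) s = 0"
      using that unfolding linz pderiv_ev_poly by auto
    have "ev_poly (z(0 := s)) Q = ev_poly z Q" if "coeffs_in {1..m} Q" for Q by (rule ev_poly_cong[OF that]) auto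
    then have "eval_mpoly f1 (z(0 := s)) = 0" "eval_mpoly g (z(0 := s)) = 0"
      unfolding P(2) g_def eval_poly using 1 P(1) cp by simp_all
    then have "eval_mpoly r (z(0 := s)) = 0" by (simp add: r(3) eval_mpoly_hom)
    then show False using rz by simp
  qed
  obtain f2 where f2: "vars_in {..m} f2" "homogeneous e f2" "\<And>y. eval_mpoly f2 y = eval_mpoly f1 (tr 1 z y)"
    by (rule subst_tr[OF m f1(1,2), where q = z]) (rule that)
  have tru2: "tr 1 z (\<lambda>v. unit 1 v + t * unit 0 v) = (\<lambda>v. z v + t * unit 0 v)" "tr 1 z (unit 0) = unit 0" for t
    by (auto simp: tr_def unit_def fun_eq_iff z)
  have lin2: "lin f2 (unit 1) (unit 0) = lin f1 z (unit 0)" by (rule lin_eqI) (simp only: poly_lin f2(3) tru2)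
  note fr1 = frame_mtr[of n m w L 0 q, OF fr le0 q'(2)]
  note fr2 = frame_mtr[of n m _ _ 1 z, OF fr1 m z(1)]
  have Z: "Zset m (mtr m (mtr m w 0 q) 1 z) f2 = Zset m w f"
    using Zset_mtr[of 1 m z f2 f1, OF m z(1) f2(3)] Zset_mtr[of 0 m q f1 f, OF le0 q'(2) f1(3)] by simp
  show thesis
    by (rule that[OF fr2 f2(1,2) Z]) (use u1 sep in \<open>simp_all only: f2(3) lin2 tru2 not_False_eq_True\<close>)
qed

end

section \<open>Simple roots and the Sylvester determinant\<close>

lemma card_simple_roots:
  fixes p :: "'a::alg_closed_field poly"
  assumes "p \<noteq> 0" "\<And>s. poly p s = 0 \<Longrightarrow> poly (pderiv p) s \<noteq> 0"
  shows "card {s. poly p s = 0} = degree p"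
  using assms
proof (induction "degree p" arbitrary: p)
  case 0
  then obtain c where "p = [:c:]" "c \<noteq> 0" by (metis degree_eq_zeroE pCons_0_0)
  then show ?case by simp
next
  case (Suc k)
  obtain a where a: "poly p a = 0" using alg_closed_imp_poly_has_root[of p] Suc by auto
  then obtain q where q: "p = [:- a, 1:] * q" by (metis dvdE poly_eq_0_iff_dvd)
  have q0: "q \<noteq> 0" using Suc.prems(1) q by auto
  have "degree p = Suc (degree q)" using q0 unfolding q by (subst degree_mult_eq) auto
  have d: "pderiv p = [:- a, 1:] * pderiv q + q" unfolding q pderiv_mult by (simp add: pderiv_pCons)
  have "poly q a \<noteq> 0" using Suc.prems(2)[OF a] by (simp add: d)
  have "card {s. poly q s = 0} = degree q"
  proof (rule Suc.hyps(1))
    show "k = degree q" using Suc.hyps(2) \<open>degree p = Suc (degree q)\<close> by simp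
    fix s assume s: "poly q s = 0"
    then have "poly p s = 0" by (simp add: q)
    then have "poly (pderiv p) s \<noteq> 0" by (rule Suc.prems(2))
    then show "poly (pderiv q) s \<noteq> 0" using s unfolding d by auto
  qed (rule q0)
  moreover have "{s. poly p s = 0} = insert a {s. poly q s = 0}" by (auto simp: q)
  ultimately show ?case using \<open>poly q a \<noteq> 0\<close> \<open>degree p = Suc (degree q)\<close> poly_roots_finite[OF q0] by simp
qed

text \<open>The Sylvester determinant of \<open>p\<close> and its derivative, formed as if \<open>p\<close> had degree \<open>e\<close>.\<close>

definition sylrow :: "nat \<Rightarrow> 'a::idom poly \<Rightarrow> nat \<Rightarrow> 'a poly" where
  "sylrow e p i = (if i < e - 1 then monom 1 i * p else monom 1 (i - (e - 1)) * pderiv p)"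

definition sylv :: "nat \<Rightarrow> 'a::idom poly \<Rightarrow> 'a" where
  "sylv e p = dt (2 * e - 1) (\<lambda>i c. coeff (sylrow e p i) c)"

lemma sylrow_ge: "sylrow e p (i + (e - 1)) = monom 1 i * pderiv p"
  by (simp add: sylrow_def del: One_nat_def)

lemma degree_sylrow:
  assumes "e \<ge> 1" "degree p \<le> e" "i < 2 * e - 1" shows "degree (sylrow e p i) < 2 * e - 1"
proof (cases "i < e - 1")
  case True
  have "degree (monom 1 i * p) \<le> i + degree p"
    by (rule order_trans[OF degree_mult_le]) (simp add: degree_monom_le)
  then show ?thesis using True assms by (simp add: sylrow_def)
next
  case False
  have "degree (monom 1 (i - (e - 1)) * pderiv p) \<le> (i - (e - 1)) + degree (pderiv p)"
    by (rule order_trans[OF degree_mult_le]) (simp add: degree_monom_le)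
  then have "degree (sylrow e p i) \<le> (i - (e - 1)) + (degree p - 1)"
    using False degree_pderiv_le[of p] unfolding sylrow_def by (simp only: if_False)
  then show ?thesis using False assms by linarith
qed

text \<open>A common root \<open>s\<close> puts the vector of powers of \<open>s\<close>, whose
  first entry is \<open>1\<close>, into the kernel of the matrix. The first row of the adjugate
  turns this into a vanishing determinant.\<close>

lemma sylv_common_root:
  fixes p :: "'a::field poly"
  assumes "e \<ge> 1" "degree p \<le> e" "sylv e p \<noteq> 0" "poly p s = 0"
  shows "poly (pderiv p) s \<noteq> 0"
proof
  assume "poly (pderiv p) s = 0"
  let ?N = "2 * e - 1" and ?M = "\<lambda>i c. coeff (sylrow e p i) c"
  have N: "0 < ?N" using assms(1) by simp
  have "(\<Sum>c<?N. ?M i c * s ^ c) = 0" if i: "i < ?N" for i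
  proof -
    have "poly (sylrow e p i) s = (\<Sum>c<?N. ?M i c * s ^ c)"
      unfolding poly_altdef using degree_sylrow[OF assms(1,2) i]
      by (intro sum.mono_neutral_left) (auto simp: coeff_eq_0)
    moreover have "poly (sylrow e p i) s = 0" using assms(4) \<open>poly (pderiv p) s = 0\<close> by (simp add: sylrow_def)
    ultimately show ?thesis by simp
  qed
  then have "0 = (\<Sum>i<?N. adjf ?N ?M 0 i * (\<Sum>c<?N. ?M i c * s ^ c))" by simp
  also have "\<dots> = (\<Sum>c<?N. (\<Sum>i<?N. adjf ?N ?M 0 i * ?M i c) * s ^ c)"
    unfolding sum_distrib_left sum_distrib_right mult.assoc by (rule sum.swap)
  also have "\<dots> = (\<Sum>c<?N. (if 0 = c then dt ?N ?M else 0) * s ^ c)"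
    by (intro sum.cong refl arg_cong2[where f = "(*)"] adjf_left N) simp
  also have "\<dots> = sylv e p" using N by (simp add: sylv_def if_distrib[of "\<lambda>x. x * _"] cong: if_cong)
  finally show False using assms(3) by simp
qed

text \<open>A vanishing determinant yields \<open>u * p + v * pderiv p = 0\<close> with
  \<open>degree v < e\<close> and not all coefficients zero. At the \<open>e\<close> simple roots of
  \<open>p\<close> the polynomial \<open>v\<close> has to vanish, so \<open>v = 0\<close> and then
  \<open>u = 0\<close>.\<close>

lemma sylv_nonzero:
  fixes p :: "'a::alg_closed_field poly"
  assumes e: "e \<ge> 1" and p: "degree p = e" and sep: "\<And>s. poly p s = 0 \<Longrightarrow> poly (pderiv p) s \<noteq> 0"
  shows "sylv e p \<noteq> 0"
proof
  let ?N = "2 * e - 1"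
  have p0: "p \<noteq> 0" using e p by auto
  assume "sylv e p = 0"
  then obtain y where y: "\<exists>i<?N. y i \<noteq> 0" "\<And>c. c < ?N \<Longrightarrow> (\<Sum>i<?N. y i * coeff (sylrow e p i) c) = 0"
    unfolding sylv_def by (rule dt_zero_kernel) blast
  define u where "u = (\<Sum>i<e - 1. monom (y i) i)"
  define v where "v = (\<Sum>i<e. monom (y (i + (e - 1))) i)"
  have split: "{..<?N} = {..<e - 1} \<union> {e - 1..<e + (e - 1)}" using e by auto
  have "(\<Sum>i<?N. Polynomial.smult (y i) (sylrow e p i)) = u * p + v * pderiv p"
  proof -
    have "(\<Sum>i<?N. Polynomial.smult (y i) (sylrow e p i))
      = (\<Sum>i<e - 1. Polynomial.smult (y i) (sylrow e p i)) + (\<Sum>i\<in>{e - 1..<e + (e - 1)}. Polynomial.smult (y i) (sylrow e p i))"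
      unfolding split by (rule sum.union_disjoint) auto
    also have "(\<Sum>i<e - 1. Polynomial.smult (y i) (sylrow e p i)) = u * p"
      unfolding u_def sum_distrib_right by (intro sum.cong refl) (simp add: sylrow_def smult_monom flip: mult_smult_left)
    also have "(\<Sum>i\<in>{e - 1..<e + (e - 1)}. Polynomial.smult (y i) (sylrow e p i)) = (\<Sum>i\<in>{0..<e}. Polynomial.smult (y (i + (e - 1))) (sylrow e p (i + (e - 1))))"
      using sum.shift_bounds_nat_ivl[of _ 0 "e - 1" e] by simp
    also have "\<dots> = v * pderiv p"
      unfolding v_def sum_distrib_right lessThan_atLeast0
      unfolding sylrow_ge by (intro sum.cong refl) (simp add: smult_monom flip: mult_smult_left)
    finally show ?thesis .
  qed
  moreover have "(\<Sum>i<?N. Polynomial.smult (y i) (sylrow e p i)) = 0"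
  proof (rule poly_eqI)
    fix c
    show "coeff (\<Sum>i<?N. Polynomial.smult (y i) (sylrow e p i)) c = coeff 0 c"
    proof (cases "c < ?N")
      case True then show ?thesis using y(2) by (simp add: coeff_sum)
    next
      case False
      then have "coeff (sylrow e p i) c = 0" if "i < ?N" for i
        using degree_sylrow[OF e _ that, of p] p by (intro coeff_eq_0) simp
      then show ?thesis by (simp add: coeff_sum)
    qed
  qed
  ultimately have uv: "u * p + v * pderiv p = 0" by simp
  have "v = 0"
  proof (rule ccontr)
    assume v0: "v \<noteq> 0"
    have "{s. poly p s = 0} \<subseteq> {s. poly v s = 0}"
    proof safe
      fix s assume s: "poly p s = 0"
      have "poly (u * p + v * pderiv p) s = 0" unfolding uv by simp
      then show "poly v s = 0" using s sep[OF s] by simp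
    qed
    then have "e \<le> card {s. poly v s = 0}"
      using card_mono[OF poly_roots_finite[OF v0]] card_simple_roots[OF p0 sep] p by metis
    also have "\<dots> \<le> degree v" by (rule card_poly_roots_bound[OF v0])
    also have "degree v \<le> e - 1" unfolding v_def
      by (intro degree_sum_le) (auto intro: order_trans[OF degree_monom_le])
    finally show False using e by simp
  qed
  then have "u = 0" using uv p0 by simp
  have cu: "coeff u i = y i" if "i < e - 1" for i using that by (simp add: u_def coeff_sum)
  have cv: "coeff v i = y (i + (e - 1))" if "i < e" for i using that by (simp add: v_def coeff_sum)
  have "y i = 0" if i: "i < ?N" for i
  proof (cases "i < e - 1")
    case True then show ?thesis using cu \<open>u = 0\<close> by auto
  next
    case False then show ?thesis using cv[of "i - (e - 1)"] i \<open>v = 0\<close> by simp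
  qed
  then show False using y(1) by blast
qed

lemma pfun_sylv:
  assumes "\<And>k. pfun I (\<lambda>x. coeff (p x) k)" shows "pfun I (\<lambda>x. sylv e (p x))"
  unfolding sylv_def
proof (rule pfun_dt)
  fix i c
  have *: "pfun I (\<lambda>x. coeff (monom 1 j * q x) c)" if "\<And>k. pfun I (\<lambda>x. coeff (q x) k)" for j q
    using that by (cases "c < j") (simp_all add: coeff_monom_mult pfun_const)
  have "pfun I (\<lambda>x. coeff (pderiv (p x)) k)" for k
    unfolding coeff_pderiv by (intro pfun_mult pfun_const assms)
  then show "pfun I (\<lambda>x. coeff (sylrow e (p x) i) c)"
    using *[of p] *[of "\<lambda>x. pderiv (p x)"] assms by (cases "i < e - 1") (simp_all add: sylrow_def)
qed

section \<open>Linear algebra of the coordinate space and kernels of linear forms\<close>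

lemma unit_coord_space: "j \<le> n \<Longrightarrow> unit j \<in> coord_space n"
  by (auto simp: unit_def coord_space_def)

lemma coord_space_expand:
  assumes "x \<in> coord_space n" shows "x = (\<Sum>j\<le>n. vscale (x j) (unit j))"
  using assms by (auto simp: fun_eq_iff vscale_def unit_def coord_space_def sum_fun_apply if_distrib[of "\<lambda>x. _ * x"] cong: if_cong)

lemma independent_units: "vec.independent (unit ` {..n} :: (nat \<Rightarrow> 'a::field) set)" (is "vec.independent (?U n)")
  and inj_unit: "inj_on (unit :: nat \<Rightarrow> nat \<Rightarrow> 'a) A"
proof -
  show inj: "inj_on (unit :: nat \<Rightarrow> nat \<Rightarrow> 'a) A" for A
    by (rule inj_onI) (metis unit_def zero_neq_one)
  show "vec.independent (?U n)"
  proof (induction n)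
    case 0
    have "(unit 0 :: nat \<Rightarrow> 'a) \<noteq> 0" by (auto simp: unit_def fun_eq_iff)
    then show ?case by simp
  next
    case (Suc n)
    have "?U n \<subseteq> coord_space n" using unit_coord_space by blast
    then have "vec.span (?U n) \<subseteq> coord_space n" by (rule vec.span_minimal[OF _ coord_space_subspace])
    moreover have "(unit (Suc n) :: nat \<Rightarrow> 'a) \<notin> coord_space n" by (auto simp: unit_def coord_space_def)
    ultimately have "unit (Suc n) \<notin> vec.span (?U n)" by blast
    then show ?case using Suc by (simp add: atMost_Suc vec.independent_insertI)
  qed
qed

lemma span_units: "vec.span (unit ` {..n}) = (coord_space n :: (nat \<Rightarrow> 'a::field) set)"
proof
  show "vec.span (unit ` {..n}) \<subseteq> (coord_space n :: (nat \<Rightarrow> 'a) set)"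
    using unit_coord_space by (intro vec.span_minimal[OF _ coord_space_subspace]) auto
  show "(coord_space n :: (nat \<Rightarrow> 'a) set) \<subseteq> vec.span (unit ` {..n})"
  proof
    fix x :: "nat \<Rightarrow> 'a" assume "x \<in> coord_space n"
    have "(\<Sum>j\<le>n. vscale (x j) (unit j)) \<in> vec.span (unit ` {..n})"
      by (intro vec.span_sum vec.span_scale vec.span_base) auto
    then show "x \<in> vec.span (unit ` {..n})" using coord_space_expand[OF \<open>x \<in> coord_space n\<close>] by simp
  qed
qed

lemma dim_coord_space: "vec.dim (coord_space n :: (nat \<Rightarrow> 'a::field) set) = n + 1"
proof -
  have "vec.dim (coord_space n :: (nat \<Rightarrow> 'a) set) = card (unit ` {..n} :: (nat \<Rightarrow> 'a) set)"
    unfolding span_units[symmetric] by (rule vec.dim_span_eq_card_independent[OF independent_units])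
  then show ?thesis by (simp add: card_image[OF inj_unit])
qed

lemma independent_coord_space:
  assumes "vec.independent B" "B \<subseteq> (coord_space n :: (nat \<Rightarrow> 'a::field) set)"
  shows "finite B" "card B \<le> n + 1"
  using vec.independent_span_bound[of "unit ` {..n}" B] assms span_units[of n, where 'a = 'a]
    card_image[OF inj_unit[where 'a = 'a], of "{..n}"] by auto

lemma kernel_space_subspace: "vec.subspace (kernel_space n c A)"
  unfolding kernel_space_def
  by (auto simp: vec.subspace_def coord_space_def vscale_def algebra_simps sum.distrib simp flip: sum_distrib_left)

text \<open>\<open>bm\<close> is the matrix of the restriction of the linear forms \<open>A\<close> to the range of \<open>phi\<close>; \<open>ya\<close>
  parametrizes by two coordinates the kernel of this restriction, with denominators \<open>dl\<close> cleared.\<close>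

definition bm :: "nat \<Rightarrow> (nat \<Rightarrow> nat \<Rightarrow> 'a::field) \<Rightarrow> (nat \<times> nat \<Rightarrow> 'a) \<Rightarrow> nat \<Rightarrow> nat \<Rightarrow> 'a" where
  "bm n w A r i = (\<Sum>j\<le>n. A (r, j) * w i j)"

definition dl :: "nat \<Rightarrow> nat \<Rightarrow> (nat \<Rightarrow> nat \<Rightarrow> 'a::field) \<Rightarrow> (nat \<times> nat \<Rightarrow> 'a) \<Rightarrow> 'a" where
  "dl n c w A = dt c (\<lambda>r l. bm n w A r (2 + l))"

definition ya :: "nat \<Rightarrow> nat \<Rightarrow> (nat \<Rightarrow> nat \<Rightarrow> 'a::field) \<Rightarrow> (nat \<times> nat \<Rightarrow> 'a) \<Rightarrow> 'a \<Rightarrow> 'a \<Rightarrow> nat \<Rightarrow> 'a" where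
  "ya n c w A s t i = (if i = 0 then dl n c w A * s else if i = 1 then dl n c w A * t
     else - (\<Sum>r<c. adjf c (\<lambda>r l. bm n w A r (2 + l)) (i - 2) r * (s * bm n w A r 0 + t * bm n w A r 1)))"

lemma sum_two: "(\<Sum>i\<le>Suc c. g i) = g 0 + g 1 + (\<Sum>l<c. g (2 + l))"
  by (simp add: sum.atMost_Suc_shift lessThan_Suc_atMost[symmetric] sum.lessThan_Suc_shift algebra_simps del: sum.lessThan_Suc)

lemma ya_kernel:
  assumes r: "r < c" shows "(\<Sum>i\<le>Suc c. bm n w A r i * ya n c w A s t i) = 0"
proof -
  let ?b = "bm n w A" and ?J = "adjf c (\<lambda>r l. bm n w A r (2 + l))"
  have "(\<Sum>l<c. ?b r (2 + l) * ya n c w A s t (2 + l)) = - (\<Sum>l<c. \<Sum>r'<c. ?b r (2 + l) * (?J l r' * (s * ?b r' 0 + t * ?b r' 1)))"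
    by (simp add: ya_def sum_distrib_left sum_negf)
  also have "\<dots> = - (\<Sum>r'<c. (\<Sum>l<c. ?b r (2 + l) * ?J l r') * (s * ?b r' 0 + t * ?b r' 1))"
    by (subst sum.swap) (simp add: sum_distrib_right mult.assoc)
  also have "\<dots> = - (\<Sum>r'<c. (if r = r' then dl n c w A else 0) * (s * ?b r' 0 + t * ?b r' 1))"
    unfolding dl_def using adjf_right[OF r, of _ "\<lambda>r l. bm n w A r (2 + l)"] by (intro arg_cong[of _ _ uminus] sum.cong refl) simp
  also have "\<dots> = - (dl n c w A * (s * ?b r 0 + t * ?b r 1))"
    using r by (simp add: if_distrib[of "\<lambda>x. x * _"] cong: if_cong)
  finally have s: "(\<Sum>l<c. ?b r (2 + l) * ya n c w A s t (2 + l)) = - (dl n c w A * (s * ?b r 0 + t * ?b r 1))" .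
  show ?thesis unfolding sum_two s by (simp add: ya_def algebra_simps)
qed

lemma ya_complete:
  assumes y: "\<And>r. r < c \<Longrightarrow> (\<Sum>i\<le>Suc c. bm n w A r i * y i) = 0" and i: "i \<le> Suc c"
  shows "dl n c w A * y i = ya n c w A (y 0) (y 1) i"
proof -
  let ?b = "bm n w A" and ?J = "adjf c (\<lambda>r l. bm n w A r (2 + l))"
  consider "i = 0" | "i = 1" | l where "i = 2 + l" "l < c" using i by (cases i; cases "i - 1") auto
  then show ?thesis
  proof cases
    case 3
    have *: "y 0 * ?b r 0 + y 1 * ?b r 1 = - (\<Sum>k<c. ?b r (2 + k) * y (2 + k))" if "r < c" for r
      using y[OF that] unfolding sum_two by (simp add: eq_neg_iff_add_eq_0 algebra_simps)
    have "ya n c w A (y 0) (y 1) i = - (\<Sum>r<c. ?J l r * (y 0 * ?b r 0 + y 1 * ?b r 1))"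
      by (simp add: ya_def 3)
    also have "\<dots> = - (\<Sum>r<c. ?J l r * - (\<Sum>k<c. ?b r (2 + k) * y (2 + k)))"
      by (intro arg_cong[of _ _ uminus] sum.cong refl arg_cong2[where f = "(*)"] *) simp
    also have "\<dots> = (\<Sum>r<c. \<Sum>k<c. ?J l r * (?b r (2 + k) * y (2 + k)))"
      by (simp add: sum_distrib_left sum_negf)
    also have "\<dots> = (\<Sum>k<c. (\<Sum>r<c. ?J l r * ?b r (2 + k)) * y (2 + k))"
      by (subst sum.swap) (simp add: sum_distrib_right mult.assoc)
    also have "\<dots> = (\<Sum>k<c. (if l = k then dl n c w A else 0) * y (2 + k))"
      unfolding dl_def using adjf_left[OF 3(2), of _ "\<lambda>r l. bm n w A r (2 + l)"] by (intro sum.cong refl) simp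
    also have "\<dots> = dl n c w A * y i" using 3 by (simp add: if_distrib[of "\<lambda>x. x * _"] cong: if_cong)
    finally show ?thesis by simp
  qed (simp_all add: ya_def)
qed

lemma ya_linear: "ya n c w A s t i = s * ya n c w A 1 0 i + t * ya n c w A 0 1 i"
  by (simp add: ya_def algebra_simps sum.distrib sum_distrib_left)

lemma phi_kernel_iff:
  assumes "frame n m w L"
  shows "phi m w y \<in> kernel_space n c A \<longleftrightarrow> (\<forall>r<c. (\<Sum>i\<le>m. bm n w A r i * y i) = 0)"
proof -
  have "(\<Sum>j\<le>n. A (r, j) * phi m w y j) = (\<Sum>i\<le>m. bm n w A r i * y i)" for r
    unfolding phi_def bm_def sum_distrib_left sum_distrib_right by (subst sum.swap) (simp add: mult_ac)
  then show ?thesis using phi_coord_space[OF assms] by (simp add: kernel_space_def)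
qed

text \<open>If \<open>dl\<close> is nonzero, the rows of \<open>A\<close> are independent on the
  span of \<open>w 2, ..., w (c + 1)\<close>, so this span is a complement of the kernel. Hence a
  generic polynomial that contains the factor \<open>dl\<close> guarantees the rank
  condition.\<close>

lemma dim_kernel_space:
  fixes w :: "nat \<Rightarrow> nat \<Rightarrow> 'a::field"
  assumes w: "\<And>l. l < c \<Longrightarrow> w (2 + l) \<in> coord_space n" and d: "dl n c w A \<noteq> 0"
  shows "vec.dim (kernel_space n c A) + c = n + 1"
proof -
  let ?K = "kernel_space n c A" and ?J = "adjf c (\<lambda>r l. bm n w A r (2 + l))"
  define F where "F l x = (\<Sum>r<c. ?J l r * (\<Sum>j\<le>n. A (r, j) * x j))" for l and x :: "nat \<Rightarrow> 'a"
  have Fw: "F l (w (2 + k)) = (if l = k then dl n c w A else 0)" if "l < c" "k < c" for l k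
    using adjf_left[OF that, of "\<lambda>r l. bm n w A r (2 + l)"] by (simp add: F_def dl_def bm_def)
  have Fk: "F l x = 0" if "x \<in> ?K" for l x using that by (simp add: F_def kernel_space_def)
  have Fsub: "vec.subspace {x. F l x = 0}" for l
    unfolding vec.subspace_def F_def vscale_def
    by (auto simp: algebra_simps sum.distrib simp flip: sum_distrib_left)
  obtain B where B: "B \<subseteq> ?K" "vec.independent B" "?K \<subseteq> vec.span B" "card B = vec.dim ?K"
    using vec.basis_exists[of ?K] by blast
  have KC: "?K \<subseteq> coord_space n" by (auto simp: kernel_space_def)
  have finB: "finite B" using independent_coord_space[OF B(2)] B(1) KC by blast
  define C where "C l = B \<union> (\<lambda>k. w (2 + k)) ` {..<l}" for l
  have C: "vec.independent (C l) \<and> card (C l) = card B + l" if "l \<le> c" for l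
    using that
  proof (induction l)
    case 0 then show ?case using B(2) by (simp add: C_def)
  next
    case (Suc l)
    have "C l \<subseteq> {x. F l x = 0}" unfolding C_def using Fk B(1) Fw Suc.prems by auto
    then have "vec.span (C l) \<subseteq> {x. F l x = 0}" by (rule vec.span_minimal[OF _ Fsub])
    moreover have "F l (w (2 + l)) \<noteq> 0" using Fw Suc.prems d by simp
    ultimately have n: "w (2 + l) \<notin> vec.span (C l)" by blast
    have CS: "C (Suc l) = insert (w (2 + l)) (C l)" unfolding C_def by (auto simp: lessThan_Suc)
    have "finite (C l)" using finB by (simp add: C_def)
    moreover have "w (2 + l) \<notin> C l" using n vec.span_base by blast
    ultimately show ?case unfolding CS using Suc n by (simp add: vec.independent_insertI)
  qed
  have span: "vec.span (C c) = coord_space n"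
  proof
    have "C c \<subseteq> coord_space n" unfolding C_def using B(1) KC w by auto
    then show "vec.span (C c) \<subseteq> coord_space n" by (rule vec.span_minimal[OF _ coord_space_subspace])
    show "coord_space n \<subseteq> vec.span (C c)"
    proof
      fix x :: "nat \<Rightarrow> 'a" assume x: "x \<in> coord_space n"
      let ?s = "\<Sum>k<c. vscale (F k x / dl n c w A) (w (2 + k))"
      have s: "?s \<in> vec.span (C c)"
        by (intro vec.span_sum vec.span_scale vec.span_base) (auto simp: C_def)
      have "x - ?s \<in> ?K"
        unfolding kernel_space_def
      proof (intro CollectI conjI allI impI)
        show "x - ?s \<in> coord_space n"
          by (intro vec.subspace_diff[OF coord_space_subspace] vec.subspace_sum[OF coord_space_subspace]
              vec.subspace_scale[OF coord_space_subspace] x w) auto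
        fix r assume r: "r < c"
        have "(\<Sum>j\<le>n. A (r, j) * ?s j) = (\<Sum>j\<le>n. \<Sum>k<c. F k x / dl n c w A * (A (r, j) * w (2 + k) j))"
          by (simp add: vscale_def sum_fun_apply sum_distrib_left mult_ac)
        also have "\<dots> = (\<Sum>k<c. F k x / dl n c w A * bm n w A r (2 + k))"
          unfolding bm_def sum_distrib_left by (rule sum.swap)
        also have "\<dots> = (\<Sum>k<c. \<Sum>r'<c. bm n w A r (2 + k) * ?J k r' * (\<Sum>j\<le>n. A (r', j) * x j)) / dl n c w A"
          unfolding F_def by (simp add: sum_divide_distrib sum_distrib_left sum_distrib_right mult_ac)
        also have "(\<Sum>k<c. \<Sum>r'<c. bm n w A r (2 + k) * ?J k r' * (\<Sum>j\<le>n. A (r', j) * x j))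
            = (\<Sum>r'<c. (\<Sum>k<c. bm n w A r (2 + k) * ?J k r') * (\<Sum>j\<le>n. A (r', j) * x j))"
          unfolding sum_distrib_right[of _ "{..<c}" "\<Sum>j\<le>n. A (_, j) * x j"] by (rule sum.swap)
        also have "\<dots> = (\<Sum>r'<c. (if r = r' then dl n c w A else 0) * (\<Sum>j\<le>n. A (r', j) * x j))"
          unfolding dl_def using adjf_right[OF r, of _ "\<lambda>r l. bm n w A r (2 + l)"] by (intro sum.cong refl) simp
        also have "\<dots> = dl n c w A * (\<Sum>j\<le>n. A (r, j) * x j)"
          using r by (simp add: if_distrib[of "\<lambda>x. x * _"] cong: if_cong)
        finally show "(\<Sum>j\<le>n. A (r, j) * (x - ?s) j) = 0" using d by (simp add: right_diff_distrib sum_subtractf)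
      qed
      then have "x - ?s \<in> vec.span (C c)" using B(3) vec.span_mono[of B "C c"] by (auto simp: C_def)
      then have "(x - ?s) + ?s \<in> vec.span (C c)" using s by (rule vec.span_add)
      then show "x \<in> vec.span (C c)" by simp
    qed
  qed
  have "n + 1 = vec.dim (vec.span (C c))" unfolding span dim_coord_space ..
  also have "\<dots> = card (C c)" using C[OF le_refl] by (intro vec.dim_span_eq_card_independent) blast
  finally show ?thesis using C[OF le_refl] B(4) by simp
qed

lemma pfun_bm: "r < c \<Longrightarrow> pfun ({..<c} \<times> {..n}) (\<lambda>A. bm n w A r i)"
  unfolding bm_def by (intro pfun_sum pfun_mult pfun_const pfun_var) auto

lemma pfun_dl: "pfun ({..<c} \<times> {..n}) (dl n c w)"
  unfolding dl_def by (intro pfun_dt pfun_bm)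

lemma pfun_ya:
  assumes "i \<le> Suc c" shows "pfun ({..<c} \<times> {..n}) (\<lambda>A. ya n c w A s t i)"
proof -
  let ?I = "{..<c} \<times> {..n}"
  consider "i = 0" | "i = 1" | l where "i = 2 + l" "l < c" using assms by (cases i; cases "i - 1") auto
  then show ?thesis
  proof cases
    case 3
    have "pfun ?I (\<lambda>A. - (\<Sum>r<c. adjf c (\<lambda>r l. bm n w A r (2 + l)) l r * (s * bm n w A r 0 + t * bm n w A r 1)))"
      by (intro pfun_uminus pfun_sum pfun_mult pfun_add pfun_const pfun_adjf pfun_bm) (use 3 in auto)
    then show ?thesis using 3 by (simp add: ya_def)
  qed (simp_all add: ya_def pfun_mult pfun_dl pfun_const)
qed

text \<open>A matrix that shows the genericity conditions to be satisfiable: its rows are the dual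
  forms from index \<open>2\<close> on, so its kernel meets the subspace in the line through the
  points of \<open>w 0\<close> and \<open>w 1\<close>.\<close>

lemma generic_A:
  assumes fr: "frame n (Suc c) w L" and A: "A = (\<lambda>(r, j). L (2 + r) j)"
  shows "dl n c w A = 1" "i \<le> Suc c \<Longrightarrow> ya n c w A 1 0 i = unit 0 i" "i \<le> Suc c \<Longrightarrow> ya n c w A 0 1 i = unit 1 i"
proof -
  have b: "bm n w A r i = (if i = 2 + r then 1 else 0)" if "r < c" "i \<le> Suc c" for r i
    using fr that unfolding frame_def bm_def A by auto
  have "dl n c w A = dt c (\<lambda>r l. if r = l then 1 else 0)" unfolding dl_def by (rule dt_cong) (simp add: b)
  then show "dl n c w A = 1" by (simp add: dt_one)
  then show "i \<le> Suc c \<Longrightarrow> ya n c w A 1 0 i = unit 0 i" "i \<le> Suc c \<Longrightarrow> ya n c w A 0 1 i = unit 1 i"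
    by (auto simp: ya_def unit_def b)
qed

text \<open>The kernel meets the subspace in the line through the points with coordinates
  \<open>a\<close> and \<open>b\<close>. As \<open>f(a)\<close> is nonzero, the section consists of
  the points \<open>b + s * a\<close> with \<open>s\<close> a root of the restriction, which has
  degree \<open>e\<close> and simple roots.\<close>

lemma section_card:
  fixes f :: "(nat, 'a::alg_closed_field) mpoly"
  assumes fr: "frame n (Suc c) w L" and e: "e \<ge> 1" and f: "vars_in {..Suc c} f" "homogeneous e f"
    and a: "a = ya n c w A 1 0" and b: "b = ya n c w A 0 1"
    and d: "dl n c w A \<noteq> 0" and fa: "eval_mpoly f a \<noteq> 0" and sy: "sylv e (lin f b a) \<noteq> 0"
  shows "finite (Zset (Suc c) w f \<inter> proj_of n (kernel_space n c A))"
    "card (Zset (Suc c) w f \<inter> proj_of n (kernel_space n c A)) = e"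
proof -
  let ?\<Phi> = "lin f b a" and ?m = "Suc c" and ?K = "kernel_space n c A"
  have "coeff ?\<Phi> e \<noteq> 0" "degree ?\<Phi> \<le> e" using fa lin_homogeneous[OF f(2)] by simp_all
  then have deg: "degree ?\<Phi> = e" "?\<Phi> \<noteq> 0" using le_degree[of ?\<Phi> e] by auto
  have cr: "card {s. poly ?\<Phi> s = 0} = e"
    using card_simple_roots[OF deg(2) sylv_common_root[OF e _ sy]] deg(1) by simp
  have yab: "ya n c w A s t i = s * a i + t * b i" for s t i unfolding a b by (rule ya_linear)
  have ab01: "a 0 = dl n c w A" "a 1 = 0" "b 0 = 0" "b 1 = dl n c w A" by (simp_all add: a b ya_def)
  define P where "P s = pl (phi ?m w (\<lambda>i. b i + s * a i))" for s
  have nz: "phi ?m w (\<lambda>i. b i + s * a i) \<noteq> 0" for s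
  proof
    assume "phi ?m w (\<lambda>i. b i + s * a i) = 0"
    then have "b 1 + s * a 1 = 0" using phi_eq_0_iff[OF fr] by auto
    then show False using ab01 d by simp
  qed
  have inj: "s = s'" if Ps: "P s = P s'" for s s'
  proof -
    obtain k where k: "\<And>i. i \<le> ?m \<Longrightarrow> b i + s * a i = k * (b i + s' * a i)"
      using pl_phi_eqE[OF fr Ps[unfolded P_def] nz] by blast
    have "k = 1" using k[of 1] ab01 d by simp
    then show ?thesis using k[of 0] ab01 d by simp
  qed
  have "Zset ?m w f \<inter> proj_of n ?K = P ` {s. poly ?\<Phi> s = 0}"
  proof (intro equalityI subsetI)
    fix p assume "p \<in> P ` {s. poly ?\<Phi> s = 0}"
    then obtain s where s: "p = P s" "eval_mpoly f (\<lambda>v. b v + s * a v) = 0" by auto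
    have pp: "p \<in> proj_space n" unfolding s(1) P_def by (rule pl_in_proj_space[OF phi_coord_space[OF fr] nz])
    have "\<forall>r<c. (\<Sum>i\<le>?m. bm n w A r i * (b i + s * a i)) = 0"
      using ya_kernel[of _ c n w A s 1] by (simp add: yab add.commute del: sum.atMost_Suc)
    then have "phi ?m w (\<lambda>i. b i + s * a i) \<in> ?K" unfolding phi_kernel_iff[OF fr] .
    then have "p \<subseteq> ?K" unfolding s(1) P_def pl_subset_iff[OF kernel_space_subspace] .
    then show "p \<in> Zset ?m w f \<inter> proj_of n ?K" using s(2) nz pp unfolding s(1) P_def Zset_def proj_of_def by auto
  next
    fix p assume "p \<in> Zset ?m w f \<inter> proj_of n ?K"
    then obtain y where y: "p = pl (phi ?m w y)" "phi ?m w y \<noteq> 0" "eval_mpoly f y = 0" "pl (phi ?m w y) \<subseteq> ?K"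
      by (auto simp: Zset_def proj_of_def)
    have "\<forall>r<c. (\<Sum>i\<le>?m. bm n w A r i * y i) = 0"
      using y(4) unfolding pl_subset_iff[OF kernel_space_subspace] phi_kernel_iff[OF fr] .
    then have "dl n c w A * y i = ya n c w A (y 0) (y 1) i" if "i \<le> ?m" for i using that by (intro ya_complete) auto
    then have dy: "dl n c w A * y i = y 0 * a i + y 1 * b i" if "i \<le> ?m" for i using that unfolding yab .
    have ev: "eval_mpoly f (\<lambda>i. y 0 * a i + y 1 * b i) = 0"
    proof -
      have "eval_mpoly f (\<lambda>i. y 0 * a i + y 1 * b i) = eval_mpoly f (\<lambda>i. dl n c w A * y i)"
        by (rule eval_mpoly_cong[OF f(1)]) (simp add: dy)
      then show ?thesis using y(3) by (simp add: eval_mpoly_smult[OF f(2)])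
    qed
    have y1: "y 1 \<noteq> 0"
    proof
      assume z: "y 1 = 0"
      then have "eval_mpoly f (\<lambda>i. y 0 * a i) = 0" using ev by simp
      then have "y 0 = 0" using fa by (simp add: eval_mpoly_smult[OF f(2)])
      then have "\<forall>i\<le>?m. y i = 0" using dy z d by auto
      then show False using y(2) phi_eq_0_iff[OF fr] by blast
    qed
    define s where "s = y 0 / y 1"
    have eq: "y 0 * a i + y 1 * b i = y 1 * (b i + s * a i)" for i using y1 by (simp add: s_def field_simps)
    have "eval_mpoly f (\<lambda>i. b i + s * a i) = 0" using ev y1 unfolding eq eval_mpoly_smult[OF f(2)] by simp
    moreover have "p = P s"
    proof -
      have "phi ?m w (\<lambda>i. dl n c w A * y i) = phi ?m w (\<lambda>i. y 1 * (b i + s * a i))"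
        by (rule phi_cong) (simp only: dy eq)
      then have "vscale (dl n c w A) (phi ?m w y) = vscale (y 1) (phi ?m w (\<lambda>i. b i + s * a i))"
        unfolding phi_scale vscale_def .
      then show ?thesis unfolding y(1) P_def using pl_scale[OF d] pl_scale[OF y1] by metis
    qed
    ultimately show "p \<in> P ` {s. poly ?\<Phi> s = 0}" by auto
  qed
  moreover have "card (P ` {s. poly ?\<Phi> s = 0}) = e" using inj cr by (subst card_image) (auto intro: inj_onI)
  ultimately show "finite (Zset ?m w f \<inter> proj_of n ?K)" "card (Zset ?m w f \<inter> proj_of n ?K) = e"
    using poly_roots_finite[OF deg(2)] by simp_all
qed

text \<open>\<open>G\<close> is the product of three conditions: the section is a line,
  \<open>f\<close> does not vanish at its point \<open>a\<close>, and the roots on the line are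
  simple. The matrix of \<open>generic_A\<close> shows that \<open>G\<close> is nonzero.\<close>

lemma general_section:
  fixes f :: "(nat, 'a::alg_closed_field) mpoly"
  assumes fr: "frame n (Suc c) w L" and e: "e \<ge> 1" and f: "vars_in {..Suc c} f" "homogeneous e f"
    and f0: "eval_mpoly f (unit 0) \<noteq> 0"
    and sep: "\<And>s. poly (lin f (unit 1) (unit 0)) s = 0 \<Longrightarrow> poly (pderiv (lin f (unit 1) (unit 0))) s \<noteq> 0"
  obtains G where "G \<noteq> 0" "vars_in ({..<c} \<times> {..n}) G"
    "\<And>A. eval_mpoly G A \<noteq> 0 \<Longrightarrow> vec.dim (kernel_space n c A) + c = n + 1"
    "\<And>A. eval_mpoly G A \<noteq> 0 \<Longrightarrow> finite (Zset (Suc c) w f \<inter> proj_of n (kernel_space n c A))"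
    "\<And>A. eval_mpoly G A \<noteq> 0 \<Longrightarrow> card (Zset (Suc c) w f \<inter> proj_of n (kernel_space n c A)) = e"
proof -
  let ?a = "\<lambda>A. ya n c w A 1 0" and ?b = "\<lambda>A. ya n c w A 0 1" and ?I = "{..<c} \<times> {..n}"
  have "pfun ?I (\<lambda>A. dl n c w A * eval_mpoly f (?a A) * sylv e (lin f (?b A) (?a A)))"
  proof (intro pfun_mult pfun_sylv)
    show "pfun ?I (\<lambda>A. dl n c w A)" by (rule pfun_dl)
    show "pfun ?I (\<lambda>A. eval_mpoly f (?a A))" by (rule pfun_compose[OF f(1)]) (simp add: pfun_ya)
    show "pfun ?I (\<lambda>A. coeff (lin f (?b A) (?a A)) k)" for k
      by (rule pfun_lin[OF f(1)]) (simp_all add: pfun_ya)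
  qed
  then obtain G where G: "vars_in ?I G"
    "\<And>A. eval_mpoly G A = dl n c w A * eval_mpoly f (?a A) * sylv e (lin f (?b A) (?a A))" by (rule pfunE) blast
  have "G \<noteq> 0"
  proof -
    define A where "A = (\<lambda>(r, j). L (2 + r) j)"
    note gA = generic_A[OF fr A_def]
    have "eval_mpoly f (?a A) = eval_mpoly f (unit 0)" by (rule eval_mpoly_cong[OF f(1)]) (simp add: gA)
    moreover have "lin f (?b A) (?a A) = lin f (unit 1) (unit 0)" by (rule lin_cong[OF f(1)]) (simp_all add: gA)
    moreover have "sylv e (lin f (unit 1) (unit 0)) \<noteq> 0"
    proof (rule sylv_nonzero[OF e _ sep])
      show "degree (lin f (unit 1) (unit 0)) = e"
        using lin_homogeneous[OF f(2), of "unit 1" "unit 0"] f0 le_degree[of "lin f (unit 1) (unit 0)" e] by simp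
    qed
    ultimately have "eval_mpoly G A \<noteq> 0" using f0 by (simp add: G(2) gA)
    then show ?thesis by auto
  qed
  moreover have "vec.dim (kernel_space n c A) + c = n + 1"
    "finite (Zset (Suc c) w f \<inter> proj_of n (kernel_space n c A))"
    "card (Zset (Suc c) w f \<inter> proj_of n (kernel_space n c A)) = e" if "eval_mpoly G A \<noteq> 0" for A
  proof -
    have nz: "dl n c w A \<noteq> 0" "eval_mpoly f (?a A) \<noteq> 0" "sylv e (lin f (?b A) (?a A)) \<noteq> 0"
      using that by (auto simp: G(2))
    show "vec.dim (kernel_space n c A) + c = n + 1"
      by (rule dim_kernel_space[OF _ nz(1)]) (use fr in \<open>simp add: frame_def\<close>)
    show "finite (Zset (Suc c) w f \<inter> proj_of n (kernel_space n c A))"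
      "card (Zset (Suc c) w f \<inter> proj_of n (kernel_space n c A)) = e"
      by (rule section_card[OF fr e f refl refl nz])+
  qed
  ultimately show thesis using G(1) by (intro that[of G])
qed

text \<open>Two generic counts agree because two nonzero polynomials have a common nonroot. There
  \<open>G\<close> also provides the rank condition under which the other count is asserted.\<close>

theorem (in hyper) degree_Z: "irreducible_degree n (Zset m w f) = e"
proof -
  obtain c where c: "m = Suc c" using m by (cases m) auto
  obtain w' L' f' where fr': "frame n m w' L'" and f': "vars_in {..m} f'" "homogeneous e f'" and Z: "Zset m w' f' = Zset m w f"
    and u: "eval_mpoly f' (unit 0) \<noteq> 0"
    and sep: "\<And>s. poly (lin f' (unit 1) (unit 0)) s = 0 \<Longrightarrow> poly (pderiv (lin f' (unit 1) (unit 0))) s \<noteq> 0"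
    by (rule separable_frame) (rule that)
  let ?Z = "Zset m w f" and ?K = "kernel_space n c"
  have Z': "Zset (Suc c) w' f' = ?Z" using Z unfolding c .
  note gs = general_section[OF fr'[unfolded c] e f'[unfolded c] u sep, unfolded Z']
  obtain G where G: "G \<noteq> 0" "vars_in ({..<c} \<times> {..n}) G"
    "\<And>A. eval_mpoly G A \<noteq> 0 \<Longrightarrow> vec.dim (?K A) + c = n + 1"
    "\<And>A. eval_mpoly G A \<noteq> 0 \<Longrightarrow> finite (?Z \<inter> proj_of n (?K A))"
    "\<And>A. eval_mpoly G A \<noteq> 0 \<Longrightarrow> card (?Z \<inter> proj_of n (?K A)) = e"
    by (rule gs) (assumption | rule that)+
  have dim: "proj_dim n ?Z = ereal (real k) \<longleftrightarrow> k = c" for k using dim_Z by (auto simp: c)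
  have gen: "for_general_subspace n c (\<lambda>L. finite (?Z \<inter> L) \<and> card (?Z \<inter> L) = e)"
    unfolding for_general_subspace_def using G by (intro exI[of _ G]) simp
  have uniq: "D = e" if g: "for_general_subspace n c (\<lambda>L. finite (?Z \<inter> L) \<and> card (?Z \<inter> L) = D)" for D
  proof -
    obtain G' :: "(nat \<times> nat, 'a) mpoly" where G': "G' \<noteq> 0"
      "\<And>A. eval_mpoly G' A \<noteq> 0 \<and> vec.dim (?K A) + c = n + 1 \<Longrightarrow> card (?Z \<inter> proj_of n (?K A)) = D"
      using g unfolding for_general_subspace_def by auto
    obtain A where A: "eval_mpoly G A \<noteq> 0" "eval_mpoly G' A \<noteq> 0" by (rule mpoly_common_nonroot[OF G(1) G'(1)])
    then show ?thesis using G(3,5)[OF A(1)] G'(2)[of A] by simp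
  qed
  show ?thesis
    unfolding irreducible_degree_def dim
  proof (rule the_equality)
    show "\<exists>k. k = c \<and> for_general_subspace n k (\<lambda>L. finite (?Z \<inter> L) \<and> card (?Z \<inter> L) = e)" using gen by simp
    fix D assume "\<exists>k. k = c \<and> for_general_subspace n k (\<lambda>L. finite (?Z \<inter> L) \<and> card (?Z \<inter> L) = D)"
    then show "D = e" using uniq by simp
  qed
qed

section \<open>Unions of irreducible sets\<close>

lemma irreducible_in_Union:
  assumes "finite T" "\<And>t. t \<in> T \<Longrightarrow> closedin X (Z t)" "irreducible_in X Y" "Y \<subseteq> (\<Union>t\<in>T. Z t)"
  shows "\<exists>t\<in>T. Y \<subseteq> Z t"
  using assms(1,2,4)
proof (induction T rule: finite_induct)
  case empty then show ?case using assms(3) by (simp add: irreducible_in_def)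
next
  case (insert t T)
  have "closedin X (\<Union>t\<in>T. Z t)" using insert by (intro closedin_Union) auto
  moreover have "closedin X (Z t)" "Y \<subseteq> Z t \<union> (\<Union>t\<in>T. Z t)" using insert.prems by auto
  ultimately have "Y \<subseteq> Z t \<or> Y \<subseteq> (\<Union>t\<in>T. Z t)" using assms(3) unfolding irreducible_in_def by blast
  then show ?case using insert by auto
qed

text \<open>The sets \<open>Z t\<close> may coincide. The components are shown to be among them, and
  this bounds the degree from above by the sum of the \<open>e t\<close>.\<close>

locale irreducible_union =
  fixes n r d :: nat and T :: "'t set" and Z :: "'t \<Rightarrow> 'a::alg_closed_field point set" and e :: "'t \<Rightarrow> nat"
  assumes T: "finite T" "T \<noteq> {}"
    and Zc: "\<And>t. t \<in> T \<Longrightarrow> closedin (zariski n) (Z t)" and Zi: "\<And>t. t \<in> T \<Longrightarrow> irreducible_in (zariski n) (Z t)"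
    and Zd: "\<And>t. t \<in> T \<Longrightarrow> proj_dim n (Z t) = ereal (real r)"
    and Ze: "\<And>t. t \<in> T \<Longrightarrow> irreducible_degree n (Z t) = e t" and e: "(\<Sum>t\<in>T. e t) \<le> d"
begin

definition V where "V = (\<Union>t\<in>T. Z t)"

lemma irreducible_in_V:
  assumes "irreducible_in (zariski n) Y" "Y \<subseteq> V" obtains t where "t \<in> T" "Y \<subseteq> Z t"
  using irreducible_in_Union[of T "zariski n" Z Y] T(1) Zc assms unfolding V_def by auto

lemma components: "proj_components n V \<subseteq> Z ` T"
proof
  fix Y assume "Y \<in> proj_components n V"
  then have Y: "irreducible_in (zariski n) Y" "Y \<subseteq> V" "\<And>Y'. irreducible_in (zariski n) Y' \<Longrightarrow> Y' \<subseteq> V \<Longrightarrow> Y \<subseteq> Y' \<Longrightarrow> Y' = Y"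
    by (auto simp: irreducible_components_def)
  obtain t where t: "t \<in> T" "Y \<subseteq> Z t" using Y(1,2) by (rule irreducible_in_V)
  then have "Z t = Y" using Zi by (intro Y(3)) (auto simp: V_def)
  then show "Y \<in> Z ` T" using t by blast
qed

lemma component_ex:
  assumes "p \<in> V" shows "\<exists>Y\<in>proj_components n V. p \<in> Y"
proof -
  obtain t where t: "t \<in> T" "p \<in> Z t" using assms by (auto simp: V_def)
  have "finite (Z ` T)" "Z t \<in> Z ` T" using T(1) t(1) by auto
  note max = finite_has_maximal2[OF this]
  obtain M where M: "M \<in> Z ` T" "Z t \<subseteq> M" "\<forall>B\<in>Z ` T. M \<subseteq> B \<longrightarrow> M = B" using max by auto
  obtain s where s0: "s \<in> T" "M = Z s" using M(1) by auto
  have s: "s \<in> T" "Z t \<subseteq> Z s" "\<And>u. u \<in> T \<Longrightarrow> Z s \<subseteq> Z u \<Longrightarrow> Z u = Z s"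
    using M(2,3) s0 by auto
  have "Z s \<in> proj_components n V"
    unfolding irreducible_components_def
  proof (intro CollectI conjI allI impI)
    show "irreducible_in (zariski n) (Z s)" "Z s \<subseteq> V" using Zi s(1) by (auto simp: V_def)
    fix Y assume Y: "irreducible_in (zariski n) Y \<and> Y \<subseteq> V \<and> Z s \<subseteq> Y"
    then obtain u where u: "u \<in> T" "Y \<subseteq> Z u" using irreducible_in_V[of Y] by auto
    then have "Z u = Z s" using Y s(3) by blast
    then show "Y = Z s" using u(2) Y by blast
  qed
  then show ?thesis using s(2) t(2) by blast
qed

lemma dim_component: "Y \<in> proj_components n V \<Longrightarrow> proj_dim n Y = ereal (real r)"
  using components Zd by blast

lemma dim_V: "proj_dim n V = ereal (real r)"
proof (rule antisym)
  obtain t where t: "t \<in> T" using T(2) by blast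
  have "ereal (real r) = proj_dim n (Z t)" using Zd[OF t] by simp
  also have "\<dots> \<le> proj_dim n V"
    unfolding krull_dim_zchain
  proof (rule Sup_subset_mono, safe)
    fix q Y assume "zchain n (Z t) q Y"
    then have "zchain n V q Y" using t unfolding zchain_def V_def by blast
    then show "\<exists>q'. ereal (real q) = ereal (real q') \<and> (\<exists>Y. zchain n V q' Y)" by blast
  qed
  finally show "ereal (real r) \<le> proj_dim n V" .
  show "proj_dim n V \<le> ereal (real r)"
  proof (rule proj_dim_le)
    fix q Y assume q: "zchain n V q Y"
    then have "irreducible_in (zariski n) (Y q)" "Y q \<subseteq> V" by (auto simp: zchain_def)
    then obtain t where t: "t \<in> T" "Y q \<subseteq> Z t" by (rule irreducible_in_V)
    have inc: "Y i \<subseteq> Y j" if "i \<le> j" "j \<le> q" for i j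
      using that
    proof (induction j rule: dec_induct)
      case (step j)
      then have "Y j \<subset> Y (Suc j)" using q by (simp add: zchain_def)
      then show ?case using step by auto
    qed simp
    have "Y i \<subseteq> Z t" if "i \<le> q" for i using inc[OF that le_refl] t(2) by blast
    then have "zchain n (Z t) q Y" using q by (simp add: zchain_def)
    then show "q \<le> r" using proj_dim_ge Zd[OF t(1)] by fastforce
  qed
qed

lemma V_equidim: "V \<in> equidim_subvarieties n r d"
proof -
  have "closedin (zariski n) V" unfolding V_def using T(1) Zc by (intro closedin_Union) auto
  moreover have "equidimensional n V" unfolding equidimensional_def using dim_component by simp
  moreover have "proj_degree n V \<le> d"
  proof -
    have "proj_degree n V \<le> (\<Sum>Y\<in>Z ` T. irreducible_degree n Y)"
      unfolding proj_degree_def using components T(1) by (intro sum_mono2) auto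
    also have "\<dots> \<le> (\<Sum>t\<in>T. irreducible_degree n (Z t))"
      using sum_image_le[of T "irreducible_degree n" Z] T(1) by (simp add: comp_def)
    also have "\<dots> \<le> d" using Ze e by simp
    finally show ?thesis .
  qed
  ultimately show ?thesis using dim_V by (simp add: equidim_subvarieties_def)
qed

end

section \<open>Linear subspaces\<close>

lemma point_closed:
  fixes p :: "'a::alg_closed_field point"
  assumes "p \<in> proj_space n" shows "closedin (zariski n) {p}" "irreducible_in (zariski n) {p}"
proof -
  obtain v where v: "v \<in> coord_space n" "v \<noteq> 0" "p = pl v" using assms by (rule proj_spaceE)
  obtain i where i: "v i \<noteq> 0" using v(2) by (auto simp: fun_eq_iff)
  then have "i \<le> n" using v(1) by (auto simp: coord_space_def not_le[symmetric])
  define L where "L = (\<lambda>(_::nat) j. if j = i then 1 / v i else 0)"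
  have fr: "frame n 0 (\<lambda>_. v) L"
    unfolding frame_def L_def using v(1) i \<open>i \<le> n\<close> by (simp add: if_distrib[of "\<lambda>x. x * _"] cong: if_cong)
  have ph: "phi 0 (\<lambda>_. v) y = vscale (y 0) v" for y by (simp add: phi_def vscale_def)
  have "Zset 0 (\<lambda>_. v) 0 = {p}"
  proof (intro equalityI subsetI)
    fix q assume "q \<in> Zset 0 (\<lambda>_. v) 0"
    then obtain y where y: "q = pl (vscale (y 0) v)" "vscale (y 0) v \<noteq> 0" by (auto simp: Zset_def ph)
    have "y 0 \<noteq> 0" using y(2) by (auto simp: vscale_def fun_eq_iff)
    then show "q \<in> {p}" using y(1) pl_scale v(3) by auto
  next
    fix q assume "q \<in> {p}"
    then have "q = pl (phi 0 (\<lambda>_. v) (\<lambda>_. 1))" "phi 0 (\<lambda>_. v) (\<lambda>_. 1) \<noteq> 0" using v by (simp_all add: ph)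
    then show "q \<in> Zset 0 (\<lambda>_. v) 0" by (auto simp: Zset_def)
  qed
  moreover have "closedin (zariski n) (Zset 0 (\<lambda>_. v) 0)" by (rule Zset_closed[OF fr, of _ 0]) (auto simp: homogeneous_def)
  ultimately show "closedin (zariski n) {p}" by simp
  show "irreducible_in (zariski n) {p}" using assms by (auto simp: irreducible_in_def)
qed

lemma dim_proj_subspace:
  fixes W :: "'a::alg_closed_field point set"
  assumes "is_proj_subspace n k W" shows "proj_dim n W \<le> ereal (real k)"
proof (rule proj_dim_le)
  fix r Z assume Z: "zchain n W r Z"
  obtain U where U: "vec.subspace U" "U \<subseteq> coord_space n" "vec.dim U = k + 1" "W = proj_of n U"
    using assms by (auto simp: is_proj_subspace_def)
  obtain B where B: "B \<subseteq> U" "vec.independent B" "U \<subseteq> vec.span B" "card B = k + 1"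
    using vec.basis_exists[of U] U(3) by metis
  have finB: "finite B" using B(4) card_ge_0_finite by force
  obtain b where b: "bij_betw b {0..<k + 1} B" using ex_bij_betw_nat_finite[OF finB] B(4) by metis
  have "U \<subseteq> range (phi k b)"
  proof
    fix x assume "x \<in> U"
    then have "x \<in> range (\<lambda>u. \<Sum>v\<in>B. vscale (u v) v)" using B(3) unfolding vec.span_finite[OF finB] by (rule subsetD[rotated])
    then obtain u where "x = (\<Sum>v\<in>B. vscale (u v) v)" by (rule rangeE)
    also have "\<dots> = (\<Sum>i\<in>{0..<k + 1}. vscale (u (b i)) (b i))" by (rule sum.reindex_bij_betw[OF b, symmetric])
    also have "\<dots> = phi k b (\<lambda>i. u (b i))"
      by (auto simp: phi_def fun_eq_iff sum_fun_apply vscale_def atLeast0LessThan lessThan_Suc_atMost simp del: sum.lessThan_Suc)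
    finally show "x \<in> range (phi k b)" by blast
  qed
  then have "\<Union>W \<subseteq> range (phi k b)" unfolding U(4) proj_of_def by blast
  then show "r \<le> k" by (rule zchain_length[OF Z])
qed

lemma (in irreducible_union) not_evades:
  assumes "is_proj_subspace n k W" "p \<in> W" "p \<in> V" "r + k < n"
  shows "\<not> evades n W V"
proof
  assume ev: "evades n W V"
  obtain Y where Y: "Y \<in> proj_components n V" "p \<in> Y" using component_ex[OF assms(3)] by blast
  have pn: "p \<in> proj_space n" using assms(1,2) by (auto simp: is_proj_subspace_def proj_of_def)
  have "zchain n (W \<inter> Y) 0 (\<lambda>_. {p})" using point_closed[OF pn] assms(2) Y(2) by (simp add: zchain_def)
  then have "ereal (real 0) \<le> proj_dim n (W \<inter> Y)" by (rule proj_dim_ge)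
  also have "\<dots> \<le> proj_dim n W + proj_dim n Y - ereal (real n)" using ev Y(1) by (simp add: evades_def)
  also have "\<dots> \<le> ereal (real k) + ereal (real r) - ereal (real n)"
    unfolding dim_component[OF Y(1)] using dim_proj_subspace[OF assms(1)] by (intro ereal_minus_mono add_mono) auto
  also have "\<dots> = ereal (real k + real r - real n)" by simp
  finally have "0 \<le> real k + real r - real n" by (simp add: zero_ereal_def)
  then show False using assms(4) by linarith
qed

text \<open>Extend a basis of the subspace to one of the coordinate space; the coordinates that
  belong to the \<open>n - k\<close> added vectors cut out the subspace.\<close>

lemma annihilator_ex:
  assumes "is_proj_subspace n k W" "k < n"
  shows "\<exists>h. \<forall>p\<in>proj_space n. (\<forall>x\<in>p. \<forall>c<n - k. (\<Sum>j\<le>n. x j * h c j) = 0) \<longrightarrow> p \<in> W"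
proof -
  obtain U where U: "vec.subspace U" "U \<subseteq> coord_space n" "vec.dim U = k + 1" "W = proj_of n U"
    using assms by (auto simp: is_proj_subspace_def)
  obtain B where B: "B \<subseteq> U" "vec.independent B" "U \<subseteq> vec.span B" "card B = k + 1"
    using vec.basis_exists[of U] U(3) by metis
  have BC: "B \<subseteq> coord_space n" using B(1) U(2) by blast
  obtain C where C: "B \<subseteq> C" "C \<subseteq> coord_space n" "vec.independent C" "coord_space n \<subseteq> vec.span C"
    by (rule vec.maximal_independent_subset_extend[OF BC B(2)])
  have sp: "vec.span C = coord_space n" using C(2,4) vec.span_minimal[OF C(2) coord_space_subspace] by blast
  have finC: "finite C" using independent_coord_space[OF C(3,2)] by blast
  have "card C = n + 1" using vec.dim_span_eq_card_independent[OF C(3)] unfolding sp dim_coord_space by simp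
  then have "card (C - B) = n - k" using card_Diff_subset[OF finite_subset[OF C(1) finC] C(1)] B(4) by simp
  then obtain g where g: "bij_betw g {0..<n - k} (C - B)" using ex_bij_betw_nat_finite[of "C - B"] finC by auto
  define h where "h c j = vec.representation C (unit j) (g c)" for c j
  have rep: "vec.representation C x (g c) = (\<Sum>j\<le>n. x j * h c j)" if x: "x \<in> coord_space n" for x c
  proof -
    have "vec.representation C x = vec.representation C (\<Sum>j\<le>n. vscale (x j) (unit j))"
      using coord_space_expand[OF x] by simp
    also have "\<dots> = (\<lambda>b. \<Sum>j\<le>n. vec.representation C (vscale (x j) (unit j)) b)"
      by (rule vec.representation_sum[OF C(3)]) (auto simp: sp intro!: vec.subspace_scale[OF coord_space_subspace] unit_coord_space)
    finally show ?thesis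
      by (simp add: h_def vec.representation_scale[OF C(3)] sp unit_coord_space)
  qed
  have "p \<in> W" if p: "p \<in> proj_space n" and z: "\<forall>x\<in>p. \<forall>c<n - k. (\<Sum>j\<le>n. x j * h c j) = 0" for p
  proof -
    have "x \<in> U" if x: "x \<in> p" for x
    proof -
      have xc: "x \<in> coord_space n" using p x by (auto simp: proj_space_def)
      have r0: "vec.representation C x b = 0" if "b \<in> C - B" for b
      proof -
        have "b \<in> g ` {0..<n - k}" using g that by (simp add: bij_betw_def)
        then obtain c where "c < n - k" "b = g c" by auto
        then show ?thesis using rep[OF xc] z x by simp
      qed
      have "x = (\<Sum>b\<in>C. vscale (vec.representation C x b) b)"
        by (rule vec.sum_representation_eq[symmetric, OF C(3) _ finC order_refl]) (simp add: sp xc)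
      also have "\<dots> = (\<Sum>b\<in>B. vscale (vec.representation C x b) b)"
        using r0 C(1) finC by (intro sum.mono_neutral_right) auto
      also have "\<dots> \<in> U" using B(1) by (intro vec.subspace_sum[OF U(1)] vec.subspace_scale[OF U(1)]) auto
      finally show ?thesis .
    qed
    then show ?thesis using p by (auto simp: U(4) proj_of_def)
  qed
  then show ?thesis by blast
qed

section \<open>Hypersurfaces meeting all subspaces of a family\<close>

lemma mdeg_prod_mset:
  fixes M :: "(nat, 'a::field) mpoly multiset"
  assumes "0 \<notin># M" shows "mdeg (prod_mset M) = (\<Sum>p\<in>#M. mdeg p)"
  using assms
proof (induction M)
  case (add p M)
  then have "prod_mset M \<noteq> 0" by (simp add: prod_mset_zero_iff)
  then show ?case using add by (simp add: mdeg_mult)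
qed (simp add: mdeg_MC[of 1, simplified])

lemma sum_set_mset_le: "(\<Sum>p\<in>set_mset M. f p :: nat) \<le> (\<Sum>p\<in>#M. f p)"
  by (induction M) (auto simp: sum.insert_if)

text \<open>\<open>M\<close> is a factorization of the form through the given subspaces. A repeated
  factor gives the same hypersurface again, hence the degrees are summed over
  \<open>set_mset M\<close>, and the sum is only bounded by \<open>d\<close>.\<close>

lemma form_hypersurfaces:
  fixes h :: "nat \<Rightarrow> nat \<Rightarrow> nat \<Rightarrow> 'a::alg_closed_field"
  assumes m: "m > 0" and d: "d > 0" and N: "Suc N = card (Mon m d) + k * (if d = 1 then m else Suc m)"
  shows "\<exists>w L M. (\<forall>p\<in>#M. hyper (m + k) m w L p (mdeg p)) \<and> (\<Sum>p\<in>set_mset M. mdeg p) \<le> d \<and> M \<noteq> {#} \<and>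
    (\<forall>i<N. \<exists>p\<in>#M. \<exists>P\<in>Zset m w p. \<forall>x\<in>P. \<forall>c<m. (\<Sum>j\<le>m + k. x j * h i c j) = 0)"
proof -
  let ?n = "m + k"
  obtain u a s where s: "s \<in> Sg ?n m" and us: "\<forall>i\<le>m. \<forall>j\<le>m. u i (s j) = (if i = j then 1 else 0)"
    and a: "\<exists>\<alpha>\<in>Mon m d. a \<alpha> \<noteq> (0 :: 'a)" and z: "\<forall>i<N. lf ?n m d (h i) (u, a) = 0"
    using form_through_subspaces[OF m d N, of h] by blast
  \<comment> \<open>Entries beyond the last coordinate are cut off to stay in the coordinate space.
    The dual forms pick the columns \<open>s\<close>, in which \<open>u\<close> is the
    identity.\<close>
  define w where "w i j = (if j \<le> ?n then u i j else 0)" for i j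
  define L where "L i j = (if j = s i then 1 else 0 :: 'a)" for i j
  have fr: "frame ?n m w L"
    using us Sg_le[OF s] by (auto simp: frame_def w_def L_def coord_space_def if_distrib[of "\<lambda>x. x * _"] cong: if_cong)
  define F where "F = fmP m d a"
  obtain \<alpha> where "\<alpha> \<in> Mon m d" "a \<alpha> \<noteq> 0" using a by blast
  then have "Poly_Mapping.lookup F \<alpha> \<noteq> 0" by (simp add: F_def lookup_fmP)
  then have F0: "F \<noteq> 0" by auto
  have Fh: "homogeneous d F" and Fv: "vars_in {..m} F" unfolding F_def by (rule homogeneous_fmP, rule vars_in_fmP)
  have Fd: "mdeg F = d" by (rule mdeg_homogeneous[OF Fh F0])
  have Fu: "\<not> F dvd 1" using mpoly_unit_iff[of F] Fd d by simp
  obtain M where M: "\<forall>p\<in>#M. irreducible p" "prod_mset M = F" using irreducible_factorization_ex[OF F0 Fu] by blast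
  have hy: "hyper ?n m w L p (mdeg p)" if p: "p \<in># M" for p
  proof -
    have "p dvd F" using p M(2) by (metis dvd_prod_mset)
    then obtain q where q: "F = p * q" by (elim dvdE)
    have "vars_in {..m} p" using vars_in_factor Fv F0 unfolding q by blast
    moreover have "homogeneous (mdeg p) p" using homogeneous_factor Fh F0 unfolding q by blast
    moreover have "mdeg p \<ge> 1" "irreducible p" using M(1) p mpoly_unit_iff[of p] by (auto simp: irreducible_def)
    ultimately show ?thesis using fr m by unfold_locales auto
  qed
  have "0 \<notin># M" using M(1) by (auto simp: irreducible_def)
  then have "(\<Sum>p\<in>#M. mdeg p) = d" using mdeg_prod_mset[of M] M(2) Fd by simp
  moreover have "(\<Sum>p\<in>set_mset M. mdeg p) \<le> (\<Sum>p\<in>#M. mdeg p)"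
    by (rule sum_set_mset_le)
  moreover have "M \<noteq> {#}" using M(2) Fu by auto
  moreover have "\<exists>p\<in>#M. \<exists>P\<in>Zset m w p. \<forall>x\<in>P. \<forall>c<m. (\<Sum>j\<le>?n. x j * h i c j) = 0" if i: "i < N" for i
  proof -
    obtain y where y: "\<exists>i\<le>m. y i \<noteq> 0" "\<forall>c<m. (\<Sum>j\<le>?n. (\<Sum>i\<le>m. y i * u i j) * h i c j) = 0" "fm m d a y = 0"
      using lf_zeroD[OF z[rule_format, OF i] d] by blast
    have "prod_mset M = F" by (rule M(2))
    have ph: "phi m w y \<noteq> 0" using y(1) phi_eq_0_iff[OF fr] by blast
    have "eval_mpoly (prod_mset M) y = 0" unfolding M(2) F_def eval_fmP by (rule y(3))
    then have "\<exists>p\<in>#M. eval_mpoly p y = 0" by (induction M) (auto simp: eval_mpoly_mult)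
    then obtain p where p: "p \<in># M" "eval_mpoly p y = 0" by blast
    have "(\<Sum>j\<le>?n. x j * h i c j) = 0" if x: "x \<in> pl (phi m w y)" and c: "c < m" for x c
    proof -
      obtain t where "x = vscale t (phi m w y)" using x by (auto simp: pl_eq)
      then have "x j = t * (\<Sum>i\<le>m. y i * u i j)" if "j \<le> ?n" for j using that by (simp add: vscale_def phi_def w_def)
      then have "(\<Sum>j\<le>?n. x j * h i c j) = t * (\<Sum>j\<le>?n. (\<Sum>i\<le>m. y i * u i j) * h i c j)"
        unfolding sum_distrib_left[of t "\<lambda>j. (\<Sum>i\<le>m. y i * u i j) * h i c j"]
        by (intro sum.cong refl) (simp only: atMost_iff mult.assoc)
      then show ?thesis using y(2) c by simp
    qed
    moreover have "pl (phi m w y) \<in> Zset m w p" using p(2) ph by (auto simp: Zset_def)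
    ultimately show ?thesis using p(1) by blast
  qed
  ultimately show ?thesis using hy by (intro exI[of _ w] exI[of _ L] exI[of _ M]) auto
qed

text \<open>The list is cut into \<open>s\<close> blocks of \<open>N\<close> subspaces, the member
  \<open>t * N + i\<close> being number \<open>i\<close> of block \<open>t\<close>. Each block has a
  form of degree \<open>D\<close> of its own, on a subspace of its own, and the union of the
  hypersurfaces has degree at most \<open>s * D\<close>.\<close>

lemma family_missed:
  fixes ws :: "'a::alg_closed_field point set list"
  assumes m: "m > 0" and D: "D > 0" and s: "s > 0" and N: "Suc N = card (Mon m D) + k * (if D = 1 then m else Suc m)"
    and len: "length ws \<le> s * N" and ws: "\<And>W. W \<in> set ws \<Longrightarrow> is_proj_subspace (m + k) k W"
  shows "\<exists>V\<in>equidim_subvarieties (m + k) (m - 1) (s * D). \<forall>W\<in>set ws. \<not> evades (m + k) W V"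
proof -
  let ?n = "m + k"
  define ann where "ann h W \<longleftrightarrow> (\<forall>p\<in>proj_space ?n. (\<forall>x\<in>p. \<forall>c<m. (\<Sum>j\<le>?n. x j * h c j) = 0) \<longrightarrow> p \<in> W)"
    for h :: "nat \<Rightarrow> nat \<Rightarrow> 'a" and W
  have "\<forall>W\<in>set ws. \<exists>h. ann h W"
    using annihilator_ex[OF ws] m unfolding ann_def by auto
  then obtain H where H: "\<And>W. W \<in> set ws \<Longrightarrow> ann (H W) W" using bchoice[of "set ws" "\<lambda>W h. ann h W"] by auto
  \<comment> \<open>An index beyond the end of \<open>ws\<close> yields arbitrary linear forms;
    incomplete blocks are filled up in this way.\<close>
  define hh where "hh t i = H (ws ! (t * N + i))" for t i
  define Q where "Q t X = (case X of (w, L, M) \<Rightarrow>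
    (\<forall>p\<in>#M. hyper ?n m w L p (mdeg p)) \<and> (\<Sum>p\<in>set_mset M. mdeg p) \<le> D \<and> M \<noteq> {#} \<and>
    (\<forall>i<N. \<exists>p\<in>#M. \<exists>P\<in>Zset m w p. \<forall>x\<in>P. \<forall>c<m. (\<Sum>j\<le>?n. x j * hh t i c j) = 0))" for t X
  have "\<exists>X. Q t X" for t
    using form_hypersurfaces[OF m D N, of "hh t"] unfolding Q_def by auto
  then have "\<exists>X. \<forall>t. Q t (X t)" by (intro choice allI)
  then obtain X where X: "\<And>t. Q t (X t)" by auto
  define w L M where "w t = fst (X t)" and "L t = fst (snd (X t))" and "M t = snd (snd (X t))" for t
  have "X t = (w t, L t, M t)" for t by (simp add: w_def L_def M_def)
  then have QX: "Q t (w t, L t, M t)" for t using X[of t] by simp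
  have M: "\<And>t p. p \<in># M t \<Longrightarrow> hyper ?n m (w t) (L t) p (mdeg p)"
    "\<And>t. (\<Sum>p\<in>set_mset (M t). mdeg p) \<le> D" "\<And>t. M t \<noteq> {#}"
    "\<And>t i. i < N \<Longrightarrow> \<exists>p\<in>#M t. \<exists>P\<in>Zset m (w t) p. \<forall>x\<in>P. \<forall>c<m. (\<Sum>j\<le>?n. x j * hh t i c j) = 0"
    using QX unfolding Q_def by auto
  define T where "T = (SIGMA t:{..<s}. set_mset (M t))"
  define Z where "Z = (\<lambda>(t, p). Zset m (w t) p)"
  interpret irreducible_union ?n "m - 1" "s * D" T Z "\<lambda>(t, p). mdeg p"
  proof
    show "finite T" by (auto simp: T_def)
    obtain p where "p \<in># M 0" using M(3)[of 0] by blast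
    then have "(0, p) \<in> T" using s by (simp add: T_def)
    then show "T \<noteq> {}" by blast
    show "(\<Sum>t\<in>T. case t of (t, p) \<Rightarrow> mdeg p) \<le> s * D"
    proof -
      have "(\<Sum>t\<in>T. case t of (t, p) \<Rightarrow> mdeg p) = (\<Sum>t<s. \<Sum>p\<in>set_mset (M t). mdeg p)"
        unfolding T_def by (rule sum.Sigma[symmetric]) auto
      also have "\<dots> \<le> (\<Sum>t<s. D)" by (intro sum_mono M(2))
      finally show ?thesis by simp
    qed
    fix x assume "x \<in> T"
    then obtain t p where x: "x = (t, p)" "p \<in># M t" by (auto simp: T_def)
    interpret hyper ?n m "w t" "L t" p "mdeg p" by (rule M(1)[OF x(2)])
    show "closedin (zariski ?n) (Z x)" "irreducible_in (zariski ?n) (Z x)" "proj_dim ?n (Z x) = ereal (real (m - 1))"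
      "irreducible_degree ?n (Z x) = (case x of (t, p) \<Rightarrow> mdeg p)"
      using Z_closed Z_irreducible dim_Z degree_Z by (simp_all add: x Z_def)
  qed
  have "\<not> evades ?n W V" if W: "W \<in> set ws" for W
  proof -
    obtain j where j: "j < length ws" "W = ws ! j" using W by (auto simp: in_set_conv_nth)
    then have jN: "j < s * N" using len by simp
    then have N0: "N > 0" by (cases N) auto
    have t: "j div N < s" "j mod N < N" using jN N0 by (auto simp: less_mult_imp_div_less)
    obtain p P where p: "p \<in># M (j div N)" and P: "P \<in> Zset m (w (j div N)) p"
      and z: "\<forall>x\<in>P. \<forall>c<m. (\<Sum>i\<le>?n. x i * hh (j div N) (j mod N) c i) = 0" using M(4)[OF t(2)] by blast
    interpret hyper ?n m "w (j div N)" "L (j div N)" p "mdeg p" by (rule M(1)[OF p])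
    have "P \<in> proj_space ?n" using P Z_irreducible by (auto simp: irreducible_in_def)
    moreover have "hh (j div N) (j mod N) = H W" unfolding hh_def j(2) by simp
    ultimately have "P \<in> W" using H[OF W] z unfolding ann_def by simp
    moreover have "P \<in> V" unfolding V_def
      by (rule UN_I[of "(j div N, p)"]) (use P p t(1) in \<open>simp_all add: T_def Z_def\<close>)
    ultimately show ?thesis using not_evades[OF ws[OF W]] m by simp
  qed
  then show ?thesis using V_equidim by blast
qed

section \<open>The lower bounds and their growth\<close>

lemma evasive_family_size:
  fixes H :: "'a::alg_closed_field point set multiset"
  assumes "n \<ge> 1" "d \<ge> 1" "k < n" "subspace_family n k H" "evasive n (equidim_subvarieties n (n - k - 1) d) H"
  shows "size H \<ge> (if d = 1 then (n - k) * (k + 1) + 1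
    else max (d * (n - k) * (k + 1) + 1) (((d + (n - k)) choose d) + (n - k + 1) * k))"
proof -
  define m where "m = n - k"
  have m: "m > 0" "n = m + k" "n - k - 1 = m - 1" using assms(3) by (auto simp: m_def)
  obtain ws where ws: "mset ws = H" using ex_mset by blast
  have big: "s * N < size H"
    if sD: "D > 0" "s > 0" "Suc N = card (Mon m D) + k * (if D = 1 then m else Suc m)" "s * D = d" for s D N
  proof (rule ccontr)
    assume "\<not> s * N < size H"
    then have len: "length ws \<le> s * N" using ws by auto
    have sub: "is_proj_subspace (m + k) k W" if "W \<in> set ws" for W
      using assms(4) that ws m(2) unfolding subspace_family_def by (metis set_mset_mset)
    obtain V where V: "V \<in> equidim_subvarieties (m + k) (m - 1) (s * D)" "\<forall>W\<in>set ws. \<not> evades (m + k) W V"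
      using family_missed[OF m(1) sD(1,2,3) len sub] by blast
    then have "V \<in> equidim_subvarieties n (n - k - 1) d" using m sD(4) by simp
    then obtain W where "W \<in># H" "evades n W V" using assms(5) by (auto simp: evasive_def)
    then show False using V(2) ws m(2) by (metis set_mset_mset)
  qed
  \<comment> \<open>\<open>d\<close> blocks with linear forms: the \<open>m + 1\<close> monomials of
    degree one give \<open>N = m * (k + 1)\<close>.\<close>
  have 1: "d * (m * (k + 1)) < size H"
    by (rule big[of 1]) (use assms(2) in \<open>simp_all add: card_Mon algebra_simps\<close>)
  have "((d + m) choose d) + (m + 1) * k \<le> size H" if "d \<noteq> 1"
  proof -
    have "0 < card (Mon m d)" by (simp add: card_Mon)
    then obtain N where N: "Suc N = card (Mon m d) + k * (if d = 1 then m else Suc m)"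
      by (metis add_is_0 gr0_implies_Suc neq0_conv)
    \<comment> \<open>One block with forms of degree \<open>d\<close>. The inequality is strict, so
      \<open>size H\<close> is at least \<open>N + 1\<close>, the number of monomials plus
      \<open>k * (m + 1)\<close>.\<close>
    have "1 * N < size H" by (rule big[of d]) (use assms(2) N in simp_all)
    then show ?thesis using N that by (simp add: card_Mon algebra_simps)
  qed
  then show ?thesis using 1 unfolding m_def[symmetric] by (auto simp: algebra_simps)
qed

text \<open>By symmetry the binomial coefficient increases with \<open>d\<close>, so
  \<open>d\<close> may be replaced by a fixed \<open>D \<le> d\<close>; this leaves growth of order
  \<open>m ^ D\<close>.\<close>

lemma binomial_lower:
  assumes "D \<le> d" "D > 0" shows "(real m / real D) ^ D \<le> real ((d + m) choose d)"
proof -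
  have "(real m / real D) ^ D \<le> (real (D + m) / real D) ^ D"
    by (intro power_mono divide_right_mono) auto
  also have "\<dots> \<le> real ((D + m) choose D)" using binomial_ge_n_over_k_pow_k[of D "D + m"] by simp
  also have "(D + m) choose D = (D + m) choose m" using binomial_symmetric[of D "D + m"] by simp
  also have "real \<dots> \<le> real ((d + m) choose m)" using assms(1) by (intro of_nat_mono binomial_right_mono) simp
  also have "(d + m) choose m = (d + m) choose d" using binomial_symmetric[of d "d + m"] by simp
  finally show ?thesis .
qed

lemma superpolynomial:
  fixes k d :: "nat \<Rightarrow> nat" and S :: "nat \<Rightarrow> nat"
  assumes S: "\<And>n. n \<ge> 1 \<Longrightarrow> d n > 1 \<Longrightarrow> S n \<ge> ((d n + (n - k n)) choose d n)"
    and k: "(\<lambda>n. real (n - k n)) \<in> \<Omega>(\<lambda>n. real n)" and d: "(\<lambda>n. real (d n)) \<in> \<omega>(\<lambda>_. 1)"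
  shows "(\<lambda>n. real (S n)) \<in> \<omega>(\<lambda>n. real n ^ c)"
proof (rule landau_omega.smallI)
  fix K :: real assume K: "K > 0"
  obtain e where e: "e > 0" "eventually (\<lambda>n. norm (real (n - k n)) \<ge> e * norm (real n)) at_top"
    using k by (rule landau_omega.bigE)
  \<comment> \<open>A power of \<open>n\<close> beyond \<open>n ^ c\<close> absorbs the constant
    \<open>K\<close>. The exponent is at least \<open>2\<close>, so that eventually
    \<open>d n > 1\<close> and the bound by the binomial coefficient applies.\<close>
  define D where "D = c + 2"
  define B where "B = (e / real D) ^ D"
  have B: "B > 0" using e(1) by (simp add: B_def D_def)
  have ev: "eventually (\<lambda>n. norm (real (d n)) \<ge> real D * norm (1 :: real)) at_top"
    by (rule landau_omega.smallD[OF d]) (simp add: D_def)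
  have ev': "eventually (\<lambda>n. real n \<ge> K / B) at_top"
    using filterlim_real_sequentially unfolding filterlim_at_top by blast
  show "eventually (\<lambda>n. norm (real (S n)) \<ge> K * norm (real n ^ c)) at_top"
    using ev ev' eventually_ge_at_top[of "1::nat"] e(2)
  proof eventually_elim
    case (elim n)
    then have n: "real n \<ge> K / B" "n \<ge> 1" "D \<le> d n" "e * real n \<le> real (n - k n)" by simp_all
    have "K * real n ^ c \<le> (B * real n) * real n ^ c"
      using n(1) B by (intro mult_right_mono) (auto simp: field_simps)
    also have "\<dots> \<le> (B * real n) * real n ^ c * real n"
      using n(2) B mult_left_mono[of 1 "real n" "(B * real n) * real n ^ c"] by simp
    also have "\<dots> = (e * real n / real D) ^ D" by (simp add: B_def D_def power_divide power_mult_distrib)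
    also have "\<dots> \<le> (real (n - k n) / real D) ^ D" using n(4) e(1) by (intro power_mono divide_right_mono) auto
    also have "\<dots> \<le> real ((d n + (n - k n)) choose d n)" by (rule binomial_lower[OF n(3)]) (simp add: D_def)
    also have "\<dots> \<le> real (S n)" using S[OF n(2)] n(3) by (simp add: D_def)
    finally show ?case by simp
  qed
qed

theorem theorem1p9:
  shows
    "(\<forall>(n::nat) (d::nat) (k::nat) (H :: 'a::alg_closed_field point set multiset).
        n \<ge> 1 \<and> d \<ge> 1 \<and> k < n \<and> subspace_family n k H \<and>
        evasive n (equidim_subvarieties n (n - k - 1) d) H
        \<longrightarrow> size H \<ge>
          (if d = 1 then (n - k) * (k + 1) + 1
           else max (d * (n - k) * (k + 1) + 1)
                    (((d + (n - k)) choose d) + (n - k + 1) * k)))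
     \<and>
     (\<forall>(k :: nat \<Rightarrow> nat) (d :: nat \<Rightarrow> nat) (H :: nat \<Rightarrow> 'a point set multiset).
        (\<forall>n\<ge>1. d n \<ge> 1 \<and> k n < n \<and> subspace_family n (k n) (H n) \<and>
           evasive n (equidim_subvarieties n (n - k n - 1) (d n)) (H n)) \<and>
        (\<lambda>n. real (n - k n)) \<in> \<Omega>(\<lambda>n. real n) \<and>
        (\<lambda>n. real (d n)) \<in> \<omega>(\<lambda>_. 1)
        \<longrightarrow> (\<forall>c::nat. (\<lambda>n. real (size (H n))) \<in> \<omega>(\<lambda>n. real n ^ c)))"
proof (intro conjI allI impI, goal_cases)
  case (1 n d k H)
  then show ?case by (intro evasive_family_size) auto
next
  case (2 k d H c)
  have "size (H n) \<ge> ((d n + (n - k n)) choose d n)" if n: "n \<ge> 1" "d n > 1" for n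
    using evasive_family_size[of n "d n" "k n" "H n"] 2 n by auto
  then show ?case using 2 by (intro superpolynomial[where k = k and d = d]) auto
qed

end
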